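(* Let $\mathbb{K}$ be a field, $A$ a $\mathbb{K}$-algebra, $G$ a finite group acting on $A$ by algebra automorphisms, and $n\geq 2$. Equip the $n$-preprojective algebra $\Pi_n(A)$ with the induced $G$-action. Then there is an isomorphism of algebras $\Pi_n(A)\#G\simeq\Pi_n(A\#G)$.
   Context: Tensor products without subscript are over $\mathbb{K}$; $\mathbb{K}$ acts centrally on all bimodules. $A^e=A\otimes A^{\mathrm{op}}$, and $A$-$A$-bimodules are identified with left $A^e$-modules, and also with right $A^e$-modules (via $amb=m\cdot(b\otimes a)$). $\mathrm{Ext}^{m}_{A^e}(M,A^e)$ is a right $A^e$-module, hence an $A$-$A$-bimodule. For an $A$-$A$-bimodule $V$, $T_A(V)=A\oplus V\oplus V^{\otimes_A2}\oplus\cdots$ is the tensor algebra. The $n$-preprojective algebra of $A$ is $\Pi_n(A)=T_A(\mathrm{Ext}^{n-1}_{A^e}(A,A^e))$. The skew group algebra is $A\#G=A\otimes\mathbb{K}G$ with $(a\#g)(b\#h)=ag(b)\#gh$. Induced action: a $G$-compatible $A$-$A$-bimodule is an $A$-$A$-bimodule $M$ with a $\mathbb{K}$-linear $G$-action such that $g(amb)=g(a)g(m)g(b)$; equivalently a left module over $\Delta=A^e\#G$ (with $g(a\otimes b)=g(a)\otimes g(b)$ on $A^e$). For such $M$, $\mathrm{Hom}_{A^e}(M,A^e)$ is $G$-compatible via $g(\theta)(m)=g(\theta(g^{-1}(m)))$. Taking a projective resolution $P^\bullet$ of $M$ as a left $\Delta$-module, $\mathrm{Ext}^{m}_{A^e}(M,A^e)=H^{m}(\mathrm{Hom}_{A^e}(P^\bullet,A^e))$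 becomes $G$-compatible. Applied to $M=A$, this makes $V=\mathrm{Ext}^{n-1}_{A^e}(A,A^e)$ a $G$-compatible bimodule, and $G$ acts on $\Pi_n(A)=T_A(V)$ by algebra automorphisms through $g(v_1\otimes_A\cdots\otimes_Av_k)=g(v_1)\otimes_A\cdots\otimes_Ag(v_k)$ and the given action on $A$. *)

theory Defs
  imports "HOL-Algebra.Algebra" "HOL-Algebra.Product_Groups" "HOL-Algebra.Free_Abelian_Groups"
begin

section \<open>Algebras and actions of groups on them\<close>

text \<open>The library locale \<^locale>\<open>algebra\<close> only covers commutative algebras.\<close>

locale K_algebra = R?: field K + A?: ring A + module K A
  for K :: "('k, 'x) ring_scheme" (structure) and A :: "('k, 'a, 'y) module_scheme" (structure) +
  assumes smult_mult_left:
      "\<lbrakk>c \<in> carrier K; x \<in> carrier A; y \<in> carrier A\<rbrakk> \<Longrightarrow> (c \<odot>\<^bsub>A\<^esub> x) \<otimes>\<^bsub>A\<^esub> y = c \<odot>\<^bsub>A\<^esub> (x \<otimes>\<^bsub>A\<^esub> y)"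
    and smult_mult_right:
      "\<lbrakk>c \<in> carrier K; x \<in> carrier A; y \<in> carrier A\<rbrakk> \<Longrightarrow> x \<otimes>\<^bsub>A\<^esub> (c \<odot>\<^bsub>A\<^esub> y) = c \<odot>\<^bsub>A\<^esub> (x \<otimes>\<^bsub>A\<^esub> y)"

definition algebra_isos ::
    "('k, 'x) ring_scheme \<Rightarrow> ('k, 'a, 'y) module_scheme \<Rightarrow> ('k, 'b, 'z) module_scheme \<Rightarrow> ('a \<Rightarrow> 'b) set"
  where "algebra_isos K A B =
    {h \<in> ring_iso A B. \<forall>c\<in>carrier K. \<forall>x\<in>carrier A. h (c \<odot>\<^bsub>A\<^esub> x) = c \<odot>\<^bsub>B\<^esub> h x}"

locale algebra_action = K_algebra K A + group_action G "carrier A" \<phi>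
  for K :: "('k, 'x) ring_scheme" (structure) and A :: "('k, 'a, 'y) module_scheme" (structure)
    and G :: "('g, 'z) monoid_scheme" (structure) and \<phi> :: "'g \<Rightarrow> 'a \<Rightarrow> 'a" +
  assumes automorphism: "g \<in> carrier G \<Longrightarrow> \<phi> g \<in> algebra_isos K A A"

definition opposite :: "('k, 'a) module \<Rightarrow> ('k, 'a) module"
  where "opposite A = A\<lparr>monoid.mult := (\<lambda>x y. y \<otimes>\<^bsub>A\<^esub> x)\<rparr>"

text \<open>The skew group algebra of a finite group: the family \<open>x\<close> stands for the sum of all \<open>x g # g\<close>.\<close>

definition skew_group_algebra ::
    "('k, 'a) module \<Rightarrow> ('g, 'z) monoid_scheme \<Rightarrow> ('g \<Rightarrow> 'a \<Rightarrow> 'a) \<Rightarrow> ('k, 'g \<Rightarrow> 'a) module"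
  where "skew_group_algebra A G \<phi> =
    \<lparr>carrier = (\<Pi>\<^sub>E g\<in>carrier G. carrier A),
     monoid.mult = (\<lambda>x y. \<lambda>k\<in>carrier G.
       (\<Oplus>\<^bsub>A\<^esub>g\<in>carrier G. x g \<otimes>\<^bsub>A\<^esub> \<phi> g (y (inv\<^bsub>G\<^esub> g \<otimes>\<^bsub>G\<^esub> k)))),
     monoid.one = (\<lambda>k\<in>carrier G. if k = \<one>\<^bsub>G\<^esub> then \<one>\<^bsub>A\<^esub> else \<zero>\<^bsub>A\<^esub>),
     ring.zero = (\<lambda>k\<in>carrier G. \<zero>\<^bsub>A\<^esub>),
     ring.add = (\<lambda>x y. \<lambda>k\<in>carrier G. x k \<oplus>\<^bsub>A\<^esub> y k),
     smult = (\<lambda>c x. \<lambda>k\<in>carrier G. c \<odot>\<^bsub>A\<^esub> x k)\<rparr>"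

definition skew_elem ::
    "('k, 'a) module \<Rightarrow> ('g, 'z) monoid_scheme \<Rightarrow> 'a \<Rightarrow> 'g \<Rightarrow> 'g \<Rightarrow> 'a"
  where "skew_elem A G a g = (\<lambda>k\<in>carrier G. if k = g then a else \<zero>\<^bsub>A\<^esub>)"

section \<open>Abelian groups given by generators and relators\<close>

text \<open>
  Presented groups are quotients of \<^const>\<open>free_Abelian_group\<close> and, like it, are written
  multiplicatively. The maps below take cosets to cosets, and \<^const>\<open>the_elem\<close> extracts the common
  value on all representatives; they are meaningful only for maps that respect the relators.
\<close>

definition pres_group :: "'w set \<Rightarrow> ('w \<Rightarrow>\<^sub>0 int) set \<Rightarrow> ('w \<Rightarrow>\<^sub>0 int) set monoid"
  where "pres_group S R = free_Abelian_group S Mod generate (free_Abelian_group S) R"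

definition pres_class :: "'w set \<Rightarrow> ('w \<Rightarrow>\<^sub>0 int) set \<Rightarrow> ('w \<Rightarrow>\<^sub>0 int) \<Rightarrow> ('w \<Rightarrow>\<^sub>0 int) set"
  where "pres_class S R x = generate (free_Abelian_group S) R #>\<^bsub>free_Abelian_group S\<^esub> x"

text \<open>The target is the group with generators \<open>S\<close> and relators \<open>R\<close>.\<close>

definition pres_map :: "'w set \<Rightarrow> ('w \<Rightarrow>\<^sub>0 int) set \<Rightarrow> ('v \<Rightarrow> 'w) \<Rightarrow>
    ('v \<Rightarrow>\<^sub>0 int) set \<Rightarrow> ('w \<Rightarrow>\<^sub>0 int) set"
  where "pres_map S R f U =
    the_elem ((\<lambda>x. pres_class S R (frag_extend (\<lambda>v. frag_of (f v)) x)) ` U)"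

definition pres_map2 :: "'w set \<Rightarrow> ('w \<Rightarrow>\<^sub>0 int) set \<Rightarrow> ('u \<Rightarrow> 'v \<Rightarrow> 'w) \<Rightarrow>
    ('u \<Rightarrow>\<^sub>0 int) set \<Rightarrow> ('v \<Rightarrow>\<^sub>0 int) set \<Rightarrow> ('w \<Rightarrow>\<^sub>0 int) set"
  where "pres_map2 S R f U W =
    the_elem ((\<lambda>(x, y). pres_class S R
      (frag_extend (\<lambda>u. frag_extend (\<lambda>v. frag_of (f u v)) y) x)) ` (U \<times> W))"

section \<open>The enveloping algebra\<close>

definition tensor_relators ::
    "('k, 'x) ring_scheme \<Rightarrow> ('k, 'a) module \<Rightarrow> ('k, 'b) module \<Rightarrow> ('a \<times> 'b \<Rightarrow>\<^sub>0 int) set"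
  where "tensor_relators K A B =
    {frag_of (a \<oplus>\<^bsub>A\<^esub> a', b) - frag_of (a, b) - frag_of (a', b) | a a' b.
       a \<in> carrier A \<and> a' \<in> carrier A \<and> b \<in> carrier B} \<union>
    {frag_of (a, b \<oplus>\<^bsub>B\<^esub> b') - frag_of (a, b) - frag_of (a, b') | a b b'.
       a \<in> carrier A \<and> b \<in> carrier B \<and> b' \<in> carrier B} \<union>
    {frag_of (c \<odot>\<^bsub>A\<^esub> a, b) - frag_of (a, c \<odot>\<^bsub>B\<^esub> b) | c a b.
       c \<in> carrier K \<and> a \<in> carrier A \<and> b \<in> carrier B}"

definition tensor_product ::
    "('k, 'x) ring_scheme \<Rightarrow> ('k, 'a) module \<Rightarrow> ('k, 'b) module \<Rightarrow>
     ('k, ('a \<times> 'b \<Rightarrow>\<^sub>0 int) set) module"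
  where "tensor_product K A B =
    (let S = carrier A \<times> carrier B; R = tensor_relators K A B in
    \<lparr>carrier = carrier (pres_group S R),
     monoid.mult = pres_map2 S R (\<lambda>(a, b) (a', b'). (a \<otimes>\<^bsub>A\<^esub> a', b \<otimes>\<^bsub>B\<^esub> b')),
     monoid.one = pres_class S R (frag_of (\<one>\<^bsub>A\<^esub>, \<one>\<^bsub>B\<^esub>)),
     ring.zero = \<one>\<^bsub>pres_group S R\<^esub>,
     ring.add = (\<otimes>\<^bsub>pres_group S R\<^esub>),
     smult = (\<lambda>c. pres_map S R (\<lambda>(a, b). (c \<odot>\<^bsub>A\<^esub> a, b)))\<rparr>)"

definition enveloping ::
    "('k, 'x) ring_scheme \<Rightarrow> ('k, 'a) module \<Rightarrow> ('k, ('a \<times> 'a \<Rightarrow>\<^sub>0 int) set) module"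
  where "enveloping K A = tensor_product K A (opposite A)"

definition env_elem ::
    "('k, 'x) ring_scheme \<Rightarrow> ('k, 'a) module \<Rightarrow> 'a \<Rightarrow> 'a \<Rightarrow> ('a \<times> 'a \<Rightarrow>\<^sub>0 int) set"
  where "env_elem K A a b =
    pres_class (carrier A \<times> carrier A) (tensor_relators K A (opposite A)) (frag_of (a, b))"

definition env_action ::
    "('k, 'x) ring_scheme \<Rightarrow> ('k, 'a) module \<Rightarrow> ('g \<Rightarrow> 'a \<Rightarrow> 'a) \<Rightarrow>
     'g \<Rightarrow> ('a \<times> 'a \<Rightarrow>\<^sub>0 int) set \<Rightarrow> ('a \<times> 'a \<Rightarrow>\<^sub>0 int) set"
  where "env_action K A \<phi> g =
    pres_map (carrier A \<times> carrier A) (tensor_relators K A (opposite A))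
      (\<lambda>(a, b). (\<phi> g a, \<phi> g b))"

definition skew_enveloping ::
    "('k, 'x) ring_scheme \<Rightarrow> ('k, 'a) module \<Rightarrow> ('g, 'z) monoid_scheme \<Rightarrow> ('g \<Rightarrow> 'a \<Rightarrow> 'a) \<Rightarrow>
     ('k, 'g \<Rightarrow> ('a \<times> 'a \<Rightarrow>\<^sub>0 int) set) module"
  where "skew_enveloping K A G \<phi> = skew_group_algebra (enveloping K A) G (env_action K A \<phi>)"

section \<open>Modules over noncommutative rings\<close>

text \<open>
  Modules are stored in the library record, whose fields \<^const>\<open>monoid.mult\<close> and \<^const>\<open>one\<close> play
  no role. A right module is stored in the same record, with \<open>r \<odot> m\<close> standing for \<open>m \<cdot> r\<close>.
\<close>

locale left_module = R?: ring R + M?: abelian_group M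
  for R :: "('r, 'x) ring_scheme" (structure) and M :: "('r, 'm, 'y) module_scheme" (structure) +
  assumes smult_closed: "\<lbrakk>r \<in> carrier R; x \<in> carrier M\<rbrakk> \<Longrightarrow> r \<odot>\<^bsub>M\<^esub> x \<in> carrier M"
    and smult_l_distr: "\<lbrakk>r \<in> carrier R; s \<in> carrier R; x \<in> carrier M\<rbrakk> \<Longrightarrow>
      (r \<oplus>\<^bsub>R\<^esub> s) \<odot>\<^bsub>M\<^esub> x = r \<odot>\<^bsub>M\<^esub> x \<oplus>\<^bsub>M\<^esub> s \<odot>\<^bsub>M\<^esub> x"
    and smult_r_distr: "\<lbrakk>r \<in> carrier R; x \<in> carrier M; y \<in> carrier M\<rbrakk> \<Longrightarrow>
      r \<odot>\<^bsub>M\<^esub> (x \<oplus>\<^bsub>M\<^esub> y) = r \<odot>\<^bsub>M\<^esub> x \<oplus>\<^bsub>M\<^esub> r \<odot>\<^bsub>M\<^esub> y"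
    and smult_assoc: "\<lbrakk>r \<in> carrier R; s \<in> carrier R; x \<in> carrier M\<rbrakk> \<Longrightarrow>
      (r \<otimes>\<^bsub>R\<^esub> s) \<odot>\<^bsub>M\<^esub> x = r \<odot>\<^bsub>M\<^esub> (s \<odot>\<^bsub>M\<^esub> x)"
    and smult_one: "x \<in> carrier M \<Longrightarrow> \<one>\<^bsub>R\<^esub> \<odot>\<^bsub>M\<^esub> x = x"

definition module_hom ::
    "('r, 'x) ring_scheme \<Rightarrow> ('r, 'm) module \<Rightarrow> ('r, 'n) module \<Rightarrow> ('m \<Rightarrow> 'n) set"
  where "module_hom R M N =
    {f \<in> hom (add_monoid M) (add_monoid N).
      \<forall>r\<in>carrier R. \<forall>x\<in>carrier M. f (r \<odot>\<^bsub>M\<^esub> x) = r \<odot>\<^bsub>N\<^esub> f x}"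

text \<open>
  The lifting property cannot quantify over modules of every type. The types chosen here suffice:
  they admit the free module on the elements of \<open>P\<close> (as a module of families indexed by \<open>P\<close>) and its
  canonical surjection onto \<open>P\<close>, so a module projective in this sense is a direct summand of a free
  module and hence has the lifting property in all types.
\<close>

definition projective_module :: "('r, 'x) ring_scheme \<Rightarrow> ('r, 'p) module \<Rightarrow> bool"
  where "projective_module R P \<longleftrightarrow> left_module R P \<and>
    (\<forall>(M :: ('r, 'p \<Rightarrow> 'r) module) (N :: ('r, 'p) module) f h.
      left_module R M \<and> left_module R N \<and>
      f \<in> module_hom R M N \<and> f ` carrier M = carrier N \<and> h \<in> module_hom R P N \<longrightarrow>
      (\<exists>k \<in> module_hom R P M. \<forall>x\<in>carrier P. f (k x) = h x))"

text \<open>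
  An exact complex \<open>\<dots> \<rightarrow> P 1 \<rightarrow> P 0 \<rightarrow> M \<rightarrow> 0\<close> with differentials \<open>d i : P (i + 1) \<rightarrow> P i\<close> and
  augmentation \<open>e : P 0 \<rightarrow> M\<close>. That all \<open>P i\<close> live in one type is no restriction, as modules can be
  transported along bijections.
\<close>

definition projective_resolution :: "('r, 'x) ring_scheme \<Rightarrow> ('r, 'm) module \<Rightarrow>
    (nat \<Rightarrow> ('r, 'p) module) \<Rightarrow> (nat \<Rightarrow> 'p \<Rightarrow> 'p) \<Rightarrow> ('p \<Rightarrow> 'm) \<Rightarrow> bool"
  where "projective_resolution R M P d e \<longleftrightarrow>
    left_module R M \<and>
    (\<forall>i. projective_module R (P i)) \<and>
    (\<forall>i. d i \<in> module_hom R (P (Suc i)) (P i)) \<and>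
    e \<in> module_hom R (P 0) M \<and>
    e ` carrier (P 0) = carrier M \<and>
    a_kernel (P 0) M e = d 0 ` carrier (P 1) \<and>
    (\<forall>i. a_kernel (P (Suc i)) (P i) (d i) = d (Suc i) ` carrier (P (Suc (Suc i))))"

definition quotient_module :: "('r, 'm) module \<Rightarrow> 'm set \<Rightarrow> ('r, 'm set) module"
  where "quotient_module M N =
    \<lparr>carrier = a_rcosets\<^bsub>M\<^esub> N, monoid.mult = undefined, monoid.one = undefined,
     ring.zero = N, ring.add = (<+>\<^bsub>M\<^esub>),
     smult = (\<lambda>r U. the_elem ((\<lambda>x. N +>\<^bsub>M\<^esub> (r \<odot>\<^bsub>M\<^esub> x)) ` U))\<rparr>"

text \<open>The right module of left \<open>S\<close>-linear maps from \<open>M\<close> to \<open>S\<close>, where \<open>(\<theta> \<cdot> s) m = \<theta> m \<cdot> s\<close>.\<close>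

definition dual_module :: "('k, 's) module \<Rightarrow> ('s, 'p) module \<Rightarrow> ('s, 'p \<Rightarrow> 's) module"
  where "dual_module S M =
    \<lparr>carrier = {\<theta> \<in> carrier M \<rightarrow>\<^sub>E carrier S.
       (\<forall>x\<in>carrier M. \<forall>y\<in>carrier M. \<theta> (x \<oplus>\<^bsub>M\<^esub> y) = \<theta> x \<oplus>\<^bsub>S\<^esub> \<theta> y) \<and>
       (\<forall>s\<in>carrier S. \<forall>x\<in>carrier M. \<theta> (s \<odot>\<^bsub>M\<^esub> x) = s \<otimes>\<^bsub>S\<^esub> \<theta> x)},
     monoid.mult = undefined, monoid.one = undefined,
     ring.zero = (\<lambda>x\<in>carrier M. \<zero>\<^bsub>S\<^esub>),
     ring.add = (\<lambda>\<theta> \<eta>. \<lambda>x\<in>carrier M. \<theta> x \<oplus>\<^bsub>S\<^esub> \<eta> x),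
     smult = (\<lambda>s \<theta>. \<lambda>x\<in>carrier M. \<theta> x \<otimes>\<^bsub>S\<^esub> s)\<rparr>"

text \<open>
  The right \<open>S\<close>-module \<open>H\<^sup>m(Hom\<^sub>S(P, S))\<close>; it is \<open>Ext\<^sup>m\<^sub>S(M, S)\<close> when \<open>(P, d)\<close> is a projective
  resolution of \<open>M\<close> over \<open>S\<close>.
\<close>

definition cocycles ::
    "('k, 's) module \<Rightarrow> (nat \<Rightarrow> ('s, 'p) module) \<Rightarrow> (nat \<Rightarrow> 'p \<Rightarrow> 'p) \<Rightarrow> nat \<Rightarrow> ('p \<Rightarrow> 's) set"
  where "cocycles S P d m =
    {\<theta> \<in> carrier (dual_module S (P m)). \<forall>x\<in>carrier (P (Suc m)). \<theta> (d m x) = \<zero>\<^bsub>S\<^esub>}"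

definition coboundaries ::
    "('k, 's) module \<Rightarrow> (nat \<Rightarrow> ('s, 'p) module) \<Rightarrow> (nat \<Rightarrow> 'p \<Rightarrow> 'p) \<Rightarrow> nat \<Rightarrow> ('p \<Rightarrow> 's) set"
  where "coboundaries S P d m =
    (case m of 0 \<Rightarrow> {\<zero>\<^bsub>dual_module S (P 0)\<^esub>}
     | Suc j \<Rightarrow> (\<lambda>\<eta>. \<lambda>x\<in>carrier (P m). \<eta> (d j x)) ` carrier (dual_module S (P j)))"

definition ext_module ::
    "('k, 's) module \<Rightarrow> (nat \<Rightarrow> ('s, 'p) module) \<Rightarrow> (nat \<Rightarrow> 'p \<Rightarrow> 'p) \<Rightarrow> nat \<Rightarrow> ('s, ('p \<Rightarrow> 's) set) module"
  where "ext_module S P d m =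
    quotient_module (dual_module S (P m)\<lparr>carrier := cocycles S P d m\<rparr>) (coboundaries S P d m)"

section \<open>Bimodules\<close>

definition regular_bimodule ::
    "('k, 'a) module \<Rightarrow> (('a \<times> 'a \<Rightarrow>\<^sub>0 int) set, 'a) module"
  where "regular_bimodule A =
    \<lparr>carrier = carrier A, monoid.mult = undefined, monoid.one = undefined,
     ring.zero = \<zero>\<^bsub>A\<^esub>, ring.add = (\<oplus>\<^bsub>A\<^esub>),
     smult = (\<lambda>U m. the_elem ((\<lambda>x. \<Oplus>\<^bsub>A\<^esub>p\<in>Poly_Mapping.keys x.
       add_pow A (Poly_Mapping.lookup x p) (fst p \<otimes>\<^bsub>A\<^esub> m \<otimes>\<^bsub>A\<^esub> snd p)) ` U))\<rparr>"

text \<open>\<open>A\<close> as a module over \<^const>\<open>skew_enveloping\<close>: \<open>(x # g) \<odot> m = x \<odot> g(m)\<close>.\<close>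

definition skew_regular_bimodule ::
    "('k, 'a) module \<Rightarrow> ('g, 'z) monoid_scheme \<Rightarrow> ('g \<Rightarrow> 'a \<Rightarrow> 'a) \<Rightarrow>
     ('g \<Rightarrow> ('a \<times> 'a \<Rightarrow>\<^sub>0 int) set, 'a) module"
  where "skew_regular_bimodule A G \<phi> =
    \<lparr>carrier = carrier A, monoid.mult = undefined, monoid.one = undefined,
     ring.zero = \<zero>\<^bsub>A\<^esub>, ring.add = (\<oplus>\<^bsub>A\<^esub>),
     smult = (\<lambda>D m. \<Oplus>\<^bsub>A\<^esub>g\<in>carrier G. D g \<odot>\<^bsub>regular_bimodule A\<^esub> \<phi> g m)\<rparr>"

text \<open>Restriction of scalars along \<open>s \<mapsto> s # 1\<close>, and the group action \<open>p \<mapsto> (1 # g) \<odot> p\<close>.\<close>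

definition restrict_scalars ::
    "('k, 's) module \<Rightarrow> ('g, 'z) monoid_scheme \<Rightarrow> ('g \<Rightarrow> 's, 'p) module \<Rightarrow> ('s, 'p) module"
  where "restrict_scalars S G P =
    \<lparr>carrier = carrier P, monoid.mult = undefined, monoid.one = undefined,
     ring.zero = \<zero>\<^bsub>P\<^esub>, ring.add = (\<oplus>\<^bsub>P\<^esub>),
     smult = (\<lambda>s x. skew_elem S G s \<one>\<^bsub>G\<^esub> \<odot>\<^bsub>P\<^esub> x)\<rparr>"

definition module_action ::
    "('k, 's) module \<Rightarrow> ('g, 'z) monoid_scheme \<Rightarrow> ('g \<Rightarrow> 's, 'p) module \<Rightarrow> 'g \<Rightarrow> 'p \<Rightarrow> 'p"
  where "module_action S G P g x = skew_elem S G \<one>\<^bsub>S\<^esub> g \<odot>\<^bsub>P\<^esub> x"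

record ('a, 'v) bimodule = "'v ring" +
  left_act :: "'a \<Rightarrow> 'v \<Rightarrow> 'v"
  right_act :: "'v \<Rightarrow> 'a \<Rightarrow> 'v"

text \<open>The bimodule of a right module over the enveloping algebra: \<open>a v b = v \<cdot> (b \<otimes> a)\<close>.\<close>

definition bimodule_of_right ::
    "('k, 'x) ring_scheme \<Rightarrow> ('k, 'a) module \<Rightarrow> (('a \<times> 'a \<Rightarrow>\<^sub>0 int) set, 'v) module \<Rightarrow>
     ('a, 'v) bimodule"
  where "bimodule_of_right K A V =
    \<lparr>carrier = carrier V, monoid.mult = undefined, monoid.one = undefined,
     ring.zero = \<zero>\<^bsub>V\<^esub>, ring.add = (\<oplus>\<^bsub>V\<^esub>),
     left_act = (\<lambda>a v. env_elem K A \<one>\<^bsub>A\<^esub> a \<odot>\<^bsub>V\<^esub> v),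
     right_act = (\<lambda>v b. env_elem K A b \<one>\<^bsub>A\<^esub> \<odot>\<^bsub>V\<^esub> v)\<rparr>"

section \<open>The tensor algebra of a bimodule\<close>

text \<open>
  The \<open>k\<close>-fold tensor power of \<open>V\<close> over \<open>A\<close>, for \<open>k \<ge> 1\<close>: the list \<open>[v\<^sub>1, \<dots>, v\<^sub>k]\<close> stands for
  \<open>v\<^sub>1 \<otimes> \<dots> \<otimes> v\<^sub>k\<close>, and the relators express additivity in each factor and balancedness over \<open>A\<close>.
\<close>

definition words :: "('a, 'v) bimodule \<Rightarrow> nat \<Rightarrow> 'v list set"
  where "words V k = {vs \<in> lists (carrier V). length vs = k}"

definition power_relators ::
    "('k, 'a) module \<Rightarrow> ('a, 'v) bimodule \<Rightarrow> nat \<Rightarrow> ('v list \<Rightarrow>\<^sub>0 int) set"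
  where "power_relators A V k =
    {frag_of (us @ [v \<oplus>\<^bsub>V\<^esub> w] @ ws) - frag_of (us @ [v] @ ws) - frag_of (us @ [w] @ ws) | us v w ws.
       us \<in> lists (carrier V) \<and> ws \<in> lists (carrier V) \<and> v \<in> carrier V \<and> w \<in> carrier V \<and>
       length us + 1 + length ws = k} \<union>
    {frag_of (us @ [right_act V v a, w] @ ws) - frag_of (us @ [v, left_act V a w] @ ws) | us v a w ws.
       us \<in> lists (carrier V) \<and> ws \<in> lists (carrier V) \<and> v \<in> carrier V \<and> w \<in> carrier V \<and>
       a \<in> carrier A \<and> length us + 2 + length ws = k}"

definition tensor_power ::
    "('k, 'a) module \<Rightarrow> ('a, 'v) bimodule \<Rightarrow> nat \<Rightarrow> ('v list \<Rightarrow>\<^sub>0 int) set monoid"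
  where "tensor_power A V k = pres_group (words V k) (power_relators A V k)"

definition power_map :: "('k, 'a) module \<Rightarrow> ('a, 'v) bimodule \<Rightarrow> nat \<Rightarrow> ('v list \<Rightarrow> 'v list) \<Rightarrow>
    ('v list \<Rightarrow>\<^sub>0 int) set \<Rightarrow> ('v list \<Rightarrow>\<^sub>0 int) set"
  where "power_map A V k = pres_map (words V k) (power_relators A V k)"

definition power_left ::
    "('k, 'a) module \<Rightarrow> ('a, 'v) bimodule \<Rightarrow> nat \<Rightarrow> 'a \<Rightarrow> ('v list \<Rightarrow>\<^sub>0 int) set \<Rightarrow> ('v list \<Rightarrow>\<^sub>0 int) set"
  where "power_left A V k a = power_map A V k (\<lambda>vs. left_act V a (hd vs) # tl vs)"

definition power_right ::
    "('k, 'a) module \<Rightarrow> ('a, 'v) bimodule \<Rightarrow> nat \<Rightarrow> 'a \<Rightarrow> ('v list \<Rightarrow>\<^sub>0 int) set \<Rightarrow> ('v list \<Rightarrow>\<^sub>0 int) set"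
  where "power_right A V k a = power_map A V k (\<lambda>vs. butlast vs @ [right_act V (last vs) a])"

definition power_concat :: "('k, 'a) module \<Rightarrow> ('a, 'v) bimodule \<Rightarrow> nat \<Rightarrow>
    ('v list \<Rightarrow>\<^sub>0 int) set \<Rightarrow> ('v list \<Rightarrow>\<^sub>0 int) set \<Rightarrow> ('v list \<Rightarrow>\<^sub>0 int) set"
  where "power_concat A V k = pres_map2 (words V k) (power_relators A V k) (@)"

text \<open>
  An element \<open>(a, f)\<close> consists of the component \<open>a\<close> in degree 0 and of the finitely supported family
  \<open>f\<close> of its components in the degrees \<open>k \<ge> 1\<close>. Since \<^const>\<open>tensor_power\<close> is written
  multiplicatively, the operations \<open>\<otimes>\<close> and \<^const>\<open>finprod\<close> in it denote sums.
\<close>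

definition positive_part ::
    "('k, 'a) module \<Rightarrow> ('a, 'v) bimodule \<Rightarrow> (nat \<Rightarrow> ('v list \<Rightarrow>\<^sub>0 int) set) monoid"
  where "positive_part A V = sum_group {1..} (tensor_power A V)"

definition tensor_algebra :: "('k, 'a) module \<Rightarrow> ('a, 'v) bimodule \<Rightarrow>
    ('k, 'a \<times> (nat \<Rightarrow> ('v list \<Rightarrow>\<^sub>0 int) set)) module"
  where "tensor_algebra A V =
    \<lparr>carrier = carrier A \<times> carrier (positive_part A V),
     monoid.mult = (\<lambda>(a, f) (b, g).
       (a \<otimes>\<^bsub>A\<^esub> b,
        \<lambda>k\<in>{1..}. power_left A V k a (g k) \<otimes>\<^bsub>tensor_power A V k\<^esub> power_right A V k b (f k)
          \<otimes>\<^bsub>tensor_power A V k\<^esub>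
          finprod (tensor_power A V k) (\<lambda>i. power_concat A V k (f i) (g (k - i))) {1..<k})),
     monoid.one = (\<one>\<^bsub>A\<^esub>, \<one>\<^bsub>positive_part A V\<^esub>),
     ring.zero = (\<zero>\<^bsub>A\<^esub>, \<one>\<^bsub>positive_part A V\<^esub>),
     ring.add = (\<lambda>(a, f) (b, g). (a \<oplus>\<^bsub>A\<^esub> b, f \<otimes>\<^bsub>positive_part A V\<^esub> g)),
     smult = (\<lambda>c (a, f). (c \<odot>\<^bsub>A\<^esub> a, \<lambda>k\<in>{1..}. power_left A V k (c \<odot>\<^bsub>A\<^esub> \<one>\<^bsub>A\<^esub>) (f k)))\<rparr>"

definition tensor_algebra_action :: "('k, 'a) module \<Rightarrow> ('a, 'v) bimodule \<Rightarrow>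
    ('g \<Rightarrow> 'a \<Rightarrow> 'a) \<Rightarrow> ('g \<Rightarrow> 'v \<Rightarrow> 'v) \<Rightarrow>
    'g \<Rightarrow> 'a \<times> (nat \<Rightarrow> ('v list \<Rightarrow>\<^sub>0 int) set) \<Rightarrow> 'a \<times> (nat \<Rightarrow> ('v list \<Rightarrow>\<^sub>0 int) set)"
  where "tensor_algebra_action A V \<phi> \<psi> g =
    (\<lambda>(a, f). (\<phi> g a, \<lambda>k\<in>{1..}. power_map A V k (map (\<psi> g)) (f k)))"

section \<open>Preprojective algebras\<close>

text \<open>
  \<open>Ext\<^sup>m\<close> of \<open>A\<close> into its enveloping algebra, as a bimodule, and the \<open>n\<close>-preprojective algebra, both
  computed from a projective resolution \<open>(P, d)\<close> of \<open>A\<close> over its enveloping algebra.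
\<close>

definition ext_bimodule ::
    "('k, 'x) ring_scheme \<Rightarrow> ('k, 'a) module \<Rightarrow> (nat \<Rightarrow> (('a \<times> 'a \<Rightarrow>\<^sub>0 int) set, 'p) module) \<Rightarrow>
     (nat \<Rightarrow> 'p \<Rightarrow> 'p) \<Rightarrow> nat \<Rightarrow> ('a, ('p \<Rightarrow> ('a \<times> 'a \<Rightarrow>\<^sub>0 int) set) set) bimodule"
  where "ext_bimodule K A P d m = bimodule_of_right K A (ext_module (enveloping K A) P d m)"

definition preprojective_algebra ::
    "('k, 'x) ring_scheme \<Rightarrow> ('k, 'a) module \<Rightarrow> (nat \<Rightarrow> (('a \<times> 'a \<Rightarrow>\<^sub>0 int) set, 'p) module) \<Rightarrow>
     (nat \<Rightarrow> 'p \<Rightarrow> 'p) \<Rightarrow> nat \<Rightarrow>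
     ('k, 'a \<times> (nat \<Rightarrow> (('p \<Rightarrow> ('a \<times> 'a \<Rightarrow>\<^sub>0 int) set) set list \<Rightarrow>\<^sub>0 int) set)) module"
  where "preprojective_algebra K A P d n = tensor_algebra A (ext_bimodule K A P d (n - 1))"

text \<open>
  When \<open>(P, d)\<close> is a projective resolution of \<open>A\<close> over \<^const>\<open>skew_enveloping\<close>, restriction of scalars
  makes it one over the enveloping algebra (over which the skew algebra is free), and the group acts
  on cochains by \<open>g(\<theta>) x = g(\<theta>(g\<^sup>-\<^sup>1 x))\<close>. A cohomology class is a coset of cocycles, and its image
  under \<open>g\<close> is the image coset.
\<close>

definition ext_action :: "('k, 'x) ring_scheme \<Rightarrow> ('k, 'a) module \<Rightarrow> ('g, 'z) monoid_scheme \<Rightarrow>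
    ('g \<Rightarrow> 'a \<Rightarrow> 'a) \<Rightarrow> (nat \<Rightarrow> ('g \<Rightarrow> ('a \<times> 'a \<Rightarrow>\<^sub>0 int) set, 'p) module) \<Rightarrow> nat \<Rightarrow>
    'g \<Rightarrow> ('p \<Rightarrow> ('a \<times> 'a \<Rightarrow>\<^sub>0 int) set) set \<Rightarrow> ('p \<Rightarrow> ('a \<times> 'a \<Rightarrow>\<^sub>0 int) set) set"
  where "ext_action K A G \<phi> P m g U =
    (\<lambda>\<theta>. \<lambda>x\<in>carrier (P m).
      env_action K A \<phi> g (\<theta> (module_action (enveloping K A) G (P m) (inv\<^bsub>G\<^esub> g) x))) ` U"

definition preprojective_action :: "('k, 'x) ring_scheme \<Rightarrow> ('k, 'a) module \<Rightarrow> ('g, 'z) monoid_scheme \<Rightarrow>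
    ('g \<Rightarrow> 'a \<Rightarrow> 'a) \<Rightarrow> (nat \<Rightarrow> ('g \<Rightarrow> ('a \<times> 'a \<Rightarrow>\<^sub>0 int) set, 'p) module) \<Rightarrow>
    (nat \<Rightarrow> 'p \<Rightarrow> 'p) \<Rightarrow> nat \<Rightarrow> 'g \<Rightarrow>
    'a \<times> (nat \<Rightarrow> (('p \<Rightarrow> ('a \<times> 'a \<Rightarrow>\<^sub>0 int) set) set list \<Rightarrow>\<^sub>0 int) set) \<Rightarrow>
    'a \<times> (nat \<Rightarrow> (('p \<Rightarrow> ('a \<times> 'a \<Rightarrow>\<^sub>0 int) set) set list \<Rightarrow>\<^sub>0 int) set)"
  where "preprojective_action K A G \<phi> P d n =
    tensor_algebra_action A
      (ext_bimodule K A (\<lambda>i. restrict_scalars (enveloping K A) G (P i)) d (n - 1))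
      \<phi> (ext_action K A G \<phi> P (n - 1))"

end

theory Submission
  imports Defs
begin

text \<open>
  Write \<open>B\<close> for the skew group algebra of \<open>A\<close>, \<open>S\<close> and \<open>E\<close> for the enveloping algebras of \<open>A\<close> and
  \<open>B\<close>, and \<open>\<Delta>\<close> for the skew group algebra of \<open>S\<close>. The theorem follows from two facts. First, \<open>W =
  Ext\<^sub>E(B, E)\<close> is \<open>V \<otimes> KG\<close> for \<open>V = Ext\<^sub>S(A, S)\<close>, with the group acting by \<open>g v = g(v) g\<close>. Second,
  for every bimodule of this form the tensor algebra over \<open>B\<close> is the skew group algebra of the
  tensor algebra over \<open>A\<close>, because in a word over \<open>W\<close> all group elements can be moved to the right
  end.

  The first fact holds because \<open>E\<close> is a crossed product of \<open>S\<close> with \<open>G \<times> G\<close>: it is free over \<open>S\<close>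
  on the invertible elements \<open>\<gamma> g h = g \<otimes> h\<close>, which normalize \<open>S\<close> (\<open>\<gamma>_act\<close>, \<open>\<gamma>_twist\<close>,
  \<open>E_decomp\<close>). The ring \<open>\<Delta>\<close> embeds in \<open>E\<close> as the span of the \<open>\<gamma> g g\<^sup>-\<^sup>1\<close>, and \<open>E\<close> is free over it
  on the \<open>\<gamma> h 1\<close>, so resolutions over \<open>E\<close> restrict to resolutions over \<open>\<Delta>\<close>. As \<open>A\<close> is a direct
  summand of \<open>B\<close> over \<open>\<Delta>\<close>, there are \<open>\<Delta>\<close>-linear chain maps \<open>f : P \<rightarrow> Q\<close> and \<open>c : Q \<rightarrow> P\<close> over
  inclusion and projection. An \<open>S\<close>-linear cochain \<open>\<theta>\<close> on \<open>P\<close> extends to a \<open>\<Delta>\<close>-linear map into \<open>E\<close>;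
  composing with \<open>c\<close> and summing over the cosets of \<open>\<Delta>\<close> (the trace) gives an \<open>E\<close>-linear cochain \<open>lam \<theta>\<close> on \<open>Q\<close>. The coefficients of \<open>lam \<theta> \<circ> f\<close> are
  twists of \<open>\<theta>\<close> composed with \<open>tw k = c \<circ> \<gamma> k\<^sup>-\<^sup>1 1 \<circ> f\<close>. On \<open>A\<close> this map is the identity for \<open>k =
  1\<close> and zero otherwise, hence it is homotopic to the identity or to zero (\<open>tw_homotopy\<close>), and \<open>\<theta>\<close>
  can be read off from \<open>lam \<theta>\<close> up to coboundaries: \<open>lam_injective\<close>. Conversely the trace of \<open>f \<circ>
  c\<close> lifts the identity of \<open>B\<close> and is homotopic to the identity (\<open>fc_homotopy\<close>), so every cocycle
  on \<open>Q\<close> is cohomologous to a combination of cochains \<open>lam \<theta>\<close>: \<open>lam_surjective\<close>. The result is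
  stated in \<open>ext_skew_bimodule\<close>.

  For the second fact, \<open>hk\<close> sends a family \<open>x\<close> in the tensor power of \<open>V\<close> to the sum of the \<open>x g \<cdot>
  g\<close> in the tensor power of \<open>W\<close>. Its inverse \<open>\<Psi>\<close> expands each factor in the basis \<open>G\<close> and collects
  the group elements at the right end. That \<open>hk\<close> respects both actions and concatenation
  (\<open>hk_left\<close>, \<open>hk_right\<close>, \<open>hk_concat\<close>) is exactly multiplicativity of the resulting map of
  algebras.
\<close>

section \<open>Presented abelian groups\<close>

abbreviation add_hom where "add_hom M N \<equiv> hom (add_monoid M) (add_monoid N)"
abbreviation keys where "keys \<equiv> Poly_Mapping.keys"

text \<open>
  The value at \<open>x\<close> of the homomorphism from the free abelian group that sends the generator \<open>w\<close> to
  \<open>f w\<close>.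
\<close>

definition free_eval :: "('b, 'm) monoid_scheme \<Rightarrow> ('w \<Rightarrow> 'b) \<Rightarrow> ('w \<Rightarrow>\<^sub>0 int) \<Rightarrow> 'b"
  where "free_eval H f x =
    finprod H (\<lambda>w. f w [^]\<^bsub>H\<^esub> Poly_Mapping.lookup x w) (keys x)"

lemma (in comm_group) free_eval_superset:
  assumes "finite T" "keys x \<subseteq> T" "f \<in> T \<rightarrow> carrier G"
  shows "free_eval G f x = finprod G (\<lambda>w. f w [^] Poly_Mapping.lookup x w) T"
  unfolding free_eval_def
  by (rule finprod_mono_neutral_cong_left) (use assms in "auto simp: in_keys_iff")

lemma (in comm_group) free_eval_closed:
  assumes "f \<in> S \<rightarrow> carrier G" "keys x \<subseteq> S"
  shows "free_eval G f x \<in> carrier G"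
  unfolding free_eval_def by (rule finprod_closed) (use assms in auto)

lemma (in comm_group) free_eval_add:
  assumes f: "f \<in> S \<rightarrow> carrier G" and x: "keys x \<subseteq> S" and y: "keys y \<subseteq> S"
  shows "free_eval G f (x + y) = free_eval G f x \<otimes> free_eval G f y"
proof -
  let ?T = "keys x \<union> keys y"
  have T: "finite ?T" "f \<in> ?T \<rightarrow> carrier G" using assms by auto
  have "free_eval G f (x + y) = finprod G (\<lambda>w. f w [^] Poly_Mapping.lookup (x + y) w) ?T"
    by (rule free_eval_superset) (use T Poly_Mapping.keys_add[of x y] in auto)
  also have "\<dots> = finprod G (\<lambda>w. f w [^] Poly_Mapping.lookup x w \<otimes> f w [^] Poly_Mapping.lookup y w) ?T"
    by (rule finprod_cong') (use T in "auto simp: lookup_add int_pow_mult Pi_iff")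
  also have "\<dots> = free_eval G f x \<otimes> free_eval G f y"
    by (subst finprod_multf) (use T in "auto simp: free_eval_superset[of ?T]")
  finally show ?thesis .
qed

lemma (in comm_group) free_eval_zero [simp]: "free_eval G f 0 = \<one>"
  by (simp add: free_eval_def)

lemma (in comm_group) free_eval_frag_of:
  "f w \<in> carrier G \<Longrightarrow> free_eval G f (frag_of w) = f w"
  by (simp add: free_eval_def)

lemma (in comm_group) free_eval_diff:
  assumes f: "f \<in> S \<rightarrow> carrier G" and x: "keys x \<subseteq> S" and y: "keys y \<subseteq> S"
  shows "free_eval G f (x - y) = free_eval G f x \<otimes> inv free_eval G f y"
proof -
  have k: "keys (x - y) \<subseteq> S"
    using x y keys_diff[of x y] by blast
  have "free_eval G f x = free_eval G f (x - y) \<otimes> free_eval G f y"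
    using free_eval_add[OF f k y] by simp
  then show ?thesis
    using free_eval_closed[OF f] x y k by (simp add: inv_solve_right)
qed

lemma (in comm_group) free_eval_relator2:
  assumes "f a \<in> carrier G" "f b \<in> carrier G" "f a = f b"
  shows "free_eval G f (frag_of a - frag_of b) = \<one>"
  using assms free_eval_diff[of f "{a, b}" "frag_of a" "frag_of b"]
  by (simp add: free_eval_frag_of)

lemma (in comm_group) free_eval_relator3:
  assumes "f b \<in> carrier G" "f c \<in> carrier G" "f a = f b \<otimes> f c"
  shows "free_eval G f (frag_of a - frag_of b - frag_of c) = \<one>"
proof -
  have k: "keys (frag_of a - frag_of b) \<subseteq> {a, b, c}"
    using keys_diff[of "frag_of a" "frag_of b"] by auto
  have "free_eval G f (frag_of a - frag_of b - frag_of c) = f a \<otimes> inv f b \<otimes> inv f c"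
    using assms k free_eval_diff[of f "{a, b, c}" "frag_of a - frag_of b" "frag_of c"]
      free_eval_diff[of f "{a, b, c}" "frag_of a" "frag_of b"]
    by (simp add: free_eval_frag_of)
  then show ?thesis using assms by (simp add: m_comm m_assoc[symmetric])
qed

lemma keys_add_subset:
  "keys x \<subseteq> S \<Longrightarrow> keys y \<subseteq> S \<Longrightarrow> keys (x + y) \<subseteq> S"
  by (rule order_trans[OF Poly_Mapping.keys_add]) simp

lemma keys_diff_subset:
  "keys x \<subseteq> S \<Longrightarrow> keys y \<subseteq> S \<Longrightarrow> keys (x - y) \<subseteq> S"
  by (rule order_trans[OF keys_diff]) simp

lemmas free_induct [consumes 1, case_names zero diff gen] = free_Abelian_group_induct

text \<open>
  A map on generators that kills the relators factors through the presented group; on a coset all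
  representatives have the same value, which \<^const>\<open>the_elem\<close> extracts.
\<close>

definition pres_lift :: "('b, 'm) monoid_scheme \<Rightarrow> ('w \<Rightarrow> 'b) \<Rightarrow> ('w \<Rightarrow>\<^sub>0 int) set \<Rightarrow> 'b"
  where "pres_lift H f U = the_elem (free_eval H f ` U)"

definition pres_gen :: "'w set \<Rightarrow> ('w \<Rightarrow>\<^sub>0 int) set \<Rightarrow> 'w \<Rightarrow> ('w \<Rightarrow>\<^sub>0 int) set"
  where "pres_gen S R w = pres_class S R (frag_of w)"

locale presentation =
  fixes S :: "'w set" and R :: "('w \<Rightarrow>\<^sub>0 int) set"
  assumes relators: "R \<subseteq> carrier (free_Abelian_group S)"
begin

abbreviation F where "F \<equiv> free_Abelian_group S"
abbreviation N where "N \<equiv> generate F R"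
abbreviation cls where "cls \<equiv> pres_class S R"
abbreviation \<G> where "\<G> \<equiv> pres_group S R"

lemma N_normal: "N \<lhd> F"
proof -
  have "subgroup N F" using relators by (simp add: group.generate_is_subgroup)
  then show ?thesis
    using abelian_free_Abelian_group comm_group.normal_iff_subgroup by blast
qed

lemma N_subset: "n \<in> N \<Longrightarrow> keys n \<subseteq> S"
  using group.generate_in_carrier[OF group_free_Abelian_group relators] by simp

lemma comm_group_pres: "comm_group \<G>"
  unfolding pres_group_def
  using N_normal abelian_free_Abelian_group comm_group.abelian_FactGroup normal_imp_subgroup by blast

lemma carrier_pres: "carrier \<G> = cls ` {x. keys x \<subseteq> S}"
  by (auto simp: pres_group_def FactGroup_def RCOSETS_def pres_class_def)

lemma cls_closed [intro]: "keys x \<subseteq> S \<Longrightarrow> cls x \<in> carrier \<G>"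
  by (simp add: carrier_pres)

lemma cls_mult:
  "keys x \<subseteq> S \<Longrightarrow> keys y \<subseteq> S \<Longrightarrow> cls x \<otimes>\<^bsub>\<G>\<^esub> cls y = cls (x + y)"
  using normal.rcos_sum[OF N_normal, of x y] by (simp add: pres_group_def FactGroup_def pres_class_def)

lemma cls_zero: "cls 0 = \<one>\<^bsub>\<G>\<^esub>"
proof -
  have "N #>\<^bsub>F\<^esub> \<one>\<^bsub>F\<^esub> = N"
    by (rule group.coset_mult_one) (use N_subset in auto)
  then show ?thesis by (simp add: pres_group_def FactGroup_def pres_class_def)
qed

lemma cls_diff:
  assumes "keys x \<subseteq> S" "keys y \<subseteq> S"
  shows "cls (x - y) = cls x \<otimes>\<^bsub>\<G>\<^esub> inv\<^bsub>\<G>\<^esub> cls y"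
proof -
  interpret comm_group \<G> by (rule comm_group_pres)
  have k: "keys (x - y) \<subseteq> S"
    using assms by (simp add: keys_diff_subset)
  have "cls x = cls (x - y) \<otimes>\<^bsub>\<G>\<^esub> cls y" using cls_mult[OF k assms(2)] by simp
  then show ?thesis using assms k by (simp add: inv_solve_right cls_closed)
qed

lemma cls_relator: "n \<in> N \<Longrightarrow> cls n = \<one>\<^bsub>\<G>\<^esub>"
  using N_normal N_subset
  by (simp add: pres_group_def FactGroup_def pres_class_def normal_imp_subgroup subgroup.rcos_const)

lemma cls_relator_gen: "r \<in> R \<Longrightarrow> cls r = \<one>\<^bsub>\<G>\<^esub>"
  using cls_relator generate.incl by metis

lemma mem_cls: "u \<in> cls x \<longleftrightarrow> (\<exists>n\<in>N. u = n + x)"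
  by (auto simp: pres_class_def r_coset_def)

lemma self_in_cls: "x \<in> cls x"
  unfolding mem_cls using generate.one[of F R] by force

lemma gen_closed [intro]: "w \<in> S \<Longrightarrow> pres_gen S R w \<in> carrier \<G>"
  unfolding pres_gen_def by (rule cls_closed) simp

lemma gen_relator2:
  assumes "frag_of a - frag_of b \<in> R" "a \<in> S" "b \<in> S"
  shows "pres_gen S R a = pres_gen S R b"
proof -
  interpret comm_group \<G> by (rule comm_group_pres)
  show ?thesis
    using cls_relator_gen[OF assms(1)] cls_diff[of "frag_of a" "frag_of b"] assms(2,3)
    by (metis cls_closed gen_closed inv_equality inv_inv inv_closed keys_frag_of pres_gen_def
        carrier_free_Abelian_group_iff frag_of_in_free_Abelian_group)
qed

lemma gen_relator3:
  assumes "frag_of a - frag_of b - frag_of c \<in> R" "a \<in> S" "b \<in> S" "c \<in> S"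
  shows "pres_gen S R a = pres_gen S R b \<otimes>\<^bsub>\<G>\<^esub> pres_gen S R c"
proof -
  interpret comm_group \<G> by (rule comm_group_pres)
  have k: "keys (frag_of a - frag_of b) \<subseteq> S"
    using keys_diff[of "frag_of a" "frag_of b"] assms by auto
  have "cls (frag_of a) \<otimes>\<^bsub>\<G>\<^esub> inv\<^bsub>\<G>\<^esub> cls (frag_of b) \<otimes>\<^bsub>\<G>\<^esub> inv\<^bsub>\<G>\<^esub> cls (frag_of c) = \<one>\<^bsub>\<G>\<^esub>"
    using cls_relator_gen[OF assms(1)] cls_diff[of "frag_of a - frag_of b" "frag_of c"]
      cls_diff[of "frag_of a" "frag_of b"] assms k by simp
  moreover have c: "cls (frag_of a) \<in> carrier \<G>" "cls (frag_of b) \<in> carrier \<G>" "cls (frag_of c) \<in> carrier \<G>"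
    using assms by (auto intro!: cls_closed)
  ultimately show ?thesis unfolding pres_gen_def
    by (metis inv_closed inv_equality inv_inv m_closed inv_solve_right m_comm)
qed

text \<open>The induction principle behind all identities in presented groups.\<close>

lemma pres_induct [consumes 1, case_names gen one mult inv]:
  assumes "U \<in> carrier \<G>"
    and gens: "\<And>w. w \<in> S \<Longrightarrow> Q (pres_gen S R w)" and one: "Q \<one>\<^bsub>\<G>\<^esub>"
    and mult: "\<And>U W. \<lbrakk>U \<in> carrier \<G>; W \<in> carrier \<G>; Q U; Q W\<rbrakk> \<Longrightarrow> Q (U \<otimes>\<^bsub>\<G>\<^esub> W)"
    and inv: "\<And>U. \<lbrakk>U \<in> carrier \<G>; Q U\<rbrakk> \<Longrightarrow> Q (inv\<^bsub>\<G>\<^esub> U)"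
  shows "Q U"
proof -
  interpret comm_group \<G> by (rule comm_group_pres)
  have "Q (cls x)" if "keys x \<subseteq> S" for x
    using that
  proof (induction x rule: free_induct)
      case zero then show ?case by (simp add: cls_zero one)
  next
    case (diff x y) then show ?case by (simp add: cls_diff mult inv cls_closed)
  next
    case (gen a) then show ?case using gens by (simp add: pres_gen_def)
  qed
  then show ?thesis using assms(1) by (auto simp: carrier_pres)
qed

lemma hom_eq_on_gens:
  assumes "group H" "a \<in> hom \<G> H" "b \<in> hom \<G> H"
    and "\<And>w. w \<in> S \<Longrightarrow> a (pres_gen S R w) = b (pres_gen S R w)" and "U \<in> carrier \<G>"
  shows "a U = b U"
proof -
  interpret comm_group \<G> by (rule comm_group_pres)
  interpret a: group_hom \<G> H a by (simp add: group_hom_def group_hom_axioms_def assms is_group)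
  interpret b: group_hom \<G> H b by (simp add: group_hom_def group_hom_axioms_def assms is_group)
  show ?thesis using assms(5) by (induction rule: pres_induct) (auto simp: assms(4))
qed

lemma pres_lift:
  assumes "comm_group H" "f \<in> S \<rightarrow> carrier H" and R: "\<And>r. r \<in> R \<Longrightarrow> free_eval H f r = \<one>\<^bsub>H\<^esub>"
  shows pres_lift_cls: "keys x \<subseteq> S \<Longrightarrow> pres_lift H f (cls x) = free_eval H f x"
    and pres_lift_hom: "pres_lift H f \<in> hom \<G> H"
    and pres_lift_gen: "w \<in> S \<Longrightarrow> pres_lift H f (pres_gen S R w) = f w"
proof -
  interpret H: comm_group H by fact
  interpret h: group_hom F H "free_eval H f"
    by (auto simp: group_hom_def group_hom_axioms_def H.is_group hom_def
        intro!: H.free_eval_closed[OF assms(2)] H.free_eval_add[OF assms(2)])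
  have N1: "free_eval H f n = \<one>\<^bsub>H\<^esub>" if "n \<in> N" for n
  proof -
    have "N \<subseteq> kernel F H (free_eval H f)"
      by (rule group.generate_subgroup_incl[OF _ _ h.subgroup_kernel])
        (use relators R in "simp_all add: kernel_def subset_iff")
    then show ?thesis using that by (auto simp: kernel_def)
  qed
  show c: "pres_lift H f (cls x) = free_eval H f x" if x: "keys x \<subseteq> S" for x
  proof -
    have "free_eval H f ` cls x = {free_eval H f x}"
    proof -
      have "free_eval H f u = free_eval H f x" if "u \<in> cls x" for u
      proof -
        obtain n where "n \<in> N" "u = n + x" using \<open>u \<in> cls x\<close> by (auto simp: mem_cls)
        then show ?thesis
          using H.free_eval_add[OF assms(2) N_subset x] N1 H.free_eval_closed[OF assms(2) x] by simp
      qed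
      moreover have "x \<in> cls x" by (rule self_in_cls)
      ultimately show ?thesis by blast
    qed
    then show ?thesis by (simp add: pres_lift_def)
  qed
  show "pres_lift H f \<in> hom \<G> H"
  proof (rule homI)
    show "pres_lift H f U \<in> carrier H" if "U \<in> carrier \<G>" for U
      using that c H.free_eval_closed[OF assms(2)] by (auto simp: carrier_pres)
    fix U W assume "U \<in> carrier \<G>" "W \<in> carrier \<G>"
    then obtain x y where xy: "keys x \<subseteq> S" "keys y \<subseteq> S" "U = cls x" "W = cls y"
      by (auto simp: carrier_pres)
    have "keys (x + y) \<subseteq> S" using xy by (simp add: keys_add_subset)
    then show "pres_lift H f (U \<otimes>\<^bsub>\<G>\<^esub> W) = pres_lift H f U \<otimes>\<^bsub>H\<^esub> pres_lift H f W"
      using xy c by (simp add: cls_mult H.free_eval_add[OF assms(2)])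
  qed
  show "pres_lift H f (pres_gen S R w) = f w" if "w \<in> S"
    using c[of "frag_of w"] that assms(2) by (auto simp: pres_gen_def H.free_eval_frag_of Pi_iff)
qed

lemma cls_frag_extend:
  assumes "f \<in> T \<rightarrow> S" "keys x \<subseteq> T"
  shows "cls (frag_extend (\<lambda>v. frag_of (f v)) x) = free_eval \<G> (\<lambda>v. pres_gen S R (f v)) x"
proof -
  interpret comm_group \<G> by (rule comm_group_pres)
  have f: "(\<lambda>v. pres_gen S R (f v)) \<in> T \<rightarrow> carrier \<G>" using assms by auto
  have k: "keys (frag_extend (\<lambda>v. frag_of (f v)) x) \<subseteq> S"
    if "keys x \<subseteq> T" for x
    using keys_frag_extend[of "\<lambda>v. frag_of (f v)" x] that assms(1) by fastforce
  show ?thesis using assms(2)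
  proof (induction x rule: free_induct)
      case zero then show ?case by (simp add: cls_zero)
  next
    case (diff x y) then show ?case using k by (simp add: frag_extend_diff cls_diff free_eval_diff[OF f])
  next
    case (gen a) then show ?case using f by (subst free_eval_frag_of) (auto simp: pres_gen_def)
  qed
qed

end

lemma frag_extend_diff_fun:
  fixes a b :: "'u \<Rightarrow> 'w \<Rightarrow>\<^sub>0 int"
  shows "frag_extend (\<lambda>u. a u - b u) x = frag_extend a x - frag_extend b x"
proof -
  have "frag_cmul k (p - q) = frag_cmul k p - frag_cmul k q" for k and p q :: "'w \<Rightarrow>\<^sub>0 int"
    by (rule poly_mapping_eqI) (simp add: lookup_minus right_diff_distrib)
  then show ?thesis by (simp add: frag_extend_def sum_subtractf)
qed

locale presentation_map = dom: presentation S R + cod: presentation T Q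
  for S :: "'v set" and R and T :: "'w set" and Q +
  fixes f :: "'v \<Rightarrow> 'w"
  assumes f_closed: "v \<in> S \<Longrightarrow> f v \<in> T"
    and f_relators: "r \<in> R \<Longrightarrow>
      free_eval (pres_group T Q) (\<lambda>v. pres_gen T Q (f v)) r = \<one>\<^bsub>pres_group T Q\<^esub>"
begin

lemma pres_map_eq_lift:
  assumes "U \<in> carrier (pres_group S R)"
  shows "pres_map T Q f U = pres_lift (pres_group T Q) (\<lambda>v. pres_gen T Q (f v)) U"
proof -
  obtain x where x: "keys x \<subseteq> S" "U = pres_class S R x"
    using assms by (auto simp: dom.carrier_pres)
  have "keys u \<subseteq> S" if "u \<in> U" for u
  proof -
    obtain n where "n \<in> dom.N" "u = n + x" using \<open>u \<in> U\<close> x by (auto simp: dom.mem_cls)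
    then show ?thesis using x dom.N_subset[of n] Poly_Mapping.keys_add[of n x] by blast
  qed
  then show ?thesis unfolding pres_map_def pres_lift_def
    by (intro arg_cong[of _ _ the_elem] image_cong refl cod.cls_frag_extend[where T = S]) (auto simp: f_closed)
qed

lemma pres_map_hom: "pres_map T Q f \<in> hom (pres_group S R) (pres_group T Q)"
proof -
  interpret comm_group "pres_group S R" by (rule dom.comm_group_pres)
  have "pres_lift (pres_group T Q) (\<lambda>v. pres_gen T Q (f v)) \<in> hom (pres_group S R) (pres_group T Q)"
    by (rule dom.pres_lift_hom[OF cod.comm_group_pres]) (use f_closed f_relators in auto)
  then show ?thesis by (auto simp: hom_def pres_map_eq_lift Pi_iff)
qed

lemma pres_map_gen: "v \<in> S \<Longrightarrow> pres_map T Q f (pres_gen S R v) = pres_gen T Q (f v)"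
  using dom.pres_lift_gen[OF cod.comm_group_pres, of "\<lambda>v. pres_gen T Q (f v)"] f_closed f_relators
  by (simp add: pres_map_eq_lift dom.gen_closed cod.gen_closed)

end

locale presentation_map2 = dom1: presentation S R + dom2: presentation S' R' + cod: presentation T Q
  for S :: "'u set" and R and S' :: "'v set" and R' and T :: "'w set" and Q +
  fixes f :: "'u \<Rightarrow> 'v \<Rightarrow> 'w"
  assumes f_closed: "u \<in> S \<Longrightarrow> v \<in> S' \<Longrightarrow> f u v \<in> T"
    and f_relators1: "r \<in> R \<Longrightarrow> v \<in> S' \<Longrightarrow>
      free_eval (pres_group T Q) (\<lambda>u. pres_gen T Q (f u v)) r = \<one>\<^bsub>pres_group T Q\<^esub>"
    and f_relators2: "r' \<in> R' \<Longrightarrow> u \<in> S \<Longrightarrow>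
      free_eval (pres_group T Q) (\<lambda>v. pres_gen T Q (f u v)) r' = \<one>\<^bsub>pres_group T Q\<^esub>"
begin

definition bilin where
  "bilin x y = pres_class T Q (frag_extend (\<lambda>u. frag_extend (\<lambda>v. frag_of (f u v)) y) x)"

sublocale cod: comm_group "pres_group T Q" by (rule cod.comm_group_pres)
sublocale dom1: comm_group "pres_group S R" by (rule dom1.comm_group_pres)
sublocale dom2: comm_group "pres_group S' R'" by (rule dom2.comm_group_pres)

lemma keys_bilin:
  assumes "keys x \<subseteq> S" "keys y \<subseteq> S'"
  shows "keys (frag_extend (\<lambda>u. frag_extend (\<lambda>v. frag_of (f u v)) y) x) \<subseteq> T"
proof -
  have "keys (frag_extend (\<lambda>v. frag_of (f u v)) y) \<subseteq> T" if "u \<in> S" for u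
    using keys_frag_extend[of "\<lambda>v. frag_of (f u v)" y] that assms f_closed by fastforce
  then show ?thesis
    using keys_frag_extend[of "\<lambda>u. frag_extend (\<lambda>v. frag_of (f u v)) y" x] assms by blast
qed

lemma bilin_closed:
  "keys x \<subseteq> S \<Longrightarrow> keys y \<subseteq> S' \<Longrightarrow> bilin x y \<in> carrier (pres_group T Q)"
  unfolding bilin_def by (rule cod.cls_closed) (rule keys_bilin)

lemma bilin_diff1:
  assumes "keys x \<subseteq> S" "keys x' \<subseteq> S" "keys y \<subseteq> S'"
  shows "bilin (x - x') y = bilin x y \<otimes>\<^bsub>pres_group T Q\<^esub> inv\<^bsub>pres_group T Q\<^esub> bilin x' y"
  using assms by (simp add: bilin_def frag_extend_diff cod.cls_diff keys_bilin)

lemma bilin_diff2: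
  assumes "keys x \<subseteq> S" "keys y \<subseteq> S'" "keys y' \<subseteq> S'"
  shows "bilin x (y - y') = bilin x y \<otimes>\<^bsub>pres_group T Q\<^esub> inv\<^bsub>pres_group T Q\<^esub> bilin x y'"
  using assms by (simp add: bilin_def frag_extend_diff frag_extend_diff_fun cod.cls_diff keys_bilin)

lemma bilin_zero: "bilin 0 y = \<one>\<^bsub>pres_group T Q\<^esub>" "bilin x 0 = \<one>\<^bsub>pres_group T Q\<^esub>"
proof -
  have "frag_extend (\<lambda>u. 0 :: 'w \<Rightarrow>\<^sub>0 int) x = 0" by (rule frag_extend_eq_0) simp
  then show "bilin 0 y = \<one>\<^bsub>pres_group T Q\<^esub>" "bilin x 0 = \<one>\<^bsub>pres_group T Q\<^esub>"
    unfolding bilin_def by (simp_all only: frag_extend_0 cod.cls_zero)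
qed

lemma bilin_relator1:
  assumes "n \<in> generate (free_Abelian_group S) R" "keys y \<subseteq> S'"
  shows "bilin n y = \<one>\<^bsub>pres_group T Q\<^esub>"
  using assms(2)
proof (induction y rule: free_induct)
  case zero then show ?case by (simp add: bilin_zero)
next
  case (diff x y) then show ?case using assms dom1.N_subset by (simp add: bilin_diff2)
next
  case (gen v)
  have k: "keys n \<subseteq> S" using assms dom1.N_subset by blast
  have f: "(\<lambda>u. pres_gen T Q (f u v)) \<in> S \<rightarrow> carrier (pres_group T Q)" using f_closed gen by auto
  note l = dom1.pres_lift[OF cod.comm_group_pres f f_relators1[OF _ gen]]
  interpret h: group_hom "pres_group S R" "pres_group T Q" "pres_lift (pres_group T Q) (\<lambda>u. pres_gen T Q (f u v))"
    using l(2) by (simp add: group_hom_def group_hom_axioms_def cod.is_group dom1.is_group)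
  have "bilin n (frag_of v) = free_eval (pres_group T Q) (\<lambda>u. pres_gen T Q (f u v)) n"
    unfolding bilin_def frag_extend_of by (rule cod.cls_frag_extend[of _ S]) (use f_closed gen k in auto)
  also have "\<dots> = pres_lift (pres_group T Q) (\<lambda>u. pres_gen T Q (f u v)) (pres_class S R n)"
    using l(1)[OF _ k] by simp
  also have "\<dots> = \<one>\<^bsub>pres_group T Q\<^esub>" using h.hom_one by (simp add: dom1.cls_relator[OF assms(1)])
  finally show ?case .
qed

lemma bilin_relator2:
  assumes "n \<in> generate (free_Abelian_group S') R'" "keys x \<subseteq> S"
  shows "bilin x n = \<one>\<^bsub>pres_group T Q\<^esub>"
  using assms(2)
proof (induction x rule: free_induct)
  case zero then show ?case by (simp add: bilin_zero)
next
  case (diff x y) then show ?case using assms dom2.N_subset by (simp add: bilin_diff1)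
next
  case (gen u)
  have k: "keys n \<subseteq> S'" using assms dom2.N_subset by blast
  have f: "(\<lambda>v. pres_gen T Q (f u v)) \<in> S' \<rightarrow> carrier (pres_group T Q)" using f_closed gen by auto
  note l = dom2.pres_lift[OF cod.comm_group_pres f f_relators2[OF _ gen]]
  interpret h: group_hom "pres_group S' R'" "pres_group T Q" "pres_lift (pres_group T Q) (\<lambda>v. pres_gen T Q (f u v))"
    using l(2) by (simp add: group_hom_def group_hom_axioms_def cod.is_group dom2.is_group)
  have "bilin (frag_of u) n = free_eval (pres_group T Q) (\<lambda>v. pres_gen T Q (f u v)) n"
    unfolding bilin_def frag_extend_of by (rule cod.cls_frag_extend[of _ S']) (use f_closed gen k in auto)
  also have "\<dots> = pres_lift (pres_group T Q) (\<lambda>v. pres_gen T Q (f u v)) (pres_class S' R' n)"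
    using l(1)[OF _ k] by simp
  also have "\<dots> = \<one>\<^bsub>pres_group T Q\<^esub>" using h.hom_one by (simp add: dom2.cls_relator[OF assms(1)])
  finally show ?case .
qed

lemma pres_map2_cls:
  assumes x: "keys x \<subseteq> S" and y: "keys y \<subseteq> S'"
  shows "pres_map2 T Q f (pres_class S R x) (pres_class S' R' y) = bilin x y"
proof -
  have const: "bilin u w = bilin x y" if "u \<in> pres_class S R x" "w \<in> pres_class S' R' y" for u w
  proof -
    obtain n n' where n: "n \<in> generate (free_Abelian_group S) R" "u = n + x"
      "n' \<in> generate (free_Abelian_group S') R'" "w = n' + y"
      using \<open>u \<in> _\<close> \<open>w \<in> _\<close> by (auto simp: dom1.mem_cls dom2.mem_cls)
    have k: "keys n \<subseteq> S" "keys n' \<subseteq> S'" using n dom1.N_subset dom2.N_subset by simp_all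
    then have k': "keys (n + x) \<subseteq> S" "keys (n' + y) \<subseteq> S'"
      using x y by (simp_all add: keys_add_subset)
    have "bilin ((n + x) - n) (n' + y) = bilin (n + x) (n' + y)"
      unfolding bilin_diff1[OF k'(1) k(1) k'(2)] bilin_relator1[OF n(1) k'(2)]
      using bilin_closed[OF k'] by simp
    moreover have "bilin x ((n' + y) - n') = bilin x (n' + y)"
      unfolding bilin_diff2[OF x k'(2) k(2)] bilin_relator2[OF n(3) x]
      using bilin_closed[OF x k'(2)] by simp
    ultimately show ?thesis using n by simp
  qed
  have "(\<lambda>(u, w). bilin u w) ` (pres_class S R x \<times> pres_class S' R' y) =
      (\<lambda>_. bilin x y) ` (pres_class S R x \<times> pres_class S' R' y)"
    by (intro image_cong refl) (clarify, rule const)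
  moreover have "(x, y) \<in> pres_class S R x \<times> pres_class S' R' y"
    by (intro SigmaI dom1.self_in_cls dom2.self_in_cls)
  ultimately have "(\<lambda>(u, w). bilin u w) ` (pres_class S R x \<times> pres_class S' R' y) = {bilin x y}"
    by (simp only: image_constant)
  then show ?thesis by (simp add: pres_map2_def bilin_def)
qed

lemma pres_map2_closed:
  "U \<in> carrier (pres_group S R) \<Longrightarrow> W \<in> carrier (pres_group S' R') \<Longrightarrow>
    pres_map2 T Q f U W \<in> carrier (pres_group T Q)"
  by (auto simp: dom1.carrier_pres dom2.carrier_pres pres_map2_cls bilin_closed)

lemma pres_map2_hom1:
  assumes "W \<in> carrier (pres_group S' R')"
  shows "(\<lambda>U. pres_map2 T Q f U W) \<in> hom (pres_group S R) (pres_group T Q)"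
proof (rule homI)
  fix U U' assume U: "U \<in> carrier (pres_group S R)" "U' \<in> carrier (pres_group S R)"
  then obtain x x' where x: "keys x \<subseteq> S" "U = pres_class S R x"
     "keys x' \<subseteq> S" "U' = pres_class S R x'" by (auto simp: dom1.carrier_pres)
  obtain y where y: "keys y \<subseteq> S'" "W = pres_class S' R' y"
    using assms by (auto simp: dom2.carrier_pres)
  have k: "keys (x + x') \<subseteq> S" using x by (simp add: keys_add_subset)
  show "pres_map2 T Q f (U \<otimes>\<^bsub>pres_group S R\<^esub> U') W =
      pres_map2 T Q f U W \<otimes>\<^bsub>pres_group T Q\<^esub> pres_map2 T Q f U' W"
    unfolding x y dom1.cls_mult[OF x(1,3)] pres_map2_cls[OF x(1) y(1)] pres_map2_cls[OF x(3) y(1)]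
      pres_map2_cls[OF k y(1)]
    unfolding bilin_def frag_extend_add by (simp add: cod.cls_mult keys_bilin x(1,3) y(1))
qed (use assms pres_map2_closed in auto)

lemma pres_map2_hom2:
  assumes "U \<in> carrier (pres_group S R)"
  shows "pres_map2 T Q f U \<in> hom (pres_group S' R') (pres_group T Q)"
proof (rule homI)
  fix W W' assume W: "W \<in> carrier (pres_group S' R')" "W' \<in> carrier (pres_group S' R')"
  then obtain y y' where y: "keys y \<subseteq> S'" "W = pres_class S' R' y"
     "keys y' \<subseteq> S'" "W' = pres_class S' R' y'" by (auto simp: dom2.carrier_pres)
  obtain x where x: "keys x \<subseteq> S" "U = pres_class S R x"
    using assms by (auto simp: dom1.carrier_pres)
  have k: "keys (y + y') \<subseteq> S'" using y by (simp add: keys_add_subset)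
  have "bilin x y = bilin x (y + y') \<otimes>\<^bsub>pres_group T Q\<^esub> inv\<^bsub>pres_group T Q\<^esub> bilin x y'"
    using bilin_diff2[OF x(1) k y(3)] by simp
  then show "pres_map2 T Q f U (W \<otimes>\<^bsub>pres_group S' R'\<^esub> W') =
      pres_map2 T Q f U W \<otimes>\<^bsub>pres_group T Q\<^esub> pres_map2 T Q f U W'"
    unfolding x y dom2.cls_mult[OF y(1,3)] pres_map2_cls[OF x(1) y(1)] pres_map2_cls[OF x(1) y(3)]
      pres_map2_cls[OF x(1) k]
    using bilin_closed[OF x(1)] y k by (simp add: cod.m_assoc)
qed (use assms pres_map2_closed in auto)

lemma pres_map2_gen:
  assumes "u \<in> S" "v \<in> S'"
  shows "pres_map2 T Q f (pres_gen S R u) (pres_gen S' R' v) = pres_gen T Q (f u v)"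
  using pres_map2_cls[of "frag_of u" "frag_of v"] assms
  by (simp add: pres_gen_def bilin_def)

end

section \<open>Tensor products of algebras\<close>

lemma hom_zero:
  assumes "abelian_group M" "abelian_group N" "h \<in> add_hom M N"
  shows "h \<zero>\<^bsub>M\<^esub> = \<zero>\<^bsub>N\<^esub>"
  using hom_one[OF assms(3)] assms(1,2)[THEN abelian_group.a_group] by simp

lemma hom_closed_add: "h \<in> add_hom M N \<Longrightarrow> x \<in> carrier M \<Longrightarrow> h x \<in> carrier N"
  by (simp add: hom_def Pi_iff)

lemma hom_add: "h \<in> add_hom M N \<Longrightarrow> x \<in> carrier M \<Longrightarrow> y \<in> carrier M \<Longrightarrow>
    h (x \<oplus>\<^bsub>M\<^esub> y) = h x \<oplus>\<^bsub>N\<^esub> h y"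
  by (simp add: hom_def)

lemma hom_minus:
  assumes "abelian_group M" "abelian_group N" "h \<in> add_hom M N" "x \<in> carrier M"
  shows "h (\<ominus>\<^bsub>M\<^esub> x) = \<ominus>\<^bsub>N\<^esub> h x"
proof -
  interpret group_hom "add_monoid M" "add_monoid N" h
    using assms by (simp add: group_hom_def group_hom_axioms_def abelian_group.a_group)
  show ?thesis using hom_inv[of x] assms by (simp add: a_inv_def)
qed

lemma hom_finprod:
  assumes "comm_group M" "comm_group N" "h \<in> hom M N" "f \<in> I \<rightarrow> carrier M"
  shows "h (finprod M f I) = finprod N (\<lambda>i. h (f i)) I"
proof -
  interpret M: comm_group M by fact
  interpret N: comm_group N by fact
  have z: "h \<one>\<^bsub>M\<^esub> = \<one>\<^bsub>N\<^esub>" by (rule hom_one[OF assms(3) M.is_group N.is_group])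
  have c: "\<And>x. x \<in> carrier M \<Longrightarrow> h x \<in> carrier N" using assms(3) by (auto simp: hom_def)
  show ?thesis using assms(4)
  proof (induction I rule: infinite_finite_induct)
    case (insert i I)
    then have "f i \<in> carrier M" "f \<in> I \<rightarrow> carrier M" "(\<lambda>i. h (f i)) \<in> I \<rightarrow> carrier N" "h (f i) \<in> carrier N"
      using c by (auto simp: Pi_iff)
    then show ?case using insert hom_mult[OF assms(3)] by simp
  qed (simp_all add: z)
qed

lemma hom_finsum:
  assumes "abelian_group M" "abelian_group N" "h \<in> add_hom M N" "f \<in> I \<rightarrow> carrier M"
  shows "h (finsum M f I) = finsum N (\<lambda>i. h (f i)) I"
  using hom_finprod[OF assms(1,2)[THEN abelian_group.a_comm_group] assms(3)] assms(4) by (simp add: finsum_def)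

lemma (in abelian_group) finsum_single:
  assumes "finite I" "i \<in> I" "f i \<in> carrier G" "\<And>j. j \<in> I \<Longrightarrow> j \<noteq> i \<Longrightarrow> f j = \<zero>"
  shows "finsum G f I = f i"
proof -
  have "f j \<in> carrier G" if "j \<in> I" for j using assms that by (cases "j = i") auto
  then have "finsum G f I = finsum G f {i}"
    by (intro add.finprod_mono_neutral_cong_right) (use assms in auto)
  then show ?thesis using assms by simp
qed

lemma (in comm_monoid) finprod_Sigma:
  assumes "finite I" "finite J" "\<And>i j. i \<in> I \<Longrightarrow> j \<in> J \<Longrightarrow> f i j \<in> carrier G"
  shows "finprod G (\<lambda>i. finprod G (f i) J) I = finprod G (\<lambda>p. f (fst p) (snd p)) (I \<times> J)"
  using assms(1,3)
proof (induction I)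
  case (insert i I)
  have "finprod G (\<lambda>p. f (fst p) (snd p)) (insert i I \<times> J) =
      finprod G (\<lambda>p. f (fst p) (snd p)) ({i} \<times> J \<union> I \<times> J)"
    by (simp add: Sigma_Un_distrib1[symmetric])
  also have "\<dots> = finprod G (\<lambda>p. f (fst p) (snd p)) ({i} \<times> J) \<otimes> finprod G (\<lambda>p. f (fst p) (snd p)) (I \<times> J)"
    by (rule finprod_Un_disjoint) (use insert assms(2) in auto)
  also have "finprod G (\<lambda>p. f (fst p) (snd p)) ({i} \<times> J) = finprod G (f i) J"
  proof -
    have "finprod G (\<lambda>p. f (fst p) (snd p)) ((\<lambda>j. (i, j)) ` J) = finprod G (f i) J"
      by (subst finprod_reindex) (use insert in "auto simp: inj_on_def")
    moreover have "(\<lambda>j. (i, j)) ` J = {i} \<times> J" by auto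
    ultimately show ?thesis by simp
  qed
  finally show ?case using insert by simp
qed simp

lemma (in comm_monoid) finprod_swap:
  assumes "finite I" "finite J" "\<And>i j. i \<in> I \<Longrightarrow> j \<in> J \<Longrightarrow> f i j \<in> carrier G"
  shows "finprod G (\<lambda>i. finprod G (f i) J) I = finprod G (\<lambda>j. finprod G (\<lambda>i. f i j) I) J"
proof -
  have "finprod G (\<lambda>p. f (fst p) (snd p)) (I \<times> J) = finprod G (\<lambda>p. f (snd p) (fst p)) (J \<times> I)"
  proof -
    have "I \<times> J = (\<lambda>p. (snd p, fst p)) ` (J \<times> I)" by force
    then show ?thesis
      by (simp only:) (subst finprod_reindex, use assms in "auto simp: inj_on_def")
  qed
  then show ?thesis using assms by (simp add: finprod_Sigma)
qed

definition algebra_homs ::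
    "('k, 'x) ring_scheme \<Rightarrow> ('k, 'a, 'y) module_scheme \<Rightarrow> ('k, 'b, 'z) module_scheme \<Rightarrow> ('a \<Rightarrow> 'b) set"
  where "algebra_homs K A B =
    {h \<in> ring_hom A B. \<forall>c\<in>carrier K. \<forall>x\<in>carrier A. h (c \<odot>\<^bsub>A\<^esub> x) = c \<odot>\<^bsub>B\<^esub> h x}"

lemma opposite_simps [simp]:
  "carrier (opposite A) = carrier A" "\<zero>\<^bsub>opposite A\<^esub> = \<zero>\<^bsub>A\<^esub>" "\<one>\<^bsub>opposite A\<^esub> = \<one>\<^bsub>A\<^esub>"
  "(\<oplus>\<^bsub>opposite A\<^esub>) = (\<oplus>\<^bsub>A\<^esub>)" "x \<otimes>\<^bsub>opposite A\<^esub> y = y \<otimes>\<^bsub>A\<^esub> x" "(\<odot>\<^bsub>opposite A\<^esub>) = (\<odot>\<^bsub>A\<^esub>)"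
  by (simp_all add: opposite_def)

lemma algebra_homs_opposite:
  "h \<in> algebra_homs K A B \<Longrightarrow> h \<in> algebra_homs K (opposite A) (opposite B)"
  by (auto simp: algebra_homs_def ring_hom_def)

lemma K_algebra_opposite:
  assumes "K_algebra K A" shows "K_algebra K (opposite A)"
proof -
  interpret A: K_algebra K A by fact
  have "abelian_group (opposite A)"
    by (rule abelian_groupI) (auto simp: A.A.a_ac intro: A.A.l_neg A.A.a_inv_closed)
  moreover have "monoid (opposite A)"
    by (rule monoidI) (auto simp: A.A.m_assoc)
  ultimately have R: "ring (opposite A)"
    by (rule ringI) (auto simp: A.A.l_distr A.A.r_distr)
  moreover have "module K (opposite A)"
    by (rule moduleI) (use R in "auto simp: A.smult_l_distr A.smult_r_distr A.smult_assoc1 A.R.is_cring ring.is_abelian_group")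
  ultimately show ?thesis
    by (auto simp: K_algebra_def K_algebra_axioms_def A.R.field_axioms A.smult_mult_left A.smult_mult_right)
qed

definition tens ::
    "('k, 'x) ring_scheme \<Rightarrow> ('k, 'a) module \<Rightarrow> ('k, 'b) module \<Rightarrow> 'a \<Rightarrow> 'b \<Rightarrow> ('a \<times> 'b \<Rightarrow>\<^sub>0 int) set"
  where "tens K A B a b = pres_gen (carrier A \<times> carrier B) (tensor_relators K A B) (a, b)"

text \<open>
  Elementary tensors of the enveloping algebra are the case \<open>B = opposite A\<close> of the general ones.
\<close>

lemma env_elem_eq_tens: "env_elem K A a b = tens K A (opposite A) a b"
  by (simp add: env_elem_def tens_def pres_gen_def)

locale biadditive =
  fixes A :: "('a, 'm) ring_scheme" and B :: "('b, 'n) ring_scheme" and H :: "('h, 'o) monoid_scheme"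
    and F :: "'a \<Rightarrow> 'b \<Rightarrow> 'h"
  assumes closed: "a \<in> carrier A \<Longrightarrow> b \<in> carrier B \<Longrightarrow> F a b \<in> carrier H"
    and add1: "\<lbrakk>a \<in> carrier A; a' \<in> carrier A; b \<in> carrier B\<rbrakk> \<Longrightarrow> F (a \<oplus>\<^bsub>A\<^esub> a') b = F a b \<otimes>\<^bsub>H\<^esub> F a' b"
    and add2: "\<lbrakk>a \<in> carrier A; b \<in> carrier B; b' \<in> carrier B\<rbrakk> \<Longrightarrow> F a (b \<oplus>\<^bsub>B\<^esub> b') = F a b \<otimes>\<^bsub>H\<^esub> F a b'"

locale tensor = A: K_algebra K A + B: K_algebra K B
  for K :: "('k, 'x) ring_scheme" and A :: "('k, 'a) module" and B :: "('k, 'b) module"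
begin

abbreviation S where "S \<equiv> carrier A \<times> carrier B"
abbreviation R where "R \<equiv> tensor_relators K A B"
abbreviation T where "T \<equiv> tensor_product K A B"
abbreviation t where "t \<equiv> tens K A B"

sublocale P: presentation S R
proof
  have "keys r \<subseteq> S" if "r \<in> R" for r
    using that unfolding tensor_relators_def
    by (elim UnE CollectE exE conjE) (simp_all add: keys_diff_subset A.A.a_closed B.A.a_closed A.smult_closed B.smult_closed)
  then show "R \<subseteq> carrier (free_Abelian_group S)" by auto
qed

lemma T_simps:
  "carrier T = carrier (pres_group S R)" "\<zero>\<^bsub>T\<^esub> = \<one>\<^bsub>pres_group S R\<^esub>"
  "(\<oplus>\<^bsub>T\<^esub>) = (\<otimes>\<^bsub>pres_group S R\<^esub>)" "\<one>\<^bsub>T\<^esub> = t \<one>\<^bsub>A\<^esub> \<one>\<^bsub>B\<^esub>"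
  "(\<otimes>\<^bsub>T\<^esub>) = pres_map2 S R (\<lambda>(a, b) (a', b'). (a \<otimes>\<^bsub>A\<^esub> a', b \<otimes>\<^bsub>B\<^esub> b'))"
  by (simp_all add: tensor_product_def Let_def tens_def pres_gen_def)

lemma add_monoid_T:
  "hom (add_monoid T) H = hom (pres_group S R) H" "hom H (add_monoid T) = hom H (pres_group S R)"
  by (simp_all add: hom_def T_simps)

lemma abelian_group_T: "abelian_group T"
proof -
  interpret comm_group "pres_group S R" by (rule P.comm_group_pres)
  show ?thesis
    by (rule abelian_groupI) (auto simp: T_simps m_ac intro: l_inv inv_closed)
qed

sublocale T: abelian_group T by (rule abelian_group_T)

lemma t_closed [simp, intro]: "a \<in> carrier A \<Longrightarrow> b \<in> carrier B \<Longrightarrow> t a b \<in> carrier T"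
  by (simp add: tens_def T_simps P.gen_closed)

lemma t_add1:
  "\<lbrakk>a \<in> carrier A; a' \<in> carrier A; b \<in> carrier B\<rbrakk> \<Longrightarrow> t (a \<oplus>\<^bsub>A\<^esub> a') b = t a b \<oplus>\<^bsub>T\<^esub> t a' b"
  unfolding tens_def T_simps by (rule P.gen_relator3) (auto simp: tensor_relators_def)

lemma t_add2:
  "\<lbrakk>a \<in> carrier A; b \<in> carrier B; b' \<in> carrier B\<rbrakk> \<Longrightarrow> t a (b \<oplus>\<^bsub>B\<^esub> b') = t a b \<oplus>\<^bsub>T\<^esub> t a b'"
  unfolding tens_def T_simps by (rule P.gen_relator3) (auto simp: tensor_relators_def)

lemma t_smult:
  "\<lbrakk>c \<in> carrier K; a \<in> carrier A; b \<in> carrier B\<rbrakk> \<Longrightarrow> t (c \<odot>\<^bsub>A\<^esub> a) b = t a (c \<odot>\<^bsub>B\<^esub> b)"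
  unfolding tens_def by (rule P.gen_relator2) (auto simp: tensor_relators_def)

lemma t_hom1: "b \<in> carrier B \<Longrightarrow> (\<lambda>a. t a b) \<in> add_hom A T"
  by (auto simp: hom_def t_add1)

lemma t_hom2: "a \<in> carrier A \<Longrightarrow> t a \<in> add_hom B T"
  by (auto simp: hom_def t_add2)

lemmas t_zero1 = hom_zero[OF A.A.is_abelian_group T.abelian_group_axioms t_hom1]
lemmas t_zero2 = hom_zero[OF B.A.is_abelian_group T.abelian_group_axioms t_hom2]
lemma t_induct [consumes 1, case_names t add]:
  assumes "x \<in> carrier T"
    and t: "\<And>a b. a \<in> carrier A \<Longrightarrow> b \<in> carrier B \<Longrightarrow> Q (t a b)"
    and add: "\<And>x y. \<lbrakk>x \<in> carrier T; y \<in> carrier T; Q x; Q y\<rbrakk> \<Longrightarrow> Q (x \<oplus>\<^bsub>T\<^esub> y)"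
  shows "Q x"
proof -
  have "x \<in> carrier (pres_group S R)" using assms by (simp add: T_simps)
  then have "Q x \<and> Q (\<ominus>\<^bsub>T\<^esub> x)"
  proof (induction rule: P.pres_induct)
    case (gen w)
    then obtain a b where w: "a \<in> carrier A" "b \<in> carrier B" "w = (a, b)" by auto
    have "\<ominus>\<^bsub>T\<^esub> t a b = t (\<ominus>\<^bsub>A\<^esub> a) b"
      using w hom_minus[OF A.A.is_abelian_group T.abelian_group_axioms t_hom1] by simp
    then show ?case using w t by (simp add: tens_def)
  next
    case one
    have "Q (t \<zero>\<^bsub>A\<^esub> \<zero>\<^bsub>B\<^esub>)" using t by simp
    then have q: "Q \<zero>\<^bsub>T\<^esub>" by (simp add: t_zero1)
    have "\<ominus>\<^bsub>T\<^esub> \<zero>\<^bsub>T\<^esub> = \<zero>\<^bsub>T\<^esub>" by (rule T.minus_equality) simp_all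
    then have "Q (\<ominus>\<^bsub>T\<^esub> \<zero>\<^bsub>T\<^esub>)" using q by (simp only:)
    then show ?case using q unfolding T_simps(2) by blast
  next
    case (mult U W)
    then show ?case unfolding T_simps(1,3)[symmetric] by (simp add: add T.minus_add)
  next
    case (inv U)
    then have U: "U \<in> carrier T" by (simp add: T_simps)
    have "inv\<^bsub>pres_group S R\<^esub> U = \<ominus>\<^bsub>T\<^esub> U" by (simp add: a_inv_def m_inv_def T_simps)
    then show ?case using inv U by simp
  qed
  then show ?thesis by simp
qed

lemma relators_eval:
  assumes "comm_group H" "biadditive A B H F"
    and "\<And>c a b. \<lbrakk>c \<in> carrier K; a \<in> carrier A; b \<in> carrier B\<rbrakk> \<Longrightarrow> F (c \<odot>\<^bsub>A\<^esub> a) b = F a (c \<odot>\<^bsub>B\<^esub> b)"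
    and "r \<in> R"
  shows "free_eval H (\<lambda>p. F (fst p) (snd p)) r = \<one>\<^bsub>H\<^esub>"
proof -
  interpret H: comm_group H by fact
  interpret biadditive A B H F by fact
  show ?thesis using assms(4) unfolding tensor_relators_def
    by (elim UnE CollectE exE conjE; hypsubst)
      (rule H.free_eval_relator3 H.free_eval_relator2; simp add: closed add1 add2 assms(3) A.smult_closed B.smult_closed)+
qed

sublocale M: presentation_map2 S R S R S R "\<lambda>(a, b) (a', b'). (a \<otimes>\<^bsub>A\<^esub> a', b \<otimes>\<^bsub>B\<^esub> b')"
proof (unfold_locales, goal_cases)
  case (1 u v) then show ?case by auto
next
  case (2 r v)
  then obtain a' b' where v: "v = (a', b')" "a' \<in> carrier A" "b' \<in> carrier B" by auto
  have "free_eval (pres_group S R) (\<lambda>p. t (fst p \<otimes>\<^bsub>A\<^esub> a') (snd p \<otimes>\<^bsub>B\<^esub> b')) r = \<one>\<^bsub>pres_group S R\<^esub>"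
    by (rule relators_eval[OF P.comm_group_pres])
      (use v 2 in \<open>auto simp: biadditive_def T_simps(1,3)[symmetric] A.A.l_distr B.A.l_distr t_add1 t_add2
        A.smult_mult_left B.smult_mult_left t_smult\<close>)
  then show ?case by (simp add: v tens_def case_prod_beta')
next
  case (3 r v)
  then obtain a' b' where v: "v = (a', b')" "a' \<in> carrier A" "b' \<in> carrier B" by auto
  have "free_eval (pres_group S R) (\<lambda>p. t (a' \<otimes>\<^bsub>A\<^esub> fst p) (b' \<otimes>\<^bsub>B\<^esub> snd p)) r = \<one>\<^bsub>pres_group S R\<^esub>"
    by (rule relators_eval[OF P.comm_group_pres])
      (use v 3 in \<open>auto simp: biadditive_def T_simps(1,3)[symmetric] A.A.r_distr B.A.r_distr t_add1 t_add2
        A.smult_mult_right B.smult_mult_right t_smult\<close>)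
  then show ?case by (simp add: v tens_def case_prod_beta')
qed

lemma t_mult:
  "\<lbrakk>a \<in> carrier A; b \<in> carrier B; a' \<in> carrier A; b' \<in> carrier B\<rbrakk> \<Longrightarrow>
    t a b \<otimes>\<^bsub>T\<^esub> t a' b' = t (a \<otimes>\<^bsub>A\<^esub> a') (b \<otimes>\<^bsub>B\<^esub> b')"
  using M.pres_map2_gen[of "(a, b)" "(a', b')"] by (simp add: T_simps tens_def)

lemma mult_hom1: "y \<in> carrier T \<Longrightarrow> (\<lambda>x. x \<otimes>\<^bsub>T\<^esub> y) \<in> add_hom T T"
  unfolding add_monoid_T unfolding T_simps(1,5) by (rule M.pres_map2_hom1)

lemma mult_hom2: "x \<in> carrier T \<Longrightarrow> (\<lambda>y. x \<otimes>\<^bsub>T\<^esub> y) \<in> add_hom T T"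
  unfolding add_monoid_T unfolding T_simps(1,5) by (rule M.pres_map2_hom2)

lemma ring_T: "ring T"
proof (rule ringI)
  note c = hom_closed_add[OF mult_hom1]
  note d1 = hom_add[OF mult_hom1] and d2 = hom_add[OF mult_hom2]
  have assoc0: "(x \<otimes>\<^bsub>T\<^esub> t a b) \<otimes>\<^bsub>T\<^esub> t a' b' = x \<otimes>\<^bsub>T\<^esub> (t a b \<otimes>\<^bsub>T\<^esub> t a' b')"
    if "x \<in> carrier T" "a \<in> carrier A" "b \<in> carrier B" "a' \<in> carrier A" "b' \<in> carrier B" for x a b a' b'
    using that by (induction rule: t_induct) (simp_all add: t_mult A.A.m_assoc B.A.m_assoc d1 c)
  have assoc1: "(x \<otimes>\<^bsub>T\<^esub> y) \<otimes>\<^bsub>T\<^esub> t a' b' = x \<otimes>\<^bsub>T\<^esub> (y \<otimes>\<^bsub>T\<^esub> t a' b')"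
    if "y \<in> carrier T" "x \<in> carrier T" "a' \<in> carrier A" "b' \<in> carrier B" for x y a' b'
    using that by (induction rule: t_induct) (simp_all add: assoc0 d1 d2 c)
  have assoc: "(x \<otimes>\<^bsub>T\<^esub> y) \<otimes>\<^bsub>T\<^esub> z = x \<otimes>\<^bsub>T\<^esub> (y \<otimes>\<^bsub>T\<^esub> z)"
    if "z \<in> carrier T" "x \<in> carrier T" "y \<in> carrier T" for x y z
    using that by (induction rule: t_induct) (simp_all add: assoc1 d1 d2 c)
  have l1: "\<one>\<^bsub>T\<^esub> \<otimes>\<^bsub>T\<^esub> x = x" if "x \<in> carrier T" for x
    using that by (induction rule: t_induct) (simp_all add: T_simps(4) t_mult d2)
  have r1: "x \<otimes>\<^bsub>T\<^esub> \<one>\<^bsub>T\<^esub> = x" if "x \<in> carrier T" for x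
    using that by (induction rule: t_induct) (simp_all add: T_simps(4) t_mult d1)
  have "\<one>\<^bsub>T\<^esub> \<in> carrier T" by (simp add: T_simps(4))
  then show "monoid T" by (intro monoidI) (simp_all add: c assoc l1 r1)
  show "(x \<oplus>\<^bsub>T\<^esub> y) \<otimes>\<^bsub>T\<^esub> z = x \<otimes>\<^bsub>T\<^esub> z \<oplus>\<^bsub>T\<^esub> y \<otimes>\<^bsub>T\<^esub> z"
    if "x \<in> carrier T" "y \<in> carrier T" "z \<in> carrier T" for x y z using that by (simp add: d1)
  show "z \<otimes>\<^bsub>T\<^esub> (x \<oplus>\<^bsub>T\<^esub> y) = z \<otimes>\<^bsub>T\<^esub> x \<oplus>\<^bsub>T\<^esub> z \<otimes>\<^bsub>T\<^esub> y"
    if "x \<in> carrier T" "y \<in> carrier T" "z \<in> carrier T" for x y z using that by (simp add: d2)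
qed (rule abelian_group_T)

end

definition tensor_map where
  "tensor_map K A' B' \<alpha> \<beta> =
    pres_map (carrier A' \<times> carrier B') (tensor_relators K A' B') (\<lambda>(a, b). (\<alpha> a, \<beta> b))"

locale tensor_hom = dom: tensor K A B + cod: tensor K A' B'
  for K :: "('k, 'x) ring_scheme" and A :: "('k, 'a) module" and B :: "('k, 'b) module"
    and A' :: "('k, 'c) module" and B' :: "('k, 'd) module" +
  fixes \<alpha> \<beta>
  assumes \<alpha>: "\<alpha> \<in> algebra_homs K A A'" and \<beta>: "\<beta> \<in> algebra_homs K B B'"
begin

abbreviation \<tau> where "\<tau> \<equiv> tensor_map K A' B' \<alpha> \<beta>"

lemma \<alpha>_props: "a \<in> carrier A \<Longrightarrow> \<alpha> a \<in> carrier A'" "\<alpha> \<one>\<^bsub>A\<^esub> = \<one>\<^bsub>A'\<^esub>"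
  "\<lbrakk>a \<in> carrier A; a' \<in> carrier A\<rbrakk> \<Longrightarrow> \<alpha> (a \<oplus>\<^bsub>A\<^esub> a') = \<alpha> a \<oplus>\<^bsub>A'\<^esub> \<alpha> a'"
  "\<lbrakk>a \<in> carrier A; a' \<in> carrier A\<rbrakk> \<Longrightarrow> \<alpha> (a \<otimes>\<^bsub>A\<^esub> a') = \<alpha> a \<otimes>\<^bsub>A'\<^esub> \<alpha> a'"
  "\<lbrakk>c \<in> carrier K; a \<in> carrier A\<rbrakk> \<Longrightarrow> \<alpha> (c \<odot>\<^bsub>A\<^esub> a) = c \<odot>\<^bsub>A'\<^esub> \<alpha> a"
  using \<alpha> by (auto simp: algebra_homs_def ring_hom_def)

lemma \<beta>_props: "b \<in> carrier B \<Longrightarrow> \<beta> b \<in> carrier B'" "\<beta> \<one>\<^bsub>B\<^esub> = \<one>\<^bsub>B'\<^esub>"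
  "\<lbrakk>b \<in> carrier B; b' \<in> carrier B\<rbrakk> \<Longrightarrow> \<beta> (b \<oplus>\<^bsub>B\<^esub> b') = \<beta> b \<oplus>\<^bsub>B'\<^esub> \<beta> b'"
  "\<lbrakk>b \<in> carrier B; b' \<in> carrier B\<rbrakk> \<Longrightarrow> \<beta> (b \<otimes>\<^bsub>B\<^esub> b') = \<beta> b \<otimes>\<^bsub>B'\<^esub> \<beta> b'"
  "\<lbrakk>c \<in> carrier K; b \<in> carrier B\<rbrakk> \<Longrightarrow> \<beta> (c \<odot>\<^bsub>B\<^esub> b) = c \<odot>\<^bsub>B'\<^esub> \<beta> b"
  using \<beta> by (auto simp: algebra_homs_def ring_hom_def)

sublocale m: presentation_map dom.S dom.R cod.S cod.R "\<lambda>(a, b). (\<alpha> a, \<beta> b)"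
proof (unfold_locales, goal_cases)
  case (1 v) then show ?case by (auto simp: \<alpha>_props \<beta>_props)
next
  case (2 r)
  have "free_eval (pres_group cod.S cod.R) (\<lambda>p. cod.t (\<alpha> (fst p)) (\<beta> (snd p))) r = \<one>\<^bsub>pres_group cod.S cod.R\<^esub>"
    by (rule dom.relators_eval[OF cod.P.comm_group_pres])
      (use 2 in "auto simp: biadditive_def cod.T_simps(1,3)[symmetric] \<alpha>_props \<beta>_props cod.t_add1 cod.t_add2 cod.t_smult")
  then show ?case by (simp add: tens_def case_prod_beta')
qed

lemma \<tau>_hom: "\<tau> \<in> add_hom dom.T cod.T"
  unfolding tensor_map_def dom.add_monoid_T cod.add_monoid_T by (rule m.pres_map_hom)

lemma \<tau>_tens: "a \<in> carrier A \<Longrightarrow> b \<in> carrier B \<Longrightarrow> \<tau> (dom.t a b) = cod.t (\<alpha> a) (\<beta> b)"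
  using m.pres_map_gen[of "(a, b)"] by (simp add: tensor_map_def tens_def)

lemma \<tau>_ring_hom: "\<tau> \<in> ring_hom dom.T cod.T"
proof (rule ring_hom_memI)
  interpret T: ring dom.T by (rule dom.ring_T)
  interpret T': ring cod.T by (rule cod.ring_T)
  note c = hom_closed_add[OF \<tau>_hom] and a = hom_add[OF \<tau>_hom]
  have m0: "\<tau> (x \<otimes>\<^bsub>dom.T\<^esub> dom.t a' b') = \<tau> x \<otimes>\<^bsub>cod.T\<^esub> \<tau> (dom.t a' b')"
    if "x \<in> carrier dom.T" "a' \<in> carrier A" "b' \<in> carrier B" for x a' b'
    using that by (induction rule: dom.t_induct)
      (simp_all add: dom.t_mult cod.t_mult \<tau>_tens \<alpha>_props \<beta>_props T.l_distr T'.l_distr a c)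
  show "\<tau> (x \<otimes>\<^bsub>dom.T\<^esub> y) = \<tau> x \<otimes>\<^bsub>cod.T\<^esub> \<tau> y" if "x \<in> carrier dom.T" "y \<in> carrier dom.T" for x y
    using that(2,1) by (induction rule: dom.t_induct) (simp_all add: m0 T.r_distr T'.r_distr a c)
  show "\<tau> \<one>\<^bsub>dom.T\<^esub> = \<one>\<^bsub>cod.T\<^esub>"
    by (simp add: dom.T_simps(4) cod.T_simps(4) \<tau>_tens \<alpha>_props \<beta>_props)
qed (simp_all add: hom_closed_add[OF \<tau>_hom] hom_add[OF \<tau>_hom])

end

text \<open>
  The action on the regular bimodule is a lift of the biadditive map \<open>(a, b) \<mapsto> a m b\<close>, so that the
  universal property of the tensor product applies to it.
\<close>

lemma regular_smult_eq_lift: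
  "U \<odot>\<^bsub>regular_bimodule A\<^esub> m = pres_lift (add_monoid A) (\<lambda>p. fst p \<otimes>\<^bsub>A\<^esub> m \<otimes>\<^bsub>A\<^esub> snd p) U"
  by (simp add: regular_bimodule_def pres_lift_def free_eval_def finsum_def add_pow_def)

lemma
  assumes "K_algebra K A" and m: "m \<in> carrier A"
  shows regular_smult_hom:
      "(\<lambda>U. U \<odot>\<^bsub>regular_bimodule A\<^esub> m) \<in> add_hom (enveloping K A) A"
    and regular_smult_env_elem: "\<lbrakk>a \<in> carrier A; b \<in> carrier A\<rbrakk> \<Longrightarrow>
      env_elem K A a b \<odot>\<^bsub>regular_bimodule A\<^esub> m = a \<otimes>\<^bsub>A\<^esub> m \<otimes>\<^bsub>A\<^esub> b"
proof -
  interpret A: K_algebra K A by fact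
  interpret tensor K A "opposite A" by (simp add: tensor_def assms K_algebra_opposite)
  have H: "comm_group (add_monoid A)" by (rule A.A.a_comm_group)
  let ?f = "\<lambda>p. fst p \<otimes>\<^bsub>A\<^esub> m \<otimes>\<^bsub>A\<^esub> snd p"
  have f: "?f \<in> S \<rightarrow> carrier (add_monoid A)" using m by auto
  have r: "free_eval (add_monoid A) ?f r = \<one>\<^bsub>add_monoid A\<^esub>" if "r \<in> R" for r
    by (rule relators_eval[OF H])
      (use m that in "auto simp: biadditive_def A.A.l_distr A.A.r_distr A.smult_mult_left A.smult_mult_right")
  show "(\<lambda>U. U \<odot>\<^bsub>regular_bimodule A\<^esub> m) \<in> add_hom (enveloping K A) A"
    unfolding regular_smult_eq_lift enveloping_def add_monoid_T
    using P.pres_lift_hom[OF H f r] by simp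
  show "env_elem K A a b \<odot>\<^bsub>regular_bimodule A\<^esub> m = a \<otimes>\<^bsub>A\<^esub> m \<otimes>\<^bsub>A\<^esub> b"
    if "a \<in> carrier A" "b \<in> carrier A"
    using P.pres_lift_gen[OF H f r, of "(a, b)"] that
    by (simp add: regular_smult_eq_lift env_elem_eq_tens tens_def)
qed

section \<open>Projective modules and comparison of resolutions\<close>

lemma (in left_module) smult_hom: "r \<in> carrier R \<Longrightarrow> (\<lambda>x. r \<odot>\<^bsub>M\<^esub> x) \<in> add_hom M M"
  by (auto simp: hom_def smult_closed smult_r_distr)

lemma (in left_module) smult_hom_scalar: "x \<in> carrier M \<Longrightarrow> (\<lambda>r. r \<odot>\<^bsub>M\<^esub> x) \<in> add_hom R M"
  by (auto simp: hom_def smult_closed smult_l_distr)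

lemma (in left_module) smult_zero: "r \<in> carrier R \<Longrightarrow> r \<odot>\<^bsub>M\<^esub> \<zero>\<^bsub>M\<^esub> = \<zero>\<^bsub>M\<^esub>"
  using hom_zero[OF M.abelian_group_axioms M.abelian_group_axioms smult_hom] .

lemma (in left_module) zero_smult: "x \<in> carrier M \<Longrightarrow> \<zero>\<^bsub>R\<^esub> \<odot>\<^bsub>M\<^esub> x = \<zero>\<^bsub>M\<^esub>"
  using hom_zero[OF R.abelian_group_axioms M.abelian_group_axioms smult_hom_scalar] .

lemma (in left_module) smult_minus: "r \<in> carrier R \<Longrightarrow> x \<in> carrier M \<Longrightarrow> r \<odot>\<^bsub>M\<^esub> (\<ominus>\<^bsub>M\<^esub> x) = \<ominus>\<^bsub>M\<^esub> (r \<odot>\<^bsub>M\<^esub> x)"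
  using hom_minus[OF M.abelian_group_axioms M.abelian_group_axioms smult_hom] .

lemma (in left_module) smult_finsum:
  "r \<in> carrier R \<Longrightarrow> f \<in> I \<rightarrow> carrier M \<Longrightarrow> r \<odot>\<^bsub>M\<^esub> finsum M f I = finsum M (\<lambda>i. r \<odot>\<^bsub>M\<^esub> f i) I"
  using hom_finsum[OF M.abelian_group_axioms M.abelian_group_axioms smult_hom] .

lemma (in left_module) finsum_smult:
  "x \<in> carrier M \<Longrightarrow> f \<in> I \<rightarrow> carrier R \<Longrightarrow> finsum R f I \<odot>\<^bsub>M\<^esub> x = finsum M (\<lambda>i. f i \<odot>\<^bsub>M\<^esub> x) I"
  using hom_finsum[OF R.abelian_group_axioms M.abelian_group_axioms smult_hom_scalar] .

definition pullback :: "('s \<Rightarrow> 'r) \<Rightarrow> ('r, 'm) module \<Rightarrow> ('s, 'm) module"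
  where "pullback \<sigma> M =
    \<lparr>carrier = carrier M, monoid.mult = undefined, monoid.one = undefined,
     ring.zero = \<zero>\<^bsub>M\<^esub>, ring.add = (\<oplus>\<^bsub>M\<^esub>), smult = (\<lambda>s x. \<sigma> s \<odot>\<^bsub>M\<^esub> x)\<rparr>"

lemma pullback_simps [simp]:
  "carrier (pullback \<sigma> M) = carrier M" "\<zero>\<^bsub>pullback \<sigma> M\<^esub> = \<zero>\<^bsub>M\<^esub>"
  "(\<oplus>\<^bsub>pullback \<sigma> M\<^esub>) = (\<oplus>\<^bsub>M\<^esub>)" "s \<odot>\<^bsub>pullback \<sigma> M\<^esub> x = \<sigma> s \<odot>\<^bsub>M\<^esub> x"
  by (simp_all add: pullback_def)

lemma res_eq_pullback:
  "restrict_scalars S G P = pullback (\<lambda>s. skew_elem S G s \<one>\<^bsub>G\<^esub>) P"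
  by (simp add: restrict_scalars_def pullback_def)

lemma left_module_pullback:
  assumes "ring R" "\<sigma> \<in> ring_hom R R'" "left_module R' M"
  shows "left_module R (pullback \<sigma> M)"
proof -
  interpret R: ring R by fact
  interpret M: left_module R' M by fact
  have "abelian_group (pullback \<sigma> M)"
    by (rule abelian_groupI) (auto simp: M.M.a_ac intro: M.M.l_neg M.M.a_inv_closed)
  moreover have "\<sigma> \<one>\<^bsub>R\<^esub> = \<one>\<^bsub>R'\<^esub>" and
    "\<And>r s. r \<in> carrier R \<Longrightarrow> s \<in> carrier R \<Longrightarrow> \<sigma> (r \<oplus>\<^bsub>R\<^esub> s) = \<sigma> r \<oplus>\<^bsub>R'\<^esub> \<sigma> s"
    "\<And>r s. r \<in> carrier R \<Longrightarrow> s \<in> carrier R \<Longrightarrow> \<sigma> (r \<otimes>\<^bsub>R\<^esub> s) = \<sigma> r \<otimes>\<^bsub>R'\<^esub> \<sigma> s"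
    "\<And>r. r \<in> carrier R \<Longrightarrow> \<sigma> r \<in> carrier R'"
    using assms(2) by (auto simp: ring_hom_def)
  ultimately show ?thesis
    by (simp add: left_module_def left_module_axioms_def R.ring_axioms M.smult_closed M.smult_l_distr
        M.smult_r_distr M.smult_assoc M.smult_one)
qed

lemma finsum_pullback:
  assumes "abelian_group M" "abelian_group (pullback \<sigma> M)" "f \<in> I \<rightarrow> carrier M"
  shows "finsum (pullback \<sigma> M) f I = finsum M f I"
proof -
  have "(\<lambda>x. x) \<in> add_hom M (pullback \<sigma> M)" by (simp add: hom_def)
  from hom_finsum[OF assms(1,2) this assms(3)] show ?thesis by simp
qed

lemma module_homI:
  assumes "\<And>x. x \<in> carrier M \<Longrightarrow> f x \<in> carrier N"
    and "\<And>x y. x \<in> carrier M \<Longrightarrow> y \<in> carrier M \<Longrightarrow> f (x \<oplus>\<^bsub>M\<^esub> y) = f x \<oplus>\<^bsub>N\<^esub> f y"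
    and "\<And>r x. r \<in> carrier R \<Longrightarrow> x \<in> carrier M \<Longrightarrow> f (r \<odot>\<^bsub>M\<^esub> x) = r \<odot>\<^bsub>N\<^esub> f x"
  shows "f \<in> module_hom R M N"
  using assms by (simp add: module_hom_def hom_def)

lemma module_homD:
  assumes "f \<in> module_hom R M N"
  shows "x \<in> carrier M \<Longrightarrow> f x \<in> carrier N"
    and "x \<in> carrier M \<Longrightarrow> y \<in> carrier M \<Longrightarrow> f (x \<oplus>\<^bsub>M\<^esub> y) = f x \<oplus>\<^bsub>N\<^esub> f y"
    and "r \<in> carrier R \<Longrightarrow> x \<in> carrier M \<Longrightarrow> f (r \<odot>\<^bsub>M\<^esub> x) = r \<odot>\<^bsub>N\<^esub> f x"
    and "f \<in> add_hom M N"
  using assms by (auto simp: module_hom_def hom_def)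

lemma module_hom_zero:
  assumes "f \<in> module_hom R M N" "abelian_group M" "abelian_group N"
  shows "f \<zero>\<^bsub>M\<^esub> = \<zero>\<^bsub>N\<^esub>"
  using hom_zero[OF assms(2,3) module_homD(4)[OF assms(1)]] .

lemma module_hom_comp:
  "\<lbrakk>f \<in> module_hom R M N; g \<in> module_hom R N L\<rbrakk> \<Longrightarrow> (\<lambda>x. g (f x)) \<in> module_hom R M L"
  by (rule module_homI) (simp_all add: module_homD)

lemma module_hom_diff:
  assumes "f \<in> module_hom R M N" "g \<in> module_hom R M N" "left_module R N"
  shows "(\<lambda>x. f x \<ominus>\<^bsub>N\<^esub> g x) \<in> module_hom R M N"
proof -
  interpret N: left_module R N by fact
  note [simp] = module_homD(1-3)[OF assms(1)] module_homD(1-3)[OF assms(2)]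
  show ?thesis
    by (rule module_homI) (simp_all add: a_minus_def N.M.minus_add N.M.a_ac N.smult_r_distr N.smult_minus)
qed

lemma module_hom_pullback:
  "f \<in> module_hom R' M N \<Longrightarrow> (\<And>r. r \<in> carrier R \<Longrightarrow> \<sigma> r \<in> carrier R') \<Longrightarrow>
    f \<in> module_hom R (pullback \<sigma> M) (pullback \<sigma> N)"
  by (rule module_homI) (simp_all add: module_homD)

text \<open>
  A family of elements with coordinate functionals: the projective basis theorem characterizes
  projectivity by its existence. In this form projectivity passes along ring extensions without
  quantifying over modules of a fixed type.
\<close>

definition dual_basis ::
    "('r, 'x) ring_scheme \<Rightarrow> ('r, 'p) module \<Rightarrow> 'i set \<Rightarrow> ('i \<Rightarrow> 'p) \<Rightarrow> ('p \<Rightarrow> 'i \<Rightarrow> 'r) \<Rightarrow> bool"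
  where "dual_basis R P I b s \<longleftrightarrow>
    b \<in> I \<rightarrow> carrier P \<and>
    (\<forall>x\<in>carrier P. \<forall>i\<in>I. s x i \<in> carrier R) \<and>
    (\<forall>x\<in>carrier P. finite {i \<in> I. s x i \<noteq> \<zero>\<^bsub>R\<^esub>}) \<and>
    (\<forall>x\<in>carrier P. \<forall>y\<in>carrier P. \<forall>i\<in>I. s (x \<oplus>\<^bsub>P\<^esub> y) i = s x i \<oplus>\<^bsub>R\<^esub> s y i) \<and>
    (\<forall>r\<in>carrier R. \<forall>x\<in>carrier P. \<forall>i\<in>I. s (r \<odot>\<^bsub>P\<^esub> x) i = r \<otimes>\<^bsub>R\<^esub> s x i) \<and>
    (\<forall>x\<in>carrier P. finsum P (\<lambda>i. s x i \<odot>\<^bsub>P\<^esub> b i) {i \<in> I. s x i \<noteq> \<zero>\<^bsub>R\<^esub>} = x)"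

lemma (in left_module) finsum_support:
  assumes "finite T" "{i \<in> I. c i \<noteq> \<zero>\<^bsub>R\<^esub>} \<subseteq> T" "T \<subseteq> I" "y \<in> I \<rightarrow> carrier M" "c \<in> I \<rightarrow> carrier R"
  shows "finsum M (\<lambda>i. c i \<odot>\<^bsub>M\<^esub> y i) {i \<in> I. c i \<noteq> \<zero>\<^bsub>R\<^esub>} = finsum M (\<lambda>i. c i \<odot>\<^bsub>M\<^esub> y i) T"
proof (rule M.add.finprod_mono_neutral_cong_left)
  show "c i \<odot>\<^bsub>M\<^esub> y i = \<zero>\<^bsub>M\<^esub>" if "i \<in> T - {i \<in> I. c i \<noteq> \<zero>\<^bsub>R\<^esub>}" for i
  proof -
    have "c i = \<zero>\<^bsub>R\<^esub>" "y i \<in> carrier M" using that assms by auto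
    then show ?thesis by (simp add: zero_smult)
  qed
  show "(\<lambda>i. c i \<odot>\<^bsub>M\<^esub> y i) \<in> T \<rightarrow> carrier M" using assms by (auto intro!: smult_closed)
qed (use assms in auto)

lemma dual_basis_hom:
  assumes D: "dual_basis R P I b s" and P: "left_module R P" and M: "left_module R M" and y: "y \<in> I \<rightarrow> carrier M"
  shows "(\<lambda>x. finsum M (\<lambda>i. s x i \<odot>\<^bsub>M\<^esub> y i) {i \<in> I. s x i \<noteq> \<zero>\<^bsub>R\<^esub>}) \<in> module_hom R P M"
    (is "?k \<in> _")
proof -
  interpret P: left_module R P by fact
  interpret M: left_module R M by fact
  have s: "s x \<in> I \<rightarrow> carrier R" if "x \<in> carrier P" for x using D that by (auto simp: dual_basis_def)
  have si: "s x i \<in> carrier R" if "x \<in> carrier P" "i \<in> I" for x i using D that by (auto simp: dual_basis_def)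
  have fin: "finite {i \<in> I. s x i \<noteq> \<zero>\<^bsub>R\<^esub>}" if "x \<in> carrier P" for x using D that by (auto simp: dual_basis_def)
  have yi: "y i \<in> carrier M" if "i \<in> I" for i using y that by auto
  have k: "?k x = finsum M (\<lambda>i. s x i \<odot>\<^bsub>M\<^esub> y i) T"
    if "x \<in> carrier P" "finite T" "{i \<in> I. s x i \<noteq> \<zero>\<^bsub>R\<^esub>} \<subseteq> T" "T \<subseteq> I" for x T
    by (rule M.finsum_support) (use that s y in auto)
  show ?thesis
  proof (rule module_homI)
    show "?k x \<in> carrier M" if "x \<in> carrier P" for x
      by (rule M.M.finsum_closed) (auto intro!: M.smult_closed si yi that)
    show "?k (x \<oplus>\<^bsub>P\<^esub> x') = ?k x \<oplus>\<^bsub>M\<^esub> ?k x'" if x: "x \<in> carrier P" "x' \<in> carrier P" for x x'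
    proof -
      have sa: "s (x \<oplus>\<^bsub>P\<^esub> x') i = s x i \<oplus>\<^bsub>R\<^esub> s x' i" if "i \<in> I" for i
        using D x that by (auto simp: dual_basis_def)
      let ?T = "{i \<in> I. s x i \<noteq> \<zero>\<^bsub>R\<^esub>} \<union> {i \<in> I. s x' i \<noteq> \<zero>\<^bsub>R\<^esub>}"
      have T: "finite ?T" "?T \<subseteq> I" "{i \<in> I. s (x \<oplus>\<^bsub>P\<^esub> x') i \<noteq> \<zero>\<^bsub>R\<^esub>} \<subseteq> ?T"
        using x fin by (auto simp: sa)
      have "finsum M (\<lambda>i. s (x \<oplus>\<^bsub>P\<^esub> x') i \<odot>\<^bsub>M\<^esub> y i) ?T =
          finsum M (\<lambda>i. s x i \<odot>\<^bsub>M\<^esub> y i \<oplus>\<^bsub>M\<^esub> s x' i \<odot>\<^bsub>M\<^esub> y i) ?T"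
        by (rule M.M.finsum_cong') (use x in "auto simp: sa M.smult_l_distr si yi intro!: M.smult_closed")
      also have "\<dots> = finsum M (\<lambda>i. s x i \<odot>\<^bsub>M\<^esub> y i) ?T \<oplus>\<^bsub>M\<^esub> finsum M (\<lambda>i. s x' i \<odot>\<^bsub>M\<^esub> y i) ?T"
        by (rule M.M.finsum_addf) (use x in "auto simp: si yi intro!: M.smult_closed")
      finally show ?thesis using k[OF _ T(1) T(3) T(2)] k[OF x(1) T(1) _ T(2)] k[OF x(2) T(1) _ T(2)] x by simp
    qed
    show "?k (r \<odot>\<^bsub>P\<^esub> x) = r \<odot>\<^bsub>M\<^esub> ?k x" if x: "r \<in> carrier R" "x \<in> carrier P" for r x
    proof -
      have sa: "s (r \<odot>\<^bsub>P\<^esub> x) i = r \<otimes>\<^bsub>R\<^esub> s x i" if "i \<in> I" for i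
        using D x that by (auto simp: dual_basis_def)
      let ?T = "{i \<in> I. s x i \<noteq> \<zero>\<^bsub>R\<^esub>}"
      have "?k (r \<odot>\<^bsub>P\<^esub> x) = finsum M (\<lambda>i. s (r \<odot>\<^bsub>P\<^esub> x) i \<odot>\<^bsub>M\<^esub> y i) ?T"
        by (rule k) (use x fin P.smult_closed in "auto simp: sa")
      also have "\<dots> = finsum M (\<lambda>i. r \<odot>\<^bsub>M\<^esub> (s x i \<odot>\<^bsub>M\<^esub> y i)) ?T"
        by (rule M.M.finsum_cong') (use x in "auto simp: sa M.smult_assoc si yi intro!: M.smult_closed")
      also have "\<dots> = r \<odot>\<^bsub>M\<^esub> ?k x"
        by (rule M.smult_finsum[symmetric]) (use x in "auto simp: si yi intro!: M.smult_closed")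
      finally show ?thesis .
    qed
  qed
qed

text \<open>
  The lifting property, for modules of arbitrary type: lift the images of the basis elements and
  extend by the coordinates.
\<close>

lemma dual_basis_lift:
  assumes D: "dual_basis R P I b s" and P: "left_module R P" and M: "left_module R M" and N: "left_module R N"
    and f: "f \<in> module_hom R M N" and h: "h \<in> module_hom R P N" and im: "h ` carrier P \<subseteq> f ` carrier M"
  obtains k where "k \<in> module_hom R P M" "\<And>x. x \<in> carrier P \<Longrightarrow> f (k x) = h x"
proof -
  interpret P: left_module R P by fact
  interpret M: left_module R M by fact
  interpret N: left_module R N by fact
  have bi: "b i \<in> carrier P" if "i \<in> I" for i using D that by (auto simp: dual_basis_def)
  have si: "s x i \<in> carrier R" if "x \<in> carrier P" "i \<in> I" for x i using D that by (auto simp: dual_basis_def)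
  have "\<exists>y\<in>carrier M. f y = h (b i)" if "i \<in> I" for i
    using subsetD[OF im imageI[OF bi[OF that]]] by (auto simp: image_iff)
  then obtain y where y: "\<And>i. i \<in> I \<Longrightarrow> y i \<in> carrier M" "\<And>i. i \<in> I \<Longrightarrow> f (y i) = h (b i)"
    using bchoice[of I "\<lambda>i y. y \<in> carrier M \<and> f y = h (b i)"] by blast
  let ?k = "\<lambda>x. finsum M (\<lambda>i. s x i \<odot>\<^bsub>M\<^esub> y i) {i \<in> I. s x i \<noteq> \<zero>\<^bsub>R\<^esub>}"
  have "f (?k x) = h x" if x: "x \<in> carrier P" for x
  proof -
    let ?T = "{i \<in> I. s x i \<noteq> \<zero>\<^bsub>R\<^esub>}"
    have "f (?k x) = finsum N (\<lambda>i. f (s x i \<odot>\<^bsub>M\<^esub> y i)) ?T"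
      by (rule hom_finsum[OF M.M.abelian_group_axioms N.M.abelian_group_axioms module_homD(4)[OF f]])
        (auto intro!: M.smult_closed simp: si y x)
    also have "\<dots> = finsum N (\<lambda>i. h (s x i \<odot>\<^bsub>P\<^esub> b i)) ?T"
      by (rule N.M.finsum_cong') (use x in \<open>auto simp: module_homD(3)[OF f] module_homD(3)[OF h] si y bi
        intro!: module_homD(1)[OF h] N.smult_closed P.smult_closed\<close>)
    also have "\<dots> = h (finsum P (\<lambda>i. s x i \<odot>\<^bsub>P\<^esub> b i) ?T)"
      by (rule hom_finsum[OF P.M.abelian_group_axioms N.M.abelian_group_axioms module_homD(4)[OF h], symmetric])
        (use P.smult_closed[OF si[OF x] bi] in auto)
    also have "\<dots> = h x" using D x by (simp add: dual_basis_def)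
    finally show ?thesis .
  qed
  then show thesis using that dual_basis_hom[OF D P M, of y] y by auto
qed

definition free_module :: "('r, 'x) ring_scheme \<Rightarrow> 'i set \<Rightarrow> ('r, 'i \<Rightarrow> 'r) module"
  where "free_module R I =
    \<lparr>carrier = {c \<in> I \<rightarrow>\<^sub>E carrier R. finite {i \<in> I. c i \<noteq> \<zero>\<^bsub>R\<^esub>}},
     monoid.mult = undefined, monoid.one = undefined,
     ring.zero = (\<lambda>i\<in>I. \<zero>\<^bsub>R\<^esub>), ring.add = (\<lambda>c c'. \<lambda>i\<in>I. c i \<oplus>\<^bsub>R\<^esub> c' i),
     smult = (\<lambda>r c. \<lambda>i\<in>I. r \<otimes>\<^bsub>R\<^esub> c i)\<rparr>"

lemma left_module_free_module:
  assumes "ring R" shows "left_module R (free_module R I)"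
proof -
  interpret R: ring R by fact
  let ?F = "free_module R I"
  have fin_add: "finite {i \<in> I. c i \<oplus>\<^bsub>R\<^esub> c' i \<noteq> \<zero>\<^bsub>R\<^esub>}"
    if "finite {i \<in> I. c i \<noteq> \<zero>\<^bsub>R\<^esub>}" "finite {i \<in> I. c' i \<noteq> \<zero>\<^bsub>R\<^esub>}" for c c'
    by (rule finite_subset[of _ "{i \<in> I. c i \<noteq> \<zero>\<^bsub>R\<^esub>} \<union> {i \<in> I. c' i \<noteq> \<zero>\<^bsub>R\<^esub>}"]) (use that in auto)
  have fin_smult: "finite {i \<in> I. r \<otimes>\<^bsub>R\<^esub> c i \<noteq> \<zero>\<^bsub>R\<^esub>}"
    if "finite {i \<in> I. c i \<noteq> \<zero>\<^bsub>R\<^esub>}" "r \<in> carrier R" for c r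
    by (rule finite_subset[of _ "{i \<in> I. c i \<noteq> \<zero>\<^bsub>R\<^esub>}"]) (use that in auto)
  have fin_neg: "finite {i \<in> I. \<ominus>\<^bsub>R\<^esub> c i \<noteq> \<zero>\<^bsub>R\<^esub>}"
    if "finite {i \<in> I. c i \<noteq> \<zero>\<^bsub>R\<^esub>}" for c
    by (rule finite_subset[of _ "{i \<in> I. c i \<noteq> \<zero>\<^bsub>R\<^esub>}"]) (use that in auto)
  have "abelian_group ?F"
  proof (rule abelian_groupI)
    fix c assume c: "c \<in> carrier ?F"
    show "\<exists>c'\<in>carrier ?F. c' \<oplus>\<^bsub>?F\<^esub> c = \<zero>\<^bsub>?F\<^esub>"
      by (rule bexI[of _ "\<lambda>i\<in>I. \<ominus>\<^bsub>R\<^esub> c i"])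
        (use c in "auto simp: free_module_def R.l_neg PiE_iff fin_neg cong: conj_cong intro!: restrict_ext")
  qed (auto simp: free_module_def PiE_iff fin_add R.a_ac cong: conj_cong intro!: restrict_ext
      simp: extensional_def fun_eq_iff)
  then show ?thesis
    unfolding left_module_def left_module_axioms_def
    by (auto simp: free_module_def PiE_iff fin_smult R.l_distr R.r_distr R.m_assoc R.ring_axioms
        cong: conj_cong intro!: restrict_ext simp: extensional_def fun_eq_iff)
qed

text \<open>
  Split the canonical surjection of the free module on the elements of \<open>P\<close>; the components of the
  section are the coordinates. This is the only use of the lifting property in the definition of
  projectivity, and the free module has the type that occurs there.
\<close>

lemma projective_has_dual_basis:
  fixes P :: "('r, 'p) module"
  assumes "projective_module R P"
  obtains s where "dual_basis R P (carrier P) (\<lambda>x. x) s"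
proof -
  have P: "left_module R P" using assms by (simp add: projective_module_def)
  interpret P: left_module R P by fact
  let ?F = "free_module R (carrier P)"
  have F: "left_module R ?F" by (rule left_module_free_module) (rule P.R.ring_axioms)
  interpret F: left_module R ?F by fact
  let ?e = "\<lambda>c. finsum P (\<lambda>x. c x \<odot>\<^bsub>P\<^esub> x) {x \<in> carrier P. c x \<noteq> \<zero>\<^bsub>R\<^esub>}"
  have DF: "(\<lambda>c. finsum P (\<lambda>x. c x \<odot>\<^bsub>P\<^esub> x) {x \<in> carrier P. c x \<noteq> \<zero>\<^bsub>R\<^esub>}) \<in> module_hom R ?F P"
  proof -
    note s = P.finsum_support[where I = "carrier P" and y = "\<lambda>x. x"]
    have cx: "c x \<in> carrier R" if "c \<in> carrier ?F" "x \<in> carrier P" for c x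
      using that by (auto simp: free_module_def)
    have cf: "finite {x \<in> carrier P. c x \<noteq> \<zero>\<^bsub>R\<^esub>}" if "c \<in> carrier ?F" for c
      using that by (auto simp: free_module_def)
    show ?thesis
    proof (rule module_homI)
      show "?e c \<in> carrier P" if "c \<in> carrier ?F" for c
        by (rule P.M.finsum_closed) (auto intro!: P.smult_closed cx that)
      show "?e (c \<oplus>\<^bsub>?F\<^esub> c') = ?e c \<oplus>\<^bsub>P\<^esub> ?e c'" if c: "c \<in> carrier ?F" "c' \<in> carrier ?F" for c c'
      proof -
        let ?T = "{x \<in> carrier P. c x \<noteq> \<zero>\<^bsub>R\<^esub>} \<union> {x \<in> carrier P. c' x \<noteq> \<zero>\<^bsub>R\<^esub>}"
        have a: "(c \<oplus>\<^bsub>?F\<^esub> c') x = c x \<oplus>\<^bsub>R\<^esub> c' x" if "x \<in> carrier P" for x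
          using that by (simp add: free_module_def)
        have T: "finite ?T" "?T \<subseteq> carrier P" "{x \<in> carrier P. (c \<oplus>\<^bsub>?F\<^esub> c') x \<noteq> \<zero>\<^bsub>R\<^esub>} \<subseteq> ?T"
          using c cf by (auto simp: a)
        have e: "?e c'' = finsum P (\<lambda>x. c'' x \<odot>\<^bsub>P\<^esub> x) ?T"
          if "c'' \<in> carrier ?F" "{x \<in> carrier P. c'' x \<noteq> \<zero>\<^bsub>R\<^esub>} \<subseteq> ?T" for c''
          by (rule s) (use that T cx in auto)
        have "finsum P (\<lambda>x. (c \<oplus>\<^bsub>?F\<^esub> c') x \<odot>\<^bsub>P\<^esub> x) ?T = finsum P (\<lambda>x. c x \<odot>\<^bsub>P\<^esub> x \<oplus>\<^bsub>P\<^esub> c' x \<odot>\<^bsub>P\<^esub> x) ?T"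
          by (rule P.M.finsum_cong') (use c in "auto simp: a P.smult_l_distr cx intro!: P.smult_closed")
        also have "\<dots> = finsum P (\<lambda>x. c x \<odot>\<^bsub>P\<^esub> x) ?T \<oplus>\<^bsub>P\<^esub> finsum P (\<lambda>x. c' x \<odot>\<^bsub>P\<^esub> x) ?T"
          by (rule P.M.finsum_addf) (use c in "auto simp: cx intro!: P.smult_closed")
        finally show ?thesis using e[OF F.M.a_closed[OF c] T(3)] e[OF c(1)] e[OF c(2)] by simp
      qed
      show "?e (r \<odot>\<^bsub>?F\<^esub> c) = r \<odot>\<^bsub>P\<^esub> ?e c" if c: "r \<in> carrier R" "c \<in> carrier ?F" for r c
      proof -
        let ?T = "{x \<in> carrier P. c x \<noteq> \<zero>\<^bsub>R\<^esub>}"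
        have a: "(r \<odot>\<^bsub>?F\<^esub> c) x = r \<otimes>\<^bsub>R\<^esub> c x" if "x \<in> carrier P" for x
          using that by (simp add: free_module_def)
        have "?e (r \<odot>\<^bsub>?F\<^esub> c) = finsum P (\<lambda>x. (r \<odot>\<^bsub>?F\<^esub> c) x \<odot>\<^bsub>P\<^esub> x) ?T"
          by (rule s) (use c cf cx in "auto simp: a")
        also have "\<dots> = finsum P (\<lambda>x. r \<odot>\<^bsub>P\<^esub> (c x \<odot>\<^bsub>P\<^esub> x)) ?T"
          by (rule P.M.finsum_cong') (use c in "auto simp: a P.smult_assoc cx intro!: P.smult_closed")
        also have "\<dots> = r \<odot>\<^bsub>P\<^esub> ?e c"
          by (rule P.smult_finsum[symmetric]) (use c in "auto simp: cx intro!: P.smult_closed")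
        finally show ?thesis .
      qed
    qed
  qed
  have onto: "?e ` carrier ?F = carrier P"
  proof
    show "?e ` carrier ?F \<subseteq> carrier P" using module_homD(1)[OF DF] by auto
    show "carrier P \<subseteq> ?e ` carrier ?F"
    proof
      fix p assume p: "p \<in> carrier P"
      (* The basis vector of the free module at p. *)
      let ?c = "\<lambda>x\<in>carrier P. if x = p then \<one>\<^bsub>R\<^esub> else \<zero>\<^bsub>R\<^esub>"
      have fin: "finite {x \<in> carrier P. ?c x \<noteq> \<zero>\<^bsub>R\<^esub>}" by (rule finite_subset[of _ "{p}"]) auto
      have c: "?c \<in> carrier ?F" using p fin by (auto simp: free_module_def)
      have "?e ?c = finsum P (\<lambda>x. ?c x \<odot>\<^bsub>P\<^esub> x) {p}"
        by (rule P.finsum_support) (use p in auto)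
      then have ec: "?e ?c = p" using p by (simp add: P.smult_one P.smult_closed)
      show "p \<in> ?e ` carrier ?F" by (rule image_eqI[where f = ?e, OF ec[symmetric] c])
    qed
  qed
  have "(\<lambda>x. x) \<in> module_hom R P P" by (rule module_homI) auto
  then obtain k where k: "k \<in> module_hom R P ?F" "\<And>x. x \<in> carrier P \<Longrightarrow> ?e (k x) = x"
    using assms[unfolded projective_module_def, THEN conjunct2, rule_format, of ?F P ?e "\<lambda>x. x"]
      F P DF onto by auto
  have "dual_basis R P (carrier P) (\<lambda>x. x) k"
    unfolding dual_basis_def
  proof (intro conjI ballI)
    have kc: "k x \<in> carrier ?F" if "x \<in> carrier P" for x using module_homD(1)[OF k(1) that] .
    show "k x y \<in> carrier R" if "x \<in> carrier P" "y \<in> carrier P" for x y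
      using kc[OF that(1)] that(2) by (auto simp: free_module_def)
    show "finite {i \<in> carrier P. k x i \<noteq> \<zero>\<^bsub>R\<^esub>}" if "x \<in> carrier P" for x
      using kc[OF that] by (simp add: free_module_def)
    show "k (x \<oplus>\<^bsub>P\<^esub> y) i = k x i \<oplus>\<^bsub>R\<^esub> k y i" if "x \<in> carrier P" "y \<in> carrier P" "i \<in> carrier P" for x y i
      using module_homD(2)[OF k(1) that(1,2)] that(3) by (simp add: free_module_def)
    show "k (r \<odot>\<^bsub>P\<^esub> x) i = r \<otimes>\<^bsub>R\<^esub> k x i" if "r \<in> carrier R" "x \<in> carrier P" "i \<in> carrier P" for r x i
      using module_homD(3)[OF k(1) that(1,2)] that(3) by (simp add: free_module_def)
  qed (use k(2) in auto)
  then show thesis using that by blast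
qed

text \<open>
  Along an extension that is free of finite rank, coordinates over \<open>R'\<close> are composed with the
  coordinates \<open>l j\<close> of \<open>R'\<close> over \<open>R\<close>.
\<close>

lemma dual_basis_pullback:
  assumes D: "dual_basis R' P I b s" and P: "left_module R' P" and R: "ring R" and \<sigma>: "\<sigma> \<in> ring_hom R R'"
    and J: "finite J" and w: "\<And>j. j \<in> J \<Longrightarrow> w j \<in> carrier R'"
    and l: "\<And>j. j \<in> J \<Longrightarrow> l j \<in> add_hom R' R"
    and l_lin: "\<And>j r x. \<lbrakk>j \<in> J; r \<in> carrier R; x \<in> carrier R'\<rbrakk> \<Longrightarrow> l j (\<sigma> r \<otimes>\<^bsub>R'\<^esub> x) = r \<otimes>\<^bsub>R\<^esub> l j x"
    and l_sum: "\<And>x. x \<in> carrier R' \<Longrightarrow> finsum R' (\<lambda>j. \<sigma> (l j x) \<otimes>\<^bsub>R'\<^esub> w j) J = x"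
  shows "dual_basis R (pullback \<sigma> P) (I \<times> J) (\<lambda>(i, j). w j \<odot>\<^bsub>P\<^esub> b i) (\<lambda>x (i, j). l j (s x i))"
proof -
  interpret P: left_module R' P by fact
  interpret R: ring R by fact
  let ?P = "pullback \<sigma> P"
  interpret P': left_module R ?P by (rule left_module_pullback[OF R \<sigma> P])
  have bi: "b i \<in> carrier P" if "i \<in> I" for i using D that by (auto simp: dual_basis_def)
  have si: "s x i \<in> carrier R'" if "x \<in> carrier P" "i \<in> I" for x i using D that by (auto simp: dual_basis_def)
  have fin: "finite {i \<in> I. s x i \<noteq> \<zero>\<^bsub>R'\<^esub>}" if "x \<in> carrier P" for x using D that by (auto simp: dual_basis_def)
  have sc: "\<sigma> r \<in> carrier R'" if "r \<in> carrier R" for r using \<sigma> that by (auto simp: ring_hom_def)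
  note lc = hom_closed_add[OF l]
  have l0: "l j \<zero>\<^bsub>R'\<^esub> = \<zero>\<^bsub>R\<^esub>" if "j \<in> J" for j
    by (rule hom_zero[OF P.R.is_abelian_group R.is_abelian_group l[OF that]])
  have supp: "{p \<in> I \<times> J. (case p of (i, j) \<Rightarrow> l j (s x i)) \<noteq> \<zero>\<^bsub>R\<^esub>} \<subseteq> {i \<in> I. s x i \<noteq> \<zero>\<^bsub>R'\<^esub>} \<times> J" for x
    using l0 by auto
  have sum: "finsum ?P (\<lambda>p. (case p of (i, j) \<Rightarrow> l j (s x i)) \<odot>\<^bsub>?P\<^esub> (case p of (i, j) \<Rightarrow> w j \<odot>\<^bsub>P\<^esub> b i))
      {p \<in> I \<times> J. (case p of (i, j) \<Rightarrow> l j (s x i)) \<noteq> \<zero>\<^bsub>R\<^esub>} = x" (is "finsum _ ?f _ = _")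
    if x: "x \<in> carrier P" for x
  proof -
    let ?T = "{i \<in> I. s x i \<noteq> \<zero>\<^bsub>R'\<^esub>}"
    have fc: "?f \<in> I \<times> J \<rightarrow> carrier P"
      using x by (auto intro!: P.smult_closed sc lc si bi w)
    have fc2: "?f \<in> ?T \<times> J \<rightarrow> carrier P" by (rule subsetD[OF Pi_anti_mono fc]) auto
    have "finsum ?P ?f {p \<in> I \<times> J. (case p of (i, j) \<Rightarrow> l j (s x i)) \<noteq> \<zero>\<^bsub>R\<^esub>} = finsum ?P ?f (?T \<times> J)"
      by (rule P'.finsum_support) (use x supp J fin in "auto intro!: lc si P.smult_closed bi w")
    also have "\<dots> = finsum P ?f (?T \<times> J)"
      by (rule finsum_pullback[OF P.M.abelian_group_axioms P'.M.abelian_group_axioms fc2])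
    also have "\<dots> = finsum P (\<lambda>i. finsum P (\<lambda>j. ?f (i, j)) J) ?T"
      by (subst P.M.add.finprod_Sigma[of ?T J "\<lambda>i j. ?f (i, j)"])
        (use fin[OF x] J fc2 in "auto simp: case_prod_beta' Pi_iff")
    also have "\<dots> = finsum P (\<lambda>i. s x i \<odot>\<^bsub>P\<^esub> b i) ?T"
    proof (rule P.M.finsum_cong')
      show "(\<lambda>i. s x i \<odot>\<^bsub>P\<^esub> b i) \<in> ?T \<rightarrow> carrier P" using x by (auto intro!: P.smult_closed si bi)
      fix i assume i: "i \<in> ?T"
      have "finsum P (\<lambda>j. ?f (i, j)) J = finsum P (\<lambda>j. (\<sigma> (l j (s x i)) \<otimes>\<^bsub>R'\<^esub> w j) \<odot>\<^bsub>P\<^esub> b i) J"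
        by (rule P.M.finsum_cong') (use x i in "auto simp: P.smult_assoc sc lc si w bi intro!: P.smult_closed")
      also have "\<dots> = finsum R' (\<lambda>j. \<sigma> (l j (s x i)) \<otimes>\<^bsub>R'\<^esub> w j) J \<odot>\<^bsub>P\<^esub> b i"
        by (rule P.finsum_smult[symmetric]) (use x i in "auto simp: sc lc si w bi")
      also have "\<dots> = s x i \<odot>\<^bsub>P\<^esub> b i" using l_sum[of "s x i"] x i si by simp
      finally show "finsum P (\<lambda>j. ?f (i, j)) J = s x i \<odot>\<^bsub>P\<^esub> b i" .
    qed simp
    also have "\<dots> = x" using D x by (simp add: dual_basis_def)
    finally show ?thesis .
  qed
  have fin2: "finite {p \<in> I \<times> J. (case p of (i, j) \<Rightarrow> l j (s x i)) \<noteq> \<zero>\<^bsub>R\<^esub>}" if "x \<in> carrier P" for x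
    by (rule finite_subset[OF supp]) (use fin[OF that] J in auto)
  have add: "s (x \<oplus>\<^bsub>P\<^esub> y) i = s x i \<oplus>\<^bsub>R'\<^esub> s y i" if "x \<in> carrier P" "y \<in> carrier P" "i \<in> I" for x y i
    using D that by (simp add: dual_basis_def)
  have lin: "s (r \<odot>\<^bsub>P\<^esub> x) i = r \<otimes>\<^bsub>R'\<^esub> s x i" if "r \<in> carrier R'" "x \<in> carrier P" "i \<in> I" for x r i
    using D that by (simp add: dual_basis_def)
  show ?thesis
    unfolding dual_basis_def
    by (intro conjI ballI; (rule sum | rule fin2 | (auto simp: add lin hom_add[OF l] l_lin sc si intro!: P.smult_closed w bi lc)); simp?)
qed

definition module_complex where
  "module_complex R M P d e \<longleftrightarrow> left_module R M \<and> (\<forall>i. left_module R (P i)) \<and>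
    (\<forall>i. d i \<in> module_hom R (P (Suc i)) (P i)) \<and> e \<in> module_hom R (P 0) M \<and>
    (\<forall>x\<in>carrier (P 1). e (d 0 x) = \<zero>\<^bsub>M\<^esub>) \<and>
    (\<forall>i. \<forall>x\<in>carrier (P (Suc (Suc i))). d i (d (Suc i) x) = \<zero>\<^bsub>P i\<^esub>)"

definition exact_complex where
  "exact_complex R M P d e \<longleftrightarrow> module_complex R M P d e \<and> e ` carrier (P 0) = carrier M \<and>
    (\<forall>x\<in>carrier (P 0). e x = \<zero>\<^bsub>M\<^esub> \<longrightarrow> x \<in> d 0 ` carrier (P 1)) \<and>
    (\<forall>i. \<forall>x\<in>carrier (P (Suc i)). d i x = \<zero>\<^bsub>P i\<^esub> \<longrightarrow> x \<in> d (Suc i) ` carrier (P (Suc (Suc i))))"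

lemma projective_resolution_exact:
  assumes "projective_resolution R M P d e"
  shows "exact_complex R M P d e"
proof -
  note a = assms[unfolded projective_resolution_def projective_module_def]
  have d: "\<And>i. d i \<in> module_hom R (P (Suc i)) (P i)" and e: "e \<in> module_hom R (P 0) M"
    and onto: "e ` carrier (P 0) = carrier M" and k0: "a_kernel (P 0) M e = d 0 ` carrier (P 1)"
    and k: "\<And>i. a_kernel (P (Suc i)) (P i) (d i) = d (Suc i) ` carrier (P (Suc (Suc i)))"
    and M: "left_module R M" "\<And>i. left_module R (P i)"
    using a by simp_all
  have "e (d 0 x) = \<zero>\<^bsub>M\<^esub>" if "x \<in> carrier (P 1)" for x
  proof -
    have "d 0 x \<in> a_kernel (P 0) M e" unfolding k0 using that by (rule imageI)
    then show ?thesis by (simp add: a_kernel_def')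
  qed
  moreover have "d i (d (Suc i) x) = \<zero>\<^bsub>P i\<^esub>" if "x \<in> carrier (P (Suc (Suc i)))" for i x
  proof -
    have "d (Suc i) x \<in> a_kernel (P (Suc i)) (P i) (d i)" unfolding k using that by (rule imageI)
    then show ?thesis by (simp add: a_kernel_def')
  qed
  moreover have "x \<in> d 0 ` carrier (P 1)" if "x \<in> carrier (P 0)" "e x = \<zero>\<^bsub>M\<^esub>" for x
    unfolding k0[symmetric] using that by (simp add: a_kernel_def')
  moreover have "x \<in> d (Suc i) ` carrier (P (Suc (Suc i)))"
    if "x \<in> carrier (P (Suc i))" "d i x = \<zero>\<^bsub>P i\<^esub>" for i x
    unfolding k[symmetric] using that by (simp add: a_kernel_def')
  ultimately show ?thesis
    unfolding exact_complex_def module_complex_def using d e onto M by blast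
qed

lemma exact_complex_pullback:
  assumes "exact_complex R' M P d e" "ring R" "\<sigma> \<in> ring_hom R R'"
  shows "exact_complex R (pullback \<sigma> M) (\<lambda>i. pullback \<sigma> (P i)) d e"
proof -
  have "\<And>r. r \<in> carrier R \<Longrightarrow> \<sigma> r \<in> carrier R'" using assms(3) by (auto simp: ring_hom_def)
  note h = module_hom_pullback[where \<sigma> = \<sigma> and R = R, OF _ this]
  have "\<And>i. d i \<in> module_hom R' (P (Suc i)) (P i)" "e \<in> module_hom R' (P 0) M"
    using assms(1) by (simp_all add: exact_complex_def module_complex_def)
  from h[OF this(1)] h[OF this(2)] show ?thesis using assms
    by (simp add: exact_complex_def module_complex_def left_module_pullback)
qed

text \<open>The comparison theorem, with the projectivity of \<open>P\<close> given by dual bases.\<close>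

lemma chain_lift:
  assumes D: "\<And>i. dual_basis R (P i) (J i) (b i) (s i)" and P: "module_complex R M P d e"
    and Y: "exact_complex R N Y \<delta> \<eta>" and u: "u \<in> module_hom R M N"
  obtains f where "\<And>i. f i \<in> module_hom R (P i) (Y i)"
    "\<And>x. x \<in> carrier (P 0) \<Longrightarrow> \<eta> (f 0 x) = u (e x)"
    "\<And>i x. x \<in> carrier (P (Suc i)) \<Longrightarrow> \<delta> i (f (Suc i) x) = f i (d i x)"
proof -
  have PM: "\<And>i. left_module R (P i)" "left_module R M" and d: "\<And>i. d i \<in> module_hom R (P (Suc i)) (P i)"
    and e: "e \<in> module_hom R (P 0) M" and ed: "\<And>x. x \<in> carrier (P 1) \<Longrightarrow> e (d 0 x) = \<zero>\<^bsub>M\<^esub>"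
    and dd: "\<And>i x. x \<in> carrier (P (Suc (Suc i))) \<Longrightarrow> d i (d (Suc i) x) = \<zero>\<^bsub>P i\<^esub>"
    using P by (auto simp: module_complex_def)
  have YM: "\<And>i. left_module R (Y i)" "left_module R N" and \<delta>: "\<And>i. \<delta> i \<in> module_hom R (Y (Suc i)) (Y i)"
    and \<eta>: "\<eta> \<in> module_hom R (Y 0) N" and onto: "\<eta> ` carrier (Y 0) = carrier N"
    and ex0: "\<And>x. x \<in> carrier (Y 0) \<Longrightarrow> \<eta> x = \<zero>\<^bsub>N\<^esub> \<Longrightarrow> x \<in> \<delta> 0 ` carrier (Y 1)"
    and ex: "\<And>i x. x \<in> carrier (Y (Suc i)) \<Longrightarrow> \<delta> i x = \<zero>\<^bsub>Y i\<^esub> \<Longrightarrow> x \<in> \<delta> (Suc i) ` carrier (Y (Suc (Suc i)))"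
    using Y by (auto simp: exact_complex_def module_complex_def)
  let ?Q = "\<lambda>n g. g \<in> module_hom R (P n) (Y n) \<and> (n = 0 \<longrightarrow> (\<forall>x\<in>carrier (P 0). \<eta> (g x) = u (e x))) \<and>
    (\<forall>x\<in>carrier (P (Suc n)). g (d n x) \<in> \<delta> n ` carrier (Y (Suc n)))"
  have "\<exists>f. \<forall>n. ?Q n (f n) \<and> (\<forall>x\<in>carrier (P (Suc n)). \<delta> n (f (Suc n) x) = f n (d n x))"
  proof (rule dependent_nat_choice)
    have ue: "(\<lambda>x. u (e x)) \<in> module_hom R (P 0) N" by (rule module_hom_comp[OF e u])
    then have "(\<lambda>x. u (e x)) ` carrier (P 0) \<subseteq> \<eta> ` carrier (Y 0)" using onto by (auto dest: module_homD(1))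
    from dual_basis_lift[OF D PM(1) YM(1) YM(2) \<eta> ue this]
    obtain g where g: "g \<in> module_hom R (P 0) (Y 0)" "\<And>x. x \<in> carrier (P 0) \<Longrightarrow> \<eta> (g x) = u (e x)" by blast
    have "g (d 0 x) \<in> \<delta> 0 ` carrier (Y (Suc 0))" if "x \<in> carrier (P (Suc 0))" for x
      using ex0[of "g (d 0 x)"] g ed[of x] that module_homD(1)[OF d] module_homD(1)[OF g(1)]
        module_hom_zero[OF u, OF PM(2)[THEN left_module.axioms(2)] YM(2)[THEN left_module.axioms(2)]] by simp
    then show "\<exists>g. ?Q 0 g" using g by blast
  next
    fix g n assume g: "?Q n g"
    have gd: "(\<lambda>x. g (d n x)) \<in> module_hom R (P (Suc n)) (Y n)" using g by (auto intro: module_hom_comp[OF d])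
    have "(\<lambda>x. g (d n x)) ` carrier (P (Suc n)) \<subseteq> \<delta> n ` carrier (Y (Suc n))" using g by auto
    from dual_basis_lift[OF D PM(1) YM(1) YM(1) \<delta> gd this]
    obtain g' where g': "g' \<in> module_hom R (P (Suc n)) (Y (Suc n))"
      "\<And>x. x \<in> carrier (P (Suc n)) \<Longrightarrow> \<delta> n (g' x) = g (d n x)" by blast
    have "g' (d (Suc n) x) \<in> \<delta> (Suc n) ` carrier (Y (Suc (Suc n)))" if x: "x \<in> carrier (P (Suc (Suc n)))" for x
    proof (rule ex)
      show "g' (d (Suc n) x) \<in> carrier (Y (Suc n))" using x module_homD(1)[OF d] module_homD(1)[OF g'(1)] by simp
      show "\<delta> n (g' (d (Suc n) x)) = \<zero>\<^bsub>Y n\<^esub>"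
        using g'(2)[of "d (Suc n) x"] x module_homD(1)[OF d] dd[OF x] g
          module_hom_zero[OF conjunct1[OF g] PM(1)[THEN left_module.axioms(2)] YM(1)[THEN left_module.axioms(2)]] by simp
    qed
    then show "\<exists>g'. ?Q (Suc n) g' \<and> (\<forall>x\<in>carrier (P (Suc n)). \<delta> n (g' x) = g (d n x))" using g' by auto
  qed
  then obtain f where f: "\<And>n. ?Q n (f n)" "\<And>n x. x \<in> carrier (P (Suc n)) \<Longrightarrow> \<delta> n (f (Suc n) x) = f n (d n x)"
    by blast
  show thesis by (rule that[of f]) (use f in auto)
qed

text \<open>
  A chain map that induces zero on the augmentation is null-homotopic: the homotopy is built
  degree by degree, since \<open>t - h d\<close> takes values in cycles, which are boundaries.
\<close>

lemma chain_null_homotopy: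
  assumes D: "\<And>i. dual_basis R (P i) (J i) (b i) (s i)" and P: "module_complex R M P d e"
    and Y: "exact_complex R N Y \<delta> \<eta>"
    and t: "\<And>i. t i \<in> module_hom R (P i) (Y i)" and t0: "\<And>x. x \<in> carrier (P 0) \<Longrightarrow> \<eta> (t 0 x) = \<zero>\<^bsub>N\<^esub>"
    and t_chain: "\<And>i x. x \<in> carrier (P (Suc i)) \<Longrightarrow> \<delta> i (t (Suc i) x) = t i (d i x)"
  obtains h where "\<And>i. h i \<in> module_hom R (P i) (Y (Suc i))"
    "\<And>i x. x \<in> carrier (P (Suc i)) \<Longrightarrow> t (Suc i) x = \<delta> (Suc i) (h (Suc i) x) \<oplus>\<^bsub>Y (Suc i)\<^esub> h i (d i x)"
proof -
  have PM: "\<And>i. left_module R (P i)" "left_module R M" and d: "\<And>i. d i \<in> module_hom R (P (Suc i)) (P i)"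
    and dd: "\<And>i x. x \<in> carrier (P (Suc (Suc i))) \<Longrightarrow> d i (d (Suc i) x) = \<zero>\<^bsub>P i\<^esub>"
    using P by (auto simp: module_complex_def)
  have YM: "\<And>i. left_module R (Y i)" "left_module R N" and \<delta>: "\<And>i. \<delta> i \<in> module_hom R (Y (Suc i)) (Y i)"
    and ex0: "\<And>x. x \<in> carrier (Y 0) \<Longrightarrow> \<eta> x = \<zero>\<^bsub>N\<^esub> \<Longrightarrow> x \<in> \<delta> 0 ` carrier (Y 1)"
    and ex: "\<And>i x. x \<in> carrier (Y (Suc i)) \<Longrightarrow> \<delta> i x = \<zero>\<^bsub>Y i\<^esub> \<Longrightarrow> x \<in> \<delta> (Suc i) ` carrier (Y (Suc (Suc i)))"
    using Y by (auto simp: exact_complex_def module_complex_def)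
  note YA = YM(1)[THEN left_module.axioms(2)]
  note PA = PM(1)[THEN left_module.axioms(2)]
  note dc = module_homD(1)[OF d] and tc = module_homD(1)[OF t]
  let ?Q = "\<lambda>n g. g \<in> module_hom R (P n) (Y (Suc n)) \<and> (\<forall>x\<in>carrier (P (Suc n)). \<delta> n (g (d n x)) = t n (d n x))"
  have "\<exists>h. \<forall>n. ?Q n (h n) \<and>
    (\<forall>x\<in>carrier (P (Suc n)). \<delta> (Suc n) (h (Suc n) x) = t (Suc n) x \<ominus>\<^bsub>Y (Suc n)\<^esub> h n (d n x))"
  proof (rule dependent_nat_choice)
    have "t 0 ` carrier (P 0) \<subseteq> \<delta> 0 ` carrier (Y (Suc 0))" using ex0 t0 tc by auto
    from dual_basis_lift[OF D PM(1) YM(1) YM(1) \<delta> t this]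
    obtain g where "g \<in> module_hom R (P 0) (Y (Suc 0))" "\<And>x. x \<in> carrier (P 0) \<Longrightarrow> \<delta> 0 (g x) = t 0 x" by blast
    then show "\<exists>g. ?Q 0 g" using dc by blast
  next
    fix g n assume g: "?Q n g"
    interpret Xn: abelian_group "Y n" by (rule YA)
    interpret XS: abelian_group "Y (Suc n)" by (rule YA)
    let ?r = "\<lambda>x. t (Suc n) x \<ominus>\<^bsub>Y (Suc n)\<^esub> g (d n x)"
    have gh: "g \<in> module_hom R (P n) (Y (Suc n))" using g by simp
    have gd: "(\<lambda>x. g (d n x)) \<in> module_hom R (P (Suc n)) (Y (Suc n))" by (rule module_hom_comp[OF d gh])
    have r: "?r \<in> module_hom R (P (Suc n)) (Y (Suc n))" by (rule module_hom_diff[OF t gd YM(1)])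
    have "?r ` carrier (P (Suc n)) \<subseteq> \<delta> (Suc n) ` carrier (Y (Suc (Suc n)))"
    proof
      fix y assume "y \<in> ?r ` carrier (P (Suc n))"
      then obtain x where x: "x \<in> carrier (P (Suc n))" "y = ?r x" by blast
      have c: "t (Suc n) x \<in> carrier (Y (Suc n))" "g (d n x) \<in> carrier (Y (Suc n))"
        using x tc module_homD(1)[OF gd] by auto
      have "\<delta> n y = \<delta> n (t (Suc n) x) \<ominus>\<^bsub>Y n\<^esub> \<delta> n (g (d n x))"
        using c x(2) hom_minus[OF YA YA module_homD(4)[OF \<delta>] c(2)]
        by (simp add: a_minus_def module_homD(2)[OF \<delta>])
      also have "\<dots> = \<zero>\<^bsub>Y n\<^esub>" using g x t_chain[OF x(1)] tc dc by (simp add: Xn.r_neg a_minus_def)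
      finally show "y \<in> \<delta> (Suc n) ` carrier (Y (Suc (Suc n)))"
        using ex[of y n] x c by simp
    qed
    from dual_basis_lift[OF D PM(1) YM(1) YM(1) \<delta> r this]
    obtain g' where g': "g' \<in> module_hom R (P (Suc n)) (Y (Suc (Suc n)))"
      "\<And>x. x \<in> carrier (P (Suc n)) \<Longrightarrow> \<delta> (Suc n) (g' x) = ?r x" by blast
    have "\<delta> (Suc n) (g' (d (Suc n) x)) = t (Suc n) (d (Suc n) x)" if x: "x \<in> carrier (P (Suc (Suc n)))" for x
      using g'(2)[of "d (Suc n) x"] x dc dd[OF x] tc module_hom_zero[OF gh PA YA] by (simp add: a_minus_def)
    then show "\<exists>g'. ?Q (Suc n) g' \<and>
        (\<forall>x\<in>carrier (P (Suc n)). \<delta> (Suc n) (g' x) = t (Suc n) x \<ominus>\<^bsub>Y (Suc n)\<^esub> g (d n x))"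
      using g' by blast
  qed
  then obtain h where h: "\<And>n. h n \<in> module_hom R (P n) (Y (Suc n))"
    "\<And>n x. x \<in> carrier (P (Suc n)) \<Longrightarrow> \<delta> (Suc n) (h (Suc n) x) = t (Suc n) x \<ominus>\<^bsub>Y (Suc n)\<^esub> h n (d n x)"
    by blast
  show thesis
  proof (rule that[of h])
    fix i x assume x: "x \<in> carrier (P (Suc i))"
    interpret abelian_group "Y (Suc i)" by (rule YA)
    show "t (Suc i) x = \<delta> (Suc i) (h (Suc i) x) \<oplus>\<^bsub>Y (Suc i)\<^esub> h i (d i x)"
      using h(2)[OF x] tc[OF x] module_homD(1)[OF h(1) dc[OF x]] by (simp add: a_minus_def a_assoc l_neg)
  qed (rule h(1))
qed

text \<open>The difference of the two chain maps induces zero on the augmentation.\<close>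

lemma chain_maps_homotopic:
  assumes D: "\<And>i. dual_basis R (P i) (J i) (b i) (s i)" and P: "module_complex R M P d e"
    and Y: "exact_complex R N Y \<delta> \<eta>"
    and u: "\<And>i. u i \<in> module_hom R (P i) (Y i)" and v: "\<And>i. v i \<in> module_hom R (P i) (Y i)"
    and aug: "\<And>x. x \<in> carrier (P 0) \<Longrightarrow> \<eta> (u 0 x) = \<eta> (v 0 x)"
    and u_chain: "\<And>i x. x \<in> carrier (P (Suc i)) \<Longrightarrow> \<delta> i (u (Suc i) x) = u i (d i x)"
    and v_chain: "\<And>i x. x \<in> carrier (P (Suc i)) \<Longrightarrow> \<delta> i (v (Suc i) x) = v i (d i x)"
  obtains h where "\<And>i. h i \<in> module_hom R (P i) (Y (Suc i))"
    "\<And>i x. x \<in> carrier (P (Suc i)) \<Longrightarrow>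
      u (Suc i) x = v (Suc i) x \<oplus>\<^bsub>Y (Suc i)\<^esub> (\<delta> (Suc i) (h (Suc i) x) \<oplus>\<^bsub>Y (Suc i)\<^esub> h i (d i x))"
proof -
  have YM: "\<And>i. left_module R (Y i)" "left_module R N" and \<delta>: "\<And>i. \<delta> i \<in> module_hom R (Y (Suc i)) (Y i)"
    and \<eta>: "\<eta> \<in> module_hom R (Y 0) N"
    using Y by (auto simp: exact_complex_def module_complex_def)
  note YA = YM[THEN left_module.axioms(2)]
  note uc = module_homD(1)[OF u] and vc = module_homD(1)[OF v]
  have diff: "g (x \<ominus>\<^bsub>M\<^esub> y) = g x \<ominus>\<^bsub>M'\<^esub> g y"
    if "g \<in> module_hom R M M'" "abelian_group M" "abelian_group M'" "x \<in> carrier M" "y \<in> carrier M" for g x y M M'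
    using that hom_minus[OF that(2,3) module_homD(4)[OF that(1)]] abelian_group.a_inv_closed[OF that(2)]
    by (simp add: a_minus_def module_homD(2)[OF that(1)])
  let ?t = "\<lambda>i x. u i x \<ominus>\<^bsub>Y i\<^esub> v i x"
  have t0: "\<eta> (?t 0 x) = \<zero>\<^bsub>N\<^esub>" if x: "x \<in> carrier (P 0)" for x
    using diff[OF \<eta> YA(1) YA(2) uc[OF x] vc[OF x]] aug[OF x] abelian_group.r_neg[OF YA(2) module_homD(1)[OF \<eta> vc[OF x]]]
    by (simp add: a_minus_def)
  have t_chain: "\<delta> i (?t (Suc i) x) = ?t i (d i x)" if x: "x \<in> carrier (P (Suc i))" for i x
    using diff[OF \<delta> YA(1) YA(1) uc[OF x] vc[OF x]] u_chain[OF x] v_chain[OF x] by simp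
  have t: "?t i \<in> module_hom R (P i) (Y i)" for i by (rule module_hom_diff[OF u v YM(1)])
  from chain_null_homotopy[where t = ?t, OF D P Y t t0 t_chain]
  obtain h where h: "\<And>i. h i \<in> module_hom R (P i) (Y (Suc i))"
    "\<And>i x. x \<in> carrier (P (Suc i)) \<Longrightarrow> ?t (Suc i) x = \<delta> (Suc i) (h (Suc i) x) \<oplus>\<^bsub>Y (Suc i)\<^esub> h i (d i x)"
    by blast
  show thesis
  proof (rule that[OF h(1)])
    fix i x assume x: "x \<in> carrier (P (Suc i))"
    interpret N: abelian_group "Y (Suc i)" by (rule YA)
    have "u (Suc i) x = v (Suc i) x \<oplus>\<^bsub>Y (Suc i)\<^esub> ?t (Suc i) x"
      unfolding a_minus_def using N.r_neg[OF vc[OF x]] N.r_zero[OF uc[OF x]]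
        N.a_lcomm[OF vc[OF x] uc[OF x] N.a_inv_closed[OF vc[OF x]]] by simp
    then show "u (Suc i) x = v (Suc i) x \<oplus>\<^bsub>Y (Suc i)\<^esub> (\<delta> (Suc i) (h (Suc i) x) \<oplus>\<^bsub>Y (Suc i)\<^esub> h i (d i x))"
      unfolding h(2)[OF x] .
  qed
qed

section \<open>Quotient modules and cohomology of dual complexes\<close>

locale quotient_by_submodule = left_module R M
  for R :: "('r, 'x) ring_scheme" and M :: "('r, 'm) module" +
  fixes N :: "'m set"
  assumes N_subgroup: "subgroup N (add_monoid M)"
    and N_smult: "\<lbrakk>r \<in> carrier R; x \<in> N\<rbrakk> \<Longrightarrow> r \<odot>\<^bsub>M\<^esub> x \<in> N"
begin

abbreviation coset where "coset x \<equiv> N +>\<^bsub>M\<^esub> x"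

sublocale abelian_subgroup N M
  by (rule abelian_subgroupI2) (use M.a_comm_group N_subgroup in auto)

lemma mem_coset: "u \<in> coset x \<longleftrightarrow> (\<exists>n\<in>N. u = n \<oplus>\<^bsub>M\<^esub> x)"
  by (auto simp: a_r_coset_def')

lemma coset_eq_iff:
  assumes x: "x \<in> carrier M" and y: "y \<in> carrier M"
  shows "coset x = coset y \<longleftrightarrow> (\<exists>n\<in>N. x = n \<oplus>\<^bsub>M\<^esub> y)"
proof
  assume "coset x = coset y"
  then have "x \<in> coset y" using a_rcos_self[OF x] by simp
  then show "\<exists>n\<in>N. x = n \<oplus>\<^bsub>M\<^esub> y" by (simp add: mem_coset)
next
  assume "\<exists>n\<in>N. x = n \<oplus>\<^bsub>M\<^esub> y"
  then have "x \<in> coset y" by (simp add: mem_coset)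
  from M.a_repr_independence[OF this y N_subgroup] show "coset x = coset y" by simp
qed

lemma quotient_simps:
  "carrier (quotient_module M N) = coset ` carrier M" "\<zero>\<^bsub>quotient_module M N\<^esub> = coset \<zero>\<^bsub>M\<^esub>"
  by (auto simp: quotient_module_def A_RCOSETS_def' M.a_coset_add_zero a_subset)

lemma quotient_add:
  "\<lbrakk>x \<in> carrier M; y \<in> carrier M\<rbrakk> \<Longrightarrow> coset x \<oplus>\<^bsub>quotient_module M N\<^esub> coset y = coset (x \<oplus>\<^bsub>M\<^esub> y)"
  by (simp add: quotient_module_def a_rcos_sum)

lemma quotient_smult:
  assumes r: "r \<in> carrier R" and x: "x \<in> carrier M"
  shows "r \<odot>\<^bsub>quotient_module M N\<^esub> coset x = coset (r \<odot>\<^bsub>M\<^esub> x)"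
proof -
  have c: "coset (r \<odot>\<^bsub>M\<^esub> u) = coset (r \<odot>\<^bsub>M\<^esub> x)" if "u \<in> coset x" for u
  proof -
    obtain n where n: "n \<in> N" "u = n \<oplus>\<^bsub>M\<^esub> x" using \<open>u \<in> coset x\<close> by (auto simp: mem_coset)
    have nM: "n \<in> carrier M" using a_subset n by auto
    show ?thesis
      by (subst coset_eq_iff) (use r x n nM N_smult in "auto simp: smult_closed smult_r_distr")
  qed
  have "(\<lambda>u. coset (r \<odot>\<^bsub>M\<^esub> u)) ` coset x = (\<lambda>_. coset (r \<odot>\<^bsub>M\<^esub> x)) ` coset x"
    by (intro image_cong refl c)
  also have "\<dots> = {coset (r \<odot>\<^bsub>M\<^esub> x)}" by (rule image_constant) (rule a_rcos_self[OF x])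
  finally show ?thesis by (simp add: quotient_module_def)
qed

lemma left_module_quotient: "left_module R (quotient_module M N)"
proof -
  let ?Q = "quotient_module M N"
  have "abelian_group ?Q"
  proof (rule abelian_groupI)
    fix U assume "U \<in> carrier ?Q"
    then obtain x where x: "x \<in> carrier M" "U = coset x" by (auto simp: quotient_simps)
    then show "\<exists>W\<in>carrier ?Q. W \<oplus>\<^bsub>?Q\<^esub> U = \<zero>\<^bsub>?Q\<^esub>"
      by (intro bexI[of _ "coset (\<ominus>\<^bsub>M\<^esub> x)"]) (auto simp: quotient_simps quotient_add M.l_neg)
  qed (auto simp: quotient_simps quotient_add M.a_ac)
  then show ?thesis
    unfolding left_module_def left_module_axioms_def
    by (auto simp: quotient_simps(1) quotient_add quotient_smult smult_closed smult_l_distr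
        smult_r_distr smult_assoc smult_one R.ring_axioms)
qed

end

lemma dual_simps [simp]:
  "\<zero>\<^bsub>dual_module S M\<^esub> = (\<lambda>x\<in>carrier M. \<zero>\<^bsub>S\<^esub>)"
  "\<theta> \<oplus>\<^bsub>dual_module S M\<^esub> \<eta> = (\<lambda>x\<in>carrier M. \<theta> x \<oplus>\<^bsub>S\<^esub> \<eta> x)"
  "s \<odot>\<^bsub>dual_module S M\<^esub> \<theta> = (\<lambda>x\<in>carrier M. \<theta> x \<otimes>\<^bsub>S\<^esub> s)"
  by (simp_all add: dual_module_def)

lemma dualI:
  assumes "\<And>x. x \<in> carrier M \<Longrightarrow> t x \<in> carrier S"
    "\<And>x y. x \<in> carrier M \<Longrightarrow> y \<in> carrier M \<Longrightarrow> t (x \<oplus>\<^bsub>M\<^esub> y) = t x \<oplus>\<^bsub>S\<^esub> t y"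
    "\<And>s x. s \<in> carrier S \<Longrightarrow> x \<in> carrier M \<Longrightarrow> t (s \<odot>\<^bsub>M\<^esub> x) = s \<otimes>\<^bsub>S\<^esub> t x"
    "left_module S M"
  shows "(\<lambda>x\<in>carrier M. t x) \<in> carrier (dual_module S M)"
proof -
  interpret left_module S M by fact
  show ?thesis using assms(1-3) by (auto simp: dual_module_def smult_closed)
qed

lemma dualD:
  assumes "\<theta> \<in> carrier (dual_module S M)"
  shows "x \<in> carrier M \<Longrightarrow> \<theta> x \<in> carrier S"
    "x \<in> carrier M \<Longrightarrow> y \<in> carrier M \<Longrightarrow> \<theta> (x \<oplus>\<^bsub>M\<^esub> y) = \<theta> x \<oplus>\<^bsub>S\<^esub> \<theta> y"
    "s \<in> carrier S \<Longrightarrow> x \<in> carrier M \<Longrightarrow> \<theta> (s \<odot>\<^bsub>M\<^esub> x) = s \<otimes>\<^bsub>S\<^esub> \<theta> x"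
    "\<theta> \<in> extensional (carrier M)" "\<theta> \<in> add_hom M S"
  using assms by (auto simp: dual_module_def hom_def PiE_iff)

lemma ring_opposite: assumes "ring S" shows "ring (opposite S)"
proof -
  interpret S: ring S by fact
  have "abelian_group (opposite S)"
    by (rule abelian_groupI) (auto simp: S.a_ac intro: S.l_neg S.a_inv_closed)
  moreover have "monoid (opposite S)" by (rule monoidI) (auto simp: S.m_assoc)
  ultimately show ?thesis by (rule ringI) (auto simp: S.l_distr S.r_distr)
qed

lemma left_module_dual:
  assumes "ring S" "left_module S M"
  shows "left_module (opposite S) (dual_module S M)"
proof -
  interpret S: ring S by fact
  interpret M: left_module S M by fact
  note ext = extensionalityI[OF restrict_extensional dualD(4)]
  have c_add: "(\<lambda>x\<in>carrier M. \<theta> x \<oplus>\<^bsub>S\<^esub> \<eta> x) \<in> carrier (dual_module S M)"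
    if "\<theta> \<in> carrier (dual_module S M)" "\<eta> \<in> carrier (dual_module S M)" for \<theta> \<eta>
    by (rule dualI) (use that in "simp_all add: dualD S.a_ac S.r_distr M.left_module_axioms")
  have c_smult: "(\<lambda>x\<in>carrier M. \<theta> x \<otimes>\<^bsub>S\<^esub> s) \<in> carrier (dual_module S M)"
    if "\<theta> \<in> carrier (dual_module S M)" "s \<in> carrier S" for \<theta> s
    by (rule dualI) (use that in "simp_all add: dualD S.l_distr S.m_assoc M.left_module_axioms")
  have c_zero: "(\<lambda>x\<in>carrier M. \<zero>\<^bsub>S\<^esub>) \<in> carrier (dual_module S M)"
    by (rule dualI) (simp_all add: M.left_module_axioms)
  have c_neg: "(\<lambda>x\<in>carrier M. \<ominus>\<^bsub>S\<^esub> \<theta> x) \<in> carrier (dual_module S M)"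
    if "\<theta> \<in> carrier (dual_module S M)" for \<theta>
    by (rule dualI) (use that in "simp_all add: dualD S.minus_add S.r_minus M.left_module_axioms")
  have "abelian_group (dual_module S M)"
  proof (rule abelian_groupI)
    fix \<theta> assume t: "\<theta> \<in> carrier (dual_module S M)"
    show "\<exists>\<eta>\<in>carrier (dual_module S M). \<eta> \<oplus>\<^bsub>dual_module S M\<^esub> \<theta> = \<zero>\<^bsub>dual_module S M\<^esub>"
      by (rule bexI[OF _ c_neg[OF t]]) (use t in "auto simp: dualD S.l_neg intro!: restrict_ext")
    show "\<zero>\<^bsub>dual_module S M\<^esub> \<oplus>\<^bsub>dual_module S M\<^esub> \<theta> = \<theta>"
      unfolding dual_simps by (rule ext[OF t]) (use t in "simp add: dualD")
  qed (auto simp: c_add c_zero S.a_ac dualD intro!: restrict_ext)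
  then show ?thesis
    unfolding left_module_def left_module_axioms_def
    by (auto simp: ring_opposite[OF assms(1)] c_smult S.r_distr S.l_distr S.m_assoc dualD intro!: restrict_ext ext)
qed

text \<open>
  The cohomology in degree \<open>Suc j\<close> of the dual of a complex, as a quotient
  module. In positive degree the coboundaries are the image of a map.
\<close>

locale cochain =
  fixes S :: "('k, 's) module" and P :: "nat \<Rightarrow> ('s, 'p) module" and d :: "nat \<Rightarrow> 'p \<Rightarrow> 'p" and j :: nat
  assumes ring_S: "ring S" and P_mod: "\<And>i. left_module S (P i)"
    and d_hom: "\<And>i. d i \<in> module_hom S (P (Suc i)) (P i)"
    and dd: "\<And>i x. x \<in> carrier (P (Suc (Suc i))) \<Longrightarrow> d i (d (Suc i) x) = \<zero>\<^bsub>P i\<^esub>"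
begin

abbreviation D where "D i \<equiv> dual_module S (P i)"
abbreviation Z where "Z \<equiv> cocycles S P d (Suc j)"
abbreviation B where "B \<equiv> coboundaries S P d (Suc j)"
abbreviation ZM where "ZM \<equiv> D (Suc j)\<lparr>carrier := Z\<rparr>"
abbreviation cl where "cl \<theta> \<equiv> B +>\<^bsub>ZM\<^esub> \<theta>"

sublocale S: ring S by (rule ring_S)
sublocale P: left_module S "P i" for i by (rule P_mod)
sublocale D: left_module "opposite S" "D i" for i by (rule left_module_dual[OF ring_S P_mod])

lemma Z_iff: "\<theta> \<in> Z \<longleftrightarrow> \<theta> \<in> carrier (D (Suc j)) \<and> (\<forall>x\<in>carrier (P (Suc (Suc j))). \<theta> (d (Suc j) x) = \<zero>\<^bsub>S\<^esub>)"
  by (simp add: cocycles_def)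

lemma ZM_simps: "carrier ZM = Z" "\<zero>\<^bsub>ZM\<^esub> = \<zero>\<^bsub>D (Suc j)\<^esub>" "(\<oplus>\<^bsub>ZM\<^esub>) = (\<oplus>\<^bsub>D (Suc j)\<^esub>)" "(\<odot>\<^bsub>ZM\<^esub>) = (\<odot>\<^bsub>D (Suc j)\<^esub>)"
  by simp_all

lemmas d_closed = module_homD(1)[OF d_hom]

lemma coboundary_closed:
  "\<zeta> \<in> carrier (D j) \<Longrightarrow> (\<lambda>x\<in>carrier (P (Suc j)). \<zeta> (d j x)) \<in> Z"
proof -
  assume z: "\<zeta> \<in> carrier (D j)"
  have z0: "\<zeta> \<zero>\<^bsub>P j\<^esub> = \<zero>\<^bsub>S\<^esub>"
    by (rule hom_zero[OF P.M.abelian_group_axioms S.is_abelian_group dualD(5)[OF z]])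
  have "(\<lambda>x\<in>carrier (P (Suc j)). \<zeta> (d j x)) \<in> carrier (D (Suc j))"
    by (rule dualI) (simp_all add: d_closed module_homD(2,3)[OF d_hom] dualD[OF z] P_mod)
  then show ?thesis by (simp add: Z_iff d_closed dd z0)
qed

lemma B_iff: "\<theta> \<in> B \<longleftrightarrow> (\<exists>\<zeta>\<in>carrier (D j). \<theta> = (\<lambda>x\<in>carrier (P (Suc j)). \<zeta> (d j x)))"
  by (auto simp: coboundaries_def)

lemma Z_submodule: "left_module (opposite S) ZM"
proof -
  have add: "\<theta> \<oplus>\<^bsub>D (Suc j)\<^esub> \<eta> \<in> Z" if "\<theta> \<in> Z" "\<eta> \<in> Z" for \<theta> \<eta>
    using that D.M.a_closed[of \<theta> "Suc j" \<eta>] by (simp add: Z_iff d_closed)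
  have zero: "\<zero>\<^bsub>D (Suc j)\<^esub> \<in> Z"
    using D.M.zero_closed[of "Suc j"] by (simp add: Z_iff d_closed)
  have smult: "s \<odot>\<^bsub>D (Suc j)\<^esub> \<theta> \<in> Z" if "\<theta> \<in> Z" "s \<in> carrier S" for \<theta> s
    using that D.smult_closed[of s \<theta> "Suc j"] by (simp add: Z_iff d_closed)
  have ZD: "\<theta> \<in> Z \<Longrightarrow> \<theta> \<in> carrier (D (Suc j))" for \<theta> by (simp add: Z_iff)
  have "abelian_group ZM"
  proof (rule abelian_groupI, unfold ZM_simps)
    fix \<theta> assume t: "\<theta> \<in> Z"
    have n: "(\<ominus>\<^bsub>S\<^esub> \<one>\<^bsub>S\<^esub>) \<odot>\<^bsub>D (Suc j)\<^esub> \<theta> \<in> Z" by (rule smult[OF t]) simp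
    show "\<exists>\<eta>\<in>Z. \<eta> \<oplus>\<^bsub>D (Suc j)\<^esub> \<theta> = \<zero>\<^bsub>D (Suc j)\<^esub>"
      by (rule bexI[OF _ n]) (use ZD[OF t] in "auto simp: dualD S.r_minus S.l_neg intro!: restrict_ext")
  qed (simp_all add: add zero ZD D.M.a_ac del: dual_simps)
  then show ?thesis
    unfolding left_module_def left_module_axioms_def ZM_simps
    using smult ZD D.smult_l_distr D.smult_r_distr D.smult_assoc D.smult_one by (simp add: ring_opposite ring_S)
qed

sublocale Q: quotient_by_submodule "opposite S" ZM B
proof (rule quotient_by_submodule.intro[OF Z_submodule], unfold_locales)
  interpret Z: left_module "opposite S" ZM by (rule Z_submodule)
  have BZ: "B \<subseteq> Z" using coboundary_closed by (auto simp: B_iff)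
  have sm: "s \<odot>\<^bsub>ZM\<^esub> \<theta> \<in> B" if "s \<in> carrier S" "\<theta> \<in> B" for s \<theta>
  proof -
    obtain \<zeta> where z: "\<zeta> \<in> carrier (D j)" "\<theta> = (\<lambda>x\<in>carrier (P (Suc j)). \<zeta> (d j x))"
      using \<open>\<theta> \<in> B\<close> by (auto simp: B_iff)
    have "s \<odot>\<^bsub>D j\<^esub> \<zeta> \<in> carrier (D j)" using D.smult_closed z \<open>s \<in> carrier S\<close> by simp
    then show ?thesis unfolding B_iff
      by (rule bexI[rotated]) (use z in "auto simp: d_closed intro!: restrict_ext")
  qed
  then show "r \<in> carrier (opposite S) \<Longrightarrow> x \<in> B \<Longrightarrow> r \<odot>\<^bsub>ZM\<^esub> x \<in> B" for r x by simp
  have add: "\<theta> \<oplus>\<^bsub>ZM\<^esub> \<eta> \<in> B" if tB: "\<theta> \<in> B" "\<eta> \<in> B" for \<theta> \<eta>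
  proof -
    obtain \<zeta> \<xi> where z: "\<zeta> \<in> carrier (D j)" "\<theta> = (\<lambda>x\<in>carrier (P (Suc j)). \<zeta> (d j x))"
      "\<xi> \<in> carrier (D j)" "\<eta> = (\<lambda>x\<in>carrier (P (Suc j)). \<xi> (d j x))"
      using tB by (auto simp: B_iff)
    have "\<zeta> \<oplus>\<^bsub>D j\<^esub> \<xi> \<in> carrier (D j)" by (rule D.M.a_closed) (use z in auto)
    then show ?thesis unfolding B_iff
      by (rule bexI[rotated]) (use z in "auto simp: d_closed intro!: restrict_ext")
  qed
  have zero: "\<zero>\<^bsub>ZM\<^esub> \<in> B"
    unfolding B_iff by (rule bexI[OF _ D.M.zero_closed]) (auto simp: d_closed intro!: restrict_ext)
  have neg: "\<ominus>\<^bsub>ZM\<^esub> \<theta> \<in> B" if tB: "\<theta> \<in> B" for \<theta>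
  proof -
    have tZ: "\<theta> \<in> carrier ZM" using tB BZ by auto
    have "\<ominus>\<^bsub>ZM\<^esub> \<theta> = (\<ominus>\<^bsub>S\<^esub> \<one>\<^bsub>S\<^esub>) \<odot>\<^bsub>ZM\<^esub> \<theta>"
      by (rule Z.minus_equality)
        (use tZ Z.smult_closed[of "\<ominus>\<^bsub>S\<^esub> \<one>\<^bsub>S\<^esub>" \<theta>] in "auto simp: Z_iff dualD S.r_minus S.l_neg intro!: restrict_ext")
    then show ?thesis using sm[OF _ tB] by simp
  qed
  show "B \<subseteq> carrier (add_monoid ZM)" using BZ by simp
  show "x \<otimes>\<^bsub>add_monoid ZM\<^esub> y \<in> B" if "x \<in> B" "y \<in> B" for x y using add[OF that] by simp
  show "\<one>\<^bsub>add_monoid ZM\<^esub> \<in> B" using zero by simp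
  show "inv\<^bsub>add_monoid ZM\<^esub> x \<in> B" if "x \<in> B" for x using neg[OF that] by (simp add: a_inv_def)
qed

abbreviation E where "E \<equiv> ext_module S P d (Suc j)"

lemma E_eq: "E = quotient_module ZM B" by (simp add: ext_module_def)

lemma E_module: "left_module (opposite S) E" unfolding E_eq by (rule Q.left_module_quotient)

lemma E_carrier: "carrier E = cl ` Z" by (simp add: E_eq Q.quotient_simps)

lemma E_add: "\<lbrakk>\<theta> \<in> Z; \<eta> \<in> Z\<rbrakk> \<Longrightarrow> cl \<theta> \<oplus>\<^bsub>E\<^esub> cl \<eta> = cl (\<theta> \<oplus>\<^bsub>D (Suc j)\<^esub> \<eta>)"
  using Q.quotient_add[of \<theta> \<eta>] by (simp add: E_eq)

lemma E_smult: "\<lbrakk>\<theta> \<in> Z; s \<in> carrier S\<rbrakk> \<Longrightarrow> s \<odot>\<^bsub>E\<^esub> cl \<theta> = cl (s \<odot>\<^bsub>D (Suc j)\<^esub> \<theta>)"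
  using Q.quotient_smult[of s \<theta>] by (simp add: E_eq)

lemma class_eq_iff:
  assumes "\<theta> \<in> Z" "\<eta> \<in> Z"
  shows "cl \<theta> = cl \<eta> \<longleftrightarrow>
    (\<exists>\<zeta>\<in>carrier (D j). \<forall>x\<in>carrier (P (Suc j)). \<theta> x = \<zeta> (d j x) \<oplus>\<^bsub>S\<^esub> \<eta> x)"
proof -
  have "cl \<theta> = cl \<eta> \<longleftrightarrow> (\<exists>n\<in>B. \<theta> = n \<oplus>\<^bsub>D (Suc j)\<^esub> \<eta>)"
    using Q.coset_eq_iff[of \<theta> \<eta>] assms by simp
  also have "\<dots> \<longleftrightarrow> (\<exists>\<zeta>\<in>carrier (D j). \<theta> = (\<lambda>x\<in>carrier (P (Suc j)). \<zeta> (d j x)) \<oplus>\<^bsub>D (Suc j)\<^esub> \<eta>)"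
    unfolding Bex_def B_iff by blast
  also have "\<dots> \<longleftrightarrow> (\<exists>\<zeta>\<in>carrier (D j). \<forall>x\<in>carrier (P (Suc j)). \<theta> x = \<zeta> (d j x) \<oplus>\<^bsub>S\<^esub> \<eta> x)"
  proof (rule bex_cong[OF refl])
    fix \<zeta>
    have "\<theta> \<in> extensional (carrier (P (Suc j)))" using assms(1) dualD(4)[of \<theta> S "P (Suc j)"] by (simp add: Z_iff)
    then show "(\<theta> = (\<lambda>x\<in>carrier (P (Suc j)). \<zeta> (d j x)) \<oplus>\<^bsub>D (Suc j)\<^esub> \<eta>) =
        (\<forall>x\<in>carrier (P (Suc j)). \<theta> x = \<zeta> (d j x) \<oplus>\<^bsub>S\<^esub> \<eta> x)"
      by (auto intro: extensionalityI)
  qed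
  finally show ?thesis .
qed

lemma zero_class: "\<zero>\<^bsub>E\<^esub> = cl \<zero>\<^bsub>D (Suc j)\<^esub>" by (simp add: E_eq Q.quotient_simps)

end

section \<open>Skew group rings\<close>

text \<open>
  In this locale and the ones built on it \<open>G\<close> is the implicit structure, so that operations
  without subscript are those of the group.
\<close>

locale skew_ring = A: ring A + G: group G
  for A :: "('k, 'a) module" and G :: "('g, 'z) monoid_scheme" (structure) +
  fixes \<phi> :: "'g \<Rightarrow> 'a \<Rightarrow> 'a"
  assumes finite_G: "finite (carrier G)"
    and \<phi>_hom: "g \<in> carrier G \<Longrightarrow> \<phi> g \<in> ring_hom A A"
    and \<phi>_one: "a \<in> carrier A \<Longrightarrow> \<phi> \<one> a = a"
    and \<phi>_mult: "\<lbrakk>g \<in> carrier G; h \<in> carrier G; a \<in> carrier A\<rbrakk> \<Longrightarrow> \<phi> (g \<otimes> h) a = \<phi> g (\<phi> h a)"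
begin

abbreviation B where "B \<equiv> skew_group_algebra A G \<phi>"
abbreviation B_mult (infixl "\<bullet>" 70) where "x \<bullet> y \<equiv> x \<otimes>\<^bsub>B\<^esub> y"
abbreviation e where "e \<equiv> skew_elem A G"

lemma \<phi>_props [simp]:
  assumes "g \<in> carrier G"
  shows "a \<in> carrier A \<Longrightarrow> \<phi> g a \<in> carrier A" "\<phi> g \<one>\<^bsub>A\<^esub> = \<one>\<^bsub>A\<^esub>" "\<phi> g \<zero>\<^bsub>A\<^esub> = \<zero>\<^bsub>A\<^esub>"
    "\<lbrakk>a \<in> carrier A; b \<in> carrier A\<rbrakk> \<Longrightarrow> \<phi> g (a \<oplus>\<^bsub>A\<^esub> b) = \<phi> g a \<oplus>\<^bsub>A\<^esub> \<phi> g b"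
    "\<lbrakk>a \<in> carrier A; b \<in> carrier A\<rbrakk> \<Longrightarrow> \<phi> g (a \<otimes>\<^bsub>A\<^esub> b) = \<phi> g a \<otimes>\<^bsub>A\<^esub> \<phi> g b"
    "\<phi> g \<in> add_hom A A"
proof -
  show h: "\<phi> g \<in> add_hom A A"
    using \<phi>_hom[OF assms] by (auto simp: ring_hom_def hom_def)
  show "\<phi> g \<zero>\<^bsub>A\<^esub> = \<zero>\<^bsub>A\<^esub>" by (rule hom_zero[OF A.is_abelian_group A.is_abelian_group h])
qed (use \<phi>_hom[OF assms] in "auto simp: ring_hom_def")

lemma \<phi>_inv [simp]:
  "g \<in> carrier G \<Longrightarrow> a \<in> carrier A \<Longrightarrow> \<phi> g (\<phi> (inv g) a) = a"
  "g \<in> carrier G \<Longrightarrow> a \<in> carrier A \<Longrightarrow> \<phi> (inv g) (\<phi> g a) = a"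
  by (simp_all add: \<phi>_mult[symmetric] \<phi>_one)

lemma B_carrier: "carrier B = (\<Pi>\<^sub>E g\<in>carrier G. carrier A)" by (simp add: skew_group_algebra_def)

lemma B_comp [simp]: "x \<in> carrier B \<Longrightarrow> g \<in> carrier G \<Longrightarrow> x g \<in> carrier A" by (auto simp: B_carrier)

lemma B_simps:
  "\<zero>\<^bsub>B\<^esub> = (\<lambda>k\<in>carrier G. \<zero>\<^bsub>A\<^esub>)" "x \<oplus>\<^bsub>B\<^esub> y = (\<lambda>k\<in>carrier G. x k \<oplus>\<^bsub>A\<^esub> y k)"
  "x \<bullet> y = (\<lambda>k\<in>carrier G. finsum A (\<lambda>g. x g \<otimes>\<^bsub>A\<^esub> \<phi> g (y (inv g \<otimes> k))) (carrier G))"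
  "c \<odot>\<^bsub>B\<^esub> x = (\<lambda>k\<in>carrier G. c \<odot>\<^bsub>A\<^esub> x k)"
  by (simp_all add: skew_group_algebra_def)

lemma one_B: "\<one>\<^bsub>B\<^esub> = e \<one>\<^bsub>A\<^esub> \<one>"
  by (simp add: skew_group_algebra_def skew_elem_def)

lemma B_eqI: "\<lbrakk>x \<in> carrier B; y \<in> carrier B; \<And>g. g \<in> carrier G \<Longrightarrow> x g = y g\<rbrakk> \<Longrightarrow> x = y"
  unfolding B_carrier by (rule PiE_ext)

lemma e_closed [simp]: "a \<in> carrier A \<Longrightarrow> e a g \<in> carrier B"
  by (auto simp: B_carrier skew_elem_def)

lemma e_apply: "k \<in> carrier G \<Longrightarrow> e a g k = (if k = g then a else \<zero>\<^bsub>A\<^esub>)"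
  by (simp add: skew_elem_def)

lemma B_abelian: "abelian_group B"
proof (rule abelian_groupI)
  fix x assume x: "x \<in> carrier B"
  show "\<exists>y\<in>carrier B. y \<oplus>\<^bsub>B\<^esub> x = \<zero>\<^bsub>B\<^esub>"
    by (rule bexI[of _ "\<lambda>g\<in>carrier G. \<ominus>\<^bsub>A\<^esub> x g"])
      (use x in "auto simp: B_simps B_carrier A.l_neg PiE_iff intro!: restrict_ext")
  show "\<zero>\<^bsub>B\<^esub> \<oplus>\<^bsub>B\<^esub> x = x"
    by (rule B_eqI) (use x in "auto simp: B_simps B_carrier PiE_iff")
qed (auto simp: B_simps B_carrier A.a_ac PiE_iff intro!: restrict_ext)

sublocale B: abelian_group B by (rule B_abelian)

lemma comp_hom: "g \<in> carrier G \<Longrightarrow> (\<lambda>x. x g) \<in> add_hom B A"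
  by (auto simp: hom_def B_simps)

lemmas B_finsum_apply = hom_finsum[OF B_abelian A.is_abelian_group comp_hom]

lemma e_add: "\<lbrakk>a \<in> carrier A; b \<in> carrier A\<rbrakk> \<Longrightarrow> e (a \<oplus>\<^bsub>A\<^esub> b) g = e a g \<oplus>\<^bsub>B\<^esub> e b g"
  by (auto simp: B_simps skew_elem_def intro!: restrict_ext)

lemma e_zero: "e \<zero>\<^bsub>A\<^esub> g = \<zero>\<^bsub>B\<^esub>"
  by (auto simp: B_simps skew_elem_def intro!: restrict_ext)

lemma B_decomp:
  assumes x: "x \<in> carrier B"
  shows "x = finsum B (\<lambda>g. e (x g) g) (carrier G)"
proof (rule B_eqI[OF x])
  show "finsum B (\<lambda>g. e (x g) g) (carrier G) \<in> carrier B" using x by (intro B.finsum_closed) auto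
  fix k assume k: "k \<in> carrier G"
  have "finsum B (\<lambda>g. e (x g) g) (carrier G) k = finsum A (\<lambda>g. e (x g) g k) (carrier G)"
    by (rule B_finsum_apply[OF k]) (use x in auto)
  also have "\<dots> = e (x k) k k"
    by (rule A.finsum_single[OF finite_G k]) (use x k in "auto simp: e_apply")
  finally show "x k = finsum B (\<lambda>g. e (x g) g) (carrier G) k" using k by (simp add: e_apply)
qed

lemma B_induct [consumes 1, case_names e add]:
  assumes x: "x \<in> carrier B"
    and e: "\<And>a g. \<lbrakk>a \<in> carrier A; g \<in> carrier G\<rbrakk> \<Longrightarrow> Q (e a g)"
    and add: "\<And>x y. \<lbrakk>x \<in> carrier B; y \<in> carrier B; Q x; Q y\<rbrakk> \<Longrightarrow> Q (x \<oplus>\<^bsub>B\<^esub> y)"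
  shows "Q x"
proof -
  have "Q (finsum B (\<lambda>g. e (x g) g) T)" if "finite T" "T \<subseteq> carrier G" for T
    using that
  proof (induction T)
    case empty
    have "Q (e \<zero>\<^bsub>A\<^esub> \<one>)" using e by simp
    then show ?case by (simp add: e_zero)
  next
    case (insert g T)
    then have c: "e (x g) g \<in> carrier B" "(\<lambda>g. e (x g) g) \<in> T \<rightarrow> carrier B" using x by auto
    then have "finsum B (\<lambda>g. e (x g) g) T \<in> carrier B" by (intro B.finsum_closed)
    with insert c x show ?case by (simp add: add e)
  qed
  from this[OF finite_G] B_decomp[OF x] show ?thesis by simp
qed

lemma mult_closed: "\<lbrakk>x \<in> carrier B; y \<in> carrier B\<rbrakk> \<Longrightarrow> x \<bullet> y \<in> carrier B"
  unfolding B_simps(3) by (subst B_carrier) (auto intro!: A.finsum_closed)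

lemma mult_add1:
  assumes "x \<in> carrier B" "x' \<in> carrier B" "y \<in> carrier B"
  shows "(x \<oplus>\<^bsub>B\<^esub> x') \<bullet> y = x \<bullet> y \<oplus>\<^bsub>B\<^esub> x' \<bullet> y"
proof (rule B_eqI)
  fix k assume k: "k \<in> carrier G"
  have "((x \<oplus>\<^bsub>B\<^esub> x') \<bullet> y) k = finsum A (\<lambda>g. x g \<otimes>\<^bsub>A\<^esub> \<phi> g (y (inv g \<otimes> k)) \<oplus>\<^bsub>A\<^esub>
      x' g \<otimes>\<^bsub>A\<^esub> \<phi> g (y (inv g \<otimes> k))) (carrier G)"
    unfolding B_simps(3) restrict_apply' [OF k]
    by (rule A.finsum_cong') (use k assms in "auto simp: B_simps(2) A.l_distr")
  also have "\<dots> = (x \<bullet> y \<oplus>\<^bsub>B\<^esub> x' \<bullet> y) k"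
    by (subst A.finsum_addf) (use k assms in "auto simp: B_simps")
  finally show "((x \<oplus>\<^bsub>B\<^esub> x') \<bullet> y) k = (x \<bullet> y \<oplus>\<^bsub>B\<^esub> x' \<bullet> y) k" .
qed (use assms mult_closed in auto)

lemma mult_add2:
  assumes "x \<in> carrier B" "y \<in> carrier B" "y' \<in> carrier B"
  shows "x \<bullet> (y \<oplus>\<^bsub>B\<^esub> y') = x \<bullet> y \<oplus>\<^bsub>B\<^esub> x \<bullet> y'"
proof (rule B_eqI)
  fix k assume k: "k \<in> carrier G"
  have "(x \<bullet> (y \<oplus>\<^bsub>B\<^esub> y')) k = finsum A (\<lambda>g. x g \<otimes>\<^bsub>A\<^esub> \<phi> g (y (inv g \<otimes> k)) \<oplus>\<^bsub>A\<^esub>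
      x g \<otimes>\<^bsub>A\<^esub> \<phi> g (y' (inv g \<otimes> k))) (carrier G)"
    unfolding B_simps(3) restrict_apply' [OF k]
    by (rule A.finsum_cong') (use k assms in "auto simp: B_simps(2) A.r_distr")
  also have "\<dots> = (x \<bullet> y \<oplus>\<^bsub>B\<^esub> x \<bullet> y') k"
    by (subst A.finsum_addf) (use k assms in "auto simp: B_simps")
  finally show "(x \<bullet> (y \<oplus>\<^bsub>B\<^esub> y')) k = (x \<bullet> y \<oplus>\<^bsub>B\<^esub> x \<bullet> y') k" .
qed (use assms mult_closed in auto)

text \<open>
  Monomials multiply by \<open>(a g)(b h) = a g(b) gh\<close>. Together with additivity this reduces
  ring-theoretic facts about \<open>B\<close> to monomials (\<open>B_induct\<close>).
\<close>

lemma e_mult: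
  assumes a: "a \<in> carrier A" "b \<in> carrier A" and g: "g \<in> carrier G" "h \<in> carrier G"
  shows "e a g \<bullet> e b h = e (a \<otimes>\<^bsub>A\<^esub> \<phi> g b) (g \<otimes> h)"
proof (rule B_eqI)
  fix k assume k: "k \<in> carrier G"
  have "(e a g \<bullet> e b h) k = finsum A (\<lambda>g'. e a g g' \<otimes>\<^bsub>A\<^esub> \<phi> g' (e b h (inv g' \<otimes> k))) (carrier G)"
    using k by (simp add: B_simps)
  also have "\<dots> = e a g g \<otimes>\<^bsub>A\<^esub> \<phi> g (e b h (inv g \<otimes> k))"
    by (rule A.finsum_single[OF finite_G g(1)]) (use a g k in "auto simp: e_apply")
  also have "\<dots> = e (a \<otimes>\<^bsub>A\<^esub> \<phi> g b) (g \<otimes> h) k"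
    using a g k by (auto simp: e_apply G.inv_solve_left' G.m_assoc[symmetric])
  finally show "(e a g \<bullet> e b h) k = e (a \<otimes>\<^bsub>A\<^esub> \<phi> g b) (g \<otimes> h) k" .
qed (use assms mult_closed in auto)

lemma ring_B: "ring B"
proof (rule ringI)
  have a0: "(x \<bullet> e a g) \<bullet> e b h = x \<bullet> (e a g \<bullet> e b h)"
    if "x \<in> carrier B" "a \<in> carrier A" "b \<in> carrier A" "g \<in> carrier G" "h \<in> carrier G" for x a b g h
    using that by (induction rule: B_induct) (simp_all add: e_mult \<phi>_mult A.m_assoc G.m_assoc mult_add1 mult_closed)
  have a1: "(x \<bullet> y) \<bullet> e b h = x \<bullet> (y \<bullet> e b h)"
    if "y \<in> carrier B" "x \<in> carrier B" "b \<in> carrier A" "h \<in> carrier G" for x y b h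
    using that by (induction rule: B_induct) (simp_all add: a0 mult_add1 mult_add2 mult_closed)
  have a2: "(x \<bullet> y) \<bullet> z = x \<bullet> (y \<bullet> z)"
    if "z \<in> carrier B" "x \<in> carrier B" "y \<in> carrier B" for x y z
    using that by (induction rule: B_induct) (simp_all add: a1 mult_add2 mult_closed)
  have l1: "\<one>\<^bsub>B\<^esub> \<bullet> x = x" if "x \<in> carrier B" for x
    using that by (induction rule: B_induct) (simp_all add: one_B e_mult \<phi>_one mult_add2)
  have r1: "x \<bullet> \<one>\<^bsub>B\<^esub> = x" if "x \<in> carrier B" for x
    using that by (induction rule: B_induct) (simp_all add: one_B e_mult mult_add1)
  have "\<one>\<^bsub>B\<^esub> \<in> carrier B" by (simp add: one_B)
  then show "monoid B" by (intro monoidI) (simp_all add: a2 l1 r1 mult_closed)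
qed (simp_all add: mult_add1 mult_add2 B_abelian)

sublocale BR: ring B by (rule ring_B)

lemma incl_ring_hom: "(\<lambda>a. e a \<one>) \<in> ring_hom A B"
  by (rule ring_hom_memI) (simp_all add: e_add e_mult \<phi>_one one_B)

end

section \<open>The enveloping algebra of a skew group algebra\<close>

lemma (in abelian_monoid) finsum_bij:
  assumes "bij_betw p I I" "f \<in> I \<rightarrow> carrier G"
  shows "finsum G (\<lambda>i. f (p i)) I = finsum G f I"
proof -
  have "p ` I = I" "inj_on p I" using assms by (auto simp: bij_betw_def)
  then show ?thesis using add.finprod_reindex[of f p I] assms(2) by simp
qed

lemma (in group) group_cancel_left:
  assumes "g \<in> carrier G" "h \<in> carrier G"
  shows "inv g \<otimes> (g \<otimes> h) = h" "g \<otimes> (inv g \<otimes> h) = h"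
  using assms by (simp_all add: m_assoc[symmetric])

lemmas (in group) group_normalize =
  m_assoc group_cancel_left inv_mult_group

lemma (in group) bij_mult_both:
  assumes "g \<in> carrier G" "h \<in> carrier G"
  shows "bij_betw (\<lambda>k. g \<otimes> (k \<otimes> h)) (carrier G) (carrier G)"
  by (rule bij_betw_byWitness[where f' = "\<lambda>k. inv g \<otimes> (k \<otimes> inv h)"])
    (use assms in "auto simp: group_normalize")

locale skew_algebra =
  fixes K :: "('k, 'x) ring_scheme" and A :: "('k, 'a) module" and G :: "('g, 'z) monoid_scheme" (structure)
    and \<phi> :: "'g \<Rightarrow> 'a \<Rightarrow> 'a"
  assumes action: "algebra_action K A G \<phi>" and finite_carrier: "finite (carrier G)"
begin

lemma \<phi>_iso: "g \<in> carrier G \<Longrightarrow> \<phi> g \<in> algebra_isos K A A"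
  using action by (simp add: algebra_action_def algebra_action_axioms_def)

sublocale skew_ring A G \<phi>
proof -
  interpret act: group_action G "carrier A" \<phi>
    using action by (simp add: algebra_action_def)
  interpret group G using act.group_hom by (simp add: group_hom_def)
  interpret KA: K_algebra K A using action by (simp add: algebra_action_def)
  show "skew_ring A G \<phi>"
  proof
    show "\<phi> g \<in> ring_hom A A" if "g \<in> carrier G" for g
      using \<phi>_iso[OF that] by (simp add: algebra_isos_def ring_iso_def)
    show "\<phi> \<one> a = a" if "a \<in> carrier A" for a
      using fun_cong[OF act.id_eq_one, of a] that by simp
  qed (use finite_carrier act.composition_rule in auto)
qed

sublocale KA: K_algebra K A
  using action by (simp add: algebra_action_def)

lemma \<phi>_algebra_hom: "g \<in> carrier G \<Longrightarrow> \<phi> g \<in> algebra_homs K A A"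
  using \<phi>_iso[of g] by (auto simp: algebra_isos_def ring_iso_def algebra_homs_def)

lemma \<phi>_smult: "\<lbrakk>g \<in> carrier G; c \<in> carrier K; a \<in> carrier A\<rbrakk> \<Longrightarrow> \<phi> g (c \<odot>\<^bsub>A\<^esub> a) = c \<odot>\<^bsub>A\<^esub> \<phi> g a"
  using \<phi>_algebra_hom[of g] by (auto simp: algebra_homs_def)

lemma smult_hom_A: "c \<in> carrier K \<Longrightarrow> (\<lambda>a. c \<odot>\<^bsub>A\<^esub> a) \<in> add_hom A A"
  by (auto simp: hom_def KA.smult_r_distr)

lemma smult_closed_B: "c \<in> carrier K \<Longrightarrow> x \<in> carrier B \<Longrightarrow> c \<odot>\<^bsub>B\<^esub> x \<in> carrier B"
  by (subst B_carrier) (simp add: B_simps)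

lemma smult_zero_A: "c \<in> carrier K \<Longrightarrow> c \<odot>\<^bsub>A\<^esub> \<zero>\<^bsub>A\<^esub> = \<zero>\<^bsub>A\<^esub>"
  using hom_zero[OF A.is_abelian_group A.is_abelian_group smult_hom_A] .

lemma e_smult: "c \<in> carrier K \<Longrightarrow> a \<in> carrier A \<Longrightarrow> e (c \<odot>\<^bsub>A\<^esub> a) g = c \<odot>\<^bsub>B\<^esub> e a g"
  by (auto simp: B_simps skew_elem_def smult_zero_A intro!: restrict_ext)

lemma K_algebra_B: "K_algebra K B"
proof -
  have r: "c \<odot>\<^bsub>B\<^esub> (x \<oplus>\<^bsub>B\<^esub> y) = c \<odot>\<^bsub>B\<^esub> x \<oplus>\<^bsub>B\<^esub> c \<odot>\<^bsub>B\<^esub> y"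
    if "c \<in> carrier K" "x \<in> carrier B" "y \<in> carrier B" for c x y
    using that by (auto simp: B_simps KA.smult_r_distr intro!: restrict_ext)
  have m: "module K B"
  proof (rule moduleI)
    show "\<one>\<^bsub>K\<^esub> \<odot>\<^bsub>B\<^esub> x = x" if x: "x \<in> carrier B" for x
      by (rule B_eqI) (use x smult_closed_B[OF _ x, of "\<one>\<^bsub>K\<^esub>"] in "auto simp: B_simps")
  qed (auto simp: smult_closed_B r KA.R.is_cring B_abelian,
       auto simp: B_simps KA.smult_l_distr KA.smult_assoc1 intro!: restrict_ext)
  note cl = smult_closed_B mult_closed
  have l0: "(c \<odot>\<^bsub>B\<^esub> x) \<bullet> e b h = c \<odot>\<^bsub>B\<^esub> (x \<bullet> e b h)"
    if "x \<in> carrier B" "c \<in> carrier K" "b \<in> carrier A" "h \<in> carrier G" for c x b h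
    using that by (induction rule: B_induct)
      (simp_all add: e_smult[symmetric] e_mult KA.smult_mult_left r mult_add1 cl)
  have l1: "(c \<odot>\<^bsub>B\<^esub> x) \<bullet> y = c \<odot>\<^bsub>B\<^esub> (x \<bullet> y)"
    if "y \<in> carrier B" "x \<in> carrier B" "c \<in> carrier K" for c x y
    using that by (induction rule: B_induct) (simp_all add: l0 r mult_add2 cl)
  have r0: "x \<bullet> (c \<odot>\<^bsub>B\<^esub> e b h) = c \<odot>\<^bsub>B\<^esub> (x \<bullet> e b h)"
    if "x \<in> carrier B" "c \<in> carrier K" "b \<in> carrier A" "h \<in> carrier G" for c x b h
    using that by (induction rule: B_induct)
      (simp_all add: e_smult[symmetric] e_mult KA.smult_mult_right r mult_add1 cl \<phi>_smult)
  have r1: "x \<bullet> (c \<odot>\<^bsub>B\<^esub> y) = c \<odot>\<^bsub>B\<^esub> (x \<bullet> y)"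
    if "y \<in> carrier B" "x \<in> carrier B" "c \<in> carrier K" for c x y
    using that by (induction rule: B_induct) (simp_all add: r0 r mult_add2 cl)
  show ?thesis
    by (simp add: K_algebra_def K_algebra_axioms_def KA.R.field_axioms ring_B m l1 r1)
qed

abbreviation S where "S \<equiv> enveloping K A"
abbreviation E where "E \<equiv> enveloping K B"
abbreviation \<Delta> where "\<Delta> \<equiv> skew_enveloping K A G \<phi>"
abbreviation act where "act \<equiv> env_action K A \<phi>"
abbreviation env where "env \<equiv> env_elem K A"
abbreviation incl where "incl a \<equiv> e a \<one>"

sublocale tA: tensor K A "opposite A"
  rewrites "tensor_product K A (opposite A) = S" and "tens K A (opposite A) = env"
  by (simp_all add: tensor_def KA.K_algebra_axioms K_algebra_opposite enveloping_def fun_eq_iff env_elem_eq_tens)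

sublocale tB: tensor K B "opposite B"
  rewrites "tensor_product K B (opposite B) = E" and "tens K B (opposite B) = env_elem K B"
  by (simp_all add: tensor_def K_algebra_B K_algebra_opposite enveloping_def fun_eq_iff env_elem_eq_tens)

sublocale S: ring S by (rule tA.ring_T)
sublocale E: ring E by (rule tB.ring_T)

abbreviation sumE where "sumE x \<equiv> finsum E x (carrier G)"
abbreviation sumS where "sumS x \<equiv> finsum S x (carrier G)"
abbreviation E_mult (infixl "\<cdot>" 70) where "x \<cdot> y \<equiv> x \<otimes>\<^bsub>E\<^esub> y"

text \<open>
  The tensors \<open>a g \<otimes> b h\<close> generate \<open>E\<close> additively and multiply like monomials. The second factor
  lives in the opposite algebra, which accounts for the reversed products in \<open>w_mult\<close>.
\<close>

definition w where "w a g b h = env_elem K B (e a g) (e b h)"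
abbreviation \<gamma> where "\<gamma> g h \<equiv> w \<one>\<^bsub>A\<^esub> g \<one>\<^bsub>A\<^esub> h"

lemma w_closed [simp]: "\<lbrakk>a \<in> carrier A; b \<in> carrier A\<rbrakk> \<Longrightarrow> w a g b h \<in> carrier E"
  by (simp add: w_def)

lemma w_mult:
  "\<lbrakk>a \<in> carrier A; b \<in> carrier A; a' \<in> carrier A; b' \<in> carrier A;
    g \<in> carrier G; h \<in> carrier G; g' \<in> carrier G; h' \<in> carrier G\<rbrakk> \<Longrightarrow>
    w a g b h \<cdot> w a' g' b' h' =
      w (a \<otimes>\<^bsub>A\<^esub> \<phi> g a') (g \<otimes> g') (b' \<otimes>\<^bsub>A\<^esub> \<phi> h' b) (h' \<otimes> h)"
  by (simp add: w_def tB.t_mult e_mult)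

lemma one_E: "\<one>\<^bsub>E\<^esub> = \<gamma> \<one> \<one>"
  by (simp add: w_def tB.T_simps(4) one_B)

lemma E_induct [consumes 1, case_names w add]:
  assumes "x \<in> carrier E"
    and w: "\<And>a g b h. \<lbrakk>a \<in> carrier A; g \<in> carrier G; b \<in> carrier A; h \<in> carrier G\<rbrakk> \<Longrightarrow> Q (w a g b h)"
    and add: "\<And>x y. \<lbrakk>x \<in> carrier E; y \<in> carrier E; Q x; Q y\<rbrakk> \<Longrightarrow> Q (x \<oplus>\<^bsub>E\<^esub> y)"
  shows "Q x"
proof -
  have 0: "Q (env_elem K B x (e b h))" if "x \<in> carrier B" "b \<in> carrier A" "h \<in> carrier G" for x b h
    using that by (induction rule: B_induct) (simp_all add: w[unfolded w_def] tB.t_add1 add)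
  have 1: "Q (env_elem K B x y)" if "y \<in> carrier B" "x \<in> carrier B" for x y
    using that by (induction rule: B_induct) (simp_all add: 0 tB.t_add2[simplified] add)
  show ?thesis using assms(1) by (induction rule: tB.t_induct) (simp_all add: 1 add)
qed

subsection \<open>The base ring and the group action on it\<close>

lemma act_eq: "act g = tensor_map K A (opposite A) (\<phi> g) (\<phi> g)"
  by (simp add: env_action_def tensor_map_def)

lemma id_algebra_hom: "(\<lambda>a. a) \<in> algebra_homs K A A"
  by (auto simp: algebra_homs_def ring_hom_def)

text \<open>
  Conjugation by \<open>\<gamma> g g\<^sup>-\<^sup>1\<close> induces the diagonal action \<open>act\<close> on \<open>S\<close>, conjugation by \<open>\<gamma> g 1\<close> the
  action \<open>twist\<close> on the first factor only.
\<close>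

abbreviation twist where "twist g \<equiv> tensor_map K A (opposite A) (\<phi> g) (\<lambda>a. a)"

lemma
  assumes "\<alpha> \<in> algebra_homs K A A" "\<beta> \<in> algebra_homs K A A"
  shows map_S_ring_hom: "tensor_map K A (opposite A) \<alpha> \<beta> \<in> ring_hom S S"
    and map_S_env: "\<lbrakk>a \<in> carrier A; b \<in> carrier A\<rbrakk> \<Longrightarrow>
      tensor_map K A (opposite A) \<alpha> \<beta> (env a b) = env (\<alpha> a) (\<beta> b)"
proof -
  interpret tensor_hom K A "opposite A" A "opposite A" \<alpha> \<beta>
    by (simp add: tensor_hom_def tensor_hom_axioms_def tA.tensor_axioms assms algebra_homs_opposite)
  show "tensor_map K A (opposite A) \<alpha> \<beta> \<in> ring_hom S S"
    using \<tau>_ring_hom by (simp add: enveloping_def)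
  show "tensor_map K A (opposite A) \<alpha> \<beta> (env a b) = env (\<alpha> a) (\<beta> b)"
    if "a \<in> carrier A" "b \<in> carrier A"
    using \<tau>_tens[of a b] that by (simp add: env_elem_eq_tens)
qed

lemma act_ring_hom: "g \<in> carrier G \<Longrightarrow> act g \<in> ring_hom S S"
  unfolding act_eq by (rule map_S_ring_hom[OF \<phi>_algebra_hom \<phi>_algebra_hom])

lemma act_env:
  "\<lbrakk>g \<in> carrier G; a \<in> carrier A; b \<in> carrier A\<rbrakk> \<Longrightarrow> act g (env a b) = env (\<phi> g a) (\<phi> g b)"
  unfolding act_eq by (rule map_S_env[OF \<phi>_algebra_hom \<phi>_algebra_hom])

lemmas twist_ring_hom = map_S_ring_hom[OF \<phi>_algebra_hom id_algebra_hom]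
lemmas twist_env = map_S_env[OF \<phi>_algebra_hom id_algebra_hom]

lemma act_props:
  assumes "g \<in> carrier G"
  shows "s \<in> carrier S \<Longrightarrow> act g s \<in> carrier S"
    "\<lbrakk>s \<in> carrier S; t \<in> carrier S\<rbrakk> \<Longrightarrow> act g (s \<oplus>\<^bsub>S\<^esub> t) = act g s \<oplus>\<^bsub>S\<^esub> act g t"
  using act_ring_hom[OF assms] by (auto simp: ring_hom_def)

lemma twist_props:
  assumes "g \<in> carrier G"
  shows "s \<in> carrier S \<Longrightarrow> twist g s \<in> carrier S"
    "\<lbrakk>s \<in> carrier S; t \<in> carrier S\<rbrakk> \<Longrightarrow> twist g (s \<oplus>\<^bsub>S\<^esub> t) = twist g s \<oplus>\<^bsub>S\<^esub> twist g t"
    "\<lbrakk>s \<in> carrier S; t \<in> carrier S\<rbrakk> \<Longrightarrow> twist g (s \<otimes>\<^bsub>S\<^esub> t) = twist g s \<otimes>\<^bsub>S\<^esub> twist g t"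
    "twist g \<in> add_hom S S"
  using twist_ring_hom[OF assms] by (auto simp: ring_hom_def hom_def)

lemma twist_one: "s \<in> carrier S \<Longrightarrow> twist \<one> s = s"
  by (induction rule: tA.t_induct) (simp_all add: twist_env \<phi>_one twist_props)

lemma twist_twist: "s \<in> carrier S \<Longrightarrow> g \<in> carrier G \<Longrightarrow> twist g (twist (inv g) s) = s"
  by (induction rule: tA.t_induct) (simp_all add: twist_env twist_props)

sublocale \<Delta>: skew_ring S G act
proof unfold_locales
  show "act g \<in> ring_hom S S" if "g \<in> carrier G" for g using act_ring_hom[OF that] .
  show "act \<one> s = s" if "s \<in> carrier S" for s
    using that by (induction rule: tA.t_induct) (simp_all add: act_env \<phi>_one act_props)
  show "act (g \<otimes> h) s = act g (act h s)" if "g \<in> carrier G" "h \<in> carrier G" "s \<in> carrier S" for g h s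
    using that(3,1,2) by (induction rule: tA.t_induct) (simp_all add: act_env \<phi>_mult act_props)
qed (rule finite_carrier)

abbreviation \<upsilon> where "\<upsilon> \<equiv> \<Delta>.e \<one>\<^bsub>S\<^esub>"

lemma \<Delta>_eq: "\<Delta> = \<Delta>.B" by (simp add: skew_enveloping_def)

subsection \<open>Coordinates over the base ring\<close>

lemma incl_algebra_hom: "(\<lambda>a. incl a) \<in> algebra_homs K A B"
  using incl_ring_hom by (auto simp: algebra_homs_def e_smult)

text \<open>The inclusion of \<open>S\<close> into \<open>E\<close>.\<close>

definition \<kappa> where "\<kappa> = tensor_map K B (opposite B) (\<lambda>a. incl a) (\<lambda>a. incl a)"

lemma \<kappa>_env: "\<lbrakk>a \<in> carrier A; b \<in> carrier A\<rbrakk> \<Longrightarrow> \<kappa> (env a b) = w a \<one> b \<one>"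
  and \<kappa>_ring_hom: "\<kappa> \<in> ring_hom S E"
proof -
  interpret tensor_hom K A "opposite A" B "opposite B" "\<lambda>a. incl a" "\<lambda>a. incl a"
    by (simp add: tensor_hom_def tensor_hom_axioms_def tA.tensor_axioms tB.tensor_axioms
        incl_algebra_hom algebra_homs_opposite)
  show "\<kappa> \<in> ring_hom S E" using \<tau>_ring_hom by (simp add: enveloping_def \<kappa>_def)
  show "\<kappa> (env a b) = w a \<one> b \<one>" if "a \<in> carrier A" "b \<in> carrier A"
    using \<tau>_tens[of a b] that by (simp add: env_elem_eq_tens \<kappa>_def w_def)
qed

lemma \<kappa>_props [simp]:
  "s \<in> carrier S \<Longrightarrow> \<kappa> s \<in> carrier E" "\<kappa> \<one>\<^bsub>S\<^esub> = \<one>\<^bsub>E\<^esub>" "\<kappa> \<zero>\<^bsub>S\<^esub> = \<zero>\<^bsub>E\<^esub>"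
  "\<lbrakk>s \<in> carrier S; t \<in> carrier S\<rbrakk> \<Longrightarrow> \<kappa> (s \<oplus>\<^bsub>S\<^esub> t) = \<kappa> s \<oplus>\<^bsub>E\<^esub> \<kappa> t"
  "\<lbrakk>s \<in> carrier S; t \<in> carrier S\<rbrakk> \<Longrightarrow> \<kappa> (s \<otimes>\<^bsub>S\<^esub> t) = \<kappa> s \<cdot> \<kappa> t"
proof -
  interpret ring_hom_ring S E \<kappa>
    by (intro ring_hom_ringI2) (simp_all add: S.ring_axioms E.ring_axioms \<kappa>_ring_hom)
  show "\<kappa> \<zero>\<^bsub>S\<^esub> = \<zero>\<^bsub>E\<^esub>" by simp
qed (use \<kappa>_ring_hom in "auto simp: ring_hom_def")

text \<open>
  The coefficient of \<open>x\<close> at \<open>\<gamma> k 1\<close>. Multiplying with \<open>\<gamma> l\<^sup>-\<^sup>1 l\<close> first gives access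
  to the coefficients at elements \<open>\<gamma> k l\<^sup>-\<^sup>1\<close>.
\<close>

definition coord where
  "coord k = pres_lift (add_monoid S) (\<lambda>p. env (fst p k) (snd p \<one>))"

lemma coord_hom: "k \<in> carrier G \<Longrightarrow> coord k \<in> add_hom E S"
  and coord_env: "\<lbrakk>k \<in> carrier G; x \<in> carrier B; y \<in> carrier B\<rbrakk> \<Longrightarrow>
    coord k (env_elem K B x y) = env (x k) (y \<one>)"
proof -
  let ?F = "\<lambda>x y. env (x k) (y \<one>)"
  have H: "comm_group (add_monoid S)" by (rule tA.T.a_comm_group)
  assume k: "k \<in> carrier G"
  have b: "biadditive B (opposite B) (add_monoid S) ?F"
    using k by (auto simp: biadditive_def B_simps tA.t_add1 tA.t_add2[simplified])
  have sm: "?F (c \<odot>\<^bsub>B\<^esub> x) y = ?F x (c \<odot>\<^bsub>opposite B\<^esub> y)"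
    if "c \<in> carrier K" "x \<in> carrier B" "y \<in> carrier (opposite B)" for c x y
    using that k by (simp add: B_simps tA.t_smult[simplified])
  have f: "(\<lambda>p. ?F (fst p) (snd p)) \<in> carrier B \<times> carrier (opposite B) \<rightarrow> carrier (add_monoid S)"
    using k by auto
  have r: "free_eval (add_monoid S) (\<lambda>p. ?F (fst p) (snd p)) r = \<one>\<^bsub>add_monoid S\<^esub>"
    if "r \<in> tensor_relators K B (opposite B)" for r
    using sm by (intro tB.relators_eval[where F = ?F] H b that) blast
  note l = tB.P.pres_lift[OF H f r]
  show "coord k \<in> add_hom E S"
    unfolding coord_def tB.add_monoid_T using l(2) by simp
  show "coord k (env_elem K B x y) = env (x k) (y \<one>)" if "x \<in> carrier B" "y \<in> carrier B"
    using l(3)[of "(x, y)"] that by (simp add: coord_def env_elem_eq_tens tens_def)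
qed

lemma coord_props:
  assumes "k \<in> carrier G"
  shows "x \<in> carrier E \<Longrightarrow> coord k x \<in> carrier S"
    "\<lbrakk>x \<in> carrier E; y \<in> carrier E\<rbrakk> \<Longrightarrow> coord k (x \<oplus>\<^bsub>E\<^esub> y) = coord k x \<oplus>\<^bsub>S\<^esub> coord k y"
    "coord k \<zero>\<^bsub>E\<^esub> = \<zero>\<^bsub>S\<^esub>"
  using hom_closed_add[OF coord_hom[OF assms]] hom_add[OF coord_hom[OF assms]]
    hom_zero[OF E.is_abelian_group S.is_abelian_group coord_hom[OF assms]] by auto

lemma coord_w:
  "\<lbrakk>k \<in> carrier G; a \<in> carrier A; b \<in> carrier A; g \<in> carrier G; h \<in> carrier G\<rbrakk> \<Longrightarrow>
    coord k (w a g b h) = (if g = k \<and> h = \<one> then env a b else \<zero>\<^bsub>S\<^esub>)"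
  by (auto simp: w_def coord_env e_apply tA.t_zero1[simplified] tA.t_zero2[simplified])

lemma coord_linear:
  assumes k: "k \<in> carrier G" and s: "s \<in> carrier S" and x: "x \<in> carrier E"
  shows "coord k (\<kappa> s \<cdot> x) = s \<otimes>\<^bsub>S\<^esub> coord k x"
proof -
  have 0: "coord k (\<kappa> (env a b) \<cdot> x) = env a b \<otimes>\<^bsub>S\<^esub> coord k x"
    if "a \<in> carrier A" "b \<in> carrier A" for a b
    using x that k by (induction rule: E_induct)
      (auto simp: \<kappa>_env w_mult coord_w tA.t_mult \<phi>_one E.r_distr S.r_distr coord_props)
  show ?thesis using s
    by (induction rule: tA.t_induct) (simp_all add: 0 E.l_distr S.l_distr coord_props k x)
qed

lemma \<gamma>_act: "s \<in> carrier S \<Longrightarrow> g \<in> carrier G \<Longrightarrow>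
    \<gamma> g (inv g) \<cdot> \<kappa> s = \<kappa> (act g s) \<cdot> \<gamma> g (inv g)"
proof (induction s rule: tA.t_induct)
  case (t a b) then show ?case by (simp add: \<kappa>_env act_env w_mult \<phi>_one)
qed (simp_all add: E.l_distr E.r_distr act_props)

lemma \<gamma>_twist: "s \<in> carrier S \<Longrightarrow> g \<in> carrier G \<Longrightarrow>
    \<gamma> g \<one> \<cdot> \<kappa> s = \<kappa> (twist g s) \<cdot> \<gamma> g \<one>"
proof (induction s rule: tA.t_induct)
  case (t a b) then show ?case by (simp add: \<kappa>_env twist_env w_mult \<phi>_one)
qed (simp_all add: E.l_distr E.r_distr twist_props)

text \<open>
  The basis \<open>\<gamma> g g\<^sup>-\<^sup>1 \<cdot> \<gamma> h 1\<close> of \<open>E\<close> over \<open>S\<close>, adapted to the intermediate ring \<open>\<Delta>\<close>.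
\<close>

lemma E_decomp:
  assumes "x \<in> carrier E"
  shows "sumE (\<lambda>g. sumE (\<lambda>h. \<gamma> g (inv g) \<cdot>
      (\<kappa> (coord h (\<gamma> (inv g) g \<cdot> x)) \<cdot> \<gamma> h \<one>))) = x"
    (is "finsum E (\<lambda>g. finsum E (\<lambda>h. ?f x g h) _) _ = _")
proof -
  have fc: "?f x g h \<in> carrier E" if "x \<in> carrier E" "g \<in> carrier G" "h \<in> carrier G" for x g h
    using that by (simp add: coord_props)
  show ?thesis using assms
  proof (induction rule: E_induct)
    case (w a l b k)
    (* \<gamma> l k is the product of \<gamma> ?g (inv ?g) and \<gamma> ?h 1. *)
    let ?g = "inv k" and ?h = "k \<otimes> l"
    have f: "?f (w a l b k) g h = (if g = ?g \<and> h = ?h then w a l b k else \<zero>\<^bsub>E\<^esub>)"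
      if g: "g \<in> carrier G" and h: "h \<in> carrier G" for g h
    proof -
      have "k \<otimes> g = \<one> \<longleftrightarrow> g = ?g"
        using w g by (metis G.inv_equality G.inv_inv G.r_inv G.inv_closed G.inv_comm)
      then show ?thesis
        using w g h by (auto simp: w_mult coord_w \<kappa>_env \<phi>_one G.group_normalize)
    qed
    have "sumE (\<lambda>g. sumE (\<lambda>h. ?f (w a l b k) g h)) =
        sumE (\<lambda>h. ?f (w a l b k) ?g h)"
    proof (rule tB.T.finsum_single[OF finite_G])
      show "sumE (\<lambda>h. ?f (w a l b k) ?g h) \<in> carrier E"
        by (rule tB.T.finsum_closed) (use w fc[of "w a l b k" ?g] in auto)
      fix g assume g: "g \<in> carrier G" "g \<noteq> ?g"
      have "sumE (\<lambda>h. ?f (w a l b k) g h) = sumE (\<lambda>h. \<zero>\<^bsub>E\<^esub>)"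
        by (rule tB.T.finsum_cong') (use f g in auto)
      then show "sumE (\<lambda>h. ?f (w a l b k) g h) = \<zero>\<^bsub>E\<^esub>" by simp
    qed (use w in simp)
    also have "\<dots> = ?f (w a l b k) ?g ?h"
      by (rule tB.T.finsum_single[OF finite_G]) (use w f[of ?g] fc[of "w a l b k" ?g] in auto)
    also have "\<dots> = w a l b k" using f[of ?g ?h] w by simp
    finally show ?case .
  next
    case (add x y)
    have f: "?f (x \<oplus>\<^bsub>E\<^esub> y) g h = ?f x g h \<oplus>\<^bsub>E\<^esub> ?f y g h" if "g \<in> carrier G" "h \<in> carrier G" for g h
      using that add(1,2) by (simp add: E.r_distr E.l_distr coord_props)
    have "sumE (\<lambda>g. sumE (\<lambda>h. ?f (x \<oplus>\<^bsub>E\<^esub> y) g h)) =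
        sumE (\<lambda>g. sumE (\<lambda>h. ?f x g h) \<oplus>\<^bsub>E\<^esub> sumE (\<lambda>h. ?f y g h))"
    proof (rule tB.T.finsum_cong'[OF refl])
      fix g assume g: "g \<in> carrier G"
      have "sumE (\<lambda>h. ?f (x \<oplus>\<^bsub>E\<^esub> y) g h) = sumE (\<lambda>h. ?f x g h \<oplus>\<^bsub>E\<^esub> ?f y g h)"
        by (rule tB.T.finsum_cong') (use f g fc add in auto)
      also have "\<dots> = sumE (\<lambda>h. ?f x g h) \<oplus>\<^bsub>E\<^esub> sumE (\<lambda>h. ?f y g h)"
        by (rule tB.T.finsum_addf) (use g fc add in auto)
      finally show "sumE (\<lambda>h. ?f (x \<oplus>\<^bsub>E\<^esub> y) g h) =
        sumE (\<lambda>h. ?f x g h) \<oplus>\<^bsub>E\<^esub> sumE (\<lambda>h. ?f y g h)" .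
    qed (use fc add in "auto intro!: tB.T.finsum_closed")
    also have "\<dots> = x \<oplus>\<^bsub>E\<^esub> y"
      by (subst tB.T.finsum_addf) (use fc add in "auto intro!: tB.T.finsum_closed")
    finally show ?case .
  qed
qed

subsection \<open>The ring extension \<open>\<Delta> \<rightarrow> E\<close>\<close>

text \<open>
  The embedding of \<open>\<Delta>\<close> into \<open>E\<close>, given by \<open>s # g \<mapsto> s \<cdot> \<gamma> g g\<^sup>-\<^sup>1\<close>.
\<close>

definition \<iota> where "\<iota> D = sumE (\<lambda>g. \<kappa> (D g) \<cdot> \<gamma> g (inv g))"

lemma \<iota>_closed: "D \<in> carrier \<Delta>.B \<Longrightarrow> \<iota> D \<in> carrier E"
  unfolding \<iota>_def by (rule tB.T.finsum_closed) auto

lemma \<iota>_add: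
  assumes "D \<in> carrier \<Delta>.B" "D' \<in> carrier \<Delta>.B"
  shows "\<iota> (D \<oplus>\<^bsub>\<Delta>.B\<^esub> D') = \<iota> D \<oplus>\<^bsub>E\<^esub> \<iota> D'"
proof -
  have "\<iota> (D \<oplus>\<^bsub>\<Delta>.B\<^esub> D') = sumE (\<lambda>g. \<kappa> (D g) \<cdot> \<gamma> g (inv g) \<oplus>\<^bsub>E\<^esub> \<kappa> (D' g) \<cdot> \<gamma> g (inv g))"
    unfolding \<iota>_def by (rule tB.T.finsum_cong') (use assms in "auto simp: \<Delta>.B_simps E.l_distr")
  also have "\<dots> = \<iota> D \<oplus>\<^bsub>E\<^esub> \<iota> D'"
    unfolding \<iota>_def by (rule tB.T.finsum_addf) (use assms in auto)
  finally show ?thesis .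
qed

lemma \<iota>_e: "s \<in> carrier S \<Longrightarrow> g \<in> carrier G \<Longrightarrow> \<iota> (\<Delta>.e s g) = \<kappa> s \<cdot> \<gamma> g (inv g)"
  unfolding \<iota>_def
  by (subst tB.T.finsum_single[OF finite_G]) (auto simp: \<Delta>.e_apply)

lemma \<iota>_ring_hom: "\<iota> \<in> ring_hom \<Delta> E"
proof -
  have gm: "\<gamma> g (inv g) \<cdot> \<gamma> h (inv h) = \<gamma> (g \<otimes> h) (inv (g \<otimes> h))"
    if "g \<in> carrier G" "h \<in> carrier G" for g h
    using that by (simp add: w_mult G.inv_mult_group)
  have m0: "\<iota> (D \<otimes>\<^bsub>\<Delta>.B\<^esub> \<Delta>.e t h) = \<iota> D \<cdot> \<iota> (\<Delta>.e t h)"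
    if "D \<in> carrier \<Delta>.B" "t \<in> carrier S" "h \<in> carrier G" for D t h
    using that
  proof (induction rule: \<Delta>.B_induct)
    case (e s g)
    have "\<iota> (\<Delta>.e s g) \<cdot> \<iota> (\<Delta>.e t h) = \<kappa> s \<cdot> (\<gamma> g (inv g) \<cdot> \<kappa> t) \<cdot> \<gamma> h (inv h)"
      using e by (simp add: \<iota>_e E.m_assoc)
    also have "\<dots> = \<kappa> s \<cdot> \<kappa> (act g t) \<cdot> (\<gamma> g (inv g) \<cdot> \<gamma> h (inv h))"
      using e by (simp add: \<gamma>_act E.m_assoc act_props)
    also have "\<dots> = \<iota> (\<Delta>.e s g \<otimes>\<^bsub>\<Delta>.B\<^esub> \<Delta>.e t h)"
      using e by (simp add: gm \<Delta>.e_mult \<iota>_e act_props)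
    finally show ?case by simp
  qed (simp_all add: \<Delta>.mult_add1 \<Delta>.mult_closed \<iota>_add \<iota>_closed E.l_distr)
  have m: "\<iota> (D \<otimes>\<^bsub>\<Delta>.B\<^esub> D') = \<iota> D \<cdot> \<iota> D'" if "D' \<in> carrier \<Delta>.B" "D \<in> carrier \<Delta>.B" for D D'
    using that by (induction rule: \<Delta>.B_induct)
      (simp_all add: m0 \<Delta>.mult_add2 \<Delta>.mult_closed \<iota>_add \<iota>_closed E.r_distr)
  show ?thesis unfolding \<Delta>_eq
    by (rule ring_hom_memI) (simp_all add: \<iota>_closed m \<iota>_add \<Delta>.one_B \<iota>_e one_E[symmetric])
qed

text \<open>
  The coordinates of \<open>E\<close> as a left \<open>\<Delta>\<close>-module with basis \<open>\<gamma> h 1\<close>, see \<open>lc_decomp\<close>.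
\<close>

definition lc where "lc h x = (\<lambda>g\<in>carrier G. act g (coord h (\<gamma> (inv g) g \<cdot> x)))"

lemma lc_closed: "h \<in> carrier G \<Longrightarrow> x \<in> carrier E \<Longrightarrow> lc h x \<in> carrier \<Delta>.B"
  unfolding lc_def by (subst \<Delta>.B_carrier) (simp add: act_props coord_props)

lemma lc_add: "\<lbrakk>h \<in> carrier G; x \<in> carrier E; y \<in> carrier E\<rbrakk> \<Longrightarrow>
    lc h (x \<oplus>\<^bsub>E\<^esub> y) = lc h x \<oplus>\<^bsub>\<Delta>.B\<^esub> lc h y"
  by (auto simp: lc_def \<Delta>.B_simps E.r_distr act_props coord_props intro!: restrict_ext)

lemma lc_linear:
  assumes "D \<in> carrier \<Delta>.B" and h: "h \<in> carrier G" and x: "x \<in> carrier E"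
  shows "lc h (\<iota> D \<cdot> x) = D \<otimes>\<^bsub>\<Delta>.B\<^esub> lc h x"
  using assms(1)
proof (induction rule: \<Delta>.B_induct)
  case (e s l)
  show ?case
  proof (rule \<Delta>.B_eqI)
    show "lc h (\<iota> (\<Delta>.e s l) \<cdot> x) \<in> carrier \<Delta>.B" "\<Delta>.e s l \<otimes>\<^bsub>\<Delta>.B\<^esub> lc h x \<in> carrier \<Delta>.B"
      using e h x by (simp_all add: lc_closed \<iota>_closed \<Delta>.mult_closed)
    fix g assume g: "g \<in> carrier G"
    let ?k = "inv l \<otimes> g"
    have k: "?k \<in> carrier G" using g e by simp
    have gk: "\<gamma> (inv g) g \<cdot> \<kappa> s = \<kappa> (act (inv g) s) \<cdot> \<gamma> (inv g) g"
      using \<gamma>_act[of s "inv g"] g e by simp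
    have gl: "\<gamma> (inv g) g \<cdot> \<gamma> l (inv l) = \<gamma> (inv ?k) ?k"
      using g e by (simp add: w_mult G.inv_mult_group)
    have "\<gamma> (inv g) g \<cdot> (\<iota> (\<Delta>.e s l) \<cdot> x) =
        (\<gamma> (inv g) g \<cdot> \<kappa> s) \<cdot> \<gamma> l (inv l) \<cdot> x"
      using e g x by (simp add: \<iota>_e E.m_assoc)
    also have "\<dots> = \<kappa> (act (inv g) s) \<cdot> ((\<gamma> (inv g) g \<cdot> \<gamma> l (inv l)) \<cdot> x)"
      unfolding gk using e g x by (simp add: E.m_assoc act_props)
    also have "\<dots> = \<kappa> (act (inv g) s) \<cdot> (\<gamma> (inv ?k) ?k \<cdot> x)" unfolding gl ..
    finally have "lc h (\<iota> (\<Delta>.e s l) \<cdot> x) g =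
        s \<otimes>\<^bsub>S\<^esub> act g (coord h (\<gamma> (inv ?k) ?k \<cdot> x))"
      using e g h x k by (simp add: lc_def coord_linear act_props coord_props)
    also have "act g (coord h (\<gamma> (inv ?k) ?k \<cdot> x)) = act l (lc h x ?k)"
      using e g h x k \<Delta>.\<phi>_mult[of l ?k "coord h (\<gamma> (inv ?k) ?k \<cdot> x)"]
      by (simp add: lc_def coord_props G.group_cancel_left)
    also have "s \<otimes>\<^bsub>S\<^esub> act l (lc h x ?k) = (\<Delta>.e s l \<otimes>\<^bsub>\<Delta>.B\<^esub> lc h x) g"
    proof -
      have "(\<Delta>.e s l \<otimes>\<^bsub>\<Delta>.B\<^esub> lc h x) g =
          sumS (\<lambda>g'. \<Delta>.e s l g' \<otimes>\<^bsub>S\<^esub> act g' (lc h x (inv g' \<otimes> g)))"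
        using g by (simp add: \<Delta>.B_simps)
      also have "\<dots> = \<Delta>.e s l l \<otimes>\<^bsub>S\<^esub> act l (lc h x ?k)"
        by (rule tA.T.finsum_single[OF finite_G])
          (use e g h x k lc_closed[OF h x] in "auto simp: \<Delta>.e_apply act_props")
      finally show ?thesis using e by (simp add: \<Delta>.e_apply)
    qed
    finally show "lc h (\<iota> (\<Delta>.e s l) \<cdot> x) g = (\<Delta>.e s l \<otimes>\<^bsub>\<Delta>.B\<^esub> lc h x) g" .
  qed
qed (simp_all add: \<iota>_add \<iota>_closed E.l_distr lc_add \<Delta>.mult_add1 lc_closed h x)

lemma lc_decomp:
  assumes x: "x \<in> carrier E"
  shows "sumE (\<lambda>h. \<iota> (lc h x) \<cdot> \<gamma> h \<one>) = x"
proof -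
  let ?f = "\<lambda>g h. \<gamma> g (inv g) \<cdot> (\<kappa> (coord h (\<gamma> (inv g) g \<cdot> x)) \<cdot> \<gamma> h \<one>)"
  have fc: "?f g h \<in> carrier E" if "g \<in> carrier G" "h \<in> carrier G" for g h
    using that x by (simp add: coord_props)
  have "sumE (\<lambda>h. \<iota> (lc h x) \<cdot> \<gamma> h \<one>) = sumE (\<lambda>h. sumE (\<lambda>g. ?f g h))"
  proof (rule tB.T.finsum_cong'[OF refl])
    fix h assume h: "h \<in> carrier G"
    have "\<iota> (lc h x) \<cdot> \<gamma> h \<one> =
        sumE (\<lambda>g. \<kappa> (lc h x g) \<cdot> \<gamma> g (inv g) \<cdot> \<gamma> h \<one>)"
      unfolding \<iota>_def by (rule E.finsum_ldistr[OF finite_G]) (use h lc_closed[OF h x] in auto)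
    also have "\<dots> = sumE (\<lambda>g. ?f g h)"
    proof (rule tB.T.finsum_cong'[OF refl])
      fix g assume g: "g \<in> carrier G"
      have "\<kappa> (lc h x g) \<cdot> \<gamma> g (inv g) = \<gamma> g (inv g) \<cdot> \<kappa> (coord h (\<gamma> (inv g) g \<cdot> x))"
        using g h x by (simp add: lc_def \<gamma>_act coord_props)
      then show "\<kappa> (lc h x g) \<cdot> \<gamma> g (inv g) \<cdot> \<gamma> h \<one> = ?f g h"
        using g h x by (simp add: E.m_assoc coord_props)
    qed (use fc h in auto)
    finally show "\<iota> (lc h x) \<cdot> \<gamma> h \<one> = sumE (\<lambda>g. ?f g h)" .
  qed (use fc in "auto intro!: tB.T.finsum_closed")
  also have "\<dots> = sumE (\<lambda>g. sumE (\<lambda>h. ?f g h))"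
    by (rule tB.T.add.finprod_swap[OF finite_G finite_G]) (use fc in auto)
  also have "\<dots> = x" by (rule E_decomp[OF x])
  finally show ?thesis .
qed

text \<open>
  Left multiplication by \<open>\<gamma> 1 k\<close> selects the term with \<open>g = k\<close> and twists its coefficient. This
  computes the coefficients of traces.
\<close>

lemma coord_twisted:
  assumes "k \<in> carrier G" "g \<in> carrier G" "h \<in> carrier G" "l \<in> carrier G" "s \<in> carrier S"
  shows "coord h (\<gamma> \<one> k \<cdot> (\<gamma> g (inv g) \<cdot> \<kappa> s \<cdot> \<gamma> l \<one>)) =
    (if g = k \<and> k \<otimes> l = h then twist k s else \<zero>\<^bsub>S\<^esub>)"
  using assms(5)
proof (induction rule: tA.t_induct)
  case (t a b)
  have "inv g \<otimes> k = \<one> \<longleftrightarrow> g = k" using assms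
    by (metis G.inv_closed G.inv_equality G.inv_inv G.l_inv)
  then show ?case using t assms by (auto simp: \<kappa>_env w_mult coord_w twist_env \<phi>_one G.group_normalize)
next
  case (add s t)
  then show ?case using assms by (auto simp: E.r_distr E.l_distr coord_props twist_props)
qed

end

section \<open>The trace and the extension of cochains\<close>

lemma (in skew_ring) B_add_apply: "k \<in> carrier G \<Longrightarrow> (x \<oplus>\<^bsub>B\<^esub> y) k = x k \<oplus>\<^bsub>A\<^esub> y k"
  by (simp add: B_simps)

lemma (in skew_ring) incl_mult_apply:
  assumes a: "a \<in> carrier A" and x: "x \<in> carrier B" and g: "g \<in> carrier G"
  shows "(e a \<one> \<bullet> x) g = a \<otimes>\<^bsub>A\<^esub> x g"
  using x
proof (induction rule: B_induct)
  case (e b h) then show ?case using a g by (simp add: e_mult \<phi>_one e_apply)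
next
  case (add x y) then show ?case using a g by (simp add: mult_add2) (simp add: B_simps A.r_distr)
qed

definition self_module :: "('k, 's) module \<Rightarrow> ('s, 's) module"
  where "self_module S =
    \<lparr>carrier = carrier S, monoid.mult = undefined, monoid.one = undefined,
     ring.zero = \<zero>\<^bsub>S\<^esub>, ring.add = (\<oplus>\<^bsub>S\<^esub>), smult = (\<otimes>\<^bsub>S\<^esub>)\<rparr>"

lemma self_simps [simp]:
  "carrier (self_module S) = carrier S" "\<zero>\<^bsub>self_module S\<^esub> = \<zero>\<^bsub>S\<^esub>"
  "(\<oplus>\<^bsub>self_module S\<^esub>) = (\<oplus>\<^bsub>S\<^esub>)" "(\<odot>\<^bsub>self_module S\<^esub>) = (\<otimes>\<^bsub>S\<^esub>)"
  by (simp_all add: self_module_def)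

lemma left_module_self:
  assumes "ring S" shows "left_module S (self_module S)"
proof -
  interpret S: ring S by fact
  have "abelian_group (self_module S)"
    by (rule abelian_groupI) (auto simp: S.a_ac intro: S.l_neg S.a_inv_closed)
  then show ?thesis
    by (simp add: left_module_def left_module_axioms_def S.ring_axioms S.l_distr S.r_distr S.m_assoc)
qed

lemma finsum_self:
  assumes "ring S" "f \<in> I \<rightarrow> carrier S"
  shows "finsum (self_module S) f I = finsum S f I"
proof -
  have "(\<lambda>x. x) \<in> add_hom S (self_module S)" by (simp add: hom_def)
  from hom_finsum[OF ring.is_abelian_group[OF assms(1)] _ this assms(2)]
  show ?thesis using left_module_self[OF assms(1)] by (simp add: left_module_def)
qed

context skew_algebra
begin

lemma \<iota>_closed' [simp]: "D \<in> carrier \<Delta> \<Longrightarrow> \<iota> D \<in> carrier E"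
  by (simp add: \<Delta>_eq \<iota>_closed)

lemma ring_\<Delta>: "ring \<Delta>" by (simp add: \<Delta>_eq \<Delta>.ring_B)

text \<open>
  The sum over the cosets of \<open>\<Delta>\<close> in \<open>E\<close>, with representatives \<open>\<gamma> 1 k\<close>, turns a \<open>\<Delta>\<close>-linear map into
  an \<open>E\<close>-linear one.
\<close>

definition trace where
  "trace M N t x = finsum N (\<lambda>k. \<gamma> \<one> k \<odot>\<^bsub>N\<^esub> t (\<gamma> \<one> (inv k) \<odot>\<^bsub>M\<^esub> x)) (carrier G)"

text \<open>
  Left multiplication by a monomial \<open>w a g b h\<close> permutes the cosets of \<open>\<Delta>\<close>; the element of \<open>\<Delta>\<close> by
  which it moves the representative passes through the \<open>\<Delta>\<close>-linear map \<open>t\<close>.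
\<close>

lemma trace_hom:
  assumes M: "left_module E M" and N: "left_module E N"
    and t: "t \<in> module_hom \<Delta> (pullback \<iota> M) (pullback \<iota> N)"
  shows "trace M N t \<in> module_hom E M N"
proof -
  interpret M: left_module E M by fact
  interpret N: left_module E N by fact
  have tc: "t x \<in> carrier N" if "x \<in> carrier M" for x using module_homD(1)[OF t] that by simp
  have ta: "t (x \<oplus>\<^bsub>M\<^esub> y) = t x \<oplus>\<^bsub>N\<^esub> t y" if "x \<in> carrier M" "y \<in> carrier M" for x y
    using module_homD(2)[OF t] that by simp
  have tl: "t (\<iota> D \<odot>\<^bsub>M\<^esub> x) = \<iota> D \<odot>\<^bsub>N\<^esub> t x" if "x \<in> carrier M" "D \<in> carrier \<Delta>.B" for x D
    using module_homD(3)[OF t, of D x] that by (simp add: \<Delta>_eq)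
  let ?f = "\<lambda>x k. \<gamma> \<one> k \<odot>\<^bsub>N\<^esub> t (\<gamma> \<one> (inv k) \<odot>\<^bsub>M\<^esub> x)"
  have fc: "?f x k \<in> carrier N" if "x \<in> carrier M" "k \<in> carrier G" for x k
    using that by (simp add: N.smult_closed tc M.smult_closed)
  have trc: "trace M N t x \<in> carrier N" if "x \<in> carrier M" for x
    unfolding trace_def by (rule N.M.finsum_closed) (use fc that in auto)
  have tra: "trace M N t (x \<oplus>\<^bsub>M\<^esub> y) = trace M N t x \<oplus>\<^bsub>N\<^esub> trace M N t y"
    if x: "x \<in> carrier M" "y \<in> carrier M" for x y
  proof -
    have "trace M N t (x \<oplus>\<^bsub>M\<^esub> y) = finsum N (\<lambda>k. ?f x k \<oplus>\<^bsub>N\<^esub> ?f y k) (carrier G)"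
      unfolding trace_def
      by (rule N.M.finsum_cong') (use x fc in "auto simp: M.smult_r_distr N.smult_r_distr ta tc M.smult_closed")
    also have "\<dots> = trace M N t x \<oplus>\<^bsub>N\<^esub> trace M N t y"
      unfolding trace_def by (rule N.M.finsum_addf) (use x fc in auto)
    finally show ?thesis .
  qed
  have "trace M N t (\<epsilon> \<odot>\<^bsub>M\<^esub> x) = \<epsilon> \<odot>\<^bsub>N\<^esub> trace M N t x" if "\<epsilon> \<in> carrier E" and x: "x \<in> carrier M" for \<epsilon> x
    using that(1)
  proof (induction rule: E_induct)
    case (w a g b h)
    let ?w = "w a g b h"
    have "trace M N t (?w \<odot>\<^bsub>M\<^esub> x) = finsum N (\<lambda>k. ?f (?w \<odot>\<^bsub>M\<^esub> x) (g \<otimes> (k \<otimes> h))) (carrier G)"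
      unfolding trace_def
      by (rule N.M.finsum_bij[OF G.bij_mult_both, symmetric]) (use w x fc M.smult_closed in auto)
    also have "\<dots> = finsum N (\<lambda>k. ?w \<odot>\<^bsub>N\<^esub> ?f x k) (carrier G)"
    proof (rule N.M.finsum_cong'[OF refl])
      fix k assume k: "k \<in> carrier G"
      let ?k = "g \<otimes> (k \<otimes> h)" and ?s = "env a (\<phi> (g \<otimes> k) b)"
      have s: "?s \<in> carrier S" using w k by simp
      (* The element of \<Delta> that carries the representative of index k to that of index ?k. *)
      have i: "\<iota> (\<Delta>.e ?s g) = w a g (\<phi> k b) (inv g)"
        using w k by (simp add: \<iota>_e \<kappa>_env w_mult \<phi>_one \<phi>_mult)
      have key1: "\<gamma> \<one> ?k \<cdot> \<iota> (\<Delta>.e ?s g) = ?w \<cdot> \<gamma> \<one> k"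
        unfolding i using w k by (simp add: w_mult \<phi>_one G.group_normalize)
      have key2: "\<gamma> \<one> (inv ?k) \<cdot> ?w = \<iota> (\<Delta>.e ?s g) \<cdot> \<gamma> \<one> (inv k)"
        unfolding i using w k by (simp add: w_mult \<phi>_one G.group_normalize)
      have c: "\<gamma> \<one> (inv k) \<odot>\<^bsub>M\<^esub> x \<in> carrier M" "\<iota> (\<Delta>.e ?s g) \<in> carrier E" "?w \<in> carrier E"
        using w k x s by (simp_all add: M.smult_closed \<iota>_closed)
      have "t (\<gamma> \<one> (inv ?k) \<odot>\<^bsub>M\<^esub> (?w \<odot>\<^bsub>M\<^esub> x)) = t ((\<gamma> \<one> (inv ?k) \<cdot> ?w) \<odot>\<^bsub>M\<^esub> x)"
        using w k x by (simp add: M.smult_assoc)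
      also have "\<dots> = t (\<iota> (\<Delta>.e ?s g) \<odot>\<^bsub>M\<^esub> (\<gamma> \<one> (inv k) \<odot>\<^bsub>M\<^esub> x))"
        unfolding key2 using c x k by (simp add: M.smult_assoc)
      also have "\<dots> = \<iota> (\<Delta>.e ?s g) \<odot>\<^bsub>N\<^esub> t (\<gamma> \<one> (inv k) \<odot>\<^bsub>M\<^esub> x)"
        by (rule tl) (use c s in simp_all)
      finally have "?f (?w \<odot>\<^bsub>M\<^esub> x) ?k =
          (\<gamma> \<one> ?k \<cdot> \<iota> (\<Delta>.e ?s g)) \<odot>\<^bsub>N\<^esub> t (\<gamma> \<one> (inv k) \<odot>\<^bsub>M\<^esub> x)"
        using c tc w k by (simp add: N.smult_assoc)
      then show "?f (?w \<odot>\<^bsub>M\<^esub> x) ?k = ?w \<odot>\<^bsub>N\<^esub> ?f x k"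
        unfolding key1 using c tc w k by (simp add: N.smult_assoc)
    qed (use w x fc N.smult_closed in auto)
    also have "\<dots> = ?w \<odot>\<^bsub>N\<^esub> trace M N t x"
      unfolding trace_def by (rule N.smult_finsum[symmetric]) (use w x fc in auto)
    finally show ?case .
  next
    case (add \<epsilon> \<epsilon>')
    then show ?case using x by (simp add: M.smult_l_distr N.smult_l_distr tra trc M.smult_closed)
  qed
  then show ?thesis by (intro module_homI trc tra)
qed

subsection \<open>The augmentation modules\<close>

abbreviation RA where "RA \<equiv> regular_bimodule A"
abbreviation RB where "RB \<equiv> regular_bimodule B"
abbreviation RB_smult (infixl "\<rhd>" 70) where "r \<rhd> x \<equiv> r \<odot>\<^bsub>RB\<^esub> x"
abbreviation SR where "SR \<equiv> skew_regular_bimodule A G \<phi>"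

lemma RB_simps [simp]: "carrier RB = carrier B" "\<zero>\<^bsub>RB\<^esub> = \<zero>\<^bsub>B\<^esub>" "(\<oplus>\<^bsub>RB\<^esub>) = (\<oplus>\<^bsub>B\<^esub>)"
  by (simp_all add: regular_bimodule_def)

lemma SR_simps [simp]: "carrier SR = carrier A" "\<zero>\<^bsub>SR\<^esub> = \<zero>\<^bsub>A\<^esub>" "(\<oplus>\<^bsub>SR\<^esub>) = (\<oplus>\<^bsub>A\<^esub>)"
  by (simp_all add: skew_regular_bimodule_def)

lemmas RA_hom = regular_smult_hom[OF KA.K_algebra_axioms]
lemmas RA_env = regular_smult_env_elem[OF KA.K_algebra_axioms]

lemma RB_w: "\<lbrakk>a \<in> carrier A; b \<in> carrier A; x \<in> carrier B\<rbrakk> \<Longrightarrow>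
    w a g b h \<rhd> x = e a g \<bullet> x \<bullet> e b h"
  by (simp add: w_def regular_smult_env_elem[OF K_algebra_B])

lemma SR_e:
  assumes s: "s \<in> carrier S" and g: "g \<in> carrier G" and m: "m \<in> carrier A"
  shows "\<Delta>.e s g \<odot>\<^bsub>SR\<^esub> m = s \<odot>\<^bsub>RA\<^esub> \<phi> g m"
proof -
  have c: "u \<odot>\<^bsub>RA\<^esub> \<phi> k m \<in> carrier A" if "u \<in> carrier S" "k \<in> carrier G" for u k
    using hom_closed_add[OF RA_hom] that m by simp
  have z: "\<zero>\<^bsub>S\<^esub> \<odot>\<^bsub>RA\<^esub> \<phi> k m = \<zero>\<^bsub>A\<^esub>" if "k \<in> carrier G" for k
    using hom_zero[OF S.is_abelian_group A.is_abelian_group RA_hom] that m by simp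
  have "\<Delta>.e s g \<odot>\<^bsub>SR\<^esub> m = finsum A (\<lambda>k. \<Delta>.e s g k \<odot>\<^bsub>RA\<^esub> \<phi> k m) (carrier G)"
    by (simp add: skew_regular_bimodule_def)
  also have "\<dots> = \<Delta>.e s g g \<odot>\<^bsub>RA\<^esub> \<phi> g m"
    by (rule A.finsum_single[OF finite_G g]) (use s g c z in "auto simp: \<Delta>.e_apply")
  finally show ?thesis using g by (simp add: \<Delta>.e_apply)
qed

text \<open>
  Inclusion of \<open>A\<close> into \<open>B\<close> and projection onto the coefficient at \<open>1\<close> are \<open>\<Delta>\<close>-linear because \<open>\<gamma> g
  g\<^sup>-\<^sup>1\<close> acts on \<open>B\<close> by conjugation with \<open>g\<close>, which applies \<open>g\<close> to the coefficient at \<open>1\<close>.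
\<close>

lemma incl_linear:
  assumes "left_module \<Delta> SR" "left_module E RB"
  shows "(\<lambda>a. incl a) \<in> module_hom \<Delta> SR (pullback \<iota> RB)"
proof -
  interpret SR: left_module \<Delta> SR by fact
  interpret RB: left_module E RB by fact
  have "incl (D \<odot>\<^bsub>SR\<^esub> m) = \<iota> D \<rhd> incl m" if "D \<in> carrier \<Delta>.B" and m: "m \<in> carrier A" for D m
    using that(1)
  proof (induction rule: \<Delta>.B_induct)
    case (e s g)
    have "incl (s \<odot>\<^bsub>RA\<^esub> \<phi> g m) = \<iota> (\<Delta>.e s g) \<rhd> incl m" using e(1)
    proof (induction rule: tA.t_induct)
      case (t a b)
      then show ?case using e m
        by (simp add: RA_env \<iota>_e \<kappa>_env w_mult RB_w \<phi>_one e_mult A.m_assoc \<phi>_mult[symmetric])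
    next
      case (add s s')
      note [simp] = hom_closed_add[OF RA_hom] hom_add[OF RA_hom]
      have "\<iota> (\<Delta>.e (s \<oplus>\<^bsub>S\<^esub> s') g) = \<iota> (\<Delta>.e s g) \<oplus>\<^bsub>E\<^esub> \<iota> (\<Delta>.e s' g)"
        using add(1,2) e(2) by (simp add: \<iota>_e E.l_distr)
      then show ?case using add e(2) m
        using RB.smult_l_distr[of "\<iota> (\<Delta>.e s g)" "\<iota> (\<Delta>.e s' g)" "incl m"] by (simp add: e_add \<iota>_closed)
    qed
    then show ?case using e m by (simp add: SR_e)
  next
    case (add D D')
    have "(D \<oplus>\<^bsub>\<Delta>.B\<^esub> D') \<odot>\<^bsub>SR\<^esub> m = D \<odot>\<^bsub>SR\<^esub> m \<oplus>\<^bsub>A\<^esub> D' \<odot>\<^bsub>SR\<^esub> m"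
      using SR.smult_l_distr[of D D' m] add m by (simp add: \<Delta>_eq)
    moreover have "\<iota> (D \<oplus>\<^bsub>\<Delta>.B\<^esub> D') \<rhd> incl m = \<iota> D \<rhd> incl m \<oplus>\<^bsub>B\<^esub> \<iota> D' \<rhd> incl m"
      using RB.smult_l_distr[of "\<iota> D" "\<iota> D'" "incl m"] add m by (simp add: \<iota>_add \<iota>_closed)
    moreover have "D \<odot>\<^bsub>SR\<^esub> m \<in> carrier A" "D' \<odot>\<^bsub>SR\<^esub> m \<in> carrier A"
      using SR.smult_closed[of _ m] add m by (simp_all add: \<Delta>_eq)
    ultimately show ?case using add by (simp add: e_add)
  qed
  then show ?thesis by (intro module_homI) (simp_all add: e_add \<Delta>_eq)
qed

lemma proj_linear:
  assumes "left_module \<Delta> SR" "left_module E RB"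
  shows "(\<lambda>x. x \<one>) \<in> module_hom \<Delta> (pullback \<iota> RB) SR"
proof -
  interpret SR: left_module \<Delta> SR by fact
  interpret RB: left_module E RB by fact
  have "(\<iota> D \<rhd> x) \<one> = D \<odot>\<^bsub>SR\<^esub> x \<one>" if "D \<in> carrier \<Delta>.B" and x: "x \<in> carrier B" for D x
    using that(1)
  proof (induction rule: \<Delta>.B_induct)
    case (e s g)
    have "(\<iota> (\<Delta>.e s g) \<rhd> x) \<one> = s \<odot>\<^bsub>RA\<^esub> \<phi> g (x \<one>)" using e(1)
    proof (induction rule: tA.t_induct)
      case (t a b)
      show ?case using x
      proof (induction rule: B_induct)
        case (e c l)
        have i: "\<iota> (\<Delta>.e (env a b) g) = w a g (\<phi> (inv g) b) (inv g)"
          using t \<open>g \<in> carrier G\<close> by (simp add: \<iota>_e \<kappa>_env w_mult \<phi>_one)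
        have "g \<otimes> (l \<otimes> inv g) = \<one> \<longleftrightarrow> l = \<one>"
          using e \<open>g \<in> carrier G\<close>
          by (metis G.inv_closed G.inv_solve_left G.inv_solve_right' G.l_one G.m_closed G.one_closed G.r_inv G.r_one)
        then show ?case using t e \<open>g \<in> carrier G\<close>
          unfolding i by (auto simp: RB_w e_mult e_apply RA_env \<phi>_one G.m_assoc \<phi>_mult)
      next
        case (add x y)
        have "\<iota> (\<Delta>.e (env a b) g) \<rhd> (x \<oplus>\<^bsub>B\<^esub> y) = \<iota> (\<Delta>.e (env a b) g) \<rhd> x \<oplus>\<^bsub>B\<^esub> \<iota> (\<Delta>.e (env a b) g) \<rhd> y"
          using RB.smult_r_distr[of "\<iota> (\<Delta>.e (env a b) g)" x y] add t by (simp add: \<iota>_closed)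
        then show ?case using add t \<open>g \<in> carrier G\<close>
          by (simp add: B_add_apply RA_env A.l_distr A.r_distr)
      qed
    next
      case (add s s')
      note [simp] = hom_closed_add[OF RA_hom] hom_add[OF RA_hom]
      have "\<iota> (\<Delta>.e (s \<oplus>\<^bsub>S\<^esub> s') g) = \<iota> (\<Delta>.e s g) \<oplus>\<^bsub>E\<^esub> \<iota> (\<Delta>.e s' g)"
        using add(1,2) e(2) by (simp add: \<iota>_e E.l_distr)
      then have "\<iota> (\<Delta>.e (s \<oplus>\<^bsub>S\<^esub> s') g) \<rhd> x = \<iota> (\<Delta>.e s g) \<rhd> x \<oplus>\<^bsub>B\<^esub> \<iota> (\<Delta>.e s' g) \<rhd> x"
        using RB.smult_l_distr[of "\<iota> (\<Delta>.e s g)" "\<iota> (\<Delta>.e s' g)" x] add(1,2) x by (simp add: \<iota>_closed)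
      then show ?case using add e(2) x by (simp add: B_simps)
    qed
    then show ?case using e x by (simp add: SR_e)
  next
    case (add D D')
    have "(D \<oplus>\<^bsub>\<Delta>.B\<^esub> D') \<odot>\<^bsub>SR\<^esub> x \<one> = D \<odot>\<^bsub>SR\<^esub> x \<one> \<oplus>\<^bsub>A\<^esub> D' \<odot>\<^bsub>SR\<^esub> x \<one>"
      using SR.smult_l_distr[of D D' "x \<one>"] add x by (simp add: \<Delta>_eq)
    moreover have "\<iota> (D \<oplus>\<^bsub>\<Delta>.B\<^esub> D') \<rhd> x = \<iota> D \<rhd> x \<oplus>\<^bsub>B\<^esub> \<iota> D' \<rhd> x"
      using RB.smult_l_distr[of "\<iota> D" "\<iota> D'" x] add x by (simp add: \<iota>_add \<iota>_closed)
    ultimately show ?case using add by (simp add: B_simps)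
  qed
  then show ?thesis by (intro module_homI) (simp_all add: B_simps \<Delta>_eq)
qed

lemma proj_\<gamma>_incl:
  assumes "k \<in> carrier G" "a \<in> carrier A"
  shows "(\<gamma> (inv k) \<one> \<rhd> incl a) \<one> = (if k = \<one> then a else \<zero>\<^bsub>A\<^esub>)"
proof -
  have "inv k = \<one> \<longleftrightarrow> k = \<one>" using assms by (metis G.inv_inv G.inv_one)
  then show ?thesis using assms by (auto simp: RB_w e_mult e_apply \<phi>_one eq_commute)
qed

text \<open>
  The conjugates of the projection onto \<open>A\<close> by the coset representatives are the projections onto
  the summands \<open>A k\<close> of \<open>B\<close>, so their sum is the identity.
\<close>

lemma trace_incl_proj:
  assumes "left_module E RB" "x \<in> carrier B"
  shows "trace RB RB (\<lambda>x. incl (x \<one>)) x = x"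
proof -
  interpret RB: left_module E RB by fact
  let ?f = "\<lambda>x k. \<gamma> \<one> k \<rhd> incl ((\<gamma> \<one> (inv k) \<rhd> x) \<one>)"
  have fc: "?f x k \<in> carrier RB" if "x \<in> carrier B" "k \<in> carrier G" for x k
    using that RB.smult_closed by simp
  show ?thesis unfolding trace_def using assms(2)
  proof (induction rule: B_induct)
    case (e c l)
    have f: "?f (e c l) k = (if k = l then e c l else \<zero>\<^bsub>B\<^esub>)" if k: "k \<in> carrier G" for k
    proof -
      have "\<one> = l \<otimes> inv k \<longleftrightarrow> k = l"
        using e k by (metis G.inv_solve_right G.l_one G.one_closed)
      then show ?thesis using e k by (simp add: RB_w e_mult e_apply \<phi>_one e_zero)
    qed
    have "finsum RB (?f (e c l)) (carrier G) = ?f (e c l) l"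
      by (rule RB.M.finsum_single[OF finite_G]) (use e fc[of "e c l"] f in auto)
    then show ?case using f[of l] e by simp
  next
    case (add x y)
    have "finsum RB (?f (x \<oplus>\<^bsub>B\<^esub> y)) (carrier G) = finsum RB (\<lambda>k. ?f x k \<oplus>\<^bsub>RB\<^esub> ?f y k) (carrier G)"
    proof (rule RB.M.finsum_cong'[OF refl])
      fix k assume k: "k \<in> carrier G"
      have "\<gamma> \<one> (inv k) \<rhd> (x \<oplus>\<^bsub>B\<^esub> y) =
          \<gamma> \<one> (inv k) \<rhd> x \<oplus>\<^bsub>B\<^esub> \<gamma> \<one> (inv k) \<rhd> y"
        using RB.smult_r_distr[of "\<gamma> \<one> (inv k)" x y] add by simp
      then have "incl ((\<gamma> \<one> (inv k) \<rhd> (x \<oplus>\<^bsub>B\<^esub> y)) \<one>) =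
          incl ((\<gamma> \<one> (inv k) \<rhd> x) \<one>) \<oplus>\<^bsub>B\<^esub> incl ((\<gamma> \<one> (inv k) \<rhd> y) \<one>)"
        using RB.smult_closed[of "\<gamma> \<one> (inv k)"] add k
        by (simp add: e_add[symmetric] B_add_apply)
      then show "?f (x \<oplus>\<^bsub>B\<^esub> y) k = ?f x k \<oplus>\<^bsub>RB\<^esub> ?f y k"
        using RB.smult_r_distr[of "\<gamma> \<one> k"] RB.smult_closed[of "\<gamma> \<one> (inv k)"] add k by simp
    qed (use add fc[of x] fc[of y] in auto)
    also have "\<dots> = x \<oplus>\<^bsub>B\<^esub> y"
      by (subst RB.M.finsum_addf) (use add fc[of x] fc[of y] in auto)
    finally show ?case .
  qed
qed

subsection \<open>Extending \<open>S\<close>-linear cochains to \<open>\<Delta>\<close>-linear ones\<close>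

abbreviation res where "res M \<equiv> restrict_scalars S G M"

lemma res_simps [simp]: "carrier (res M) = carrier M" "\<zero>\<^bsub>res M\<^esub> = \<zero>\<^bsub>M\<^esub>" "(\<oplus>\<^bsub>res M\<^esub>) = (\<oplus>\<^bsub>M\<^esub>)"
  "s \<odot>\<^bsub>res M\<^esub> x = \<Delta>.e s \<one> \<odot>\<^bsub>M\<^esub> x"
  by (simp_all add: restrict_scalars_def)

lemma left_module_res: "left_module \<Delta> M \<Longrightarrow> left_module S (res M)"
  unfolding res_eq_pullback
  by (rule left_module_pullback[OF S.ring_axioms]) (simp_all add: \<Delta>_eq \<Delta>.incl_ring_hom)

text \<open>
  The \<open>\<Delta>\<close>-linear map into \<open>E\<close> whose component in \<open>S\<close> is \<open>\<theta>\<close>; equivariance determines its component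
  at each \<open>\<gamma> g g\<^sup>-\<^sup>1\<close>.
\<close>

definition extend where
  "extend M \<theta> p = sumE (\<lambda>g. \<gamma> g (inv g) \<cdot> \<kappa> (\<theta> (\<upsilon> (inv g) \<odot>\<^bsub>M\<^esub> p)))"

end

section \<open>Comparison of the two resolutions\<close>

context skew_algebra
begin

text \<open>
  The action of the group on cochains, \<open>l(\<theta>) x = l(\<theta>(l\<^sup>-\<^sup>1 x))\<close>.
\<close>

abbreviation move where "move M \<theta> l \<equiv> (\<lambda>x\<in>carrier M. act l (\<theta> (\<upsilon> (inv l) \<odot>\<^bsub>M\<^esub> x)))"

context
  fixes M :: "('g \<Rightarrow> ('a \<times> 'a \<Rightarrow>\<^sub>0 int) set, 'm) module" assumes M: "left_module \<Delta> M"
begin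

interpretation M: left_module \<Delta> M by (rule M)

lemma res_smult_closed: "D \<in> carrier \<Delta>.B \<Longrightarrow> p \<in> carrier M \<Longrightarrow> D \<odot>\<^bsub>M\<^esub> p \<in> carrier M"
  using M.smult_closed by (simp add: \<Delta>_eq)

lemma res_smult_assoc: "\<lbrakk>D \<in> carrier \<Delta>.B; D' \<in> carrier \<Delta>.B; p \<in> carrier M\<rbrakk> \<Longrightarrow>
    (D \<otimes>\<^bsub>\<Delta>.B\<^esub> D') \<odot>\<^bsub>M\<^esub> p = D \<odot>\<^bsub>M\<^esub> (D' \<odot>\<^bsub>M\<^esub> p)"
  using M.smult_assoc by (simp add: \<Delta>_eq)

lemma res_smult_add: "\<lbrakk>D \<in> carrier \<Delta>.B; p \<in> carrier M; q \<in> carrier M\<rbrakk> \<Longrightarrow>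
    D \<odot>\<^bsub>M\<^esub> (p \<oplus>\<^bsub>M\<^esub> q) = D \<odot>\<^bsub>M\<^esub> p \<oplus>\<^bsub>M\<^esub> D \<odot>\<^bsub>M\<^esub> q"
  using M.smult_r_distr by (simp add: \<Delta>_eq)

lemma res_dualD:
  assumes "\<theta> \<in> carrier (dual_module S (res M))"
  shows "p \<in> carrier M \<Longrightarrow> \<theta> p \<in> carrier S"
    "p \<in> carrier M \<Longrightarrow> q \<in> carrier M \<Longrightarrow> \<theta> (p \<oplus>\<^bsub>M\<^esub> q) = \<theta> p \<oplus>\<^bsub>S\<^esub> \<theta> q"
    "s \<in> carrier S \<Longrightarrow> p \<in> carrier M \<Longrightarrow> \<theta> (\<Delta>.e s \<one> \<odot>\<^bsub>M\<^esub> p) = s \<otimes>\<^bsub>S\<^esub> \<theta> p"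
  using dualD(1-3)[OF assms] by simp_all

lemma extend_term_closed:
  "\<lbrakk>\<theta> \<in> carrier (dual_module S (res M)); p \<in> carrier M\<rbrakk> \<Longrightarrow>
    \<gamma> g h \<cdot> \<kappa> (\<theta> (\<upsilon> g' \<odot>\<^bsub>M\<^esub> p)) \<in> carrier E"
  by (simp add: res_dualD res_smult_closed)

lemma extend_closed:
  "\<lbrakk>\<theta> \<in> carrier (dual_module S (res M)); p \<in> carrier M\<rbrakk> \<Longrightarrow> extend M \<theta> p \<in> carrier E"
  unfolding extend_def by (rule tB.T.finsum_closed) (simp add: extend_term_closed)

lemma extend_linear:
  assumes t: "\<theta> \<in> carrier (dual_module S (res M))"
  shows "extend M \<theta> \<in> module_hom \<Delta> M (pullback \<iota> (self_module E))"
proof -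
  note mc = res_smult_closed and ma = res_smult_assoc
  note tc = res_dualD(1)[OF t] and tadd = res_dualD(2)[OF t] and tl = res_dualD(3)[OF t] and ec = extend_closed[OF t]
  let ?f = "\<lambda>p g. \<gamma> g (inv g) \<cdot> \<kappa> (\<theta> (\<upsilon> (inv g) \<odot>\<^bsub>M\<^esub> p))"
  have fc: "?f p g \<in> carrier E" if "p \<in> carrier M" "g \<in> carrier G" for p g
    using that by (simp add: tc mc)
  have ea: "extend M \<theta> (p \<oplus>\<^bsub>M\<^esub> q) = extend M \<theta> p \<oplus>\<^bsub>E\<^esub> extend M \<theta> q" if p: "p \<in> carrier M" "q \<in> carrier M" for p q
  proof -
    have "\<theta> (\<upsilon> g \<odot>\<^bsub>M\<^esub> (p \<oplus>\<^bsub>M\<^esub> q)) = \<theta> (\<upsilon> g \<odot>\<^bsub>M\<^esub> p) \<oplus>\<^bsub>S\<^esub> \<theta> (\<upsilon> g \<odot>\<^bsub>M\<^esub> q)" for g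
      using M.smult_r_distr[of "\<upsilon> g" p q] p by (simp add: \<Delta>_eq tadd mc)
    then have "extend M \<theta> (p \<oplus>\<^bsub>M\<^esub> q) = sumE (\<lambda>g. ?f p g \<oplus>\<^bsub>E\<^esub> ?f q g)"
      unfolding extend_def
      by (intro tB.T.finsum_cong') (use p fc in "auto simp: tc mc E.r_distr")
    also have "\<dots> = extend M \<theta> p \<oplus>\<^bsub>E\<^esub> extend M \<theta> q"
      unfolding extend_def by (rule tB.T.finsum_addf) (use p fc in auto)
    finally show ?thesis .
  qed
  have "extend M \<theta> (D \<odot>\<^bsub>M\<^esub> p) = \<iota> D \<cdot> extend M \<theta> p" if "D \<in> carrier \<Delta>.B" and p: "p \<in> carrier M" for D p
    using that(1)
  proof (induction rule: \<Delta>.B_induct)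
    case (e s l)
    have "extend M \<theta> (\<Delta>.e s l \<odot>\<^bsub>M\<^esub> p) = sumE (\<lambda>g. ?f (\<Delta>.e s l \<odot>\<^bsub>M\<^esub> p) (l \<otimes> (g \<otimes> \<one>)))"
      unfolding extend_def
      by (rule tB.T.finsum_bij[OF G.bij_mult_both, symmetric]) (use e p fc mc in auto)
    also have "\<dots> = sumE (\<lambda>g. \<iota> (\<Delta>.e s l) \<cdot> ?f p g)"
    proof (rule tB.T.finsum_cong'[OF refl])
      fix g assume g: "g \<in> carrier G"
      let ?k = "l \<otimes> g"
      have k: "?k \<in> carrier G" using e g by simp
      have "\<upsilon> (inv ?k) \<otimes>\<^bsub>\<Delta>.B\<^esub> \<Delta>.e s l = \<Delta>.e (act (inv ?k) s) \<one> \<otimes>\<^bsub>\<Delta>.B\<^esub> \<upsilon> (inv g)"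
        using e g by (simp add: \<Delta>.e_mult act_props G.group_normalize)
      then have "\<theta> (\<upsilon> (inv ?k) \<odot>\<^bsub>M\<^esub> (\<Delta>.e s l \<odot>\<^bsub>M\<^esub> p)) = act (inv ?k) s \<otimes>\<^bsub>S\<^esub> \<theta> (\<upsilon> (inv g) \<odot>\<^bsub>M\<^esub> p)"
        using e g k p by (simp add: ma[symmetric] mc tl[symmetric] act_props)
      then have "?f (\<Delta>.e s l \<odot>\<^bsub>M\<^esub> p) ?k = (\<gamma> ?k (inv ?k) \<cdot> \<kappa> (act (inv ?k) s)) \<cdot> \<kappa> (\<theta> (\<upsilon> (inv g) \<odot>\<^bsub>M\<^esub> p))"
        using e g k p by (simp add: tc mc act_props E.m_assoc)
      also have "\<dots> = (\<kappa> s \<cdot> \<gamma> ?k (inv ?k)) \<cdot> \<kappa> (\<theta> (\<upsilon> (inv g) \<odot>\<^bsub>M\<^esub> p))"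
        using e k \<gamma>_act[of "act (inv ?k) s" ?k] by (simp add: act_props)
      finally have 1: "?f (\<Delta>.e s l \<odot>\<^bsub>M\<^esub> p) ?k = (\<kappa> s \<cdot> \<gamma> ?k (inv ?k)) \<cdot> \<kappa> (\<theta> (\<upsilon> (inv g) \<odot>\<^bsub>M\<^esub> p))" .
      have gg: "\<gamma> ?k (inv ?k) = \<gamma> l (inv l) \<cdot> \<gamma> g (inv g)"
        using e g by (simp add: w_mult G.inv_mult_group)
      have 2: "(\<kappa> s \<cdot> \<gamma> ?k (inv ?k)) \<cdot> \<kappa> (\<theta> (\<upsilon> (inv g) \<odot>\<^bsub>M\<^esub> p)) =
          \<iota> (\<Delta>.e s l) \<cdot> ?f p g"
        unfolding gg using e g p by (simp add: \<iota>_e tc mc E.m_assoc)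
      show "?f (\<Delta>.e s l \<odot>\<^bsub>M\<^esub> p) (l \<otimes> (g \<otimes> \<one>)) = \<iota> (\<Delta>.e s l) \<cdot> ?f p g"
        using trans[OF 1 2] by (simp only: G.r_one[OF g])
    qed (use e p fc \<iota>_closed in auto)
    also have "\<dots> = \<iota> (\<Delta>.e s l) \<cdot> extend M \<theta> p"
      unfolding extend_def
      by (rule E.finsum_rdistr[OF finite_G, symmetric]) (use e p fc \<iota>_closed in auto)
    finally show ?case .
  next
    case (add D D')
    have "(D \<oplus>\<^bsub>\<Delta>.B\<^esub> D') \<odot>\<^bsub>M\<^esub> p = D \<odot>\<^bsub>M\<^esub> p \<oplus>\<^bsub>M\<^esub> D' \<odot>\<^bsub>M\<^esub> p"
      using M.smult_l_distr[of D D' p] add p by (simp add: \<Delta>_eq)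
    then show ?case using add p by (simp add: ea mc \<iota>_add \<iota>_closed E.l_distr ec)
  qed
  then show ?thesis by (intro module_homI) (simp_all add: ec ea \<Delta>_eq)
qed

lemma extend_add:
  assumes "\<theta> \<in> carrier (dual_module S (res M))" "\<theta>' \<in> carrier (dual_module S (res M))" "p \<in> carrier M"
  shows "extend M (\<theta> \<oplus>\<^bsub>dual_module S (res M)\<^esub> \<theta>') p = extend M \<theta> p \<oplus>\<^bsub>E\<^esub> extend M \<theta>' p"
proof -
  let ?f = "\<lambda>\<theta> g. \<gamma> g (inv g) \<cdot> \<kappa> (\<theta> (\<upsilon> (inv g) \<odot>\<^bsub>M\<^esub> p))"
  have "extend M (\<theta> \<oplus>\<^bsub>dual_module S (res M)\<^esub> \<theta>') p = sumE (\<lambda>g. ?f \<theta> g \<oplus>\<^bsub>E\<^esub> ?f \<theta>' g)"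
    unfolding extend_def
    by (rule tB.T.finsum_cong') (use assms in "auto simp: extend_term_closed res_dualD res_smult_closed E.r_distr")
  also have "\<dots> = extend M \<theta> p \<oplus>\<^bsub>E\<^esub> extend M \<theta>' p"
    unfolding extend_def by (rule tB.T.finsum_addf) (use assms in "auto simp: extend_term_closed")
  finally show ?thesis .
qed

lemma extend_smult:
  assumes "\<theta> \<in> carrier (dual_module S (res M))" "s \<in> carrier S" "p \<in> carrier M"
  shows "extend M (s \<odot>\<^bsub>dual_module S (res M)\<^esub> \<theta>) p = extend M \<theta> p \<cdot> \<kappa> s"
  unfolding extend_def
  by (subst E.finsum_ldistr[OF finite_G]; (intro tB.T.finsum_cong' refl)?)
    (use assms in "auto simp: extend_term_closed res_dualD res_smult_closed E.m_assoc")

lemma move_dual: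
  assumes t: "\<theta> \<in> carrier (dual_module S (res M))" and l: "l \<in> carrier G"
  shows "move M \<theta> l \<in> carrier (dual_module S (res M))"
proof -
  have "(\<lambda>x\<in>carrier (res M). act l (\<theta> (\<upsilon> (inv l) \<odot>\<^bsub>M\<^esub> x))) \<in> carrier (dual_module S (res M))"
  proof (rule dualI)
    fix s x assume s: "s \<in> carrier S" and x: "x \<in> carrier (res M)"
    have "\<upsilon> (inv l) \<odot>\<^bsub>M\<^esub> (\<Delta>.e s \<one> \<odot>\<^bsub>M\<^esub> x) =
        \<Delta>.e (act (inv l) s) \<one> \<odot>\<^bsub>M\<^esub> (\<upsilon> (inv l) \<odot>\<^bsub>M\<^esub> x)"
      using s x l by (simp add: res_smult_assoc[symmetric] \<Delta>.e_mult act_props)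
    then show "act l (\<theta> (\<upsilon> (inv l) \<odot>\<^bsub>M\<^esub> (s \<odot>\<^bsub>res M\<^esub> x))) =
        s \<otimes>\<^bsub>S\<^esub> act l (\<theta> (\<upsilon> (inv l) \<odot>\<^bsub>M\<^esub> x))"
      using s x l t by (simp add: res_dualD res_smult_closed act_props)
  qed (use t l in "simp_all add: res_dualD res_smult_closed res_smult_add act_props left_module_res[OF M]")
  then show ?thesis by simp
qed

text \<open>
  Substituting \<open>g \<mapsto> g l\<close> in the defining sum turns the action of \<open>l\<close> into right multiplication.
\<close>

lemma extend_move:
  assumes t: "\<theta> \<in> carrier (dual_module S (res M))" and l: "l \<in> carrier G" and p: "p \<in> carrier M"
  shows "extend M (move M \<theta> l) p = extend M \<theta> p \<cdot> \<gamma> (inv l) l"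
proof -
  let ?f = "\<lambda>g. \<gamma> g (inv g) \<cdot> \<kappa> (\<theta> (\<upsilon> (inv g) \<odot>\<^bsub>M\<^esub> p)) \<cdot> \<gamma> (inv l) l"
  have fc: "?f g \<in> carrier E" for g using t p by (simp add: extend_term_closed)
  have "extend M (move M \<theta> l) p = sumE (\<lambda>g. ?f (\<one> \<otimes> (g \<otimes> l)))"
    unfolding extend_def
  proof (rule tB.T.finsum_cong'[OF refl])
    fix g assume g: "g \<in> carrier G"
    let ?s = "\<theta> (\<upsilon> (inv (g \<otimes> l)) \<odot>\<^bsub>M\<^esub> p)"
    have s: "?s \<in> carrier S" using t p by (simp add: res_dualD res_smult_closed)
    have "move M \<theta> l (\<upsilon> (inv g) \<odot>\<^bsub>M\<^esub> p) = act l ?s"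
      using g l p by (simp add: res_smult_closed res_smult_assoc[symmetric] \<Delta>.e_mult G.inv_mult_group)
    moreover have "\<gamma> g (inv g) \<cdot> \<kappa> (act l ?s) =
        \<gamma> g (inv g) \<cdot> (\<kappa> (act l ?s) \<cdot> \<gamma> l (inv l)) \<cdot> \<gamma> (inv l) l"
      using g l s by (simp add: E.m_assoc act_props w_mult one_E[symmetric])
    moreover have "\<dots> = (\<gamma> g (inv g) \<cdot> \<gamma> l (inv l)) \<cdot> \<kappa> ?s \<cdot> \<gamma> (inv l) l"
      using g l s by (simp add: E.m_assoc act_props \<gamma>_act[symmetric])
    moreover have "\<gamma> g (inv g) \<cdot> \<gamma> l (inv l) = \<gamma> (g \<otimes> l) (inv (g \<otimes> l))"
      using g l by (simp add: w_mult G.inv_mult_group)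
    ultimately show "\<gamma> g (inv g) \<cdot> \<kappa> (move M \<theta> l (\<upsilon> (inv g) \<odot>\<^bsub>M\<^esub> p)) =
        ?f (\<one> \<otimes> (g \<otimes> l))"
      using g l by (simp only: G.l_one G.m_closed)
  qed (use fc in auto)
  also have "\<dots> = sumE ?f"
    by (rule tB.T.finsum_bij[OF G.bij_mult_both]) (use l fc in auto)
  also have "\<dots> = extend M \<theta> p \<cdot> \<gamma> (inv l) l"
    unfolding extend_def by (rule E.finsum_ldistr[OF finite_G, symmetric])
      (use t p in "auto simp: extend_term_closed")
  finally show ?thesis .
qed

end

end

locale skew_resolutions = skew_algebra K A G \<phi>
  for K :: "('k, 'x) ring_scheme" and A :: "('k, 'a) module" and G :: "('g, 'z) monoid_scheme" (structure) and \<phi> +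
  fixes P :: "nat \<Rightarrow> ('g \<Rightarrow> ('a \<times> 'a \<Rightarrow>\<^sub>0 int) set, 'p) module"
    and d :: "nat \<Rightarrow> 'p \<Rightarrow> 'p" and \<epsilon> :: "'p \<Rightarrow> 'a"
    and Q :: "nat \<Rightarrow> ((('g \<Rightarrow> 'a) \<times> ('g \<Rightarrow> 'a) \<Rightarrow>\<^sub>0 int) set, 'q) module"
    and \<delta> :: "nat \<Rightarrow> 'q \<Rightarrow> 'q" and \<eta> :: "'q \<Rightarrow> 'g \<Rightarrow> 'a"
  assumes P: "projective_resolution \<Delta> SR P d \<epsilon>" and Q: "projective_resolution E RB Q \<delta> \<eta>"
begin

lemma exact_P: "exact_complex \<Delta> SR P d \<epsilon>" by (rule projective_resolution_exact[OF P])
lemma exact_Q: "exact_complex E RB Q \<delta> \<eta>" by (rule projective_resolution_exact[OF Q])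

lemma P_props:
  shows SR_mod: "left_module \<Delta> SR" and P_mod: "left_module \<Delta> (P i)"
    and d_hom: "d i \<in> module_hom \<Delta> (P (Suc i)) (P i)" and \<epsilon>_hom: "\<epsilon> \<in> module_hom \<Delta> (P 0) SR"
    and P_complex: "module_complex \<Delta> SR P d \<epsilon>"
  using exact_P by (auto simp: exact_complex_def module_complex_def)

lemma Q_props:
  shows RB_mod: "left_module E RB" and Q_mod: "left_module E (Q i)"
    and \<delta>_hom: "\<delta> i \<in> module_hom E (Q (Suc i)) (Q i)" and \<eta>_hom: "\<eta> \<in> module_hom E (Q 0) RB"
    and Q_complex: "module_complex E RB Q \<delta> \<eta>"
  using exact_Q by (auto simp: exact_complex_def module_complex_def)

sublocale Pm: left_module \<Delta> "P i" for i by (rule P_mod)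
sublocale Qm: left_module E "Q i" for i by (rule Q_mod)

lemma P_basis: "\<exists>s. dual_basis \<Delta> (P i) (carrier (P i)) (\<lambda>x. x) s"
proof -
  have "projective_module \<Delta> (P i)" using P by (simp add: projective_resolution_def)
  then show ?thesis by (rule projective_has_dual_basis) (rule exI)
qed

lemma Q_basis: "\<exists>s. dual_basis E (Q i) (carrier (Q i)) (\<lambda>x. x) s"
proof -
  have "projective_module E (Q i)" using Q by (simp add: projective_resolution_def)
  then show ?thesis by (rule projective_has_dual_basis) (rule exI)
qed

abbreviation Q\<Delta> where "Q\<Delta> i \<equiv> pullback \<iota> (Q i)"

lemma exact_Q\<Delta>: "exact_complex \<Delta> (pullback \<iota> RB) Q\<Delta> \<delta> \<eta>"
  by (rule exact_complex_pullback[OF exact_Q ring_\<Delta> \<iota>_ring_hom])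

lemma Q\<Delta>_basis: "\<exists>b s. dual_basis \<Delta> (Q\<Delta> i) (carrier (Q i) \<times> carrier G) b s"
proof -
  obtain s where s: "dual_basis E (Q i) (carrier (Q i)) (\<lambda>x. x) s" using Q_basis by blast
  have "dual_basis \<Delta> (Q\<Delta> i) (carrier (Q i) \<times> carrier G) (\<lambda>(x, h). \<gamma> h \<one> \<odot>\<^bsub>Q i\<^esub> x) (\<lambda>x (y, h). lc h (s x y))"
    by (rule dual_basis_pullback[OF s Q_mod ring_\<Delta> \<iota>_ring_hom finite_G])
      (auto simp: hom_def lc_closed lc_add lc_linear lc_decomp \<Delta>_eq)
  then show ?thesis by blast
qed

lemma exact_res: "exact_complex S (res SR) (\<lambda>i. res (P i)) d \<epsilon>"
  unfolding res_eq_pullback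
  by (rule exact_complex_pullback[OF exact_P S.ring_axioms]) (simp add: \<Delta>_eq \<Delta>.incl_ring_hom)

lemma res_basis: "\<exists>b s. dual_basis S (res (P i)) (carrier (P i) \<times> carrier G) b s"
proof -
  obtain s where s: "dual_basis \<Delta> (P i) (carrier (P i)) (\<lambda>x. x) s" using P_basis by blast
  have "dual_basis S (res (P i)) (carrier (P i) \<times> carrier G)
      (\<lambda>(x, h). \<upsilon> h \<odot>\<^bsub>P i\<^esub> x) (\<lambda>x (y, h). s x y h)"
    unfolding res_eq_pullback
  proof (rule dual_basis_pullback[OF s P_mod S.ring_axioms _ finite_G, where l = "\<lambda>h D. D h"])
    fix D assume D: "D \<in> carrier \<Delta>"
    have "finsum \<Delta> (\<lambda>j. \<Delta>.e (D j) \<one> \<otimes>\<^bsub>\<Delta>\<^esub> \<upsilon> j) (carrier G) = finsum \<Delta>.B (\<lambda>j. \<Delta>.e (D j) j) (carrier G)"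
      unfolding \<Delta>_eq
      by (rule \<Delta>.B.finsum_cong') (use D in "auto simp: \<Delta>_eq \<Delta>.e_mult \<Delta>.\<phi>_one")
    then show "finsum \<Delta> (\<lambda>j. \<Delta>.e (D j) \<one> \<otimes>\<^bsub>\<Delta>\<^esub> \<upsilon> j) (carrier G) = D"
      using \<Delta>.B_decomp[of D] D by (simp add: \<Delta>_eq)
  qed (auto simp: \<Delta>_eq \<Delta>.incl_ring_hom \<Delta>.comp_hom \<Delta>.incl_mult_apply)
  then show ?thesis by blast
qed

text \<open>
  Both resolutions consist of modules with dual bases over \<open>\<Delta>\<close>, hence the \<open>\<Delta>\<close>-linear maps between
  \<open>A\<close> and \<open>B\<close> lift to chain maps in both directions.
\<close>

lemma comparison_maps:
  obtains f c where "\<And>i. f i \<in> module_hom \<Delta> (P i) (Q\<Delta> i)"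
    "\<And>x. x \<in> carrier (P 0) \<Longrightarrow> \<eta> (f 0 x) = incl (\<epsilon> x)"
    "\<And>i x. x \<in> carrier (P (Suc i)) \<Longrightarrow> \<delta> i (f (Suc i) x) = f i (d i x)"
    "\<And>i. c i \<in> module_hom \<Delta> (Q\<Delta> i) (P i)"
    "\<And>x. x \<in> carrier (Q 0) \<Longrightarrow> \<epsilon> (c 0 x) = \<eta> x \<one>"
    "\<And>i x. x \<in> carrier (Q (Suc i)) \<Longrightarrow> d i (c (Suc i) x) = c i (\<delta> i x)"
proof -
  obtain s where s: "\<And>i. dual_basis \<Delta> (P i) (carrier (P i)) (\<lambda>x. x) (s i)" using P_basis by metis
  obtain b r where r: "\<And>i. dual_basis \<Delta> (Q\<Delta> i) (carrier (Q i) \<times> carrier G) (b i) (r i)" using Q\<Delta>_basis by metis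
  have QC: "module_complex \<Delta> (pullback \<iota> RB) Q\<Delta> \<delta> \<eta>"
    using exact_Q\<Delta> by (simp add: exact_complex_def)
  from chain_lift[OF s P_complex exact_Q\<Delta> incl_linear[OF SR_mod RB_mod]]
  obtain f where f: "\<And>i. f i \<in> module_hom \<Delta> (P i) (Q\<Delta> i)"
    "\<And>x. x \<in> carrier (P 0) \<Longrightarrow> \<eta> (f 0 x) = incl (\<epsilon> x)"
    "\<And>i x. x \<in> carrier (P (Suc i)) \<Longrightarrow> \<delta> i (f (Suc i) x) = f i (d i x)" by blast
  from chain_lift[OF r QC exact_P proj_linear[OF SR_mod RB_mod]]
  obtain c where c: "\<And>i. c i \<in> module_hom \<Delta> (Q\<Delta> i) (P i)"
    "\<And>x. x \<in> carrier (Q\<Delta> 0) \<Longrightarrow> \<epsilon> (c 0 x) = \<eta> x \<one>"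
    "\<And>i x. x \<in> carrier (Q\<Delta> (Suc i)) \<Longrightarrow> d i (c (Suc i) x) = c i (\<delta> i x)" by blast
  show thesis by (rule that[OF f c(1)]) (use c(2,3) in simp_all)
qed

end

locale skew_comparison = skew_resolutions K A G \<phi> P d \<epsilon> Q \<delta> \<eta>
  for K :: "('k, 'x) ring_scheme" and A :: "('k, 'a) module" and G :: "('g, 'z) monoid_scheme" (structure) and \<phi>
    and P :: "nat \<Rightarrow> ('g \<Rightarrow> ('a \<times> 'a \<Rightarrow>\<^sub>0 int) set, 'p) module" and d and \<epsilon>
    and Q :: "nat \<Rightarrow> ((('g \<Rightarrow> 'a) \<times> ('g \<Rightarrow> 'a) \<Rightarrow>\<^sub>0 int) set, 'q) module" and \<delta> and \<eta> +
  fixes f :: "nat \<Rightarrow> 'p \<Rightarrow> 'q" and c :: "nat \<Rightarrow> 'q \<Rightarrow> 'p"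
  assumes f_hom: "f i \<in> module_hom \<Delta> (P i) (Q\<Delta> i)"
    and f_aug: "x \<in> carrier (P 0) \<Longrightarrow> \<eta> (f 0 x) = incl (\<epsilon> x)"
    and f_chain: "x \<in> carrier (P (Suc i)) \<Longrightarrow> \<delta> i (f (Suc i) x) = f i (d i x)"
    and c_hom: "c i \<in> module_hom \<Delta> (Q\<Delta> i) (P i)"
    and c_aug: "y \<in> carrier (Q 0) \<Longrightarrow> \<epsilon> (c 0 y) = \<eta> y \<one>"
    and c_chain: "y \<in> carrier (Q (Suc i)) \<Longrightarrow> d i (c (Suc i) y) = c i (\<delta> i y)"
begin

lemma f_props:
  "x \<in> carrier (P i) \<Longrightarrow> f i x \<in> carrier (Q i)"
  "x \<in> carrier (P i) \<Longrightarrow> y \<in> carrier (P i) \<Longrightarrow> f i (x \<oplus>\<^bsub>P i\<^esub> y) = f i x \<oplus>\<^bsub>Q i\<^esub> f i y"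
  "D \<in> carrier \<Delta>.B \<Longrightarrow> x \<in> carrier (P i) \<Longrightarrow> f i (D \<odot>\<^bsub>P i\<^esub> x) = \<iota> D \<odot>\<^bsub>Q i\<^esub> f i x"
  using module_homD[OF f_hom[of i]] by (simp_all add: \<Delta>_eq)

lemma c_props:
  "x \<in> carrier (Q i) \<Longrightarrow> c i x \<in> carrier (P i)"
  "x \<in> carrier (Q i) \<Longrightarrow> y \<in> carrier (Q i) \<Longrightarrow> c i (x \<oplus>\<^bsub>Q i\<^esub> y) = c i x \<oplus>\<^bsub>P i\<^esub> c i y"
  "D \<in> carrier \<Delta>.B \<Longrightarrow> x \<in> carrier (Q i) \<Longrightarrow> c i (\<iota> D \<odot>\<^bsub>Q i\<^esub> x) = D \<odot>\<^bsub>P i\<^esub> c i x"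
  using module_homD[OF c_hom[of i]] by (simp_all add: \<Delta>_eq)

lemma d_props:
  "x \<in> carrier (P (Suc i)) \<Longrightarrow> d i x \<in> carrier (P i)"
  "x \<in> carrier (P (Suc i)) \<Longrightarrow> y \<in> carrier (P (Suc i)) \<Longrightarrow> d i (x \<oplus>\<^bsub>P (Suc i)\<^esub> y) = d i x \<oplus>\<^bsub>P i\<^esub> d i y"
  "D \<in> carrier \<Delta>.B \<Longrightarrow> x \<in> carrier (P (Suc i)) \<Longrightarrow> d i (D \<odot>\<^bsub>P (Suc i)\<^esub> x) = D \<odot>\<^bsub>P i\<^esub> d i x"
  using module_homD[OF d_hom[of i]] by (simp_all add: \<Delta>_eq)

lemmas \<delta>_props = module_homD(1-3)[OF \<delta>_hom]

abbreviation dualP where "dualP i \<equiv> carrier (dual_module S (res (P i)))"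
abbreviation dualQ where "dualQ i \<equiv> carrier (dual_module E (Q i))"

text \<open>
  The comparison on cochains: extend to a \<open>\<Delta>\<close>-linear map, transport along \<open>c\<close>, and take the trace.
\<close>

definition lam where
  "lam i \<theta> = (\<lambda>y\<in>carrier (Q i). trace (Q i) (self_module E) (\<lambda>y. extend (P i) \<theta> (c i y)) y)"

lemma c_\<gamma>_closed: "y \<in> carrier (Q i) \<Longrightarrow> c i (\<gamma> g h \<odot>\<^bsub>Q i\<^esub> y) \<in> carrier (P i)"
  by (simp add: c_props Qm.smult_closed)

lemma lam_apply:
  assumes "\<theta> \<in> dualP i" "y \<in> carrier (Q i)"
  shows "lam i \<theta> y = sumE (\<lambda>k. \<gamma> \<one> k \<cdot> extend (P i) \<theta> (c i (\<gamma> \<one> (inv k) \<odot>\<^bsub>Q i\<^esub> y)))"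
  using assms by (simp add: lam_def trace_def)
    (rule finsum_self[OF E.ring_axioms], auto simp: extend_closed[OF P_mod] c_\<gamma>_closed)

lemma lam_dual: assumes t: "\<theta> \<in> dualP i" shows "lam i \<theta> \<in> dualQ i"
proof -
  have "(\<lambda>y. extend (P i) \<theta> (c i y)) \<in> module_hom \<Delta> (Q\<Delta> i) (pullback \<iota> (self_module E))"
    by (rule module_hom_comp[OF c_hom extend_linear[OF P_mod t]])
  note h = module_homD[OF trace_hom[OF Q_mod left_module_self[OF E.ring_axioms] this]]
  show ?thesis unfolding lam_def by (rule dualI) (use h in "simp_all add: Q_mod")
qed

lemma lam_term_closed: "\<theta> \<in> dualP i \<Longrightarrow> y \<in> carrier (Q i) \<Longrightarrow>
    \<gamma> \<one> k \<cdot> extend (P i) \<theta> (c i (\<gamma> g h \<odot>\<^bsub>Q i\<^esub> y)) \<in> carrier E"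
  by (simp add: extend_closed[OF P_mod] c_\<gamma>_closed)

lemma dualP_closed:
  "\<theta> \<in> dualP i \<Longrightarrow> \<theta>' \<in> dualP i \<Longrightarrow> \<theta> \<oplus>\<^bsub>dual_module S (res (P i))\<^esub> \<theta>' \<in> dualP i"
  "\<theta> \<in> dualP i \<Longrightarrow> s \<in> carrier S \<Longrightarrow> s \<odot>\<^bsub>dual_module S (res (P i))\<^esub> \<theta> \<in> dualP i"
proof -
  interpret left_module "opposite S" "dual_module S (res (P i))"
    by (rule left_module_dual[OF S.ring_axioms left_module_res[OF P_mod]])
  show "\<theta> \<in> dualP i \<Longrightarrow> \<theta>' \<in> dualP i \<Longrightarrow> \<theta> \<oplus>\<^bsub>dual_module S (res (P i))\<^esub> \<theta>' \<in> dualP i" by (rule M.a_closed)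
  show "\<theta> \<in> dualP i \<Longrightarrow> s \<in> carrier S \<Longrightarrow> s \<odot>\<^bsub>dual_module S (res (P i))\<^esub> \<theta> \<in> dualP i"
    by (rule smult_closed) simp_all
qed

lemma lam_add:
  assumes "\<theta> \<in> dualP i" "\<theta>' \<in> dualP i" "y \<in> carrier (Q i)"
  shows "lam i (\<theta> \<oplus>\<^bsub>dual_module S (res (P i))\<^esub> \<theta>') y = lam i \<theta> y \<oplus>\<^bsub>E\<^esub> lam i \<theta>' y"
proof -
  let ?f = "\<lambda>\<theta> k. \<gamma> \<one> k \<cdot> extend (P i) \<theta> (c i (\<gamma> \<one> (inv k) \<odot>\<^bsub>Q i\<^esub> y))"
  have "lam i (\<theta> \<oplus>\<^bsub>dual_module S (res (P i))\<^esub> \<theta>') y = sumE (\<lambda>k. ?f \<theta> k \<oplus>\<^bsub>E\<^esub> ?f \<theta>' k)"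
    unfolding lam_apply[OF dualP_closed(1)[OF assms(1,2)] assms(3)]
  proof (rule tB.T.finsum_cong'[OF refl])
    fix k
    show "?f (\<theta> \<oplus>\<^bsub>dual_module S (res (P i))\<^esub> \<theta>') k = ?f \<theta> k \<oplus>\<^bsub>E\<^esub> ?f \<theta>' k"
      using assms by (simp add: extend_add[OF P_mod] extend_closed[OF P_mod] c_\<gamma>_closed E.r_distr del: dual_simps)
  qed (use assms lam_term_closed in auto)
  also have "\<dots> = lam i \<theta> y \<oplus>\<^bsub>E\<^esub> lam i \<theta>' y"
    unfolding lam_apply[OF assms(1,3)] lam_apply[OF assms(2,3)]
    by (rule tB.T.finsum_addf) (use assms lam_term_closed in auto)
  finally show ?thesis .
qed

lemma lam_right:
  assumes "\<theta> \<in> dualP i" "\<theta>' \<in> dualP i" "y \<in> carrier (Q i)" "r \<in> carrier E"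
    and "\<And>p. p \<in> carrier (P i) \<Longrightarrow> extend (P i) \<theta>' p = extend (P i) \<theta> p \<cdot> r"
  shows "lam i \<theta>' y = lam i \<theta> y \<cdot> r"
proof -
  have "lam i \<theta> y \<cdot> r = sumE (\<lambda>k. (\<gamma> \<one> k \<cdot> extend (P i) \<theta> (c i (\<gamma> \<one> (inv k) \<odot>\<^bsub>Q i\<^esub> y))) \<cdot> r)"
    unfolding lam_apply[OF assms(1,3)] by (rule E.finsum_ldistr[OF finite_G]) (use assms lam_term_closed in auto)
  also have "\<dots> = lam i \<theta>' y"
    unfolding lam_apply[OF assms(2,3)]
    by (rule tB.T.finsum_cong') (use assms lam_term_closed in "auto simp: c_\<gamma>_closed extend_closed[OF P_mod] E.m_assoc")
  finally show ?thesis by simp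
qed

lemma lam_smult: "\<lbrakk>\<theta> \<in> dualP i; s \<in> carrier S; y \<in> carrier (Q i)\<rbrakk> \<Longrightarrow>
    lam i (s \<odot>\<^bsub>dual_module S (res (P i))\<^esub> \<theta>) y = lam i \<theta> y \<cdot> \<kappa> s"
  by (rule lam_right) (simp_all add: dualP_closed extend_smult[OF P_mod] del: dual_simps)

lemma lam_move: "\<lbrakk>\<theta> \<in> dualP i; l \<in> carrier G; y \<in> carrier (Q i)\<rbrakk> \<Longrightarrow>
    lam i (move (P i) \<theta> l) y = lam i \<theta> y \<cdot> \<gamma> (inv l) l"
  by (rule lam_right) (simp_all only: move_dual[OF P_mod] extend_move[OF P_mod] w_closed A.one_closed)

lemma pull_dual: "\<theta> \<in> dualP i \<Longrightarrow> (\<lambda>x\<in>carrier (P (Suc i)). \<theta> (d i x)) \<in> dualP (Suc i)"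
proof -
  assume t: "\<theta> \<in> dualP i"
  have "(\<lambda>x\<in>carrier (res (P (Suc i))). \<theta> (d i x)) \<in> dualP (Suc i)"
    by (rule dualI) (use res_dualD[OF P_mod t] d_props in "simp_all add: left_module_res[OF P_mod]")
  then show ?thesis by simp
qed

lemma lam_d:
  assumes t: "\<theta> \<in> dualP i" and y: "y \<in> carrier (Q (Suc i))"
  shows "lam (Suc i) (\<lambda>x\<in>carrier (P (Suc i)). \<theta> (d i x)) y = lam i \<theta> (\<delta> i y)"
proof -
  have e: "extend (P (Suc i)) (\<lambda>x\<in>carrier (P (Suc i)). \<theta> (d i x)) p = extend (P i) \<theta> (d i p)"
    if "p \<in> carrier (P (Suc i))" for p
    unfolding extend_def using that res_smult_closed[OF P_mod] res_dualD[OF P_mod t] d_props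
    by (intro tB.T.finsum_cong') auto
  show ?thesis
    unfolding lam_apply[OF pull_dual[OF t] y] lam_apply[OF t \<delta>_props(1)[OF y]]
  proof (rule tB.T.finsum_cong'[OF refl])
    fix k
    have "d i (c (Suc i) (\<gamma> \<one> (inv k) \<odot>\<^bsub>Q (Suc i)\<^esub> y)) = c i (\<gamma> \<one> (inv k) \<odot>\<^bsub>Q i\<^esub> \<delta> i y)"
      using y by (simp add: c_chain Qm.smult_closed \<delta>_props)
    then show "\<gamma> \<one> k \<cdot> extend (P (Suc i)) (\<lambda>x\<in>carrier (P (Suc i)). \<theta> (d i x)) (c (Suc i) (\<gamma> \<one> (inv k) \<odot>\<^bsub>Q (Suc i)\<^esub> y)) =
        \<gamma> \<one> k \<cdot> extend (P i) \<theta> (c i (\<gamma> \<one> (inv k) \<odot>\<^bsub>Q i\<^esub> \<delta> i y))"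
      using y by (simp add: e c_\<gamma>_closed)
  qed (use t y lam_term_closed \<delta>_props in auto)
qed

subsection \<open>Injectivity in cohomology\<close>

abbreviation tw where "tw k i p \<equiv> c i (\<gamma> (inv k) \<one> \<odot>\<^bsub>Q i\<^esub> f i p)"

lemma tw_closed: "p \<in> carrier (P i) \<Longrightarrow> tw k i p \<in> carrier (P i)"
  by (simp add: c_\<gamma>_closed f_props)

text \<open>
  Of the double sum over cosets and group elements in \<open>lam\<close> only the terms with matching indices
  contribute to a given coefficient (\<open>coord_twisted\<close>).
\<close>

lemma coord_lam:
  assumes t: "\<theta> \<in> dualP i" and p: "p \<in> carrier (P i)" and h: "h \<in> carrier G" and l: "l \<in> carrier G"
  shows "coord h (lam i \<theta> (f i p) \<cdot> \<gamma> l \<one>) =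
    sumS (\<lambda>k. if k \<otimes> l = h then twist k (\<theta> (tw k i p)) else \<zero>\<^bsub>S\<^esub>)"
proof -
  let ?y = "\<lambda>k. c i (\<gamma> \<one> (inv k) \<odot>\<^bsub>Q i\<^esub> f i p)"
  have yc: "?y k \<in> carrier (P i)" for k using p by (simp add: c_\<gamma>_closed f_props)
  have fp: "f i p \<in> carrier (Q i)" using p by (rule f_props)
  have "coord h (lam i \<theta> (f i p) \<cdot> \<gamma> l \<one>) =
      coord h (sumE (\<lambda>k. \<gamma> \<one> k \<cdot> extend (P i) \<theta> (?y k) \<cdot> \<gamma> l \<one>))"
    unfolding lam_apply[OF t fp]
    by (subst E.finsum_ldistr[OF finite_G]) (use lam_term_closed[OF t fp] in auto)
  also have "\<dots> = sumS (\<lambda>k. coord h (\<gamma> \<one> k \<cdot> extend (P i) \<theta> (?y k) \<cdot> \<gamma> l \<one>))"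
    by (rule hom_finsum[OF E.is_abelian_group S.is_abelian_group coord_hom[OF h]])
      (use lam_term_closed[OF t fp] in auto)
  also have "\<dots> = sumS (\<lambda>k. if k \<otimes> l = h then twist k (\<theta> (tw k i p)) else \<zero>\<^bsub>S\<^esub>)"
  proof (rule tA.T.finsum_cong'[OF refl])
    fix k assume k: "k \<in> carrier G"
    let ?s = "\<lambda>g. \<theta> (\<upsilon> (inv g) \<odot>\<^bsub>P i\<^esub> ?y k)"
    have s: "?s g \<in> carrier S" for g
      using yc by (simp add: res_dualD[OF P_mod t] res_smult_closed[OF P_mod])
    let ?F = "\<lambda>x. coord h (\<gamma> \<one> k \<cdot> (x \<cdot> \<gamma> l \<one>))"
    have F: "?F \<in> add_hom E S"
      using h k l by (auto simp: hom_def E.l_distr E.r_distr coord_props)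
    have "?F (extend (P i) \<theta> (?y k)) = sumS (\<lambda>g. ?F (\<gamma> g (inv g) \<cdot> \<kappa> (?s g)))"
      unfolding extend_def
      by (rule hom_finsum[OF E.is_abelian_group S.is_abelian_group F]) (use s in auto)
    also have "\<dots> = sumS (\<lambda>g. if g = k \<and> k \<otimes> l = h then twist k (?s g) else \<zero>\<^bsub>S\<^esub>)"
      by (rule tA.T.finsum_cong') (use k l h s coord_twisted twist_props in auto)
    also have "\<dots> = (if k \<otimes> l = h then twist k (?s k) else \<zero>\<^bsub>S\<^esub>)"
      by (subst tA.T.finsum_single[OF finite_G k]) (use k s twist_props in auto)
    also have "?s k = \<theta> (tw k i p)"
    proof -
      have "\<upsilon> (inv k) \<odot>\<^bsub>P i\<^esub> ?y k = c i (\<iota> (\<upsilon> (inv k)) \<odot>\<^bsub>Q i\<^esub> (\<gamma> \<one> (inv k) \<odot>\<^bsub>Q i\<^esub> f i p))"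
        using fp by (simp add: c_props Qm.smult_closed)
      also have "\<dots> = c i ((\<gamma> (inv k) k \<cdot> \<gamma> \<one> (inv k)) \<odot>\<^bsub>Q i\<^esub> f i p)"
        using fp k by (simp add: Qm.smult_assoc \<iota>_e)
      also have "\<gamma> (inv k) k \<cdot> \<gamma> \<one> (inv k) = \<gamma> (inv k) \<one>" using k by (simp add: w_mult)
      finally show ?thesis by simp
    qed
    finally show "coord h (\<gamma> \<one> k \<cdot> extend (P i) \<theta> (?y k) \<cdot> \<gamma> l \<one>) =
        (if k \<otimes> l = h then twist k (\<theta> (tw k i p)) else \<zero>\<^bsub>S\<^esub>)"
      using k l yc extend_closed[OF P_mod t] by (simp add: E.m_assoc)
  qed (use p t twist_props res_dualD[OF P_mod t] tw_closed in auto)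
  finally show ?thesis .
qed

text \<open>
  The map \<open>tw k\<close> is semilinear, that is, linear into the module with scalars twisted by \<open>k\<^sup>-\<^sup>1\<close>;
  on \<open>A\<close> it induces the coefficient at \<open>1\<close> of \<open>k\<^sup>-\<^sup>1 a\<close>, which is \<open>a\<close> for \<open>k = 1\<close> and zero
  otherwise.
\<close>

lemma tw_homotopy:
  assumes k: "k \<in> carrier G"
  obtains h where "\<And>i. h i \<in> module_hom S (res (P i)) (pullback (twist (inv k)) (res (P (Suc i))))"
    "\<And>i p. p \<in> carrier (P (Suc i)) \<Longrightarrow> tw k (Suc i) p =
      (if k = \<one> then p else \<zero>\<^bsub>P (Suc i)\<^esub>) \<oplus>\<^bsub>P (Suc i)\<^esub> (d (Suc i) (h (Suc i) p) \<oplus>\<^bsub>P (Suc i)\<^esub> h i (d i p))"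
proof -
  let ?\<sigma> = "twist (inv k)"
  let ?N = "\<lambda>i. pullback ?\<sigma> (res (P i))"
  have k': "inv k \<in> carrier G" using k by simp
  obtain b s where D: "\<And>i. dual_basis S (res (P i)) (carrier (P i) \<times> carrier G) (b i) (s i)" using res_basis by metis
  have C: "module_complex S (res SR) (\<lambda>i. res (P i)) d \<epsilon>" using exact_res by (simp add: exact_complex_def)
  have N: "exact_complex S (pullback ?\<sigma> (res SR)) ?N d \<epsilon>"
    by (rule exact_complex_pullback[OF exact_res S.ring_axioms twist_ring_hom[OF k']])
  let ?one = "\<lambda>i p. if k = \<one> then p else \<zero>\<^bsub>P i\<^esub>"
  have g1: "tw k i \<in> module_hom S (res (P i)) (?N i)" for i
  proof (rule module_homI)
    fix r p assume r: "r \<in> carrier S" and p: "p \<in> carrier (res (P i))"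
    have fp: "f i p \<in> carrier (Q i)" using p by (simp add: f_props)
    have r': "?\<sigma> r \<in> carrier S" using r k' twist_props by blast
    have "tw k i (\<Delta>.e r \<one> \<odot>\<^bsub>P i\<^esub> p) = c i (\<gamma> (inv k) \<one> \<odot>\<^bsub>Q i\<^esub> (\<kappa> r \<odot>\<^bsub>Q i\<^esub> f i p))"
      using r p by (simp add: f_props \<iota>_e one_E[symmetric])
    also have "\<dots> = c i ((\<gamma> (inv k) \<one> \<cdot> \<kappa> r) \<odot>\<^bsub>Q i\<^esub> f i p)"
      using r fp by (simp add: Qm.smult_assoc)
    also have "\<dots> = c i (\<kappa> (?\<sigma> r) \<odot>\<^bsub>Q i\<^esub> (\<gamma> (inv k) \<one> \<odot>\<^bsub>Q i\<^esub> f i p))"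
      unfolding \<gamma>_twist[OF r k'] using r' fp by (simp add: Qm.smult_assoc)
    also have "\<kappa> (?\<sigma> r) = \<iota> (\<Delta>.e (?\<sigma> r) \<one>)" using r' by (simp add: \<iota>_e one_E[symmetric])
    finally have "tw k i (\<Delta>.e r \<one> \<odot>\<^bsub>P i\<^esub> p) = \<Delta>.e (?\<sigma> r) \<one> \<odot>\<^bsub>P i\<^esub> tw k i p"
      using r' fp by (simp add: c_props Qm.smult_closed)
    then show "tw k i (r \<odot>\<^bsub>res (P i)\<^esub> p) = r \<odot>\<^bsub>?N i\<^esub> tw k i p" by simp
  next
    fix p q assume "p \<in> carrier (res (P i))" "q \<in> carrier (res (P i))"
    then show "tw k i (p \<oplus>\<^bsub>res (P i)\<^esub> q) = tw k i p \<oplus>\<^bsub>?N i\<^esub> tw k i q"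
      by (simp add: f_props c_props Qm.smult_r_distr Qm.smult_closed)
  qed (simp add: tw_closed)
  have sz: "\<Delta>.e r g \<odot>\<^bsub>P i\<^esub> \<zero>\<^bsub>P i\<^esub> = \<zero>\<^bsub>P i\<^esub>" if "r \<in> carrier S" for r g i
    using Pm.smult_zero[of "\<Delta>.e r g" i] that by (simp add: \<Delta>_eq)
  have g2: "?one i \<in> module_hom S (res (P i)) (?N i)" for i
    by (rule module_homI) (auto simp: twist_one sz twist_props[OF k'])
  have chain_tw: "d i (tw k (Suc i) p) = tw k i (d i p)" if p: "p \<in> carrier (res (P (Suc i)))" for i p
    using p by (simp add: c_chain f_props Qm.smult_closed \<delta>_props f_chain)
  have d0: "d i \<zero>\<^bsub>P (Suc i)\<^esub> = \<zero>\<^bsub>P i\<^esub>" for i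
    by (rule module_hom_zero[OF d_hom Pm.M.abelian_group_axioms Pm.M.abelian_group_axioms])
  have aug: "\<epsilon> (tw k 0 p) = \<epsilon> (?one 0 p)" if p: "p \<in> carrier (res (P 0))" for p
  proof -
    have \<epsilon>c: "\<epsilon> x \<in> carrier A" if "x \<in> carrier (P 0)" for x using module_homD(1)[OF \<epsilon>_hom that] by simp
    have e0: "\<epsilon> \<zero>\<^bsub>P 0\<^esub> = \<zero>\<^bsub>A\<^esub>"
      using module_hom_zero[OF \<epsilon>_hom Pm.M.abelian_group_axioms] SR_mod by (simp add: left_module_def)
    have "\<epsilon> (tw k 0 p) = (\<gamma> (inv k) \<one> \<rhd> \<eta> (f 0 p)) \<one>"
      using p by (simp add: c_aug f_props Qm.smult_closed module_homD(3)[OF \<eta>_hom])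
    also have "\<dots> = \<epsilon> (?one 0 p)"
      using p k proj_\<gamma>_incl[of k "\<epsilon> p"] by (simp add: f_aug \<epsilon>c e0)
    finally show ?thesis .
  qed
  have v_chain: "d i (?one (Suc i) p) = ?one i (d i p)" for i p by (simp add: d0)
  from chain_maps_homotopic[where u = "\<lambda>i p. tw k i p" and v = ?one, OF D C N g1 g2 aug chain_tw v_chain]
  obtain h where h: "\<And>i. h i \<in> module_hom S (res (P i)) (?N (Suc i))"
    "\<And>i p. p \<in> carrier (res (P (Suc i))) \<Longrightarrow>
      tw k (Suc i) p = ?one (Suc i) p \<oplus>\<^bsub>?N (Suc i)\<^esub> (d (Suc i) (h (Suc i) p) \<oplus>\<^bsub>?N (Suc i)\<^esub> h i (d i p))" by blast
  show thesis by (rule that[OF h(1)]) (use h(2) in simp)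
qed

end

context skew_comparison
begin

abbreviation PZ where "PZ j \<equiv> cocycles S (\<lambda>i. res (P i)) d (Suc j)"
abbreviation QZ where "QZ j \<equiv> cocycles E Q \<delta> (Suc j)"

lemma PZ_iff: "\<theta> \<in> PZ j \<longleftrightarrow> \<theta> \<in> dualP (Suc j) \<and> (\<forall>x\<in>carrier (P (Suc (Suc j))). \<theta> (d (Suc j) x) = \<zero>\<^bsub>S\<^esub>)"
  by (simp add: cocycles_def)

lemma QZ_iff: "\<theta> \<in> QZ j \<longleftrightarrow> \<theta> \<in> dualQ (Suc j) \<and> (\<forall>x\<in>carrier (Q (Suc (Suc j))). \<theta> (\<delta> (Suc j) x) = \<zero>\<^bsub>E\<^esub>)"
  by (simp add: cocycles_def)

lemma finsum_dual_hom:
  assumes "\<And>k. k \<in> I \<Longrightarrow> t k \<in> add_hom M S"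
    and "x \<in> carrier M" "y \<in> carrier M"
  shows "finsum S (\<lambda>k. t k (x \<oplus>\<^bsub>M\<^esub> y)) I = finsum S (\<lambda>k. t k x) I \<oplus>\<^bsub>S\<^esub> finsum S (\<lambda>k. t k y) I"
proof -
  have "finsum S (\<lambda>k. t k (x \<oplus>\<^bsub>M\<^esub> y)) I = finsum S (\<lambda>k. t k x \<oplus>\<^bsub>S\<^esub> t k y) I"
    by (rule tA.T.finsum_cong') (use assms hom_add hom_closed_add in "fastforce+")
  also have "\<dots> = finsum S (\<lambda>k. t k x) I \<oplus>\<^bsub>S\<^esub> finsum S (\<lambda>k. t k y) I"
    by (rule tA.T.finsum_addf) (use assms hom_closed_add in "fastforce+")
  finally show ?thesis .
qed

text \<open>
  Compose with \<open>f\<close> and take the coefficient at \<open>\<gamma> h 1\<close>. By \<open>coord_lam\<close> it is a sum over \<open>k\<close> of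
  twists of \<open>u (k\<^sup>-\<^sup>1 h) \<circ> tw k\<close>. By \<open>tw_homotopy\<close> the term for \<open>k = 1\<close> is \<open>u h\<close>, and everything
  else is a coboundary.
\<close>

lemma lam_injective:
  assumes e: "\<And>l. l \<in> carrier G \<Longrightarrow> u l \<in> PZ j" and \<zeta>: "\<zeta> \<in> dualQ j"
    and sum: "\<And>y. y \<in> carrier (Q (Suc j)) \<Longrightarrow>
      sumE (\<lambda>l. lam (Suc j) (u l) y \<cdot> \<gamma> l \<one>) = \<zeta> (\<delta> j y)"
    and h: "h \<in> carrier G"
  shows "\<exists>\<xi>\<in>dualP j. \<forall>p\<in>carrier (P (Suc j)). u h p = \<xi> (d j p)"
proof -
  note ud = res_dualD[OF P_mod e[THEN PZ_iff[THEN iffD1], THEN conjunct1]]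
  have u0: "u l (d (Suc j) x) = \<zero>\<^bsub>S\<^esub>" if "l \<in> carrier G" "x \<in> carrier (P (Suc (Suc j)))" for l x
    using e[OF that(1)] that(2) by (simp add: PZ_iff)
  have dual: "u l \<in> dualP (Suc j)" if "l \<in> carrier G" for l using e[OF that] by (simp add: PZ_iff)
  let ?H = "\<lambda>k h. (\<forall>i. h i \<in> module_hom S (res (P i)) (pullback (twist (inv k)) (res (P (Suc i))))) \<and>
    (\<forall>i. \<forall>p\<in>carrier (P (Suc i)). tw k (Suc i) p =
      (if k = \<one> then p else \<zero>\<^bsub>P (Suc i)\<^esub>) \<oplus>\<^bsub>P (Suc i)\<^esub> (d (Suc i) (h (Suc i) p) \<oplus>\<^bsub>P (Suc i)\<^esub> h i (d i p)))"
  have "\<exists>h. ?H k h" if k: "k \<in> carrier G" for k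
    by (rule tw_homotopy[OF k]) (rule exI, intro conjI allI ballI)
  then have "\<forall>k\<in>carrier G. \<exists>h. ?H k h" by blast
  from bchoice[OF this] obtain H where H: "\<And>k. k \<in> carrier G \<Longrightarrow> ?H k (H k)" by blast
  have H_hom: "H k i \<in> module_hom S (res (P i)) (pullback (twist (inv k)) (res (P (Suc i))))"
    if "k \<in> carrier G" for k i using H[OF that] by blast
  have Hc: "H k i x \<in> carrier (P (Suc i))" if "k \<in> carrier G" "x \<in> carrier (P i)" for k i x
    using module_homD(1)[OF H_hom[OF that(1)]] that by simp
  have tw: "tw k (Suc j) p = (if k = \<one> then p else \<zero>\<^bsub>P (Suc j)\<^esub>) \<oplus>\<^bsub>P (Suc j)\<^esub>
      (d (Suc j) (H k (Suc j) p) \<oplus>\<^bsub>P (Suc j)\<^esub> H k j (d j p))"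
    if "k \<in> carrier G" "p \<in> carrier (P (Suc j))" for k p using H[OF that(1)] that(2) by blast
  let ?l = "\<lambda>k. inv k \<otimes> h"
  let ?\<xi> = "\<lambda>k x. twist k (u (?l k) (H k j x))"
  have lc: "?l k \<in> carrier G" if "k \<in> carrier G" for k using that h by simp
  (* H k is linear up to the inverse twist, so twist k makes its composition with u linear over S. *)
  have \<xi>c: "?\<xi> k x \<in> carrier S" if "k \<in> carrier G" "x \<in> carrier (P j)" for k x
    using that by (simp add: twist_props ud Hc lc)
  have \<xi>_hom: "?\<xi> k \<in> add_hom (P j) S" if k: "k \<in> carrier G" for k
    using module_homD(2)[OF H_hom[OF k, of j]] \<xi>c k lc[OF k] by (simp add: hom_def ud twist_props Hc)
  have \<xi>_lin: "?\<xi> k (\<Delta>.e s \<one> \<odot>\<^bsub>P j\<^esub> x) = s \<otimes>\<^bsub>S\<^esub> ?\<xi> k x"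
    if k: "k \<in> carrier G" and s: "s \<in> carrier S" and x: "x \<in> carrier (P j)" for k s x
  proof -
    have s': "twist (inv k) s \<in> carrier S" using twist_props(1)[of "inv k" s] k s by simp
    have "H k j (\<Delta>.e s \<one> \<odot>\<^bsub>P j\<^esub> x) = \<Delta>.e (twist (inv k) s) \<one> \<odot>\<^bsub>P (Suc j)\<^esub> H k j x"
      using module_homD(3)[OF H_hom[OF k, of j], of s x] s x by simp
    then show ?thesis using k s s' x lc[OF k] by (simp add: ud Hc twist_props twist_twist)
  qed
  (* The cocycle kills the homotopy term d h; the term h d factors through d and stays. *)
  have ul: "u (?l k) (tw k (Suc j) p) = (if k = \<one> then u (?l k) p else \<zero>\<^bsub>S\<^esub>) \<oplus>\<^bsub>S\<^esub> u (?l k) (H k j (d j p))"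
    if k: "k \<in> carrier G" and p: "p \<in> carrier (P (Suc j))" for k p
  proof -
    have z: "u (?l k) \<zero>\<^bsub>P (Suc j)\<^esub> = \<zero>\<^bsub>S\<^esub>"
      using hom_zero[OF _ S.is_abelian_group dualD(5)[OF dual[OF lc[OF k]]]]
        left_module_res[OF P_mod, of "Suc j"] by (simp add: left_module_def)
    have c: "d (Suc j) (H k (Suc j) p) \<in> carrier (P (Suc j))" "H k j (d j p) \<in> carrier (P (Suc j))"
      using k p d_props Hc by auto
    show ?thesis
      unfolding tw[OF k p] using k p c lc[OF k] by (simp add: ud z u0 Hc)
  qed
  let ?\<chi> = "\<lambda>x. coord h (\<zeta> (f j x))"
  note \<zeta>d = dualD(1-3)[OF \<zeta>]
  have main: "?\<chi> (d j p) = u h p \<oplus>\<^bsub>S\<^esub> sumS (\<lambda>k. ?\<xi> k (d j p))" if p: "p \<in> carrier (P (Suc j))" for p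
  proof -
    have fp: "f (Suc j) p \<in> carrier (Q (Suc j))" using p by (rule f_props)
    let ?T = "\<lambda>l k. if k \<otimes> l = h then twist k (u l (tw k (Suc j) p)) else \<zero>\<^bsub>S\<^esub>"
    have Tc: "?T l k \<in> carrier S" if "l \<in> carrier G" "k \<in> carrier G" for l k
      using that p by (simp add: twist_props ud tw_closed)
    have "?\<chi> (d j p) = coord h (sumE (\<lambda>l. lam (Suc j) (u l) (f (Suc j) p) \<cdot> \<gamma> l \<one>))"
      using sum[OF fp] p by (simp add: f_chain)
    also have "\<dots> = sumS (\<lambda>l. coord h (lam (Suc j) (u l) (f (Suc j) p) \<cdot> \<gamma> l \<one>))"
      by (rule hom_finsum[OF E.is_abelian_group S.is_abelian_group coord_hom[OF h]])
        (use dualD(1)[OF lam_dual[OF dual]] fp in auto)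
    also have "\<dots> = sumS (\<lambda>l. sumS (?T l))"
      by (rule tA.T.finsum_cong') (use Tc coord_lam[OF dual p h] in "auto intro!: tA.T.finsum_closed")
    also have "\<dots> = sumS (\<lambda>k. sumS (\<lambda>l. ?T l k))"
      by (rule tA.T.add.finprod_swap[OF finite_G finite_G]) (use Tc in simp)
    also have "\<dots> = sumS (\<lambda>k. (if k = \<one> then u h p else \<zero>\<^bsub>S\<^esub>) \<oplus>\<^bsub>S\<^esub> ?\<xi> k (d j p))"
    proof (rule tA.T.finsum_cong'[OF refl])
      fix k assume k: "k \<in> carrier G"
      have kl: "k \<otimes> l = h \<longleftrightarrow> l = ?l k" if "l \<in> carrier G" for l
        using k h that by (metis G.group_cancel_left)
      have "sumS (\<lambda>l. ?T l k) = ?T (?l k) k"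
        by (rule tA.T.finsum_single[OF finite_G lc[OF k]]) (use k lc[OF k] kl p in "auto simp: twist_props ud tw_closed")
      also have "\<dots> = twist k (u (?l k) (tw k (Suc j) p))" using k h by (simp add: G.group_cancel_left)
      also have "\<dots> = (if k = \<one> then u h p else \<zero>\<^bsub>S\<^esub>) \<oplus>\<^bsub>S\<^esub> ?\<xi> k (d j p)"
        unfolding ul[OF k p]
        using k p h lc[OF k] hom_zero[OF S.is_abelian_group S.is_abelian_group twist_props(4)[OF k]]
        by (auto simp: twist_props twist_one ud Hc d_props)
      finally show "sumS (\<lambda>l. ?T l k) = (if k = \<one> then u h p else \<zero>\<^bsub>S\<^esub>) \<oplus>\<^bsub>S\<^esub> ?\<xi> k (d j p)" .
    qed (use \<xi>c ud h p d_props in auto)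
    also have "\<dots> = sumS (\<lambda>k. if k = \<one> then u h p else \<zero>\<^bsub>S\<^esub>) \<oplus>\<^bsub>S\<^esub> sumS (\<lambda>k. ?\<xi> k (d j p))"
      by (rule tA.T.finsum_addf) (use \<xi>c ud h p d_props in auto)
    also have "sumS (\<lambda>k. if k = \<one> then u h p else \<zero>\<^bsub>S\<^esub>) = u h p"
      by (subst tA.T.finsum_single[OF finite_G G.one_closed]) (use ud h p in auto)
    finally show ?thesis .
  qed
  let ?\<Xi> = "\<lambda>x. sumS (\<lambda>k. ?\<xi> k x)"
  have \<Xi>c: "?\<Xi> x \<in> carrier S" if "x \<in> carrier (P j)" for x
    by (rule tA.T.finsum_closed) (use \<xi>c that in auto)
  have \<chi>c: "?\<chi> x \<in> carrier S" if "x \<in> carrier (P j)" for x using that h \<zeta>d f_props coord_props by simp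
  have "(\<lambda>x\<in>carrier (res (P j)). ?\<chi> x \<ominus>\<^bsub>S\<^esub> ?\<Xi> x) \<in> dualP j"
  proof (rule dualI)
    fix x y assume xy: "x \<in> carrier (res (P j))" "y \<in> carrier (res (P j))"
    have "?\<Xi> (x \<oplus>\<^bsub>P j\<^esub> y) = ?\<Xi> x \<oplus>\<^bsub>S\<^esub> ?\<Xi> y" by (rule finsum_dual_hom) (use \<xi>_hom xy in auto)
    moreover have "?\<chi> (x \<oplus>\<^bsub>P j\<^esub> y) = ?\<chi> x \<oplus>\<^bsub>S\<^esub> ?\<chi> y" using xy h \<zeta>d f_props coord_props by simp
    ultimately show "?\<chi> (x \<oplus>\<^bsub>res (P j)\<^esub> y) \<ominus>\<^bsub>S\<^esub> ?\<Xi> (x \<oplus>\<^bsub>res (P j)\<^esub> y) = (?\<chi> x \<ominus>\<^bsub>S\<^esub> ?\<Xi> x) \<oplus>\<^bsub>S\<^esub> (?\<chi> y \<ominus>\<^bsub>S\<^esub> ?\<Xi> y)"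
      using xy \<Xi>c[of x] \<Xi>c[of y] \<chi>c[of x] \<chi>c[of y] by (simp add: a_minus_def tA.T.minus_add tA.T.a_ac)
  next
    fix s x assume s: "s \<in> carrier S" and x: "x \<in> carrier (res (P j))"
    have "?\<Xi> (\<Delta>.e s \<one> \<odot>\<^bsub>P j\<^esub> x) = sumS (\<lambda>k. s \<otimes>\<^bsub>S\<^esub> ?\<xi> k x)"
      by (rule tA.T.finsum_cong') (use s x \<xi>_lin \<xi>c in auto)
    also have "\<dots> = s \<otimes>\<^bsub>S\<^esub> ?\<Xi> x" by (rule S.finsum_rdistr[OF finite_G, symmetric]) (use s x \<xi>c in auto)
    finally have "?\<Xi> (\<Delta>.e s \<one> \<odot>\<^bsub>P j\<^esub> x) = s \<otimes>\<^bsub>S\<^esub> ?\<Xi> x" .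
    moreover have "?\<chi> (\<Delta>.e s \<one> \<odot>\<^bsub>P j\<^esub> x) = s \<otimes>\<^bsub>S\<^esub> ?\<chi> x"
      using s x h \<zeta>d f_props by (simp add: \<iota>_e one_E[symmetric] coord_linear)
    ultimately show "?\<chi> (s \<odot>\<^bsub>res (P j)\<^esub> x) \<ominus>\<^bsub>S\<^esub> ?\<Xi> (s \<odot>\<^bsub>res (P j)\<^esub> x) = s \<otimes>\<^bsub>S\<^esub> (?\<chi> x \<ominus>\<^bsub>S\<^esub> ?\<Xi> x)"
      using s x \<Xi>c[of x] \<chi>c[of x] by (simp add: a_minus_def S.r_distr S.r_minus)
  qed (use \<Xi>c \<chi>c in "simp_all add: left_module_res[OF P_mod]")
  moreover have "u h p = (\<lambda>x\<in>carrier (res (P j)). ?\<chi> x \<ominus>\<^bsub>S\<^esub> ?\<Xi> x) (d j p)" if p: "p \<in> carrier (P (Suc j))" for p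
    using main[OF p] d_props(1)[OF p] \<Xi>c[of "d j p"] ud(1)[OF h p]
    by (simp add: a_minus_def tA.T.a_assoc tA.T.r_neg)
  ultimately show ?thesis by blast
qed

subsection \<open>Surjectivity in cohomology\<close>

abbreviation fc where "fc i \<equiv> trace (Q i) (Q i) (\<lambda>y. f i (c i y))"

lemma fc_hom: "fc i \<in> module_hom E (Q i) (Q i)"
  by (rule trace_hom[OF Q_mod Q_mod module_hom_comp[OF c_hom f_hom]])

text \<open>
  The trace of \<open>f \<circ> c\<close> lifts the trace of inclusion after projection, which is the identity of
  \<open>B\<close>.
\<close>

lemma fc_homotopy:
  obtains s where "\<And>i. s i \<in> module_hom E (Q i) (Q (Suc i))"
    "\<And>i y. y \<in> carrier (Q (Suc i)) \<Longrightarrow> fc (Suc i) y = y \<oplus>\<^bsub>Q (Suc i)\<^esub> (\<delta> (Suc i) (s (Suc i) y) \<oplus>\<^bsub>Q (Suc i)\<^esub> s i (\<delta> i y))"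
proof -
  obtain r where D: "\<And>i. dual_basis E (Q i) (carrier (Q i)) (\<lambda>x. x) (r i)" using Q_basis by metis
  have id: "(\<lambda>y. y) \<in> module_hom E (Q i) (Q i)" for i by (rule module_homI) auto
  have trm: "\<gamma> \<one> k \<odot>\<^bsub>Q i\<^esub> f i (c i (\<gamma> \<one> (inv k) \<odot>\<^bsub>Q i\<^esub> y)) \<in> carrier (Q i)" if "y \<in> carrier (Q i)" for i k y
    using that by (simp add: Qm.smult_closed f_props c_\<gamma>_closed)
  have chain: "\<delta> i (fc (Suc i) y) = fc i (\<delta> i y)" if y: "y \<in> carrier (Q (Suc i))" for i y
  proof -
    have "\<delta> i (fc (Suc i) y) = finsum (Q i) (\<lambda>k. \<delta> i (\<gamma> \<one> k \<odot>\<^bsub>Q (Suc i)\<^esub> f (Suc i) (c (Suc i) (\<gamma> \<one> (inv k) \<odot>\<^bsub>Q (Suc i)\<^esub> y)))) (carrier G)"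
      unfolding trace_def
      by (rule hom_finsum[OF Qm.M.abelian_group_axioms Qm.M.abelian_group_axioms module_homD(4)[OF \<delta>_hom]]) (use y trm in auto)
    also have "\<dots> = fc i (\<delta> i y)"
      unfolding trace_def
      by (rule Qm.M.finsum_cong') (use y trm \<delta>_props in "auto simp: f_props c_\<gamma>_closed f_chain c_chain Qm.smult_closed")
    finally show ?thesis .
  qed
  have aug: "\<eta> (fc 0 y) = \<eta> y" if y: "y \<in> carrier (Q 0)" for y
  proof -
    note \<eta>p = module_homD[OF \<eta>_hom]
    have RBA: "abelian_group RB" using RB_mod by (simp add: left_module_def)
    interpret RB: abelian_group RB by (rule RBA)
    have "\<eta> (fc 0 y) = finsum RB (\<lambda>k. \<eta> (\<gamma> \<one> k \<odot>\<^bsub>Q 0\<^esub> f 0 (c 0 (\<gamma> \<one> (inv k) \<odot>\<^bsub>Q 0\<^esub> y)))) (carrier G)"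
      unfolding trace_def
      by (rule hom_finsum[OF Qm.M.abelian_group_axioms RBA \<eta>p(4)]) (use y trm in auto)
    also have "\<dots> = trace RB RB (\<lambda>x. incl (x \<one>)) (\<eta> y)"
      unfolding trace_def
    proof (rule RB.finsum_cong'[OF refl])
      fix k
      show "\<eta> (\<gamma> \<one> k \<odot>\<^bsub>Q 0\<^esub> f 0 (c 0 (\<gamma> \<one> (inv k) \<odot>\<^bsub>Q 0\<^esub> y))) =
          \<gamma> \<one> k \<rhd> incl ((\<gamma> \<one> (inv k) \<rhd> \<eta> y) \<one>)"
        using y by (simp add: \<eta>p(3) f_props c_\<gamma>_closed f_aug c_aug Qm.smult_closed)
    next
      show "(\<lambda>k. \<gamma> \<one> k \<rhd> incl ((\<gamma> \<one> (inv k) \<rhd> \<eta> y) \<one>)) \<in> carrier G \<rightarrow> carrier RB"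
      proof
        fix k
        have "\<eta> (\<gamma> \<one> k \<odot>\<^bsub>Q 0\<^esub> f 0 (c 0 (\<gamma> \<one> (inv k) \<odot>\<^bsub>Q 0\<^esub> y))) =
          \<gamma> \<one> k \<rhd> incl ((\<gamma> \<one> (inv k) \<rhd> \<eta> y) \<one>)"
          using y by (simp add: \<eta>p(3) f_props c_\<gamma>_closed f_aug c_aug Qm.smult_closed)
        then show "\<gamma> \<one> k \<rhd> incl ((\<gamma> \<one> (inv k) \<rhd> \<eta> y) \<one>) \<in> carrier RB"
          using \<eta>p(1)[OF trm[OF y, of k]] by simp
      qed
    qed
    also have "\<dots> = \<eta> y" by (rule trace_incl_proj[OF RB_mod]) (use \<eta>p(1)[OF y] in simp)
    finally show ?thesis .
  qed
  show thesis
    by (rule chain_maps_homotopic[where u = "\<lambda>i. fc i" and v = "\<lambda>i y. y", OF D Q_complex exact_Q fc_hom id aug chain refl])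
      (assumption, assumption, rule that)
qed

text \<open>
  The decomposition of \<open>\<theta> \<circ> f\<close> in the basis of \<open>E\<close> over \<open>\<Delta>\<close>: its coordinates are the extensions of
  the coefficients at \<open>\<gamma> h 1\<close>.
\<close>

lemma extend_coord:
  assumes \<theta>: "\<theta> \<in> dualQ i" and p: "p \<in> carrier (P i)"
  shows "sumE (\<lambda>h. extend (P i) (\<lambda>x\<in>carrier (P i). coord h (\<theta> (f i x))) p \<cdot> \<gamma> h \<one>) = \<theta> (f i p)"
proof -
  have fp: "f i p \<in> carrier (Q i)" and \<theta>p: "\<theta> (f i p) \<in> carrier E" using p dualD(1)[OF \<theta>] by (simp_all add: f_props)
  let ?F = "\<lambda>g h. \<gamma> g (inv g) \<cdot> (\<kappa> (coord h (\<gamma> (inv g) g \<cdot> \<theta> (f i p))) \<cdot> \<gamma> h \<one>)"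
  have Fc: "?F g h \<in> carrier E" if "h \<in> carrier G" for g h using that \<theta>p by (simp add: coord_props)
  have "sumE (\<lambda>h. extend (P i) (\<lambda>x\<in>carrier (P i). coord h (\<theta> (f i x))) p \<cdot> \<gamma> h \<one>) =
      sumE (\<lambda>h. sumE (\<lambda>g. ?F g h))"
  proof (rule tB.T.finsum_cong'[OF refl])
    fix h assume h: "h \<in> carrier G"
    have v: "(\<lambda>x\<in>carrier (P i). coord h (\<theta> (f i x))) (\<upsilon> (inv g) \<odot>\<^bsub>P i\<^esub> p) =
        coord h (\<gamma> (inv g) g \<cdot> \<theta> (f i p))" if g: "g \<in> carrier G" for g
      using p g fp by (simp add: res_smult_closed[OF P_mod] f_props \<iota>_e dualD(3)[OF \<theta>])
    have "extend (P i) (\<lambda>x\<in>carrier (P i). coord h (\<theta> (f i x))) p =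
        sumE (\<lambda>g. \<gamma> g (inv g) \<cdot> \<kappa> (coord h (\<gamma> (inv g) g \<cdot> \<theta> (f i p))))"
      unfolding extend_def by (rule tB.T.finsum_cong') (use v h \<theta>p coord_props in auto)
    then have "extend (P i) (\<lambda>x\<in>carrier (P i). coord h (\<theta> (f i x))) p \<cdot> \<gamma> h \<one> =
        sumE (\<lambda>g. \<gamma> g (inv g) \<cdot> \<kappa> (coord h (\<gamma> (inv g) g \<cdot> \<theta> (f i p))) \<cdot> \<gamma> h \<one>)"
      using h \<theta>p coord_props by (simp add: E.finsum_ldistr[OF finite_G])
    also have "\<dots> = sumE (\<lambda>g. ?F g h)"
      by (rule tB.T.finsum_cong') (use h \<theta>p coord_props in "auto simp: E.m_assoc")
    finally show "extend (P i) (\<lambda>x\<in>carrier (P i). coord h (\<theta> (f i x))) p \<cdot> \<gamma> h \<one> = sumE (\<lambda>g. ?F g h)" .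
  qed (use Fc in "auto intro!: tB.T.finsum_closed")
  also have "\<dots> = sumE (\<lambda>g. sumE (\<lambda>h. ?F g h))"
    by (rule tB.T.add.finprod_swap[OF finite_G finite_G]) (use Fc in auto)
  also have "\<dots> = \<theta> (f i p)" by (rule E_decomp[OF \<theta>p])
  finally show ?thesis .
qed

lemma coord_dual:
  assumes \<theta>: "\<theta> \<in> dualQ i" and h: "h \<in> carrier G"
  shows "(\<lambda>x\<in>carrier (P i). coord h (\<theta> (f i x))) \<in> dualP i"
proof -
  have "(\<lambda>x\<in>carrier (res (P i)). coord h (\<theta> (f i x))) \<in> dualP i"
    by (rule dualI) (use h dualD(1-3)[OF \<theta>] in
      \<open>simp_all add: f_props coord_props \<iota>_e one_E[symmetric] coord_linear left_module_res[OF P_mod]\<close>)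
  then show ?thesis by simp
qed

text \<open>
  Take for \<open>u h\<close> the coefficient of \<open>\<theta> \<circ> f\<close> at \<open>\<gamma> h 1\<close>. The sum of the \<open>lam (u h) \<cdot> \<gamma> h 1\<close> is then
  \<open>\<theta>\<close> composed with the trace of \<open>f \<circ> c\<close>, which is cohomologous to \<open>\<theta>\<close>.
\<close>

lemma lam_surjective:
  assumes \<theta>: "\<theta> \<in> QZ j"
  shows "\<exists>u. (\<forall>h\<in>carrier G. u h \<in> PZ j) \<and> (\<exists>\<zeta>\<in>dualQ j. \<forall>y\<in>carrier (Q (Suc j)).
    sumE (\<lambda>h. lam (Suc j) (u h) y \<cdot> \<gamma> h \<one>) = \<zeta> (\<delta> j y) \<oplus>\<^bsub>E\<^esub> \<theta> y)"
proof -
  have \<theta>d: "\<theta> \<in> dualQ (Suc j)" and \<theta>0: "\<And>x. x \<in> carrier (Q (Suc (Suc j))) \<Longrightarrow> \<theta> (\<delta> (Suc j) x) = \<zero>\<^bsub>E\<^esub>"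
    using \<theta> by (auto simp: QZ_iff)
  note \<theta>p = dualD[OF \<theta>d]
  let ?u = "\<lambda>h. \<lambda>x\<in>carrier (P (Suc j)). coord h (\<theta> (f (Suc j) x))"
  have ud: "?u h \<in> dualP (Suc j)" if "h \<in> carrier G" for h by (rule coord_dual[OF \<theta>d that])
  have uz: "?u h \<in> PZ j" if "h \<in> carrier G" for h
    using ud[OF that] that by (simp add: PZ_iff d_props f_chain[symmetric] f_props \<theta>0 coord_props)
  obtain s where s: "\<And>i. s i \<in> module_hom E (Q i) (Q (Suc i))"
    "\<And>i y. y \<in> carrier (Q (Suc i)) \<Longrightarrow> fc (Suc i) y = y \<oplus>\<^bsub>Q (Suc i)\<^esub> (\<delta> (Suc i) (s (Suc i) y) \<oplus>\<^bsub>Q (Suc i)\<^esub> s i (\<delta> i y))"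
    by (rule fc_homotopy) blast
  note sp = module_homD(1-3)[OF s(1)]
  have \<zeta>: "(\<lambda>y\<in>carrier (Q j). \<theta> (s j y)) \<in> dualQ j"
    by (rule dualI) (simp_all add: sp \<theta>p Q_mod)
  have "sumE (\<lambda>h. lam (Suc j) (?u h) y \<cdot> \<gamma> h \<one>) = (\<lambda>y\<in>carrier (Q j). \<theta> (s j y)) (\<delta> j y) \<oplus>\<^bsub>E\<^esub> \<theta> y"
    if y: "y \<in> carrier (Q (Suc j))" for y
  proof -
    let ?c = "\<lambda>k. c (Suc j) (\<gamma> \<one> (inv k) \<odot>\<^bsub>Q (Suc j)\<^esub> y)"
    have cc: "?c k \<in> carrier (P (Suc j))" for k using y by (rule c_\<gamma>_closed)
    let ?F = "\<lambda>h k. \<gamma> \<one> k \<cdot> (extend (P (Suc j)) (?u h) (?c k) \<cdot> \<gamma> h \<one>)"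
    have ec: "extend (P (Suc j)) (?u h) (?c k) \<in> carrier E" if "h \<in> carrier G" for h k
      using extend_closed[OF P_mod ud[OF that] cc] .
    have "sumE (\<lambda>h. lam (Suc j) (?u h) y \<cdot> \<gamma> h \<one>) = sumE (\<lambda>h. sumE (?F h))"
    proof (rule tB.T.finsum_cong'[OF refl])
      fix h assume h: "h \<in> carrier G"
      have "lam (Suc j) (?u h) y \<cdot> \<gamma> h \<one> =
          sumE (\<lambda>k. (\<gamma> \<one> k \<cdot> extend (P (Suc j)) (?u h) (?c k)) \<cdot> \<gamma> h \<one>)"
        unfolding lam_apply[OF ud[OF h] y] by (rule E.finsum_ldistr[OF finite_G]) (use ec h in auto)
      also have "\<dots> = sumE (?F h)"
        by (rule tB.T.finsum_cong') (use ec h in "auto simp: E.m_assoc")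
      finally show "lam (Suc j) (?u h) y \<cdot> \<gamma> h \<one> = sumE (?F h)" .
    qed (use ec in "auto intro!: tB.T.finsum_closed")
    also have "\<dots> = sumE (\<lambda>k. sumE (\<lambda>h. ?F h k))"
      by (rule tB.T.add.finprod_swap[OF finite_G finite_G]) (use ec in auto)
    also have "\<dots> = sumE (\<lambda>k. \<theta> (\<gamma> \<one> k \<odot>\<^bsub>Q (Suc j)\<^esub> f (Suc j) (?c k)))"
    proof (rule tB.T.finsum_cong'[OF refl])
      fix k assume k: "k \<in> carrier G"
      have "sumE (\<lambda>h. ?F h k) = \<gamma> \<one> k \<cdot> sumE (\<lambda>h. extend (P (Suc j)) (?u h) (?c k) \<cdot> \<gamma> h \<one>)"
        by (rule E.finsum_rdistr[OF finite_G, symmetric]) (use ec in auto)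
      then show "sumE (\<lambda>h. ?F h k) = \<theta> (\<gamma> \<one> k \<odot>\<^bsub>Q (Suc j)\<^esub> f (Suc j) (?c k))"
        unfolding extend_coord[OF \<theta>d cc] using cc f_props(1) by (simp add: \<theta>p)
    qed (use cc \<theta>p f_props(1) Qm.smult_closed in auto)
    also have "\<dots> = \<theta> (fc (Suc j) y)"
      unfolding trace_def
      by (rule hom_finsum[OF Qm.M.abelian_group_axioms E.is_abelian_group \<theta>p(5), symmetric])
        (use cc f_props(1) Qm.smult_closed in auto)
    also have "\<dots> = (\<lambda>y\<in>carrier (Q j). \<theta> (s j y)) (\<delta> j y) \<oplus>\<^bsub>E\<^esub> \<theta> y"
      unfolding s(2)[OF y] using y by (simp add: \<theta>p(1,2) \<delta>_props(1) sp(1) \<theta>0 tB.T.a_comm)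
    finally show ?thesis .
  qed
  then show ?thesis using uz \<zeta> by (intro exI[of _ ?u] conjI ballI bexI[OF _ \<zeta>])
qed

end

subsection \<open>The map on cohomology\<close>

context skew_comparison
begin

lemma cochain_P: "cochain S (\<lambda>i. res (P i)) d"
proof (rule cochain.intro)
  show "d i \<in> module_hom S (res (P (Suc i))) (res (P i))" for i
    using exact_res by (auto simp: exact_complex_def module_complex_def)
  show "d i (d (Suc i) x) = \<zero>\<^bsub>res (P i)\<^esub>" if "x \<in> carrier (res (P (Suc (Suc i))))" for i x
    using exact_res that by (auto simp: exact_complex_def module_complex_def)
qed (simp_all add: left_module_res[OF P_mod] S.ring_axioms)

lemma cochain_Q: "cochain E Q \<delta>"
proof (rule cochain.intro)
  show "\<delta> i (\<delta> (Suc i) x) = \<zero>\<^bsub>Q i\<^esub>" if "x \<in> carrier (Q (Suc (Suc i)))" for i x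
    using exact_Q that by (auto simp: exact_complex_def module_complex_def)
qed (simp_all add: Q_mod \<delta>_hom E.ring_axioms)

context
  fixes j :: nat
begin

interpretation cP: cochain S "\<lambda>i. res (P i)" d j by (rule cochain_P)
interpretation cQ: cochain E Q \<delta> j by (rule cochain_Q)

abbreviation V where "V \<equiv> ext_module S (\<lambda>i. res (P i)) d (Suc j)"
abbreviation W where "W \<equiv> ext_module E Q \<delta> (Suc j)"

lemma V_mod: "left_module (opposite S) V" by (rule cP.E_module)
lemma W_mod: "left_module (opposite E) W" by (rule cQ.E_module)

interpretation V: left_module "opposite S" V by (rule V_mod)
interpretation W: left_module "opposite E" W by (rule W_mod)

lemma lam_cocycle: assumes "\<theta> \<in> PZ j" shows "lam (Suc j) \<theta> \<in> QZ j"
proof -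
  have t: "\<theta> \<in> dualP (Suc j)" using assms by (simp add: PZ_iff)
  let ?z = "\<lambda>x\<in>carrier (P (Suc (Suc j))). \<theta> (d (Suc j) x)"
  have z: "?z \<in> dualP (Suc (Suc j))" by (rule pull_dual[OF t])
  have zz: "?z \<oplus>\<^bsub>dual_module S (res (P (Suc (Suc j))))\<^esub> ?z = ?z"
    using assms by (auto simp: PZ_iff intro!: restrict_ext)
  have "lam (Suc j) \<theta> (\<delta> (Suc j) y) = \<zero>\<^bsub>E\<^esub>" if y: "y \<in> carrier (Q (Suc (Suc j)))" for y
  proof -
    have "lam (Suc (Suc j)) ?z y = lam (Suc (Suc j)) ?z y \<oplus>\<^bsub>E\<^esub> lam (Suc (Suc j)) ?z y"
      using lam_add[OF z z y] unfolding zz .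
    then have "lam (Suc (Suc j)) ?z y = \<zero>\<^bsub>E\<^esub>" using dualD(1)[OF lam_dual[OF z] y] by simp
    then show ?thesis using lam_d[OF t y] by simp
  qed
  then show ?thesis using lam_dual[OF t] by (simp add: QZ_iff)
qed

text \<open>The map induced by \<open>lam\<close> on cohomology.\<close>

definition jm where
  "jm v = cQ.cl (lam (Suc j) (SOME \<theta>. \<theta> \<in> PZ j \<and> v = cP.cl \<theta>))"

lemma jm_class: assumes t: "\<theta> \<in> PZ j" shows "jm (cP.cl \<theta>) = cQ.cl (lam (Suc j) \<theta>)"
proof -
  let ?t = "SOME \<theta>'. \<theta>' \<in> PZ j \<and> cP.cl \<theta> = cP.cl \<theta>'"
  have t': "?t \<in> PZ j \<and> cP.cl \<theta> = cP.cl ?t" by (rule someI[of _ \<theta>]) (use t in simp)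
  then obtain \<zeta> where z: "\<zeta> \<in> dualP j" "\<And>x. x \<in> carrier (P (Suc j)) \<Longrightarrow> ?t x = \<zeta> (d j x) \<oplus>\<^bsub>S\<^esub> \<theta> x"
    using cP.class_eq_iff[of ?t \<theta>] t by auto
  let ?z = "\<lambda>x\<in>carrier (P (Suc j)). \<zeta> (d j x)"
  have d: "?t \<in> dualP (Suc j)" "\<theta> \<in> dualP (Suc j)" "?z \<in> dualP (Suc j)" using t t' pull_dual[OF z(1)] by (simp_all add: PZ_iff)
  have "?t = ?z \<oplus>\<^bsub>dual_module S (res (P (Suc j)))\<^esub> \<theta>"
    by (rule extensionalityI[OF dualD(4)[OF d(1)]]) (use z in auto)
  then have "lam (Suc j) ?t y = lam j \<zeta> (\<delta> j y) \<oplus>\<^bsub>E\<^esub> lam (Suc j) \<theta> y" if "y \<in> carrier (Q (Suc j))" for y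
    using lam_add[OF d(3,2) that] lam_d[OF z(1) that] by simp
  then have "cQ.cl (lam (Suc j) ?t) = cQ.cl (lam (Suc j) \<theta>)"
    using cQ.class_eq_iff[OF lam_cocycle lam_cocycle, of ?t \<theta>] t t' lam_dual[OF z(1)] by blast
  then show ?thesis by (simp add: jm_def)
qed

lemma V_cases: assumes "v \<in> carrier V" obtains \<theta> where "\<theta> \<in> PZ j" "v = cP.cl \<theta>"
  using assms by (auto simp: cP.E_carrier)

lemma W_cases: assumes "v \<in> carrier W" obtains \<theta> where "\<theta> \<in> QZ j" "v = cQ.cl \<theta>"
  using assms by (auto simp: cQ.E_carrier)

lemma jm_closed: "v \<in> carrier V \<Longrightarrow> jm v \<in> carrier W"
  by (erule V_cases) (simp add: jm_class cQ.E_carrier lam_cocycle)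

lemma PZ_add: "\<theta> \<in> PZ j \<Longrightarrow> \<theta>' \<in> PZ j \<Longrightarrow> \<theta> \<oplus>\<^bsub>dual_module S (res (P (Suc j)))\<^esub> \<theta>' \<in> PZ j"
  using cP.Q.M.a_closed[of \<theta> \<theta>'] by simp

lemma PZ_smult: "\<theta> \<in> PZ j \<Longrightarrow> s \<in> carrier S \<Longrightarrow> s \<odot>\<^bsub>dual_module S (res (P (Suc j)))\<^esub> \<theta> \<in> PZ j"
  using cP.Q.smult_closed[of s \<theta>] by simp

lemma QZ_smult: "\<theta> \<in> QZ j \<Longrightarrow> s \<in> carrier E \<Longrightarrow> s \<odot>\<^bsub>dual_module E (Q (Suc j))\<^esub> \<theta> \<in> QZ j"
  using cQ.Q.smult_closed[of s \<theta>] by simp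

lemma PZ_dual: "\<theta> \<in> PZ j \<Longrightarrow> \<theta> \<in> dualP (Suc j)" by (simp add: PZ_iff)
lemma QZ_dual: "\<theta> \<in> QZ j \<Longrightarrow> \<theta> \<in> dualQ (Suc j)" by (simp add: QZ_iff)

lemma jm_add: assumes "v \<in> carrier V" "v' \<in> carrier V" shows "jm (v \<oplus>\<^bsub>V\<^esub> v') = jm v \<oplus>\<^bsub>W\<^esub> jm v'"
proof -
  obtain \<theta> \<theta>' where t: "\<theta> \<in> PZ j" "v = cP.cl \<theta>" "\<theta>' \<in> PZ j" "v' = cP.cl \<theta>'"
    using assms by (metis V_cases)
  have "lam (Suc j) (\<theta> \<oplus>\<^bsub>dual_module S (res (P (Suc j)))\<^esub> \<theta>') = lam (Suc j) \<theta> \<oplus>\<^bsub>dual_module E (Q (Suc j))\<^esub> lam (Suc j) \<theta>'"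
    by (rule extensionalityI[OF dualD(4)[OF lam_dual[OF PZ_dual[OF PZ_add[OF t(1,3)]]]]])
      (use lam_add[OF PZ_dual[OF t(1)] PZ_dual[OF t(3)]] in simp_all)
  then show ?thesis unfolding t(2,4) cP.E_add[OF t(1,3)] jm_class[OF PZ_add[OF t(1,3)]] jm_class[OF t(1)] jm_class[OF t(3)]
    by (simp only: cQ.E_add[OF lam_cocycle[OF t(1)] lam_cocycle[OF t(3)]])
qed

lemma jm_right:
  assumes t: "\<theta> \<in> PZ j" "\<theta>' \<in> PZ j" and r: "r \<in> carrier E"
    and "\<And>y. y \<in> carrier (Q (Suc j)) \<Longrightarrow> lam (Suc j) \<theta>' y = lam (Suc j) \<theta> y \<cdot> r"
  shows "jm (cP.cl \<theta>') = r \<odot>\<^bsub>W\<^esub> jm (cP.cl \<theta>)"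
proof -
  have "lam (Suc j) \<theta>' = r \<odot>\<^bsub>dual_module E (Q (Suc j))\<^esub> lam (Suc j) \<theta>"
    by (rule extensionalityI[OF dualD(4)[OF lam_dual[OF PZ_dual[OF t(2)]]]]) (use assms(4) in simp_all)
  then show ?thesis
    unfolding jm_class[OF t(1)] jm_class[OF t(2)] by (simp only: cQ.E_smult[OF lam_cocycle[OF t(1)] r])
qed

lemma jm_smult: assumes "v \<in> carrier V" "s \<in> carrier S" shows "jm (s \<odot>\<^bsub>V\<^esub> v) = \<kappa> s \<odot>\<^bsub>W\<^esub> jm v"
proof -
  obtain \<theta> where t: "\<theta> \<in> PZ j" "v = cP.cl \<theta>" using assms by (metis V_cases)
  show ?thesis unfolding t(2) cP.E_smult[OF t(1) assms(2)]
    by (rule jm_right[OF t(1) PZ_smult[OF t(1) assms(2)]])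
      (simp_all only: lam_smult[OF PZ_dual[OF t(1)] assms(2)] \<kappa>_props(1) assms(2))
qed

abbreviation eact where "eact \<equiv> ext_action K A G \<phi> P (Suc j)"

lemma move_inverse:
  assumes t: "\<theta> \<in> dualP i" and l: "l \<in> carrier G"
  shows "move (P i) (move (P i) \<theta> (inv l)) l = \<theta>"
proof (rule extensionalityI[OF restrict_extensional])
  show "\<theta> \<in> extensional (carrier (P i))" using dualD(4)[OF t] by simp
  fix x assume x: "x \<in> carrier (P i)"
  have "\<upsilon> l \<odot>\<^bsub>P i\<^esub> (\<upsilon> (inv l) \<odot>\<^bsub>P i\<^esub> x) = x"
    using x l Pm.smult_one[of x i]
    by (simp add: res_smult_assoc[OF P_mod, symmetric] \<Delta>.e_mult \<Delta>_eq \<Delta>.one_B)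
  then show "move (P i) (move (P i) \<theta> (inv l)) l x = \<theta> x"
    using x l res_smult_closed[OF P_mod] res_dualD(1)[OF P_mod t] by simp
qed

lemma move_pull:
  assumes z: "\<zeta> \<in> dualP j" and l: "l \<in> carrier G"
  shows "move (P (Suc j)) (\<lambda>x\<in>carrier (P (Suc j)). \<zeta> (d j x)) l = (\<lambda>x\<in>carrier (P (Suc j)). move (P j) \<zeta> l (d j x))"
  using res_smult_closed[OF P_mod] l by (auto simp: d_props intro!: restrict_ext)

lemma move_add:
  assumes "\<theta> \<in> dualP i" "\<theta>' \<in> dualP i" "l \<in> carrier G"
  shows "move (P i) (\<theta> \<oplus>\<^bsub>dual_module S (res (P i))\<^esub> \<theta>') l = move (P i) \<theta> l \<oplus>\<^bsub>dual_module S (res (P i))\<^esub> move (P i) \<theta>' l"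
  using assms res_smult_closed[OF P_mod] by (auto simp: res_dualD[OF P_mod] act_props intro!: restrict_ext)

lemma move_PZ: assumes "\<theta> \<in> PZ j" "l \<in> carrier G" shows "move (P (Suc j)) \<theta> l \<in> PZ j"
proof -
  have "move (P (Suc j)) \<theta> l (d (Suc j) x) = \<zero>\<^bsub>S\<^esub>" if x: "x \<in> carrier (P (Suc (Suc j)))" for x
  proof -
    have "\<theta> (\<upsilon> (inv l) \<odot>\<^bsub>P (Suc j)\<^esub> d (Suc j) x) = \<zero>\<^bsub>S\<^esub>"
      using assms x d_props(3)[of "\<upsilon> (inv l)" x "Suc j"] res_smult_closed[OF P_mod, of "\<upsilon> (inv l)" x]
      by (metis PZ_iff S.one_closed \<Delta>.e_closed)
    then show ?thesis using assms(2) d_props(1)[OF x] \<Delta>.\<phi>_props(3)[OF assms(2)] by simp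
  qed
  then show ?thesis using move_dual[OF P_mod PZ_dual[OF assms(1)] assms(2)] unfolding PZ_iff by blast
qed

lemma eact_class:
  assumes t: "\<theta> \<in> PZ j" and l: "l \<in> carrier G"
  shows "eact l (cP.cl \<theta>) = cP.cl (move (P (Suc j)) \<theta> l)"
proof -
  let ?m = "\<lambda>\<theta>. move (P (Suc j)) \<theta> l" and ?B = "coboundaries S (\<lambda>i. res (P i)) d (Suc j)"
  have e: "eact l U = ?m ` U" for U
    by (simp add: ext_action_def module_action_def)
  have BZ: "b \<in> PZ j" if "b \<in> ?B" for b using that cP.Q.a_subset by auto
  have mB: "move (P (Suc j)) b k \<in> ?B" if b: "b \<in> ?B" and k: "k \<in> carrier G" for b k
  proof -
    obtain \<zeta> where z: "\<zeta> \<in> dualP j" "b = (\<lambda>x\<in>carrier (P (Suc j)). \<zeta> (d j x))"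
      using b by (auto simp: cP.B_iff)
    have m: "move (P j) \<zeta> k \<in> dualP j" by (rule move_dual[OF P_mod z(1) k])
    show ?thesis unfolding z(2) move_pull[OF z(1) k] cP.B_iff by (rule bexI[OF _ m]) simp
  qed
  have m_add: "?m (b \<oplus>\<^bsub>dual_module S (res (P (Suc j)))\<^esub> \<theta>) = ?m b \<oplus>\<^bsub>dual_module S (res (P (Suc j)))\<^esub> ?m \<theta>" if "b \<in> ?B" for b
    by (rule move_add[OF PZ_dual[OF BZ[OF that]] PZ_dual[OF t] l])
  show ?thesis unfolding e
  proof (intro equalityI subsetI)
    fix x assume "x \<in> ?m ` cP.cl \<theta>"
    then obtain b where b: "b \<in> ?B" "x = ?m (b \<oplus>\<^bsub>dual_module S (res (P (Suc j)))\<^esub> \<theta>)"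
      unfolding image_iff Bex_def cP.Q.mem_coset by auto
    show "x \<in> cP.cl (?m \<theta>)"
      unfolding cP.Q.mem_coset by (rule bexI[OF _ mB[OF b(1) l]]) (simp only: b(2) m_add[OF b(1)] cP.ZM_simps)
  next
    fix x assume "x \<in> cP.cl (?m \<theta>)"
    then obtain b where b: "b \<in> ?B" "x = b \<oplus>\<^bsub>dual_module S (res (P (Suc j)))\<^esub> ?m \<theta>"
      unfolding cP.Q.mem_coset by auto
    let ?b = "move (P (Suc j)) b (inv l)"
    have b': "?b \<in> ?B" by (rule mB[OF b(1)]) (use l in simp)
    have "x = ?m (?b \<oplus>\<^bsub>dual_module S (res (P (Suc j)))\<^esub> \<theta>)"
      unfolding m_add[OF b'] move_inverse[OF PZ_dual[OF BZ[OF b(1)]] l] by (rule b(2))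
    moreover have "?b \<oplus>\<^bsub>dual_module S (res (P (Suc j)))\<^esub> \<theta> \<in> cP.cl \<theta>"
      unfolding cP.Q.mem_coset by (rule bexI[OF _ b']) (simp only: cP.ZM_simps)
    ultimately show "x \<in> ?m ` cP.cl \<theta>" by (rule image_eqI)
  qed
qed

lemma eact_closed: "v \<in> carrier V \<Longrightarrow> l \<in> carrier G \<Longrightarrow> eact l v \<in> carrier V"
  by (erule V_cases) (simp add: eact_class cP.E_carrier move_PZ)

text \<open>In bimodule terms, \<open>l(v) = l v l\<^sup>-\<^sup>1\<close> in \<open>W\<close>.\<close>

lemma jm_eact: assumes "v \<in> carrier V" "l \<in> carrier G" shows "jm (eact l v) = \<gamma> (inv l) l \<odot>\<^bsub>W\<^esub> jm v"
proof -
  obtain \<theta> where t: "\<theta> \<in> PZ j" "v = cP.cl \<theta>" using assms by (metis V_cases)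
  show ?thesis unfolding t(2) eact_class[OF t(1) assms(2)]
    by (rule jm_right[OF t(1) move_PZ[OF t(1) assms(2)]])
      (simp_all only: lam_move[OF PZ_dual[OF t(1)] assms(2)] w_closed A.one_closed)
qed

lemma class_finsum:
  assumes u: "\<And>h. h \<in> carrier G \<Longrightarrow> u h \<in> PZ j"
  obtains T where "T \<in> QZ j" "finsum W (\<lambda>h. \<gamma> h \<one> \<odot>\<^bsub>W\<^esub> jm (cP.cl (u h))) (carrier G) = cQ.cl T"
    "\<And>y. y \<in> carrier (Q (Suc j)) \<Longrightarrow>
      T y = sumE (\<lambda>h. lam (Suc j) (u h) y \<cdot> \<gamma> h \<one>)"
proof -
  let ?D = "dual_module E (Q (Suc j))"
  let ?x = "\<lambda>h. \<gamma> h \<one> \<odot>\<^bsub>?D\<^esub> lam (Suc j) (u h)"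
  have xz: "?x h \<in> QZ j" if "h \<in> carrier G" for h by (rule QZ_smult[OF lam_cocycle[OF u[OF that]]]) simp
  have clh: "cQ.cl \<in> add_hom cQ.ZM W"
    by (auto simp: hom_def cQ.E_carrier cQ.E_add simp del: dual_simps)
  have "finsum W (\<lambda>h. \<gamma> h \<one> \<odot>\<^bsub>W\<^esub> jm (cP.cl (u h))) (carrier G) = finsum W (\<lambda>h. cQ.cl (?x h)) (carrier G)"
  proof (rule W.M.finsum_cong'[OF refl])
    show "(\<lambda>h. cQ.cl (?x h)) \<in> carrier G \<rightarrow> carrier W" using xz by (auto simp: cQ.E_carrier simp del: dual_simps)
    fix h assume h: "h \<in> carrier G"
    show "\<gamma> h \<one> \<odot>\<^bsub>W\<^esub> jm (cP.cl (u h)) = cQ.cl (?x h)"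
      unfolding jm_class[OF u[OF h]] by (rule cQ.E_smult[OF lam_cocycle[OF u[OF h]]]) simp
  qed
  also have "\<dots> = cQ.cl (finsum cQ.ZM ?x (carrier G))"
    by (rule hom_finsum[OF cQ.Q.M.abelian_group_axioms W.M.abelian_group_axioms clh, symmetric]) (use xz in auto)
  finally have 1: "finsum W (\<lambda>h. \<gamma> h \<one> \<odot>\<^bsub>W\<^esub> jm (cP.cl (u h))) (carrier G) = cQ.cl (finsum cQ.ZM ?x (carrier G))" .
  have 2: "finsum cQ.ZM ?x (carrier G) \<in> QZ j"
    using cQ.Q.M.finsum_closed[of ?x "carrier G"] xz by auto
  have 3: "finsum cQ.ZM ?x (carrier G) y = sumE (\<lambda>h. lam (Suc j) (u h) y \<cdot> \<gamma> h \<one>)"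
    if y: "y \<in> carrier (Q (Suc j))" for y
  proof -
    have ev: "(\<lambda>\<theta>. \<theta> y) \<in> add_hom cQ.ZM E"
      using y by (auto simp: hom_def dualD(1)[OF QZ_dual])
    have "finsum cQ.ZM ?x (carrier G) y = sumE (\<lambda>h. ?x h y)"
      by (rule hom_finsum[OF cQ.Q.M.abelian_group_axioms E.is_abelian_group ev]) (use xz in auto)
    then show ?thesis using y by simp
  qed
  show thesis by (rule that[OF 2 1 3])
qed

lemma jm_injective:
  assumes v: "v \<in> carrier G \<rightarrow> carrier V"
    and 0: "finsum W (\<lambda>h. \<gamma> h \<one> \<odot>\<^bsub>W\<^esub> jm (v h)) (carrier G) = \<zero>\<^bsub>W\<^esub>" and h: "h \<in> carrier G"
  shows "v h = \<zero>\<^bsub>V\<^esub>"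
proof -
  have "\<exists>\<theta>. \<theta> \<in> PZ j \<and> v h = cP.cl \<theta>" if "h \<in> carrier G" for h
    using funcset_mem[OF v that] by (metis V_cases)
  then obtain u where u: "\<And>h. h \<in> carrier G \<Longrightarrow> u h \<in> PZ j" "\<And>h. h \<in> carrier G \<Longrightarrow> v h = cP.cl (u h)"
    using bchoice[of "carrier G" "\<lambda>h \<theta>. \<theta> \<in> PZ j \<and> v h = cP.cl \<theta>"] by blast
  obtain T where T: "T \<in> QZ j" "finsum W (\<lambda>h. \<gamma> h \<one> \<odot>\<^bsub>W\<^esub> jm (cP.cl (u h))) (carrier G) = cQ.cl T"
    "\<And>y. y \<in> carrier (Q (Suc j)) \<Longrightarrow> T y = sumE (\<lambda>h. lam (Suc j) (u h) y \<cdot> \<gamma> h \<one>)"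
    using class_finsum[of u] u(1) by blast
  have "finsum W (\<lambda>h. \<gamma> h \<one> \<odot>\<^bsub>W\<^esub> jm (v h)) (carrier G) = cQ.cl T"
    unfolding T(2)[symmetric]
    by (rule W.M.finsum_cong') (use u jm_closed v W.smult_closed in "auto simp: Pi_iff")
  then have "cQ.cl T = cQ.cl \<zero>\<^bsub>dual_module E (Q (Suc j))\<^esub>" using 0 by (simp only: cQ.zero_class)
  then obtain \<zeta> where z: "\<zeta> \<in> dualQ j" "\<And>y. y \<in> carrier (Q (Suc j)) \<Longrightarrow> T y = \<zeta> (\<delta> j y) \<oplus>\<^bsub>E\<^esub> \<zero>\<^bsub>dual_module E (Q (Suc j))\<^esub> y"
    using cQ.class_eq_iff[OF T(1), of "\<zero>\<^bsub>dual_module E (Q (Suc j))\<^esub>"] cQ.Q.M.zero_closed by auto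
  have "sumE (\<lambda>h. lam (Suc j) (u h) y \<cdot> \<gamma> h \<one>) = \<zeta> (\<delta> j y)" if y: "y \<in> carrier (Q (Suc j))" for y
    using T(3)[OF y] z(2)[OF y] y dualD(1)[OF z(1) \<delta>_props(1)[OF y]] by simp
  from lam_injective[OF u(1) z(1) this h]
  obtain \<xi> where x: "\<xi> \<in> dualP j" "\<And>p. p \<in> carrier (P (Suc j)) \<Longrightarrow> u h p = \<xi> (d j p)" by blast
  have "cP.cl (u h) = cP.cl \<zero>\<^bsub>dual_module S (res (P (Suc j)))\<^esub>"
  proof (rule iffD2[OF cP.class_eq_iff[OF u(1)[OF h]]], goal_cases)
    case 1 then show ?case using cP.Q.M.zero_closed by simp
  next
    case 2 show ?case
      by (rule bexI[OF _ x(1)]) (use x(2) res_dualD(1)[OF P_mod x(1)] d_props(1) in auto)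
  qed
  then show ?thesis using u(2)[OF h] by (simp only: cP.zero_class)
qed

lemma jm_surjective:
  assumes "x \<in> carrier W"
  shows "\<exists>v\<in>carrier G \<rightarrow> carrier V. finsum W (\<lambda>h. \<gamma> h \<one> \<odot>\<^bsub>W\<^esub> jm (v h)) (carrier G) = x"
proof -
  obtain \<theta> where t: "\<theta> \<in> QZ j" "x = cQ.cl \<theta>" using assms by (metis W_cases)
  from lam_surjective[OF t(1)] obtain u \<zeta> where u: "\<And>h. h \<in> carrier G \<Longrightarrow> u h \<in> PZ j" and z: "\<zeta> \<in> dualQ j"
    "\<And>y. y \<in> carrier (Q (Suc j)) \<Longrightarrow>
      sumE (\<lambda>h. lam (Suc j) (u h) y \<cdot> \<gamma> h \<one>) = \<zeta> (\<delta> j y) \<oplus>\<^bsub>E\<^esub> \<theta> y" by blast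
  obtain T where T: "T \<in> QZ j" "finsum W (\<lambda>h. \<gamma> h \<one> \<odot>\<^bsub>W\<^esub> jm (cP.cl (u h))) (carrier G) = cQ.cl T"
    "\<And>y. y \<in> carrier (Q (Suc j)) \<Longrightarrow> T y = sumE (\<lambda>h. lam (Suc j) (u h) y \<cdot> \<gamma> h \<one>)"
    using class_finsum[of u] u by blast
  have "cQ.cl T = cQ.cl \<theta>" using cQ.class_eq_iff[OF T(1) t(1)] z T(3) by auto
  then show ?thesis using T(2) t(2) u by (intro bexI[of _ "\<lambda>h. cP.cl (u h)"]) (auto simp: cP.E_carrier)
qed

end

end

section \<open>Tensor powers of a bimodule\<close>

locale bimodule_over = A: ring A + V: abelian_group V
  for A :: "('k, 'a) module" and V :: "('a, 'v) bimodule" +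
  assumes l_closed [simp]: "\<lbrakk>a \<in> carrier A; v \<in> carrier V\<rbrakk> \<Longrightarrow> left_act V a v \<in> carrier V"
    and r_closed [simp]: "\<lbrakk>v \<in> carrier V; a \<in> carrier A\<rbrakk> \<Longrightarrow> right_act V v a \<in> carrier V"
    and l_add1: "\<lbrakk>a \<in> carrier A; b \<in> carrier A; v \<in> carrier V\<rbrakk> \<Longrightarrow>
      left_act V (a \<oplus>\<^bsub>A\<^esub> b) v = left_act V a v \<oplus>\<^bsub>V\<^esub> left_act V b v"
    and l_add2: "\<lbrakk>a \<in> carrier A; v \<in> carrier V; w \<in> carrier V\<rbrakk> \<Longrightarrow>
      left_act V a (v \<oplus>\<^bsub>V\<^esub> w) = left_act V a v \<oplus>\<^bsub>V\<^esub> left_act V a w"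
    and r_add1: "\<lbrakk>v \<in> carrier V; w \<in> carrier V; a \<in> carrier A\<rbrakk> \<Longrightarrow>
      right_act V (v \<oplus>\<^bsub>V\<^esub> w) a = right_act V v a \<oplus>\<^bsub>V\<^esub> right_act V w a"
    and r_add2: "\<lbrakk>v \<in> carrier V; a \<in> carrier A; b \<in> carrier A\<rbrakk> \<Longrightarrow>
      right_act V v (a \<oplus>\<^bsub>A\<^esub> b) = right_act V v a \<oplus>\<^bsub>V\<^esub> right_act V v b"
    and l_mult: "\<lbrakk>a \<in> carrier A; b \<in> carrier A; v \<in> carrier V\<rbrakk> \<Longrightarrow>
      left_act V (a \<otimes>\<^bsub>A\<^esub> b) v = left_act V a (left_act V b v)"
    and r_mult: "\<lbrakk>v \<in> carrier V; a \<in> carrier A; b \<in> carrier A\<rbrakk> \<Longrightarrow>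
      right_act V v (a \<otimes>\<^bsub>A\<^esub> b) = right_act V (right_act V v a) b"
    and l_r: "\<lbrakk>a \<in> carrier A; v \<in> carrier V; b \<in> carrier A\<rbrakk> \<Longrightarrow>
      left_act V a (right_act V v b) = right_act V (left_act V a v) b"
    and l_one: "v \<in> carrier V \<Longrightarrow> left_act V \<one>\<^bsub>A\<^esub> v = v"
    and r_one: "v \<in> carrier V \<Longrightarrow> right_act V v \<one>\<^bsub>A\<^esub> = v"
begin

abbreviation pow where "pow k \<equiv> tensor_power A V k"
abbreviation lft where "lft k \<equiv> power_left A V (Suc k)"
abbreviation rgt where "rgt k \<equiv> power_right A V (Suc k)"
abbreviation cat where "cat \<equiv> power_concat A V"
definition word where "word k = pres_gen (words V k) (power_relators A V k)"

text \<open>Multilinear and balanced maps on words, the maps that factor through the tensor power.\<close>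

definition multilinear where
  "multilinear k H F \<longleftrightarrow> F \<in> words V k \<rightarrow> carrier H \<and>
    (\<forall>us v w ws. us \<in> lists (carrier V) \<and> ws \<in> lists (carrier V) \<and> v \<in> carrier V \<and> w \<in> carrier V \<and>
       length us + 1 + length ws = k \<longrightarrow>
       F (us @ [v \<oplus>\<^bsub>V\<^esub> w] @ ws) = F (us @ [v] @ ws) \<otimes>\<^bsub>H\<^esub> F (us @ [w] @ ws)) \<and>
    (\<forall>us v a w ws. us \<in> lists (carrier V) \<and> ws \<in> lists (carrier V) \<and> v \<in> carrier V \<and> w \<in> carrier V \<and>
       a \<in> carrier A \<and> length us + 2 + length ws = k \<longrightarrow>
       F (us @ [right_act V v a, w] @ ws) = F (us @ [v, left_act V a w] @ ws))"

lemma words_iff: "vs \<in> words V k \<longleftrightarrow> set vs \<subseteq> carrier V \<and> length vs = k"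
  by (auto simp: words_def)

lemma presentation_power: "presentation (words V k) (power_relators A V k)"
proof
  have "keys r \<subseteq> words V k" if "r \<in> power_relators A V k" for r
    using that unfolding power_relators_def
    by (elim UnE CollectE exE conjE) (simp_all add: keys_diff_subset words_iff lists_eq_set)
  then show "power_relators A V k \<subseteq> carrier (free_Abelian_group (words V k))" by auto
qed

sublocale P: presentation "words V k" "power_relators A V k" for k by (rule presentation_power)

lemma comm_group_pow: "comm_group (pow k)" unfolding tensor_power_def by (rule P.comm_group_pres)

sublocale T: comm_group "pow k" for k by (rule comm_group_pow)

lemma word_closed [simp]: "vs \<in> words V k \<Longrightarrow> word k vs \<in> carrier (pow k)"
  by (simp add: word_def tensor_power_def P.gen_closed)

lemma multilinear_relator:
  assumes H: "comm_group H" and F: "multilinear k H F" and r: "r \<in> power_relators A V k"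
  shows "free_eval H F r = \<one>\<^bsub>H\<^esub>"
proof -
  interpret H: comm_group H by fact
  have c: "F vs \<in> carrier H" if "vs \<in> words V k" for vs using F that by (auto simp: multilinear_def)
  from r consider us v w ws where "us \<in> lists (carrier V)" "ws \<in> lists (carrier V)" "v \<in> carrier V" "w \<in> carrier V"
      "length us + 1 + length ws = k"
      "r = frag_of (us @ [v \<oplus>\<^bsub>V\<^esub> w] @ ws) - frag_of (us @ [v] @ ws) - frag_of (us @ [w] @ ws)"
    | us v a w ws where "us \<in> lists (carrier V)" "ws \<in> lists (carrier V)" "v \<in> carrier V" "w \<in> carrier V"
      "a \<in> carrier A" "length us + 2 + length ws = k"
      "r = frag_of (us @ [right_act V v a, w] @ ws) - frag_of (us @ [v, left_act V a w] @ ws)"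
    unfolding power_relators_def by (elim UnE CollectE exE conjE) metis+
  then show ?thesis
  proof cases
    case 1
    have "F (us @ [v \<oplus>\<^bsub>V\<^esub> w] @ ws) = F (us @ [v] @ ws) \<otimes>\<^bsub>H\<^esub> F (us @ [w] @ ws)"
      using F 1(1-5) unfolding multilinear_def by blast
    moreover have "F (us @ [v] @ ws) \<in> carrier H" "F (us @ [w] @ ws) \<in> carrier H"
      using 1(1-5) by (auto intro!: c simp: words_iff)
    ultimately show ?thesis unfolding 1(6) by (intro H.free_eval_relator3)
  next
    case 2
    have "F (us @ [right_act V v a, w] @ ws) = F (us @ [v, left_act V a w] @ ws)"
      using F 2(1-6) unfolding multilinear_def by blast
    moreover have "F (us @ [v, left_act V a w] @ ws) \<in> carrier H"
      using 2(1-6) by (auto intro!: c simp: words_iff)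
    ultimately show ?thesis unfolding 2(7) by (intro H.free_eval_relator2) simp_all
  qed
qed

lemma multilinearI:
  assumes "\<And>vs. vs \<in> words V k \<Longrightarrow> F vs \<in> carrier H"
    and "\<And>us v w ws. \<lbrakk>set us \<subseteq> carrier V; set ws \<subseteq> carrier V; v \<in> carrier V; w \<in> carrier V;
       k = Suc (length us + length ws)\<rbrakk> \<Longrightarrow>
       F (us @ (v \<oplus>\<^bsub>V\<^esub> w) # ws) = F (us @ v # ws) \<otimes>\<^bsub>H\<^esub> F (us @ w # ws)"
    and "\<And>us v a w ws. \<lbrakk>set us \<subseteq> carrier V; set ws \<subseteq> carrier V; v \<in> carrier V; w \<in> carrier V;
       a \<in> carrier A; k = Suc (Suc (length us + length ws))\<rbrakk> \<Longrightarrow>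
       F (us @ right_act V v a # w # ws) = F (us @ v # left_act V a w # ws)"
  shows "multilinear k H F"
  unfolding multilinear_def using assms by (auto simp: lists_eq_set)

lemma word_add:
  "\<lbrakk>set us \<subseteq> carrier V; set ws \<subseteq> carrier V; v \<in> carrier V; w \<in> carrier V; k = Suc (length us + length ws)\<rbrakk> \<Longrightarrow>
    word k (us @ (v \<oplus>\<^bsub>V\<^esub> w) # ws) = word k (us @ v # ws) \<otimes>\<^bsub>pow k\<^esub> word k (us @ w # ws)"
  unfolding word_def tensor_power_def
proof (rule P.gen_relator3)
  assume "set us \<subseteq> carrier V" "set ws \<subseteq> carrier V" "v \<in> carrier V" "w \<in> carrier V" "k = Suc (length us + length ws)"
  then have "us \<in> lists (carrier V) \<and> ws \<in> lists (carrier V) \<and> v \<in> carrier V \<and> w \<in> carrier V \<and>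
      length us + 1 + length ws = k" by (simp add: lists_eq_set)
  then have "frag_of (us @ [v \<oplus>\<^bsub>V\<^esub> w] @ ws) - frag_of (us @ [v] @ ws) - frag_of (us @ [w] @ ws) \<in> power_relators A V k"
    unfolding power_relators_def by (intro UnI1 CollectI exI) (rule conjI[OF refl])
  then show "frag_of (us @ (v \<oplus>\<^bsub>V\<^esub> w) # ws) - frag_of (us @ v # ws) - frag_of (us @ w # ws) \<in> power_relators A V k"
    by simp
qed (simp_all add: words_iff)

lemma word_balanced:
  "\<lbrakk>set us \<subseteq> carrier V; set ws \<subseteq> carrier V; v \<in> carrier V; w \<in> carrier V; a \<in> carrier A;
    k = Suc (Suc (length us + length ws))\<rbrakk> \<Longrightarrow>
    word k (us @ right_act V v a # w # ws) = word k (us @ v # left_act V a w # ws)"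
  unfolding word_def
proof (rule P.gen_relator2)
  assume "set us \<subseteq> carrier V" "set ws \<subseteq> carrier V" "v \<in> carrier V" "w \<in> carrier V" "a \<in> carrier A"
    "k = Suc (Suc (length us + length ws))"
  then have "us \<in> lists (carrier V) \<and> ws \<in> lists (carrier V) \<and> v \<in> carrier V \<and> w \<in> carrier V \<and>
      a \<in> carrier A \<and> length us + 2 + length ws = k" by (simp add: lists_eq_set)
  then have "frag_of (us @ [right_act V v a, w] @ ws) - frag_of (us @ [v, left_act V a w] @ ws) \<in> power_relators A V k"
    unfolding power_relators_def by (intro UnI2 CollectI exI) (rule conjI[OF refl])
  then show "frag_of (us @ right_act V v a # w # ws) - frag_of (us @ v # left_act V a w # ws) \<in> power_relators A V k"
    by simp
qed (simp_all add: words_iff)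

lemmas word_add0 = word_add[of "[]", simplified]

lemma word_hom_eq:
  assumes "group H" "a \<in> hom (pow k) H" "b \<in> hom (pow k) H"
    and "\<And>vs. \<lbrakk>set vs \<subseteq> carrier V; length vs = k\<rbrakk> \<Longrightarrow> a (word k vs) = b (word k vs)" and "x \<in> carrier (pow k)"
  shows "a x = b x"
  by (rule P.hom_eq_on_gens[OF assms(1), of a k b])
    (use assms in "auto simp: tensor_power_def word_def words_iff")

lemma power_lift:
  assumes H: "comm_group H" and F: "multilinear k H F"
  shows power_lift_hom: "pres_lift H F \<in> hom (pow k) H"
    and power_lift_word: "vs \<in> words V k \<Longrightarrow> pres_lift H F (word k vs) = F vs"
proof -
  have f: "F \<in> words V k \<rightarrow> carrier H" using F by (simp add: multilinear_def)
  note l = P.pres_lift[OF H f multilinear_relator[OF H F]]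
  show "pres_lift H F \<in> hom (pow k) H" using l(2) by (simp add: tensor_power_def)
  show "pres_lift H F (word k vs) = F vs" if "vs \<in> words V k" using l(3)[OF _ that] by (simp add: word_def)
qed

lemma power_map:
  assumes f: "\<And>vs. vs \<in> words V k \<Longrightarrow> f vs \<in> words V k"
    and F: "multilinear k (pow k) (\<lambda>vs. word k (f vs))"
  shows power_map_hom: "power_map A V k f \<in> hom (pow k) (pow k)"
    and power_map_word: "vs \<in> words V k \<Longrightarrow> power_map A V k f (word k vs) = word k (f vs)"
proof -
  interpret m: presentation_map "words V k" "power_relators A V k" "words V k" "power_relators A V k" f
  proof (unfold_locales, goal_cases)
    case (2 r)
    then show ?case using multilinear_relator[OF comm_group_pow F] by (simp add: tensor_power_def word_def)
  qed (rule f)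
  show "power_map A V k f \<in> hom (pow k) (pow k)"
    using m.pres_map_hom by (simp add: tensor_power_def power_map_def)
  show "power_map A V k f (word k vs) = word k (f vs)" if "vs \<in> words V k"
    using m.pres_map_gen[OF that] by (simp add: word_def power_map_def)
qed

subsection \<open>The actions and the multiplication\<close>

lemma words_Cons: "vs \<in> words V (Suc k) \<longleftrightarrow> (\<exists>v us. vs = v # us \<and> v \<in> carrier V \<and> us \<in> words V k)"
  by (cases vs) (auto simp: words_iff)

lemma words_snoc: "vs \<in> words V (Suc k) \<longleftrightarrow> (\<exists>us v. vs = us @ [v] \<and> v \<in> carrier V \<and> us \<in> words V k)"
  by (cases vs rule: rev_cases) (auto simp: words_iff)

context
  fixes a assumes a: "a \<in> carrier A"
begin

lemma left_map:
  shows power_left_hom: "lft k a \<in> hom (pow (Suc k)) (pow (Suc k))"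
    and power_left_word': "vs \<in> words V (Suc k) \<Longrightarrow>
      lft k a (word (Suc k) vs) = word (Suc k) (left_act V a (hd vs) # tl vs)"
proof -
  let ?f = "\<lambda>vs. left_act V a (hd vs) # tl vs"
  have f: "?f vs \<in> words V (Suc k)" if "vs \<in> words V (Suc k)" for vs
    using that a by (auto simp: words_Cons)
  have F: "multilinear (Suc k) (pow (Suc k)) (\<lambda>vs. word (Suc k) (?f vs))"
  proof (rule multilinearI, goal_cases)
    case (2 us v w ws)
    then show ?case using a word_add0[of ws "left_act V a v" "left_act V a w" "Suc k"]
        word_add[of "left_act V a (hd us) # tl us" ws v w "Suc k"]
      by (cases us) (auto simp: l_add2)
  next
    case (3 us v b w ws)
    then show ?case using a word_balanced[of "[]" ws "left_act V a v" w b "Suc k"]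
        word_balanced[of "left_act V a (hd us) # tl us" ws v w b "Suc k"]
      by (cases us) (auto simp: l_r)
  qed (simp add: f)
  show "lft k a \<in> hom (pow (Suc k)) (pow (Suc k))"
    unfolding power_left_def by (rule power_map_hom[OF f F])
  show "lft k a (word (Suc k) vs) = word (Suc k) (left_act V a (hd vs) # tl vs)"
    if "vs \<in> words V (Suc k)"
    unfolding power_left_def by (rule power_map_word[OF f F that])
qed

lemma right_map:
  shows power_right_hom: "rgt k a \<in> hom (pow (Suc k)) (pow (Suc k))"
    and power_right_word': "vs \<in> words V (Suc k) \<Longrightarrow>
      rgt k a (word (Suc k) vs) = word (Suc k) (butlast vs @ [right_act V (last vs) a])"
proof -
  let ?f = "\<lambda>vs. butlast vs @ [right_act V (last vs) a]"
  have f: "?f vs \<in> words V (Suc k)" if "vs \<in> words V (Suc k)" for vs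
    using that a by (auto simp: words_snoc)
  have F: "multilinear (Suc k) (pow (Suc k)) (\<lambda>vs. word (Suc k) (?f vs))"
  proof (rule multilinearI, goal_cases)
    case (2 us v w ws)
    show ?case
    proof (cases ws rule: rev_cases)
      case Nil
      then show ?thesis using a 2 word_add[of us "[]" "right_act V v a" "right_act V w a" "Suc k"]
        by (simp add: r_add1)
    next
      case (snoc ws' z)
      then show ?thesis using a 2 word_add[of us "ws' @ [right_act V z a]" v w "Suc k"]
        by (simp add: butlast_append)
    qed
  next
    case (3 us v b w ws)
    show ?case
    proof (cases ws rule: rev_cases)
      case Nil
      then show ?thesis using a 3 word_balanced[of us "[]" v "right_act V w a" b "Suc k"]
        by (simp add: butlast_append l_r)
    next
      case (snoc ws' z)
      then show ?thesis using a 3 word_balanced[of us "ws' @ [right_act V z a]" v w b "Suc k"]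
        by (simp add: butlast_append)
    qed
  qed (simp add: f)
  show "rgt k a \<in> hom (pow (Suc k)) (pow (Suc k))"
    unfolding power_right_def by (rule power_map_hom[OF f F])
  show "rgt k a (word (Suc k) vs) = word (Suc k) (butlast vs @ [right_act V (last vs) a])"
    if "vs \<in> words V (Suc k)"
    unfolding power_right_def by (rule power_map_word[OF f F that])
qed

end

lemma power_left_word:
  "\<lbrakk>a \<in> carrier A; v \<in> carrier V; set vs \<subseteq> carrier V; k = length vs\<rbrakk> \<Longrightarrow>
    lft k a (word (Suc k) (v # vs)) = word (Suc k) (left_act V a v # vs)"
  using power_left_word'[of a "v # vs" k] by (simp add: words_iff)

lemma power_right_word:
  "\<lbrakk>a \<in> carrier A; v \<in> carrier V; set vs \<subseteq> carrier V; k = length vs\<rbrakk> \<Longrightarrow>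
    rgt k a (word (Suc k) (vs @ [v])) = word (Suc k) (vs @ [right_act V v a])"
  using power_right_word'[of a "vs @ [v]" k] by (simp add: words_iff)

lemma concat_map2: "presentation_map2 (words V i) (power_relators A V i) (words V j) (power_relators A V j)
    (words V (i + j)) (power_relators A V (i + j)) (@)"
proof (unfold_locales, goal_cases)
  case (1 u v) then show ?case by (auto simp: words_iff)
next
  case (2 r u)
  have "multilinear i (pow (i + j)) (\<lambda>vs. word (i + j) (vs @ u))"
  proof (rule multilinearI, goal_cases)
    case (2 us v w ws)
    then show ?case using word_add[of us "ws @ u" v w "i + j"] \<open>u \<in> words V j\<close> by (simp add: words_iff)
  next
    case (3 us v a w ws)
    then show ?case using word_balanced[of us "ws @ u" v w a "i + j"] \<open>u \<in> words V j\<close> by (simp add: words_iff)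
  qed (use 2(2) in "auto simp: words_iff")
  then show ?case using multilinear_relator[OF comm_group_pow _ 2(1)] by (simp add: tensor_power_def word_def)
next
  case (3 r u)
  have "multilinear j (pow (i + j)) (\<lambda>vs. word (i + j) (u @ vs))"
  proof (rule multilinearI, goal_cases)
    case (2 us v w ws)
    then show ?case using word_add[of "u @ us" ws v w "i + j"] \<open>u \<in> words V i\<close> by (simp add: words_iff)
  next
    case (3 us v a w ws)
    then show ?case using word_balanced[of "u @ us" ws v w a "i + j"] \<open>u \<in> words V i\<close> by (simp add: words_iff)
  qed (use 3(2) in "auto simp: words_iff")
  then show ?case using multilinear_relator[OF comm_group_pow _ 3(1)] by (simp add: tensor_power_def word_def)
qed

lemma
  shows concat_hom1: "y \<in> carrier (pow j) \<Longrightarrow> (\<lambda>x. cat (i + j) x y) \<in> hom (pow i) (pow (i + j))"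
    and concat_hom2: "x \<in> carrier (pow i) \<Longrightarrow> cat (i + j) x \<in> hom (pow j) (pow (i + j))"
    and concat_word: "\<lbrakk>us \<in> words V i; vs \<in> words V j\<rbrakk> \<Longrightarrow>
      cat (i + j) (word i us) (word j vs) = word (i + j) (us @ vs)"
proof -
  interpret c: presentation_map2 "words V i" "power_relators A V i" "words V j" "power_relators A V j"
    "words V (i + j)" "power_relators A V (i + j)" "(@)" by (rule concat_map2)
  show "y \<in> carrier (pow j) \<Longrightarrow> (\<lambda>x. cat (i + j) x y) \<in> hom (pow i) (pow (i + j))"
    using c.pres_map2_hom1 by (simp add: power_concat_def tensor_power_def)
  show "x \<in> carrier (pow i) \<Longrightarrow> cat (i + j) x \<in> hom (pow j) (pow (i + j))"
    using c.pres_map2_hom2 by (simp add: power_concat_def tensor_power_def)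
  show "\<lbrakk>us \<in> words V i; vs \<in> words V j\<rbrakk> \<Longrightarrow>
      cat (i + j) (word i us) (word j vs) = word (i + j) (us @ vs)"
    using c.pres_map2_gen by (simp add: power_concat_def word_def)
qed

lemma concat_closed:
  "\<lbrakk>x \<in> carrier (pow i); y \<in> carrier (pow j)\<rbrakk> \<Longrightarrow> cat (i + j) x y \<in> carrier (pow (i + j))"
  using hom_in_carrier[OF concat_hom2] .

lemma left_closed: "\<lbrakk>a \<in> carrier A; x \<in> carrier (pow (Suc k))\<rbrakk> \<Longrightarrow> lft k a x \<in> carrier (pow (Suc k))"
  using hom_in_carrier[OF power_left_hom] .

lemma right_closed: "\<lbrakk>a \<in> carrier A; x \<in> carrier (pow (Suc k))\<rbrakk> \<Longrightarrow> rgt k a x \<in> carrier (pow (Suc k))"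
  using hom_in_carrier[OF power_right_hom] .

lemma hom_mult_maps:
  assumes "comm_group H" "f \<in> hom M H" "g \<in> hom M H"
  shows "(\<lambda>x. f x \<otimes>\<^bsub>H\<^esub> g x) \<in> hom M H"
proof -
  interpret comm_group H by fact
  show ?thesis using assms(2,3) by (auto simp: hom_def Pi_iff m_ac)
qed

lemma hom_comp: "f \<in> hom M N \<Longrightarrow> g \<in> hom N L \<Longrightarrow> (\<lambda>x. g (f x)) \<in> hom M L"
  by (auto simp: hom_def Pi_iff)

lemma nonempty_snoc: "length vs = Suc k \<Longrightarrow> \<exists>us v. vs = us @ [v] \<and> length us = k"
  by (cases vs rule: rev_cases) auto

lemma nonempty_Cons: "length vs = Suc k \<Longrightarrow> \<exists>us v. vs = v # us \<and> length us = k"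
  by (cases vs) auto

lemma power_left_add:
  assumes "a \<in> carrier A" "b \<in> carrier A" "x \<in> carrier (pow (Suc k))"
  shows "lft k (a \<oplus>\<^bsub>A\<^esub> b) x = lft k a x \<otimes>\<^bsub>pow (Suc k)\<^esub> lft k b x"
  by (rule word_hom_eq[OF T.is_group power_left_hom hom_mult_maps[OF comm_group_pow power_left_hom power_left_hom]])
    (use assms in "auto dest!: nonempty_Cons simp: power_left_word l_add1 word_add0")

lemma power_right_add:
  assumes "a \<in> carrier A" "b \<in> carrier A" "x \<in> carrier (pow (Suc k))"
  shows "rgt k (a \<oplus>\<^bsub>A\<^esub> b) x = rgt k a x \<otimes>\<^bsub>pow (Suc k)\<^esub> rgt k b x"
  by (rule word_hom_eq[OF T.is_group power_right_hom hom_mult_maps[OF comm_group_pow power_right_hom power_right_hom]])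
    (use assms in "auto dest!: nonempty_snoc simp: power_right_word r_add2 word_add")

lemma power_left_mult:
  assumes "a \<in> carrier A" "b \<in> carrier A" "x \<in> carrier (pow (Suc k))"
  shows "lft k (a \<otimes>\<^bsub>A\<^esub> b) x = lft k a (lft k b x)"
  by (rule word_hom_eq[OF T.is_group power_left_hom hom_comp[OF power_left_hom power_left_hom]])
    (use assms in "auto dest!: nonempty_Cons simp: power_left_word l_mult")

lemma power_right_mult:
  assumes "a \<in> carrier A" "b \<in> carrier A" "x \<in> carrier (pow (Suc k))"
  shows "rgt k (a \<otimes>\<^bsub>A\<^esub> b) x = rgt k b (rgt k a x)"
  by (rule word_hom_eq[OF T.is_group power_right_hom hom_comp[OF power_right_hom power_right_hom]])
    (use assms in "auto dest!: nonempty_snoc simp: power_right_word r_mult")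

lemma power_left_right:
  assumes "a \<in> carrier A" "b \<in> carrier A" "x \<in> carrier (pow (Suc k))"
  shows "lft k a (rgt k b x) = rgt k b (lft k a x)"
proof (rule word_hom_eq[OF T.is_group hom_comp[OF power_right_hom power_left_hom] hom_comp[OF power_left_hom power_right_hom]])
  fix vs assume vs: "set vs \<subseteq> carrier V" "length vs = Suc k"
  then obtain us v where v: "vs = us @ [v]" "length us = k" using nonempty_snoc by blast
  show "lft k a (rgt k b (word (Suc k) vs)) =
      rgt k b (lft k a (word (Suc k) vs))"
  proof (cases us)
    case Nil
    then show ?thesis using vs v assms power_right_word[of b _ "[]" k] by (simp add: power_left_word l_r)
  next
    case (Cons u us')
    then show ?thesis using vs v assms power_right_word[of b v us k] power_left_word[of a u "us' @ [v]" k]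
        power_left_word[of a u "us' @ [right_act V v b]" k] power_right_word[of b v "left_act V a u # us'" k] by simp
  qed
qed (use assms in auto)

text \<open>Concatenation is balanced over the algebra because words are.\<close>

lemma concat_right_left:
  assumes "a \<in> carrier A" "x \<in> carrier (pow (Suc i))" "y \<in> carrier (pow (Suc j))"
  shows "cat (Suc i + Suc j) (power_right A V (Suc i) a x) y =
    cat (Suc i + Suc j) x (power_left A V (Suc j) a y)"
proof (rule word_hom_eq[OF T.is_group hom_comp[OF power_right_hom concat_hom1] concat_hom1])
  fix vs assume vs: "set vs \<subseteq> carrier V" "length vs = Suc i"
  show "cat (Suc i + Suc j) (power_right A V (Suc i) a (word (Suc i) vs)) y =
    cat (Suc i + Suc j) (word (Suc i) vs) (power_left A V (Suc j) a y)"
  proof (rule word_hom_eq[OF T.is_group concat_hom2 hom_comp[OF power_left_hom concat_hom2]])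
    fix us assume us: "set us \<subseteq> carrier V" "length us = Suc j"
    obtain v vs' where v: "vs = vs' @ [v]" "length vs' = i" using vs nonempty_snoc by blast
    obtain u us' where u: "us = u # us'" "length us' = j" using us nonempty_Cons by blast
    show "cat (Suc i + Suc j) (power_right A V (Suc i) a (word (Suc i) vs)) (word (Suc j) us) =
        cat (Suc i + Suc j) (word (Suc i) vs) (power_left A V (Suc j) a (word (Suc j) us))"
      using vs us assms(1) unfolding v(1) u(1)
      by (simp only: power_right_word power_left_word v(2) u(2) set_append list.set Un_subset_iff insert_subset)
        (subst (1 2) concat_word, auto simp: words_iff v(2) u(2) word_balanced)
  qed (use assms vs left_closed right_closed words_iff in auto)
qed (use assms left_closed in auto)

lemma concat_left:
  assumes "a \<in> carrier A" "x \<in> carrier (pow (Suc i))" "y \<in> carrier (pow (Suc j))"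
  shows "cat (Suc i + Suc j) (power_left A V (Suc i) a x) y =
    power_left A V (Suc i + Suc j) a (cat (Suc i + Suc j) x y)"
proof (rule word_hom_eq[OF T.is_group hom_comp[OF power_left_hom concat_hom1] hom_comp[OF concat_hom1 power_left_hom[where k = "i + Suc j", folded add_Suc]]])
  fix vs assume vs: "set vs \<subseteq> carrier V" "length vs = Suc i"
  show "cat (Suc i + Suc j) (power_left A V (Suc i) a (word (Suc i) vs)) y =
    power_left A V (Suc i + Suc j) a (cat (Suc i + Suc j) (word (Suc i) vs) y)"
  proof (rule word_hom_eq[OF T.is_group concat_hom2 hom_comp[OF concat_hom2 power_left_hom[where k = "i + Suc j", folded add_Suc]]])
    fix us assume us: "set us \<subseteq> carrier V" "length us = Suc j"
    obtain v vs' where v: "vs = v # vs'" "length vs' = i" using vs nonempty_Cons by blast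
    have "cat (Suc i + Suc j) (word (Suc i) vs) (word (Suc j) us) = word (Suc i + Suc j) (vs @ us)"
      "cat (Suc i + Suc j) (word (Suc i) (left_act V a v # vs')) (word (Suc j) us) = word (Suc i + Suc j) (left_act V a v # vs' @ us)"
      by (subst concat_word; use vs us v assms(1) in "auto simp: words_iff")+
    then show "cat (Suc i + Suc j) (power_left A V (Suc i) a (word (Suc i) vs)) (word (Suc j) us) =
        power_left A V (Suc i + Suc j) a (cat (Suc i + Suc j) (word (Suc i) vs) (word (Suc j) us))"
      using vs us v assms(1) power_left_word[of a v vs' i] power_left_word[of a v "vs' @ us" "i + Suc j"] by simp
  qed (use assms vs left_closed words_iff in auto)
qed (use assms in auto)

lemma concat_right:
  assumes "a \<in> carrier A" "x \<in> carrier (pow (Suc i))" "y \<in> carrier (pow (Suc j))"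
  shows "cat (Suc i + Suc j) x (power_right A V (Suc j) a y) =
    power_right A V (Suc i + Suc j) a (cat (Suc i + Suc j) x y)"
proof (rule word_hom_eq[OF T.is_group concat_hom1 hom_comp[OF concat_hom1 power_right_hom[where k = "i + Suc j", folded add_Suc]]])
  fix vs assume vs: "set vs \<subseteq> carrier V" "length vs = Suc i"
  show "cat (Suc i + Suc j) (word (Suc i) vs) (power_right A V (Suc j) a y) =
    power_right A V (Suc i + Suc j) a (cat (Suc i + Suc j) (word (Suc i) vs) y)"
  proof (rule word_hom_eq[OF T.is_group hom_comp[OF power_right_hom concat_hom2] hom_comp[OF concat_hom2 power_right_hom[where k = "i + Suc j", folded add_Suc]]])
    fix us assume us: "set us \<subseteq> carrier V" "length us = Suc j"
    obtain u us' where u: "us = us' @ [u]" "length us' = j" using us nonempty_snoc by blast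
    have "cat (Suc i + Suc j) (word (Suc i) vs) (word (Suc j) us) = word (Suc i + Suc j) ((vs @ us') @ [u])"
      "cat (Suc i + Suc j) (word (Suc i) vs) (word (Suc j) (us' @ [right_act V u a])) = word (Suc i + Suc j) ((vs @ us') @ [right_act V u a])"
      by (subst concat_word; use vs us u assms(1) in "auto simp: words_iff")+
    then show "cat (Suc i + Suc j) (word (Suc i) vs) (power_right A V (Suc j) a (word (Suc j) us)) =
        power_right A V (Suc i + Suc j) a (cat (Suc i + Suc j) (word (Suc i) vs) (word (Suc j) us))"
      using vs us u assms(1) power_right_word[of a u us' j] power_right_word[of a u "vs @ us'" "i + Suc j"] by simp
  qed (use assms vs words_iff in auto)
qed (use assms right_closed in auto)

end

section \<open>Tensor powers over a skew group ring\<close>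

text \<open>
  A bimodule \<open>W\<close> over the skew group ring which is freely spanned over \<open>V\<close> by the group: every
  element is a unique sum of terms \<open>j (v h) \<cdot> h\<close>, and \<open>g v = \<psi> g v \<cdot> g\<close>. Hence \<open>\<psi>\<close> is an additive semilinear action: \<open>g\<close>
  can be cancelled on the right (\<open>J_inj\<close>), so the laws follow from the bimodule axioms of \<open>W\<close>.
\<close>

locale skew_bimodule = skew_ring A G \<phi> + V: bimodule_over A V +
    W: bimodule_over "skew_group_algebra A G \<phi>" W
  for A :: "('k, 'a) module" and G :: "('g, 'z) monoid_scheme" (structure) and \<phi> :: "'g \<Rightarrow> 'a \<Rightarrow> 'a"
    and V :: "('a, 'v) bimodule" and W :: "('g \<Rightarrow> 'a, 'w) bimodule" +
  fixes \<psi> :: "'g \<Rightarrow> 'v \<Rightarrow> 'v" and j :: "'v \<Rightarrow> 'w"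
  assumes \<psi>_closed: "\<lbrakk>g \<in> carrier G; v \<in> carrier V\<rbrakk> \<Longrightarrow> \<psi> g v \<in> carrier V"
    and j_hom: "j \<in> add_hom V W"
    and j_left: "\<lbrakk>a \<in> carrier A; v \<in> carrier V\<rbrakk> \<Longrightarrow> j (left_act V a v) = left_act W (e a \<one>) (j v)"
    and j_right: "\<lbrakk>v \<in> carrier V; a \<in> carrier A\<rbrakk> \<Longrightarrow> j (right_act V v a) = right_act W (j v) (e a \<one>)"
    and j_act: "\<lbrakk>g \<in> carrier G; v \<in> carrier V\<rbrakk> \<Longrightarrow>
      left_act W (e \<one>\<^bsub>A\<^esub> g) (j v) = right_act W (j (\<psi> g v)) (e \<one>\<^bsub>A\<^esub> g)"
    and j_inj: "\<lbrakk>u \<in> carrier G \<rightarrow> carrier V;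
        finsum W (\<lambda>h. right_act W (j (u h)) (e \<one>\<^bsub>A\<^esub> h)) (carrier G) = \<zero>\<^bsub>W\<^esub>; h \<in> carrier G\<rbrakk> \<Longrightarrow> u h = \<zero>\<^bsub>V\<^esub>"
    and j_surj: "w \<in> carrier W \<Longrightarrow> \<exists>v\<in>carrier G \<rightarrow> carrier V.
        finsum W (\<lambda>h. right_act W (j (v h)) (e \<one>\<^bsub>A\<^esub> h)) (carrier G) = w"
begin

abbreviation \<upsilon> where "\<upsilon> \<equiv> e \<one>\<^bsub>A\<^esub>"
abbreviation VP where "VP k \<equiv> V.pow (Suc k)"
abbreviation WP where "WP k \<equiv> W.pow (Suc k)"
abbreviation sumV where "sumV k x \<equiv> finprod (VP k) x (carrier G)"
abbreviation sumW where "sumW k x \<equiv> finprod (WP k) x (carrier G)"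
abbreviation Lv where "Lv k a \<equiv> power_left A V (Suc k) a"
abbreviation Rv where "Rv k a \<equiv> power_right A V (Suc k) a"

lemma j_closed [simp]: "v \<in> carrier V \<Longrightarrow> j v \<in> carrier W" by (rule hom_closed_add[OF j_hom])
lemmas j_add = hom_add[OF j_hom]
abbreviation J where "J v h \<equiv> right_act W (j v) (\<upsilon> h)"

lemma J_closed [simp]: "v \<in> carrier V \<Longrightarrow> J v h \<in> carrier W" by simp

lemma J_hom: "(\<lambda>v. J v h) \<in> add_hom V W"
  by (auto simp: hom_def j_add W.r_add1)

lemmas J_add = hom_add[OF J_hom]
lemmas J_zero = hom_zero[OF V.V.abelian_group_axioms W.V.abelian_group_axioms J_hom]

lemma J_one: "v \<in> carrier V \<Longrightarrow> J v \<one> = j v"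
  by (simp add: one_B[symmetric] W.r_one)

lemma J_sum_cong:
  assumes v: "v \<in> carrier G \<rightarrow> carrier V" and v': "v' \<in> carrier G \<rightarrow> carrier V"
    and eq: "finsum W (\<lambda>h. J (v h) h) (carrier G) = finsum W (\<lambda>h. J (v' h) h) (carrier G)" and h: "h \<in> carrier G"
  shows "v h = v' h"
proof -
  have c: "v h \<in> carrier V" "v' h \<in> carrier V" if "h \<in> carrier G" for h using v v' that by auto
  have J_minus: "J (\<ominus>\<^bsub>V\<^esub> u) h = \<ominus>\<^bsub>W\<^esub> J u h" if "u \<in> carrier V" for u h
    using hom_minus[OF V.V.abelian_group_axioms W.V.abelian_group_axioms J_hom that] .
  have "finsum W (\<lambda>h. J (v h \<oplus>\<^bsub>V\<^esub> \<ominus>\<^bsub>V\<^esub> v' h) h) (carrier G) = finsum W (\<lambda>h. J (v h) h \<oplus>\<^bsub>W\<^esub> J (\<ominus>\<^bsub>V\<^esub> v' h) h) (carrier G)"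
    by (rule W.V.finsum_cong') (use c J_add in auto)
  also have "\<dots> = finsum W (\<lambda>h. J (v h) h) (carrier G) \<oplus>\<^bsub>W\<^esub> finsum W (\<lambda>h. J (\<ominus>\<^bsub>V\<^esub> v' h) h) (carrier G)"
    by (rule W.V.finsum_addf) (use c in auto)
  also have "\<dots> = finsum W (\<lambda>h. J (v' h) h \<oplus>\<^bsub>W\<^esub> J (\<ominus>\<^bsub>V\<^esub> v' h) h) (carrier G)"
    unfolding eq by (rule W.V.finsum_addf[symmetric]) (use c in auto)
  also have "\<dots> = finsum W (\<lambda>h. \<zero>\<^bsub>W\<^esub>) (carrier G)"
    by (rule W.V.finsum_cong') (use c J_minus W.V.r_neg in auto)
  finally have "finsum W (\<lambda>h. J (v h \<oplus>\<^bsub>V\<^esub> \<ominus>\<^bsub>V\<^esub> v' h) h) (carrier G) = \<zero>\<^bsub>W\<^esub>" by simp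
  from j_inj[of "\<lambda>h. v h \<oplus>\<^bsub>V\<^esub> \<ominus>\<^bsub>V\<^esub> v' h", OF _ this h] have "v h \<oplus>\<^bsub>V\<^esub> \<ominus>\<^bsub>V\<^esub> v' h = \<zero>\<^bsub>V\<^esub>" using c by auto
  then show ?thesis using c[OF h] V.V.minus_equality V.V.minus_minus by fastforce
qed

lemma J_single:
  "\<lbrakk>v \<in> carrier V; g \<in> carrier G\<rbrakk> \<Longrightarrow> finsum W (\<lambda>h. J (if h = g then v else \<zero>\<^bsub>V\<^esub>) h) (carrier G) = J v g"
  by (subst W.V.finsum_single[OF finite_G]) (auto simp: J_zero)

lemma J_inj: "\<lbrakk>v \<in> carrier V; v' \<in> carrier V; g \<in> carrier G; J v g = J v' g\<rbrakk> \<Longrightarrow> v = v'"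
  using J_sum_cong[of "\<lambda>h. if h = g then v else \<zero>\<^bsub>V\<^esub>" "\<lambda>h. if h = g then v' else \<zero>\<^bsub>V\<^esub>" g]
  by (simp add: J_single)

lemma J_right:
  assumes "v \<in> carrier V" "g \<in> carrier G" "a \<in> carrier A" "l \<in> carrier G"
  shows "right_act W (J v g) (e a l) = J (right_act V v (\<phi> g a)) (g \<otimes> l)"
proof -
  have "right_act W (J v g) (e a l) = right_act W (j v) (\<upsilon> g \<bullet> e a l)"
    using assms by (simp add: W.r_mult)
  also have "\<upsilon> g \<bullet> e a l = e (\<phi> g a) \<one> \<bullet> \<upsilon> (g \<otimes> l)"
    using assms by (simp add: e_mult)
  finally show ?thesis using assms by (simp add: W.r_mult j_right)
qed

lemma J_left:
  assumes "v \<in> carrier V" "g \<in> carrier G" "a \<in> carrier A" "l \<in> carrier G"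
  shows "left_act W (e a l) (J v g) = J (left_act V a (\<psi> l v)) (l \<otimes> g)"
proof -
  have "e a l = e a \<one> \<bullet> \<upsilon> l" using assms by (simp add: e_mult \<phi>_one)
  then have "left_act W (e a l) (J v g) = left_act W (e a \<one>) (right_act W (left_act W (\<upsilon> l) (j v)) (\<upsilon> g))"
    using assms by (simp add: W.l_mult W.l_r)
  also have "\<dots> = left_act W (e a \<one>) (right_act W (j (\<psi> l v)) (\<upsilon> l \<bullet> \<upsilon> g))"
    using assms by (simp add: j_act W.r_mult \<psi>_closed)
  finally show ?thesis using assms by (simp add: e_mult W.l_r j_left \<psi>_closed)
qed

lemma \<psi>_left:
  assumes "a \<in> carrier A" "v \<in> carrier V" "g \<in> carrier G"
  shows "\<psi> g (left_act V a v) = left_act V (\<phi> g a) (\<psi> g v)"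
proof (rule J_inj)
  have "J (\<psi> g (left_act V a v)) g = left_act W (\<upsilon> g \<bullet> e a \<one>) (j v)"
    using assms by (simp add: j_act[symmetric] j_left W.l_mult)
  also have "\<dots> = J (left_act V (\<phi> g a) (\<psi> g v)) g"
    using assms J_left[of v "\<one>" "\<phi> g a" g] by (simp add: e_mult J_one)
  finally show "J (\<psi> g (left_act V a v)) g = J (left_act V (\<phi> g a) (\<psi> g v)) g" .
qed (use assms \<psi>_closed in auto)

lemma \<psi>_right:
  assumes "a \<in> carrier A" "v \<in> carrier V" "g \<in> carrier G"
  shows "\<psi> g (right_act V v a) = right_act V (\<psi> g v) (\<phi> g a)"
proof (rule J_inj)
  have "J (\<psi> g (right_act V v a)) g = right_act W (left_act W (\<upsilon> g) (j v)) (e a \<one>)"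
    using assms by (simp add: j_act[symmetric] j_right W.l_r)
  also have "\<dots> = J (right_act V (\<psi> g v) (\<phi> g a)) g"
    using assms J_right[of "\<psi> g v" g a "\<one>"] by (simp add: j_act \<psi>_closed)
  finally show "J (\<psi> g (right_act V v a)) g = J (right_act V (\<psi> g v) (\<phi> g a)) g" .
qed (use assms \<psi>_closed in auto)

lemma \<psi>_add:
  assumes "v \<in> carrier V" "w \<in> carrier V" "g \<in> carrier G"
  shows "\<psi> g (v \<oplus>\<^bsub>V\<^esub> w) = \<psi> g v \<oplus>\<^bsub>V\<^esub> \<psi> g w"
proof (rule J_inj)
  have "J (\<psi> g (v \<oplus>\<^bsub>V\<^esub> w)) g = J (\<psi> g v) g \<oplus>\<^bsub>W\<^esub> J (\<psi> g w) g"
    using assms by (simp add: j_act[symmetric] j_add W.l_add2)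
  also have "\<dots> = J (\<psi> g v \<oplus>\<^bsub>V\<^esub> \<psi> g w) g" using assms \<psi>_closed by (simp only: J_add)
  finally show "J (\<psi> g (v \<oplus>\<^bsub>V\<^esub> w)) g = J (\<psi> g v \<oplus>\<^bsub>V\<^esub> \<psi> g w) g" .
qed (use assms \<psi>_closed in auto)

lemma \<psi>_mult:
  assumes "v \<in> carrier V" "g \<in> carrier G" "h \<in> carrier G"
  shows "\<psi> (g \<otimes> h) v = \<psi> g (\<psi> h v)"
proof (rule J_inj)
  have "J (\<psi> (g \<otimes> h) v) (g \<otimes> h) = left_act W (\<upsilon> g \<bullet> \<upsilon> h) (j v)"
    using assms by (simp add: j_act[symmetric] e_mult)
  also have "\<dots> = left_act W (\<upsilon> g) (J (\<psi> h v) h)" using assms by (simp add: W.l_mult j_act)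
  also have "\<dots> = J (\<psi> g (\<psi> h v)) (g \<otimes> h)"
    using assms J_left[of "\<psi> h v" h "\<one>\<^bsub>A\<^esub>" g] by (simp add: \<psi>_closed V.l_one)
  finally show "J (\<psi> (g \<otimes> h) v) (g \<otimes> h) = J (\<psi> g (\<psi> h v)) (g \<otimes> h)" .
qed (use assms \<psi>_closed in auto)

lemma \<psi>_one: "v \<in> carrier V \<Longrightarrow> \<psi> \<one> v = v"
proof (rule J_inj)
  assume v: "v \<in> carrier V"
  have "J (\<psi> \<one> v) \<one> = left_act W (\<upsilon> \<one>) (j v)" using v by (simp only: j_act G.one_closed)
  then show "J (\<psi> \<one> v) \<one> = J v \<one>" using v by (simp add: one_B[symmetric] W.l_one W.r_one)
qed (simp_all add: \<psi>_closed)

subsection \<open>Coordinates\<close>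

text \<open>The coordinates of an element of \<open>W\<close> in this decomposition.\<close>

definition cw where "cw w = (SOME v. v \<in> carrier G \<rightarrow> carrier V \<and> finsum W (\<lambda>h. J (v h) h) (carrier G) = w)"

lemma
  assumes "w \<in> carrier W"
  shows cw_closed: "cw w \<in> carrier G \<rightarrow> carrier V" and cw_sum: "finsum W (\<lambda>h. J (cw w h) h) (carrier G) = w"
proof -
  have "\<exists>v. v \<in> carrier G \<rightarrow> carrier V \<and> finsum W (\<lambda>h. J (v h) h) (carrier G) = w" using j_surj[OF assms] by blast
  from someI_ex[OF this] show "cw w \<in> carrier G \<rightarrow> carrier V" "finsum W (\<lambda>h. J (cw w h) h) (carrier G) = w"
    unfolding cw_def by auto
qed

lemma cw_apply: "w \<in> carrier W \<Longrightarrow> h \<in> carrier G \<Longrightarrow> cw w h \<in> carrier V" using cw_closed by auto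

lemma cw_unique:
  assumes "v \<in> carrier G \<rightarrow> carrier V" "finsum W (\<lambda>h. J (v h) h) (carrier G) = w" "h \<in> carrier G"
  shows "cw w h = v h"
proof -
  have "w \<in> carrier W" unfolding assms(2)[symmetric] using assms(1) by (intro W.V.finsum_closed) (auto simp: Pi_iff)
  from J_sum_cong[OF cw_closed[OF this] assms(1) _ assms(3)] cw_sum[OF this] assms(2) show ?thesis by simp
qed

lemma cw_add: "\<lbrakk>w \<in> carrier W; w' \<in> carrier W; h \<in> carrier G\<rbrakk> \<Longrightarrow> cw (w \<oplus>\<^bsub>W\<^esub> w') h = cw w h \<oplus>\<^bsub>V\<^esub> cw w' h"
proof (rule cw_unique)
  assume w: "w \<in> carrier W" "w' \<in> carrier W"
  have "finsum W (\<lambda>h. J (cw w h \<oplus>\<^bsub>V\<^esub> cw w' h) h) (carrier G) = finsum W (\<lambda>h. J (cw w h) h \<oplus>\<^bsub>W\<^esub> J (cw w' h) h) (carrier G)"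
    by (rule W.V.finsum_cong') (use w cw_apply J_add in auto)
  also have "\<dots> = w \<oplus>\<^bsub>W\<^esub> w'" by (subst W.V.finsum_addf) (use w cw_apply in "auto simp: cw_sum")
  finally show "finsum W (\<lambda>h. J (cw w h \<oplus>\<^bsub>V\<^esub> cw w' h) h) (carrier G) = w \<oplus>\<^bsub>W\<^esub> w'" .
qed (auto intro: cw_apply)

lemma cw_J: "\<lbrakk>v \<in> carrier V; g \<in> carrier G; h \<in> carrier G\<rbrakk> \<Longrightarrow> cw (J v g) h = (if h = g then v else \<zero>\<^bsub>V\<^esub>)"
  by (rule cw_unique[of "\<lambda>h. if h = g then v else \<zero>\<^bsub>V\<^esub>"]) (auto simp: J_single)

lemma bij_right: "l \<in> carrier G \<Longrightarrow> bij_betw (\<lambda>g. g \<otimes> l) (carrier G) (carrier G)"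
  by (rule bij_betw_byWitness[where f' = "\<lambda>g. g \<otimes> inv l"]) (auto simp: G.m_assoc)

lemma bij_left: "l \<in> carrier G \<Longrightarrow> bij_betw (\<lambda>g. l \<otimes> g) (carrier G) (carrier G)"
  by (rule bij_betw_byWitness[where f' = "\<lambda>g. inv l \<otimes> g"]) (auto simp: G.group_cancel_left)

lemma cw_right:
  assumes w: "w \<in> carrier W" and a: "a \<in> carrier A" and l: "l \<in> carrier G" and h: "h \<in> carrier G"
  shows "cw (right_act W w (e a l)) h = right_act V (cw w (h \<otimes> inv l)) (\<phi> (h \<otimes> inv l) a)"
proof (rule cw_unique[OF _ _ h, of "\<lambda>h. right_act V (cw w (h \<otimes> inv l)) (\<phi> (h \<otimes> inv l) a)"])
  let ?v = "\<lambda>h. right_act V (cw w (h \<otimes> inv l)) (\<phi> (h \<otimes> inv l) a)"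
  show c: "?v \<in> carrier G \<rightarrow> carrier V" using w a l cw_apply by auto
  have rh: "(\<lambda>w. right_act W w (e a l)) \<in> add_hom W W"
    using a by (auto simp: hom_def W.r_add1)
  have "finsum W (\<lambda>h. J (?v h) h) (carrier G) = finsum W (\<lambda>g. J (?v (g \<otimes> l)) (g \<otimes> l)) (carrier G)"
    by (rule W.V.finsum_bij[OF bij_right[OF l], symmetric]) (use c in "auto simp: Pi_iff")
  also have "\<dots> = finsum W (\<lambda>g. right_act W (J (cw w g) g) (e a l)) (carrier G)"
    by (rule W.V.finsum_cong') (use w a l cw_apply in "auto simp: J_right G.m_assoc")
  also have "\<dots> = right_act W (finsum W (\<lambda>g. J (cw w g) g) (carrier G)) (e a l)"
    by (rule hom_finsum[OF W.V.abelian_group_axioms W.V.abelian_group_axioms rh, symmetric]) (use w cw_apply in auto)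
  finally show "finsum W (\<lambda>h. J (?v h) h) (carrier G) = right_act W w (e a l)" by (simp add: cw_sum[OF w])
qed

lemma cw_left:
  assumes w: "w \<in> carrier W" and a: "a \<in> carrier A" and l: "l \<in> carrier G" and h: "h \<in> carrier G"
  shows "cw (left_act W (e a l) w) h = left_act V a (\<psi> l (cw w (inv l \<otimes> h)))"
proof (rule cw_unique[OF _ _ h, of "\<lambda>h. left_act V a (\<psi> l (cw w (inv l \<otimes> h)))"])
  let ?v = "\<lambda>h. left_act V a (\<psi> l (cw w (inv l \<otimes> h)))"
  show c: "?v \<in> carrier G \<rightarrow> carrier V" using w a l cw_apply \<psi>_closed by auto
  have lh: "(\<lambda>w. left_act W (e a l) w) \<in> add_hom W W"
    using a by (auto simp: hom_def W.l_add2)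
  have "finsum W (\<lambda>h. J (?v h) h) (carrier G) = finsum W (\<lambda>g. J (?v (l \<otimes> g)) (l \<otimes> g)) (carrier G)"
    by (rule W.V.finsum_bij[OF bij_left[OF l], symmetric]) (use c in "auto simp: Pi_iff")
  also have "\<dots> = finsum W (\<lambda>g. left_act W (e a l) (J (cw w g) g)) (carrier G)"
    by (rule W.V.finsum_cong') (use w a l cw_apply \<psi>_closed in "auto simp: J_left G.group_cancel_left")
  also have "\<dots> = left_act W (e a l) (finsum W (\<lambda>g. J (cw w g) g) (carrier G))"
    by (rule hom_finsum[OF W.V.abelian_group_axioms W.V.abelian_group_axioms lh, symmetric]) (use w cw_apply in auto)
  finally show "finsum W (\<lambda>h. J (?v h) h) (carrier G) = left_act W (e a l) w" by (simp add: cw_sum[OF w])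
qed

subsection \<open>The action on tensor powers, and the map induced by \<open>j\<close>\<close>

abbreviation \<psi>T where "\<psi>T k g \<equiv> power_map A V k (map (\<psi> g))"

lemma
  assumes g: "g \<in> carrier G"
  shows \<psi>T_hom: "\<psi>T k g \<in> hom (V.pow k) (V.pow k)"
    and \<psi>T_word: "vs \<in> words V k \<Longrightarrow> \<psi>T k g (V.word k vs) = V.word k (map (\<psi> g) vs)"
proof -
  have c: "\<psi> g ` set us \<subseteq> carrier V" if "set us \<subseteq> carrier V" for us using that \<psi>_closed[OF g] by auto
  have f: "map (\<psi> g) vs \<in> words V k" if "vs \<in> words V k" for vs
    using that c by (simp add: V.words_iff)
  have F: "V.multilinear k (V.pow k) (\<lambda>vs. V.word k (map (\<psi> g) vs))"
  proof (rule V.multilinearI, goal_cases)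
    case (2 us v w ws)
    then show ?case using g c V.word_add[of "map (\<psi> g) us" "map (\<psi> g) ws" "\<psi> g v" "\<psi> g w" k]
      by (simp add: \<psi>_add \<psi>_closed)
  next
    case (3 us v a w ws)
    then show ?case using g c V.word_balanced[of "map (\<psi> g) us" "map (\<psi> g) ws" "\<psi> g v" "\<psi> g w" "\<phi> g a" k]
      by (simp add: \<psi>_left \<psi>_right \<psi>_closed)
  qed (simp add: f)
  show "\<psi>T k g \<in> hom (V.pow k) (V.pow k)" by (rule V.power_map_hom[OF f F])
  show "vs \<in> words V k \<Longrightarrow> \<psi>T k g (V.word k vs) = V.word k (map (\<psi> g) vs)"
    by (rule V.power_map_word[OF f F])
qed

lemma \<psi>T_closed: "g \<in> carrier G \<Longrightarrow> x \<in> carrier (V.pow k) \<Longrightarrow> \<psi>T k g x \<in> carrier (V.pow k)"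
  using hom_in_carrier[OF \<psi>T_hom] .

lemma map_\<psi>_closed: "set vs \<subseteq> carrier V \<Longrightarrow> g \<in> carrier G \<Longrightarrow> \<psi> g ` set vs \<subseteq> carrier V"
  using \<psi>_closed by auto

lemma \<psi>T_mult:
  assumes "x \<in> carrier (V.pow k)" "g \<in> carrier G" "h \<in> carrier G"
  shows "\<psi>T k (g \<otimes> h) x = \<psi>T k g (\<psi>T k h x)"
proof (rule V.word_hom_eq[OF V.T.is_group \<psi>T_hom V.hom_comp[OF \<psi>T_hom \<psi>T_hom]])
  fix vs assume vs: "set vs \<subseteq> carrier V" "length vs = k"
  have "map (\<psi> (g \<otimes> h)) vs = map (\<psi> g) (map (\<psi> h) vs)"
    using vs(1) assms by (induction vs) (auto simp: \<psi>_mult)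
  then show "\<psi>T k (g \<otimes> h) (V.word k vs) = \<psi>T k g (\<psi>T k h (V.word k vs))"
    using vs assms map_\<psi>_closed by (simp add: \<psi>T_word V.words_iff del: map_map map_eq_conv)
qed (use assms in auto)

lemma \<psi>T_one: assumes "x \<in> carrier (V.pow k)" shows "\<psi>T k \<one> x = x"
proof (rule V.word_hom_eq[OF V.T.is_group \<psi>T_hom, where b = "\<lambda>x. x"])
  fix vs assume vs: "set vs \<subseteq> carrier V" "length vs = k"
  have "map (\<psi> \<one>) vs = vs" using vs(1) by (induction vs) (auto simp: \<psi>_one)
  then show "\<psi>T k \<one> (V.word k vs) = V.word k vs" using vs by (simp add: \<psi>T_word V.words_iff)
qed (use assms in "auto simp: hom_def")

lemma \<psi>T_left:
  assumes "a \<in> carrier A" "g \<in> carrier G" "x \<in> carrier (VP k)"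
  shows "\<psi>T (Suc k) g (Lv k a x) = Lv k (\<phi> g a) (\<psi>T (Suc k) g x)"
  by (rule V.word_hom_eq[OF V.T.is_group V.hom_comp[OF V.power_left_hom \<psi>T_hom] V.hom_comp[OF \<psi>T_hom V.power_left_hom]])
    (use assms map_\<psi>_closed in "auto dest!: V.nonempty_Cons simp: V.power_left_word \<psi>T_word V.words_iff \<psi>_left \<psi>_closed")

lemma \<psi>T_concat:
  assumes "g \<in> carrier G" "x \<in> carrier (V.pow i)" "y \<in> carrier (V.pow k)"
  shows "\<psi>T (i + k) g (V.cat (i + k) x y) = V.cat (i + k) (\<psi>T i g x) (\<psi>T k g y)"
proof (rule V.word_hom_eq[OF V.T.is_group V.hom_comp[OF V.concat_hom1 \<psi>T_hom] V.hom_comp[OF \<psi>T_hom V.concat_hom1]])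
  fix vs assume vs: "set vs \<subseteq> carrier V" "length vs = i"
  show "\<psi>T (i + k) g (V.cat (i + k) (V.word i vs) y) =
      V.cat (i + k) (\<psi>T i g (V.word i vs)) (\<psi>T k g y)"
    by (rule V.word_hom_eq[OF V.T.is_group V.hom_comp[OF V.concat_hom2 \<psi>T_hom] V.hom_comp[OF \<psi>T_hom V.concat_hom2]])
      (use assms vs map_\<psi>_closed in "auto simp: \<psi>T_word V.words_iff V.concat_word")
qed (use assms \<psi>T_closed in auto)

text \<open>The map on tensor powers induced by \<open>j\<close>.\<close>

definition \<Phi> where "\<Phi> k = pres_lift (W.pow k) (\<lambda>vs. W.word k (map j vs))"

lemma
  shows \<Phi>_hom: "\<Phi> k \<in> hom (V.pow k) (W.pow k)"
    and \<Phi>_word: "vs \<in> words V k \<Longrightarrow> \<Phi> k (V.word k vs) = W.word k (map j vs)"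
proof -
  have c: "j ` set us \<subseteq> carrier W" if "set us \<subseteq> carrier V" for us using that by auto
  have F: "V.multilinear k (W.pow k) (\<lambda>vs. W.word k (map j vs))"
  proof (rule V.multilinearI, goal_cases)
    case (1 vs) then show ?case using c by (simp add: V.words_iff W.words_iff)
  next
    case (2 us v w ws)
    then show ?case using c W.word_add[of "map j us" "map j ws" "j v" "j w" k] by (simp add: j_add)
  next
    case (3 us v a w ws)
    then show ?case using c W.word_balanced[of "map j us" "map j ws" "j v" "j w" "e a \<one>" k]
      by (simp add: j_left j_right)
  qed
  show "\<Phi> k \<in> hom (V.pow k) (W.pow k)" unfolding \<Phi>_def by (rule V.power_lift_hom[OF W.comm_group_pow F])
  show "vs \<in> words V k \<Longrightarrow> \<Phi> k (V.word k vs) = W.word k (map j vs)"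
    unfolding \<Phi>_def by (rule V.power_lift_word[OF W.comm_group_pow F])
qed

lemma \<Phi>_closed: "x \<in> carrier (V.pow k) \<Longrightarrow> \<Phi> k x \<in> carrier (W.pow k)" using hom_in_carrier[OF \<Phi>_hom] .

abbreviation Lw where "Lw k b \<equiv> power_left B W (Suc k) b"
abbreviation Rw where "Rw k b \<equiv> power_right B W (Suc k) b"

lemma j_image: "set vs \<subseteq> carrier V \<Longrightarrow> j ` set vs \<subseteq> carrier W" by auto

lemma \<Phi>_left:
  assumes "a \<in> carrier A" "x \<in> carrier (VP k)"
  shows "\<Phi> (Suc k) (Lv k a x) = Lw k (e a \<one>) (\<Phi> (Suc k) x)"
  by (rule V.word_hom_eq[OF W.T.is_group V.hom_comp[OF V.power_left_hom \<Phi>_hom] V.hom_comp[OF \<Phi>_hom W.power_left_hom]])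
    (use assms j_image in "auto dest!: V.nonempty_Cons simp: V.power_left_word W.power_left_word \<Phi>_word V.words_iff j_left")

lemma \<Phi>_right:
  assumes "a \<in> carrier A" "x \<in> carrier (VP k)"
  shows "\<Phi> (Suc k) (Rv k a x) = Rw k (e a \<one>) (\<Phi> (Suc k) x)"
  by (rule V.word_hom_eq[OF W.T.is_group V.hom_comp[OF V.power_right_hom \<Phi>_hom] V.hom_comp[OF \<Phi>_hom W.power_right_hom]])
    (use assms j_image in "auto dest!: V.nonempty_snoc simp: V.power_right_word W.power_right_word \<Phi>_word V.words_iff j_right")

lemma \<Phi>_concat:
  assumes "x \<in> carrier (V.pow i)" "y \<in> carrier (V.pow k)"
  shows "\<Phi> (i + k) (V.cat (i + k) x y) = W.cat (i + k) (\<Phi> i x) (\<Phi> k y)"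
proof (rule V.word_hom_eq[OF W.T.is_group V.hom_comp[OF V.concat_hom1 \<Phi>_hom] V.hom_comp[OF \<Phi>_hom W.concat_hom1]])
  fix vs assume vs: "set vs \<subseteq> carrier V" "length vs = i"
  show "\<Phi> (i + k) (V.cat (i + k) (V.word i vs) y) = W.cat (i + k) (\<Phi> i (V.word i vs)) (\<Phi> k y)"
    by (rule V.word_hom_eq[OF W.T.is_group V.hom_comp[OF V.concat_hom2 \<Phi>_hom] V.hom_comp[OF \<Phi>_hom W.concat_hom2]])
      (use assms vs j_image in "auto simp: \<Phi>_word V.words_iff W.words_iff V.concat_word W.concat_word intro!: \<Phi>_closed")
qed (use assms \<Phi>_closed in auto)

lemma left_group_word:
  assumes g: "g \<in> carrier G"
  shows "\<lbrakk>v \<in> carrier V; set vs \<subseteq> carrier V; set p \<subseteq> carrier W; k = length p + length vs\<rbrakk> \<Longrightarrow>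
    W.word (Suc k) (p @ left_act W (\<upsilon> g) (j v) # map j vs) =
    Rw k (\<upsilon> g) (W.word (Suc k) (p @ map j (map (\<psi> g) (v # vs))))"
proof (induction vs arbitrary: v p)
  case Nil
  then show ?case using g by (simp add: j_act W.power_right_word \<psi>_closed)
next
  case (Cons u us)
  have "W.word (Suc k) (p @ left_act W (\<upsilon> g) (j v) # map j (u # us)) =
      W.word (Suc k) ((p @ [j (\<psi> g v)]) @ left_act W (\<upsilon> g) (j u) # map j us)"
    using W.word_balanced[of p "map j us" "j (\<psi> g v)" "j u" "\<upsilon> g" "Suc k"] g Cons.prems j_image[of us]
    by (simp add: j_act \<psi>_closed)
  also have "\<dots> = Rw k (\<upsilon> g) (W.word (Suc k) ((p @ [j (\<psi> g v)]) @ map j (map (\<psi> g) (u # us))))"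
    by (rule Cons.IH) (use Cons.prems g \<psi>_closed in auto)
  finally show ?case by simp
qed

lemma \<Phi>_act:
  assumes g: "g \<in> carrier G" and x: "x \<in> carrier (VP k)"
  shows "Lw k (\<upsilon> g) (\<Phi> (Suc k) x) = Rw k (\<upsilon> g) (\<Phi> (Suc k) (\<psi>T (Suc k) g x))"
proof (rule V.word_hom_eq[OF W.T.is_group V.hom_comp[OF \<Phi>_hom W.power_left_hom]
      V.hom_comp[OF V.hom_comp[OF \<psi>T_hom \<Phi>_hom] W.power_right_hom]])
  fix vs assume vs: "set vs \<subseteq> carrier V" "length vs = Suc k"
  then obtain v us where v: "vs = v # us" "length us = k" using V.nonempty_Cons by blast
  have "Lw k (\<upsilon> g) (\<Phi> (Suc k) (V.word (Suc k) vs)) = W.word (Suc k) (left_act W (\<upsilon> g) (j v) # map j us)"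
    using vs v g j_image[of us] by (simp add: \<Phi>_word V.words_iff W.power_left_word)
  also have "\<dots> = Rw k (\<upsilon> g) (W.word (Suc k) (map j (map (\<psi> g) (v # us))))"
    using left_group_word[OF g, of v us "[]" k] vs v by simp
  also have "\<dots> = Rw k (\<upsilon> g) (\<Phi> (Suc k) (\<psi>T (Suc k) g (V.word (Suc k) vs)))"
    using vs v g map_\<psi>_closed[of vs g] by (simp add: \<psi>T_word \<Phi>_word V.words_iff)
  finally show "Lw k (\<upsilon> g) (\<Phi> (Suc k) (V.word (Suc k) vs)) =
      Rw k (\<upsilon> g) (\<Phi> (Suc k) (\<psi>T (Suc k) g (V.word (Suc k) vs)))" .
qed (use assms in auto)

end

context skew_bimodule
begin

text \<open>
  The element \<open>x \<cdot> g\<close> of the tensor power of \<open>W\<close>. The index \<open>k\<close> is one less than the number of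
  factors, which excludes the empty power.
\<close>

abbreviation RP where "RP k g x \<equiv> Rw k (\<upsilon> g) (\<Phi> (Suc k) x)"

lemma RP_hom: "RP k g \<in> hom (VP k) (WP k)"
  by (rule V.hom_comp[OF \<Phi>_hom W.power_right_hom]) simp

lemma RP_closed: "x \<in> carrier (VP k) \<Longrightarrow> RP k g x \<in> carrier (WP k)"
  using hom_in_carrier[OF RP_hom] .

lemma Rw_Rw: "\<lbrakk>x \<in> carrier (WP k); g \<in> carrier G; l \<in> carrier G\<rbrakk> \<Longrightarrow>
    Rw k (\<upsilon> l) (Rw k (\<upsilon> g) x) = Rw k (\<upsilon> (g \<otimes> l)) x"
  by (simp add: W.power_right_mult[symmetric] e_mult)

text \<open>
  The sum of the \<open>x g \<cdot> g\<close>, for a family \<open>x\<close> in the tensor power of \<open>V\<close>.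
\<close>

definition hk where "hk k x = sumW k (\<lambda>g. RP k g (x g))"

lemma hk_closed: "x \<in> carrier G \<rightarrow> carrier (VP k) \<Longrightarrow> hk k x \<in> carrier (WP k)"
  unfolding hk_def by (rule W.T.finprod_closed) (auto intro: RP_closed)

text \<open>
  Sums over pairs of group elements, collected by their product: the shape of every product in a
  skew group ring.
\<close>

lemma hk_convolution:
  assumes F: "\<And>g l. g \<in> carrier G \<Longrightarrow> l \<in> carrier G \<Longrightarrow> F g l \<in> carrier (VP k)"
  shows "sumW k (\<lambda>g. sumW k (\<lambda>l. RP k (g \<otimes> l) (F g l))) =
    hk k (\<lambda>m. sumV k (\<lambda>g. F g (inv g \<otimes> m)))"
proof -
  let ?W = "WP k"
  have "hk k (\<lambda>m. sumV k (\<lambda>g. F g (inv g \<otimes> m))) =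
      finprod ?W (\<lambda>m. finprod ?W (\<lambda>g. RP k m (F g (inv g \<otimes> m))) (carrier G)) (carrier G)"
    unfolding hk_def
  proof (rule W.T.finprod_cong'[OF refl])
    fix m assume m: "m \<in> carrier G"
    show "RP k m (sumV k (\<lambda>g. F g (inv g \<otimes> m))) =
        finprod ?W (\<lambda>g. RP k m (F g (inv g \<otimes> m))) (carrier G)"
      by (rule hom_finprod[OF V.comm_group_pow W.comm_group_pow RP_hom]) (use F m in auto)
  qed (auto intro!: W.T.finprod_closed RP_closed F)
  also have "\<dots> = finprod ?W (\<lambda>g. finprod ?W (\<lambda>m. RP k m (F g (inv g \<otimes> m))) (carrier G)) (carrier G)"
    by (rule W.T.finprod_swap[OF finite_G finite_G]) (auto intro!: RP_closed F)
  also have "\<dots> = finprod ?W (\<lambda>g. finprod ?W (\<lambda>l. RP k (g \<otimes> l) (F g l)) (carrier G)) (carrier G)"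
  proof (rule W.T.finprod_cong'[OF refl])
    fix g assume g: "g \<in> carrier G"
    have img: "(\<lambda>l. g \<otimes> l) ` carrier G = carrier G" "inj_on (\<lambda>l. g \<otimes> l) (carrier G)"
      using bij_left[OF g] by (auto simp: bij_betw_def)
    have "finprod ?W (\<lambda>m. RP k m (F g (inv g \<otimes> m))) ((\<lambda>l. g \<otimes> l) ` carrier G) =
        finprod ?W (\<lambda>l. RP k (g \<otimes> l) (F g (inv g \<otimes> (g \<otimes> l)))) (carrier G)"
      by (rule W.T.finprod_reindex[OF _ img(2)]) (use g F in "auto intro!: RP_closed")
    also have "\<dots> = finprod ?W (\<lambda>l. RP k (g \<otimes> l) (F g l)) (carrier G)"
      by (rule W.T.finprod_cong') (use g F in "auto intro!: RP_closed simp: G.group_cancel_left")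
    finally show "finprod ?W (\<lambda>m. RP k m (F g (inv g \<otimes> m))) (carrier G) =
        finprod ?W (\<lambda>l. RP k (g \<otimes> l) (F g l)) (carrier G)" unfolding img(1) .
  qed (auto intro!: W.T.finprod_closed RP_closed F)
  finally show ?thesis by simp
qed

lemma left_RP:
  assumes "a \<in> carrier A" "g \<in> carrier G" "l \<in> carrier G" "y \<in> carrier (VP k)"
  shows "Lw k (e a g) (RP k l y) = RP k (g \<otimes> l) (Lv k a (\<psi>T (Suc k) g y))"
proof -
  have "e a g = e a \<one> \<bullet> \<upsilon> g" using assms by (simp add: e_mult \<phi>_one)
  then have "Lw k (e a g) (RP k l y) = Rw k (\<upsilon> l) (Lw k (e a \<one>) (Lw k (\<upsilon> g) (\<Phi> (Suc k) y)))"
    using assms by (simp add: W.power_left_mult W.power_left_right \<Phi>_closed W.left_closed W.right_closed)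
  also have "\<dots> = Rw k (\<upsilon> l) (Rw k (\<upsilon> g) (Lw k (e a \<one>) (\<Phi> (Suc k) (\<psi>T (Suc k) g y))))"
    using assms by (simp add: \<Phi>_act W.power_left_right \<Phi>_closed \<psi>T_closed)
  also have "\<dots> = RP k (g \<otimes> l) (Lv k a (\<psi>T (Suc k) g y))"
    using assms by (simp add: Rw_Rw \<Phi>_left \<Phi>_closed \<psi>T_closed W.left_closed)
  finally show ?thesis .
qed

lemma right_RP:
  assumes "b \<in> carrier A" "g \<in> carrier G" "l \<in> carrier G" "x \<in> carrier (VP k)"
  shows "Rw k (e b l) (RP k g x) = RP k (g \<otimes> l) (Rv k (\<phi> g b) x)"
proof -
  have "Rw k (e b l) (RP k g x) = Rw k (\<upsilon> g \<bullet> e b l) (\<Phi> (Suc k) x)"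
    using assms by (simp add: W.power_right_mult \<Phi>_closed)
  also have "\<upsilon> g \<bullet> e b l = e (\<phi> g b) \<one> \<bullet> \<upsilon> (g \<otimes> l)"
    using assms by (simp add: e_mult)
  finally show ?thesis using assms by (simp add: W.power_right_mult \<Phi>_closed \<Phi>_right)
qed

text \<open>The computation \<open>(x g)(y l) = x g(y) g l\<close> in tensor powers.\<close>

lemma concat_RP:
  assumes "g \<in> carrier G" "l \<in> carrier G" "x \<in> carrier (V.pow (Suc i))" "y \<in> carrier (V.pow (Suc n))"
    and k: "Suc k = Suc i + Suc n"
  shows "W.cat (Suc k) (RP i g x) (RP n l y) =
    RP k (g \<otimes> l) (V.cat (Suc k) x (\<psi>T (Suc n) g y))"
proof -
  note c = \<Phi>_closed[OF assms(3)] \<Phi>_closed[OF assms(4)] \<Phi>_closed[OF \<psi>T_closed[OF assms(1,4)]]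
  have R: "Rw k b z = power_right B W (Suc i + Suc n) b z" for b z by (simp only: k)
  have cc: "W.cat (Suc k) (\<Phi> (Suc i) x) (\<Phi> (Suc n) (\<psi>T (Suc n) g y)) \<in> carrier (WP k)"
    unfolding k by (rule W.concat_closed[OF c(1,3)])
  have "W.cat (Suc k) (RP i g x) (RP n l y) =
      Rw k (\<upsilon> l) (W.cat (Suc k) (RP i g x) (\<Phi> (Suc n) y))"
    unfolding R unfolding k by (rule W.concat_right) (use c W.right_closed in auto)
  also have "W.cat (Suc k) (RP i g x) (\<Phi> (Suc n) y) =
      W.cat (Suc k) (\<Phi> (Suc i) x) (Lw n (\<upsilon> g) (\<Phi> (Suc n) y))"
    unfolding k by (rule W.concat_right_left) (use c in auto)
  also have "Lw n (\<upsilon> g) (\<Phi> (Suc n) y) = RP n g (\<psi>T (Suc n) g y)" by (rule \<Phi>_act) (use assms in auto)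
  also have "W.cat (Suc k) (\<Phi> (Suc i) x) (RP n g (\<psi>T (Suc n) g y)) =
      Rw k (\<upsilon> g) (W.cat (Suc k) (\<Phi> (Suc i) x) (\<Phi> (Suc n) (\<psi>T (Suc n) g y)))"
    unfolding R unfolding k by (rule W.concat_right) (use c in auto)
  also have "Rw k (\<upsilon> l) (Rw k (\<upsilon> g) (W.cat (Suc k) (\<Phi> (Suc i) x) (\<Phi> (Suc n) (\<psi>T (Suc n) g y)))) =
      Rw k (\<upsilon> (g \<otimes> l)) (W.cat (Suc k) (\<Phi> (Suc i) x) (\<Phi> (Suc n) (\<psi>T (Suc n) g y)))"
    by (rule Rw_Rw[OF cc]) (use assms in auto)
  also have "W.cat (Suc k) (\<Phi> (Suc i) x) (\<Phi> (Suc n) (\<psi>T (Suc n) g y)) =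
      \<Phi> (Suc k) (V.cat (Suc k) x (\<psi>T (Suc n) g y))"
    unfolding k by (rule \<Phi>_concat[symmetric]) (use assms \<psi>T_closed in auto)
  finally show ?thesis .
qed

lemma hk_concat:
  assumes x: "x \<in> carrier G \<rightarrow> carrier (V.pow (Suc i))" and y: "y \<in> carrier G \<rightarrow> carrier (V.pow (Suc n))"
    and k: "Suc k = Suc i + Suc n"
  shows "W.cat (Suc k) (hk i x) (hk n y) =
    hk k (\<lambda>m. sumV k (\<lambda>g. V.cat (Suc k) (x g) (\<psi>T (Suc n) g (y (inv g \<otimes> m)))))"
proof -
  have c1: "RP i g (x g) \<in> carrier (W.pow (Suc i))" if "g \<in> carrier G" for g using RP_closed x that by auto
  have c2: "RP n g (y g) \<in> carrier (W.pow (Suc n))" if "g \<in> carrier G" for g using RP_closed y that by auto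
  have cF: "V.cat (Suc k) (x g) (\<psi>T (Suc n) g (y l)) \<in> carrier (VP k)"
    if "g \<in> carrier G" "l \<in> carrier G" for g l
    unfolding k by (rule V.concat_closed[OF _ \<psi>T_closed]) (use x y that in "auto simp: Pi_iff")
  have "W.cat (Suc k) (hk i x) (hk n y) =
      sumW k (\<lambda>g. W.cat (Suc k) (RP i g (x g)) (hk n y))"
    unfolding hk_def[of i] k
    by (rule hom_finprod[OF W.comm_group_pow W.comm_group_pow W.concat_hom1[OF hk_closed[OF y]]]) (use c1 in auto)
  also have "\<dots> = sumW k (\<lambda>g. sumW k (\<lambda>l.
      RP k (g \<otimes> l) (V.cat (Suc k) (x g) (\<psi>T (Suc n) g (y l)))))"
  proof (rule W.T.finprod_cong'[OF refl])
    fix g assume g: "g \<in> carrier G"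
    have "W.cat (Suc k) (RP i g (x g)) (hk n y) =
        sumW k (\<lambda>l. W.cat (Suc k) (RP i g (x g)) (RP n l (y l)))"
      unfolding hk_def k
      by (rule hom_finprod[OF W.comm_group_pow W.comm_group_pow W.concat_hom2[OF c1[OF g]]]) (use c2 in auto)
    also have "\<dots> = sumW k (\<lambda>l. RP k (g \<otimes> l) (V.cat (Suc k) (x g) (\<psi>T (Suc n) g (y l))))"
      by (intro W.T.finprod_cong'[OF refl] concat_RP[OF _ _ _ _ k]) (use g x y cF in "auto intro: RP_closed simp: Pi_iff")
    finally show "W.cat (Suc k) (RP i g (x g)) (hk n y) =
        sumW k (\<lambda>l. RP k (g \<otimes> l) (V.cat (Suc k) (x g) (\<psi>T (Suc n) g (y l))))" .
  qed (auto intro!: W.T.finprod_closed RP_closed cF)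
  also have "\<dots> = hk k (\<lambda>m. sumV k (\<lambda>g. V.cat (Suc k) (x g) (\<psi>T (Suc n) g (y (inv g \<otimes> m)))))"
    by (rule hk_convolution) (rule cF)
  finally show ?thesis .
qed

lemma left_B_hom: "x \<in> carrier (WP k) \<Longrightarrow> (\<lambda>b. Lw k b x) \<in> hom (add_monoid B) (WP k)"
  by (auto simp: hom_def W.left_closed W.power_left_add)

lemma right_B_hom: "x \<in> carrier (WP k) \<Longrightarrow> (\<lambda>b. Rw k b x) \<in> hom (add_monoid B) (WP k)"
  by (auto simp: hom_def W.right_closed W.power_right_add)

lemma B_decomp_prod: "x \<in> carrier B \<Longrightarrow> x = finprod (add_monoid B) (\<lambda>g. e (x g) g) (carrier G)"
  using B_decomp[of x] by (simp add: finsum_def)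

lemma hk_left:
  assumes b: "b \<in> carrier B" and y: "y \<in> carrier G \<rightarrow> carrier (VP k)"
  shows "Lw k b (hk k y) =
    hk k (\<lambda>m. sumV k (\<lambda>g. Lv k (b g) (\<psi>T (Suc k) g (y (inv g \<otimes> m)))))"
proof -
  have c2: "RP k g (y g) \<in> carrier (WP k)" if "g \<in> carrier G" for g using RP_closed y that by auto
  have cF: "Lv k (b g) (\<psi>T (Suc k) g (y l)) \<in> carrier (VP k)"
    if "g \<in> carrier G" "l \<in> carrier G" for g l
    by (rule V.left_closed[OF _ \<psi>T_closed]) (use b y that in "auto simp: Pi_iff")
  have "Lw k b (hk k y) = Lw k (finprod (add_monoid B) (\<lambda>g. e (b g) g) (carrier G)) (hk k y)"
    using B_decomp_prod[OF b] by simp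
  also have "\<dots> = sumW k (\<lambda>g. Lw k (e (b g) g) (hk k y))"
    by (rule hom_finprod[OF B.a_comm_group W.comm_group_pow left_B_hom[OF hk_closed[OF y]]]) (use b in auto)
  also have "\<dots> = sumW k (\<lambda>g. sumW k (\<lambda>l.
      RP k (g \<otimes> l) (Lv k (b g) (\<psi>T (Suc k) g (y l)))))"
  proof (rule W.T.finprod_cong'[OF refl])
    fix g assume g: "g \<in> carrier G"
    have "Lw k (e (b g) g) (hk k y) = sumW k (\<lambda>l. Lw k (e (b g) g) (RP k l (y l)))"
      unfolding hk_def
      by (rule hom_finprod[OF W.comm_group_pow W.comm_group_pow W.power_left_hom]) (use b g c2 in auto)
    also have "\<dots> = sumW k (\<lambda>l. RP k (g \<otimes> l) (Lv k (b g) (\<psi>T (Suc k) g (y l))))"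
      by (intro W.T.finprod_cong'[OF refl] left_RP) (use g b y cF in "auto intro: RP_closed simp: Pi_iff")
    finally show "Lw k (e (b g) g) (hk k y) =
        sumW k (\<lambda>l. RP k (g \<otimes> l) (Lv k (b g) (\<psi>T (Suc k) g (y l))))" .
  qed (auto intro!: W.T.finprod_closed RP_closed cF)
  also have "\<dots> = hk k (\<lambda>m. sumV k (\<lambda>g. Lv k (b g) (\<psi>T (Suc k) g (y (inv g \<otimes> m)))))"
    by (rule hk_convolution) (rule cF)
  finally show ?thesis .
qed

lemma hk_right:
  assumes b: "b \<in> carrier B" and x: "x \<in> carrier G \<rightarrow> carrier (VP k)"
  shows "Rw k b (hk k x) =
    hk k (\<lambda>m. sumV k (\<lambda>g. Rv k (\<phi> g (b (inv g \<otimes> m))) (x g)))"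
proof -
  have c2: "RP k g (x g) \<in> carrier (WP k)" if "g \<in> carrier G" for g using RP_closed x that by auto
  have cF: "Rv k (\<phi> g (b l)) (x g) \<in> carrier (VP k)"
    if "g \<in> carrier G" "l \<in> carrier G" for g l
    by (rule V.right_closed) (use b x that in "auto simp: Pi_iff")
  have "Rw k b (hk k x) = sumW k (\<lambda>g. Rw k b (RP k g (x g)))"
    unfolding hk_def
    by (rule hom_finprod[OF W.comm_group_pow W.comm_group_pow W.power_right_hom]) (use b c2 in auto)
  also have "\<dots> = sumW k (\<lambda>g. sumW k (\<lambda>l.
      RP k (g \<otimes> l) (Rv k (\<phi> g (b l)) (x g))))"
  proof (rule W.T.finprod_cong'[OF refl])
    fix g assume g: "g \<in> carrier G"
    have "Rw k b (RP k g (x g)) = Rw k (finprod (add_monoid B) (\<lambda>l. e (b l) l) (carrier G)) (RP k g (x g))"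
      using B_decomp_prod[OF b] by simp
    also have "\<dots> = sumW k (\<lambda>l. Rw k (e (b l) l) (RP k g (x g)))"
      by (rule hom_finprod[OF B.a_comm_group W.comm_group_pow right_B_hom[OF c2[OF g]]]) (use b in auto)
    also have "\<dots> = sumW k (\<lambda>l. RP k (g \<otimes> l) (Rv k (\<phi> g (b l)) (x g)))"
      by (intro W.T.finprod_cong'[OF refl] right_RP) (use g b x cF in "auto intro: RP_closed simp: Pi_iff")
    finally show "Rw k b (RP k g (x g)) =
        sumW k (\<lambda>l. RP k (g \<otimes> l) (Rv k (\<phi> g (b l)) (x g)))" .
  qed (auto intro!: W.T.finprod_closed RP_closed cF)
  also have "\<dots> = hk k (\<lambda>m. sumV k (\<lambda>g. Rv k (\<phi> g (b (inv g \<otimes> m))) (x g)))"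
    by (rule hk_convolution) (rule cF)
  finally show ?thesis .
qed

subsection \<open>Coordinates on tensor powers\<close>

text \<open>
  The coefficient at \<open>m\<close> of a word over \<open>W\<close> after all group elements have been moved to the right.
  For \<open>w # ws\<close>, expand \<open>w\<close> as the sum of its \<open>v g\<close>; moving \<open>g\<close> past the rest applies \<open>g\<close> to it and
  multiplies its group element by \<open>g\<close> on the left. Empty words do not occur in powers of positive
  degree.
\<close>

primrec wc :: "'w list \<Rightarrow> 'g \<Rightarrow> ('v list \<Rightarrow>\<^sub>0 int) set" where
  "wc [] m = undefined"
| "wc (w # ws) m = (if ws = [] then V.word (Suc 0) [cw w m]
    else finprod (V.pow (Suc (length ws))) (\<lambda>g. V.cat (Suc (length ws)) (V.word (Suc 0) [cw w g])
      (\<psi>T (length ws) g (wc ws (inv g \<otimes> m)))) (carrier G))"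

lemmas concat1_hom1 = V.concat_hom1[where i = "Suc 0", simplified]
lemmas concat1_hom2 = V.concat_hom2[where i = "Suc 0", simplified]
lemmas concat1_closed = V.concat_closed[where i = "Suc 0", simplified]
lemmas concat1_word = V.concat_word[where i = "Suc 0", simplified]

lemma word1_closed: "v \<in> carrier V \<Longrightarrow> V.word (Suc 0) [v] \<in> carrier (V.pow (Suc 0))"
  by (simp add: V.words_iff)

lemma wc_closed: "\<lbrakk>set ws \<subseteq> carrier W; ws \<noteq> []; m \<in> carrier G\<rbrakk> \<Longrightarrow> wc ws m \<in> carrier (V.pow (length ws))"
proof (induction ws arbitrary: m)
  case (Cons w ws)
  then show ?case
    by (auto intro!: word1_closed cw_apply V.T.finprod_closed concat1_closed \<psi>T_closed)
qed simp

lemma wc_term_closed: "\<lbrakk>v \<in> carrier V; set ws \<subseteq> carrier W; ws \<noteq> []; m \<in> carrier G; g \<in> carrier G\<rbrakk> \<Longrightarrow>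
    V.cat (Suc (length ws)) (V.word (Suc 0) [v]) (\<psi>T (length ws) g (wc ws m)) \<in> carrier (V.pow (Suc (length ws)))"
  by (rule concat1_closed[OF word1_closed \<psi>T_closed[OF _ wc_closed]])

lemma wc_add:
  "\<lbrakk>set us \<subseteq> carrier W; set ws \<subseteq> carrier W; v \<in> carrier W; w \<in> carrier W; m \<in> carrier G\<rbrakk> \<Longrightarrow>
    wc (us @ (v \<oplus>\<^bsub>W\<^esub> w) # ws) m = wc (us @ v # ws) m \<otimes>\<^bsub>V.pow (Suc (length us + length ws))\<^esub> wc (us @ w # ws) m"
proof (induction us arbitrary: m)
  case Nil
  show ?case
  proof (cases "ws = []")
    case True
    then show ?thesis using Nil V.word_add0[of "[]" "cw v m" "cw w m" "Suc 0"] by (simp add: cw_add cw_apply)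
  next
    case False
    let ?n = "length ws" let ?y = "\<lambda>g. \<psi>T (length ws) g (wc ws (inv g \<otimes> m))"
    let ?f = "\<lambda>v g. V.cat (Suc ?n) (V.word (Suc 0) [cw v g]) (?y g)"
    have yc: "?y g \<in> carrier (V.pow ?n)" if "g \<in> carrier G" for g
      using that Nil False by (auto intro!: \<psi>T_closed wc_closed)
    have fc: "?f v g \<in> carrier (V.pow (Suc ?n))" if "v \<in> carrier W" "g \<in> carrier G" for v g
      using that yc by (auto intro!: concat1_closed word1_closed cw_apply)
    have "finprod (V.pow (Suc ?n)) (?f (v \<oplus>\<^bsub>W\<^esub> w)) (carrier G) =
        finprod (V.pow (Suc ?n)) (\<lambda>g. ?f v g \<otimes>\<^bsub>V.pow (Suc ?n)\<^esub> ?f w g) (carrier G)"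
    proof (rule V.T.finprod_cong'[OF refl])
      fix g assume g: "g \<in> carrier G"
      have "V.word (Suc 0) [cw (v \<oplus>\<^bsub>W\<^esub> w) g] = V.word (Suc 0) [cw v g] \<otimes>\<^bsub>V.pow (Suc 0)\<^esub> V.word (Suc 0) [cw w g]"
        using V.word_add0[of "[]" "cw v g" "cw w g" "Suc 0"] Nil g by (simp add: cw_add cw_apply)
      then show "?f (v \<oplus>\<^bsub>W\<^esub> w) g = ?f v g \<otimes>\<^bsub>V.pow (Suc ?n)\<^esub> ?f w g"
        using hom_mult[OF concat1_hom1[OF yc[OF g]]] Nil g by (simp add: word1_closed cw_apply)
    qed (use fc Nil in auto)
    also have "\<dots> = finprod (V.pow (Suc ?n)) (?f v) (carrier G) \<otimes>\<^bsub>V.pow (Suc ?n)\<^esub> finprod (V.pow (Suc ?n)) (?f w) (carrier G)"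
      by (rule V.T.finprod_multf) (use fc Nil in auto)
    finally show ?thesis using False by simp
  qed
next
  case (Cons u us)
  let ?n = "Suc (length us + length ws)"
  let ?f = "\<lambda>x g. V.cat (Suc ?n) (V.word (Suc 0) [cw u g]) (\<psi>T ?n g (wc (us @ x # ws) (inv g \<otimes> m)))"
  have wcc: "wc (us @ x # ws) m' \<in> carrier (V.pow ?n)" if "x \<in> carrier W" "m' \<in> carrier G" for x m'
    using wc_closed[of "us @ x # ws" m'] that Cons.prems by simp
  have fc: "?f x g \<in> carrier (V.pow (Suc ?n))" if "x \<in> carrier W" "g \<in> carrier G" for x g
    using that Cons.prems by (intro concat1_closed word1_closed cw_apply \<psi>T_closed wcc) auto
  have "finprod (V.pow (Suc ?n)) (?f (v \<oplus>\<^bsub>W\<^esub> w)) (carrier G) =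
      finprod (V.pow (Suc ?n)) (\<lambda>g. ?f v g \<otimes>\<^bsub>V.pow (Suc ?n)\<^esub> ?f w g) (carrier G)"
  proof (rule V.T.finprod_cong'[OF refl])
    fix g assume g: "g \<in> carrier G"
    let ?m = "inv g \<otimes> m"
    have m: "?m \<in> carrier G" using g Cons.prems by simp
    have "wc (us @ (v \<oplus>\<^bsub>W\<^esub> w) # ws) ?m = wc (us @ v # ws) ?m \<otimes>\<^bsub>V.pow ?n\<^esub> wc (us @ w # ws) ?m"
      by (rule Cons.IH) (use Cons.prems m in auto)
    then show "?f (v \<oplus>\<^bsub>W\<^esub> w) g = ?f v g \<otimes>\<^bsub>V.pow (Suc ?n)\<^esub> ?f w g"
      using hom_mult[OF \<psi>T_hom[OF g] wcc[OF Cons.prems(3) m] wcc[OF Cons.prems(4) m]] Cons.prems g m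
        hom_mult[OF concat1_hom2[OF word1_closed[OF cw_apply[of u g]]] \<psi>T_closed[OF g wcc[OF Cons.prems(3) m]] \<psi>T_closed[OF g wcc[OF Cons.prems(4) m]]]
      by simp
  qed (use fc Cons.prems in auto)
  also have "\<dots> = finprod (V.pow (Suc ?n)) (?f v) (carrier G) \<otimes>\<^bsub>V.pow (Suc ?n)\<^esub> finprod (V.pow (Suc ?n)) (?f w) (carrier G)"
    by (rule V.T.finprod_multf) (use fc Cons.prems in auto)
  finally show ?case by simp
qed

text \<open>
  Left multiplication by \<open>a l\<close> acts on the coordinates of the first factor, where it shifts the
  summation index by \<open>l\<close>.
\<close>

lemma wc_left:
  assumes w: "w \<in> carrier W" and ws: "set ws \<subseteq> carrier W" and a: "a \<in> carrier A" and l: "l \<in> carrier G" and m: "m \<in> carrier G"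
  shows "wc (left_act W (e a l) w # ws) m =
    power_left A V (Suc (length ws)) a (\<psi>T (Suc (length ws)) l (wc (w # ws) (inv l \<otimes> m)))"
proof (cases "ws = []")
  case True
  have c: "cw w (inv l \<otimes> m) \<in> carrier V" using assms cw_apply by simp
  then show ?thesis using True assms V.power_left_word[of a "\<psi> l (cw w (inv l \<otimes> m))" "[]" 0]
    by (simp add: cw_left \<psi>T_word V.words_iff \<psi>_closed)
next
  case False
  then obtain n where n: "length ws = Suc n" by (cases ws) auto
  let ?V = "V.pow (Suc (Suc n))"
  let ?y = "\<lambda>g. wc ws (inv g \<otimes> m)"
  let ?f = "\<lambda>w m g. V.cat (Suc (Suc n)) (V.word (Suc 0) [cw w g]) (\<psi>T (Suc n) g (wc ws (inv g \<otimes> m)))"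
  have fc: "?f w m g \<in> carrier ?V" if "w \<in> carrier W" "m \<in> carrier G" "g \<in> carrier G" for w m g
    using wc_term_closed[of "cw w g" ws "inv g \<otimes> m" g] that ws False cw_apply n by simp
  have img: "(\<lambda>g. l \<otimes> g) ` carrier G = carrier G" "inj_on (\<lambda>g. l \<otimes> g) (carrier G)"
    using bij_left[OF l] by (auto simp: bij_betw_def)
  let ?lw = "left_act W (e a l) w"
  have lw: "?lw \<in> carrier W" using w a by simp
  have h: "(\<lambda>x. power_left A V (Suc (Suc n)) a (\<psi>T (Suc (Suc n)) l x)) \<in> hom ?V ?V"
    by (rule V.hom_comp[OF \<psi>T_hom[OF l] V.power_left_hom[OF a]])
  have "wc (?lw # ws) m = finprod ?V (?f ?lw m) ((\<lambda>g. l \<otimes> g) ` carrier G)"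
    using False n img(1) by simp
  also have "\<dots> = finprod ?V (\<lambda>g. ?f ?lw m (l \<otimes> g)) (carrier G)"
    by (rule V.T.finprod_reindex[OF _ img(2)]) (use fc lw m l in auto)
  also have "\<dots> = finprod ?V (\<lambda>g. power_left A V (Suc (Suc n)) a (\<psi>T (Suc (Suc n)) l (?f w (inv l \<otimes> m) g))) (carrier G)"
  proof (rule V.T.finprod_cong'[OF refl])
    show "(\<lambda>g. power_left A V (Suc (Suc n)) a (\<psi>T (Suc (Suc n)) l (?f w (inv l \<otimes> m) g))) \<in> carrier G \<rightarrow> carrier ?V"
      using fc w l m by (auto intro!: hom_in_carrier[OF h])
    fix g assume g: "g \<in> carrier G"
    let ?z = "wc ws (inv g \<otimes> (inv l \<otimes> m))"
    have z: "?z \<in> carrier (V.pow (Suc n))" using wc_closed[OF ws False, of "inv g \<otimes> (inv l \<otimes> m)"] g l m n by simp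
    have v: "cw w g \<in> carrier V" using w g by (rule cw_apply)
    have 1: "\<psi>T (Suc (Suc n)) l (?f w (inv l \<otimes> m) g) =
        V.cat (Suc (Suc n)) (V.word (Suc 0) [\<psi> l (cw w g)]) (\<psi>T (Suc n) l (\<psi>T (Suc n) g ?z))"
      using \<psi>T_concat[OF l word1_closed[OF v] \<psi>T_closed[OF g z]] v l by (simp add: \<psi>T_word V.words_iff)
    have 2: "power_left A V (Suc (Suc n)) a (V.cat (Suc (Suc n)) (V.word (Suc 0) [\<psi> l (cw w g)]) (\<psi>T (Suc n) l (\<psi>T (Suc n) g ?z))) =
        V.cat (Suc (Suc n)) (V.word (Suc 0) [left_act V a (\<psi> l (cw w g))]) (\<psi>T (Suc n) l (\<psi>T (Suc n) g ?z))"
      using V.concat_left[OF a word1_closed[OF \<psi>_closed[OF l v]] \<psi>T_closed[OF l \<psi>T_closed[OF g z]]]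
        V.power_left_word[of a "\<psi> l (cw w g)" "[]" 0] a v l by (simp add: \<psi>_closed)
    have 3: "wc ws (inv (l \<otimes> g) \<otimes> m) = ?z" using l g m by (simp add: G.inv_mult_group G.m_assoc)
    have 4: "cw ?lw (l \<otimes> g) = left_act V a (\<psi> l (cw w g))"
      using w a l g by (simp add: cw_left G.group_cancel_left)
    show "?f ?lw m (l \<otimes> g) = power_left A V (Suc (Suc n)) a (\<psi>T (Suc (Suc n)) l (?f w (inv l \<otimes> m) g))"
      unfolding 1 2 3 4 \<psi>T_mult[OF z l g] ..
  qed
  also have "\<dots> = power_left A V (Suc (Suc n)) a (\<psi>T (Suc (Suc n)) l (finprod ?V (?f w (inv l \<otimes> m)) (carrier G)))"
    by (rule hom_finprod[OF V.comm_group_pow V.comm_group_pow h, symmetric]) (use fc w l m in auto)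
  also have "\<dots> = power_left A V (Suc (length ws)) a (\<psi>T (Suc (length ws)) l (wc (w # ws) (inv l \<otimes> m)))"
    using False n by simp
  finally show ?thesis .
qed

text \<open>
  Balancedness at the first factor: for a monomial \<open>a l\<close>, acting on \<open>v\<close> from the right shifts the
  coordinates of \<open>v\<close> by \<open>l\<close>, and this shift is absorbed by reindexing the sum.
\<close>

lemma wc_balanced0:
  assumes v: "v \<in> carrier W" and w: "w \<in> carrier W" and ws: "set ws \<subseteq> carrier W" and b: "b \<in> carrier B" and m: "m \<in> carrier G"
  shows "wc (right_act W v b # w # ws) m = wc (v # left_act W b w # ws) m"
  using b
proof (induction rule: B_induct)
  case (e a l)
  let ?n = "Suc (length ws)" let ?V = "V.pow (Suc ?n)"
  let ?f = "\<lambda>v w g. V.cat (Suc ?n) (V.word (Suc 0) [cw v g]) (\<psi>T ?n g (wc (w # ws) (inv g \<otimes> m)))"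
  have fc: "?f v w g \<in> carrier ?V" if "v \<in> carrier W" "w \<in> carrier W" "g \<in> carrier G" for v w g
    using wc_term_closed[of "cw v g" "w # ws" "inv g \<otimes> m" g] that ws cw_apply m by simp
  have img: "(\<lambda>g. g \<otimes> l) ` carrier G = carrier G" "inj_on (\<lambda>g. g \<otimes> l) (carrier G)"
    using bij_right[OF e(2)] by (auto simp: bij_betw_def)
  have "wc (right_act W v (e a l) # w # ws) m = finprod ?V (?f (right_act W v (e a l)) w) ((\<lambda>g. g \<otimes> l) ` carrier G)"
    using img(1) by simp
  also have "\<dots> = finprod ?V (\<lambda>g. ?f (right_act W v (e a l)) w (g \<otimes> l)) (carrier G)"
    by (rule V.T.finprod_reindex[OF _ img(2)]) (use fc v w e in auto)
  also have "\<dots> = finprod ?V (?f v (left_act W (e a l) w)) (carrier G)"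
  proof (rule V.T.finprod_cong'[OF refl])
    fix g assume g: "g \<in> carrier G"
    let ?z = "wc (w # ws) (inv l \<otimes> (inv g \<otimes> m))"
    have z: "?z \<in> carrier (V.pow ?n)"
      using wc_closed[of "w # ws" "inv l \<otimes> (inv g \<otimes> m)"] w ws e g m by (simp del: wc.simps)
    have vg: "cw v g \<in> carrier V" using v g by (rule cw_apply)
    have 1: "cw (right_act W v (e a l)) (g \<otimes> l) = right_act V (cw v g) (\<phi> g a)"
      using v e g by (simp add: cw_right G.m_assoc)
    have 2: "wc (w # ws) (inv (g \<otimes> l) \<otimes> m) = ?z"
      using e g m by (simp add: G.inv_mult_group G.m_assoc del: wc.simps)
    have 3: "wc (left_act W (e a l) w # ws) (inv g \<otimes> m) = power_left A V ?n a (\<psi>T ?n l ?z)"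
      by (rule wc_left) (use w ws e g m in auto)
    have 4: "\<psi>T ?n g (power_left A V ?n a (\<psi>T ?n l ?z)) = power_left A V ?n (\<phi> g a) (\<psi>T ?n (g \<otimes> l) ?z)"
      using e g z by (simp add: \<psi>T_left \<psi>T_closed \<psi>T_mult del: wc.simps)
    have 5: "V.word (Suc 0) [right_act V (cw v g) (\<phi> g a)] = power_right A V (Suc 0) (\<phi> g a) (V.word (Suc 0) [cw v g])"
      using V.power_right_word[of "\<phi> g a" "cw v g" "[]" 0] vg e g by simp
    have 6: "V.cat (Suc ?n) (power_right A V (Suc 0) (\<phi> g a) (V.word (Suc 0) [cw v g])) (\<psi>T ?n (g \<otimes> l) ?z) =
        V.cat (Suc ?n) (V.word (Suc 0) [cw v g]) (power_left A V ?n (\<phi> g a) (\<psi>T ?n (g \<otimes> l) ?z))"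
      using V.concat_right_left[OF _ word1_closed[OF vg] \<psi>T_closed[OF _ z], of "\<phi> g a" "g \<otimes> l"] e g by (simp del: wc.simps)
    show "?f (right_act W v (e a l)) w (g \<otimes> l) = ?f v (left_act W (e a l) w) g"
      unfolding 1 2 3 4 5 6 ..
  qed (use fc v w e in auto)
  also have "\<dots> = wc (v # left_act W (e a l) w # ws) m" by simp
  finally show ?case .
next
  case (add b b')
  have "wc (right_act W v (b \<oplus>\<^bsub>B\<^esub> b') # w # ws) m =
      wc (right_act W v b # w # ws) m \<otimes>\<^bsub>V.pow (Suc (Suc (length ws)))\<^esub> wc (right_act W v b' # w # ws) m"
    using wc_add[of "[]" "w # ws" "right_act W v b" "right_act W v b'" m] add v w ws m
    by (simp add: W.r_add2 del: wc.simps)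
  also have "\<dots> = wc (v # left_act W (b \<oplus>\<^bsub>B\<^esub> b') w # ws) m"
    using wc_add[of "[v]" ws "left_act W b w" "left_act W b' w" m] add v w ws m
    by (simp add: W.l_add1 del: wc.simps)
  finally show ?case .
qed

lemma wc_balanced:
  "\<lbrakk>set us \<subseteq> carrier W; set ws \<subseteq> carrier W; v \<in> carrier W; w \<in> carrier W; b \<in> carrier B; m \<in> carrier G\<rbrakk> \<Longrightarrow>
    wc (us @ right_act W v b # w # ws) m = wc (us @ v # left_act W b w # ws) m"
proof (induction us arbitrary: m)
  case Nil
  then show ?case using wc_balanced0[of v w ws b m] by (simp del: wc.simps)
next
  case (Cons u us)
  let ?n = "Suc (Suc (length us + length ws))"
  let ?y = "us @ v # left_act W b w # ws"
  have "finprod (V.pow (Suc ?n)) (\<lambda>g. V.cat (Suc ?n) (V.word (Suc 0) [cw u g])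
        (\<psi>T ?n g (wc (us @ right_act W v b # w # ws) (inv g \<otimes> m)))) (carrier G) =
      finprod (V.pow (Suc ?n)) (\<lambda>g. V.cat (Suc ?n) (V.word (Suc 0) [cw u g])
        (\<psi>T ?n g (wc ?y (inv g \<otimes> m)))) (carrier G)"
    by (rule V.T.finprod_cong') (use Cons wc_term_closed[of _ ?y] cw_apply in "auto simp del: wc.simps")
  then show ?case by simp
qed

text \<open>
  The inverse of \<open>hk\<close>; see \<open>\<Psi>_hk\<close> and \<open>hk_\<Psi>\<close>.
\<close>

definition \<Psi> where "\<Psi> k m = pres_lift (VP k) (\<lambda>ws. wc ws m)"

lemma
  assumes m: "m \<in> carrier G"
  shows \<Psi>_hom: "\<Psi> k m \<in> hom (WP k) (VP k)"
    and \<Psi>_word: "ws \<in> words W (Suc k) \<Longrightarrow> \<Psi> k m (W.word (Suc k) ws) = wc ws m"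
proof -
  have F: "W.multilinear (Suc k) (VP k) (\<lambda>ws. wc ws m)"
  proof (rule W.multilinearI, goal_cases)
    case (1 vs)
    then show ?case using wc_closed[of vs m] m by (cases "vs = []") (auto simp: W.words_iff simp del: wc.simps)
  next
    case (2 us v w ws)
    then show ?case using wc_add[of us ws v w m] m by simp
  next
    case (3 us v b w ws)
    then show ?case using wc_balanced[of us ws v w b m] m by simp
  qed
  show "\<Psi> k m \<in> hom (WP k) (VP k)"
    unfolding \<Psi>_def by (rule W.power_lift_hom[OF V.comm_group_pow F])
  show "ws \<in> words W (Suc k) \<Longrightarrow> \<Psi> k m (W.word (Suc k) ws) = wc ws m"
    unfolding \<Psi>_def by (rule W.power_lift_word[OF V.comm_group_pow F])
qed

lemma \<Psi>_closed: "m \<in> carrier G \<Longrightarrow> x \<in> carrier (WP k) \<Longrightarrow> \<Psi> k m x \<in> carrier (VP k)"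
  using hom_in_carrier[OF \<Psi>_hom] .

lemma word_zero: "V.word (Suc 0) [\<zero>\<^bsub>V\<^esub>] = \<one>\<^bsub>V.pow (Suc 0)\<^esub>"
proof -
  have "V.word (Suc 0) [\<zero>\<^bsub>V\<^esub>] = V.word (Suc 0) [\<zero>\<^bsub>V\<^esub>] \<otimes>\<^bsub>V.pow (Suc 0)\<^esub> V.word (Suc 0) [\<zero>\<^bsub>V\<^esub>]"
    using V.word_add0[of "[]" "\<zero>\<^bsub>V\<^esub>" "\<zero>\<^bsub>V\<^esub>" "Suc 0"] by simp
  then show ?thesis using word1_closed[of "\<zero>\<^bsub>V\<^esub>"] by (simp add: V.T.l_cancel_one')
qed

lemma finprod_pow_single:
  assumes "i \<in> carrier G" "f i \<in> carrier (V.pow k)" "\<And>l. l \<in> carrier G \<Longrightarrow> l \<noteq> i \<Longrightarrow> f l = \<one>\<^bsub>V.pow k\<^esub>"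
  shows "finprod (V.pow k) f (carrier G) = f i"
proof -
  have "f l \<in> carrier (V.pow k)" if "l \<in> carrier G" for l using assms that by (cases "l = i") auto
  then have "finprod (V.pow k) f (carrier G) = finprod (V.pow k) f {i}"
    by (intro V.T.finprod_mono_neutral_cong_right) (use assms finite_G in auto)
  then show ?thesis using assms by simp
qed

text \<open>
  Words \<open>j u \<otimes> \<dots> \<otimes> (j v \<cdot> g)\<close> have their group element at the right end already.
\<close>

lemma wc_image:
  "\<lbrakk>set us \<subseteq> carrier V; v \<in> carrier V; g \<in> carrier G; m \<in> carrier G\<rbrakk> \<Longrightarrow>
    wc (map j us @ [J v g]) m =
      (if m = g then V.word (Suc (length us)) (us @ [v]) else \<one>\<^bsub>V.pow (Suc (length us))\<^esub>)"
proof (induction us arbitrary: m)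
  case Nil
  then show ?case by (simp add: cw_J word_zero)
next
  case (Cons u us)
  let ?n = "Suc (length us)"
  let ?f = "\<lambda>g'. V.cat (Suc ?n) (V.word (Suc 0) [cw (j u) g']) (\<psi>T ?n g' (wc (map j us @ [J v g]) (inv g' \<otimes> m)))"
  have cu: "cw (j u) g' = (if g' = \<one> then u else \<zero>\<^bsub>V\<^esub>)" if "g' \<in> carrier G" for g'
    using cw_J[of u "\<one>" g'] Cons.prems that by (simp add: J_one)
  have wcc: "wc (map j us @ [J v g]) m' \<in> carrier (V.pow ?n)" if "m' \<in> carrier G" for m'
    using wc_closed[of "map j us @ [J v g]" m'] that Cons.prems j_image[of us] by simp
  have "finprod (V.pow (Suc ?n)) ?f (carrier G) = ?f \<one>"
  proof (rule finprod_pow_single)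
    show "?f \<one> \<in> carrier (V.pow (Suc ?n))"
      using Cons.prems cu by (intro concat1_closed word1_closed \<psi>T_closed wcc) auto
    fix l assume l: "l \<in> carrier G" "l \<noteq> \<one>"
    have y: "\<psi>T ?n l (wc (map j us @ [J v g]) (inv l \<otimes> m)) \<in> carrier (V.pow ?n)"
      using l Cons.prems by (intro \<psi>T_closed wcc) auto
    show "?f l = \<one>\<^bsub>V.pow (Suc ?n)\<^esub>"
      using hom_one[OF concat1_hom1[OF y] V.T.is_group V.T.is_group] cu[OF l(1)] l(2) by (simp add: word_zero)
  qed simp
  also have "\<dots> = V.cat (Suc ?n) (V.word (Suc 0) [u]) (wc (map j us @ [J v g]) m)"
    using Cons.prems cu[OF G.one_closed] \<psi>T_one[OF wcc[of m]] by simp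
  also have "\<dots> = (if m = g then V.word (Suc ?n) (u # us @ [v]) else \<one>\<^bsub>V.pow (Suc ?n)\<^esub>)"
    using Cons hom_one[OF concat1_hom2[OF word1_closed[of u]] V.T.is_group V.T.is_group, of ?n] concat1_word[of "[u]" "us @ [v]" ?n]
    by (simp add: V.words_iff)
  finally show ?case by simp
qed

lemma \<Psi>_RP:
  assumes g: "g \<in> carrier G" and m: "m \<in> carrier G" and x: "x \<in> carrier (VP k)"
  shows "\<Psi> k m (RP k g x) = (if m = g then x else \<one>\<^bsub>VP k\<^esub>)"
proof (rule V.word_hom_eq[OF V.T.is_group V.hom_comp[OF RP_hom \<Psi>_hom[OF m]], where b = "\<lambda>x. if m = g then x else \<one>\<^bsub>VP k\<^esub>"])
  fix vs assume vs: "set vs \<subseteq> carrier V" "length vs = Suc k"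
  then obtain us v where v: "vs = us @ [v]" "length us = k" using V.nonempty_snoc by blast
  have "RP k g (V.word (Suc k) vs) = W.word (Suc k) (map j us @ [J v g])"
    using vs v j_image[of us] by (simp add: \<Phi>_word V.words_iff W.power_right_word)
  then show "\<Psi> k m (RP k g (V.word (Suc k) vs)) = (if m = g then V.word (Suc k) vs else \<one>\<^bsub>VP k\<^esub>)"
    using wc_image[of us v g m] vs v g m j_image[of us] by (simp add: \<Psi>_word W.words_iff)
qed (use x in "auto simp: hom_def")

lemma \<Psi>_hk:
  assumes m: "m \<in> carrier G" and x: "x \<in> carrier G \<rightarrow> carrier (VP k)"
  shows "\<Psi> k m (hk k x) = x m"
proof -
  have xc: "x g \<in> carrier (VP k)" if "g \<in> carrier G" for g using x that by auto
  have "\<Psi> k m (hk k x) = sumV k (\<lambda>g. \<Psi> k m (RP k g (x g)))"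
    unfolding hk_def by (rule hom_finprod[OF W.comm_group_pow V.comm_group_pow \<Psi>_hom[OF m]]) (use xc RP_closed in auto)
  also have "\<dots> = \<Psi> k m (RP k m (x m))"
    by (rule finprod_pow_single[OF m]) (use m xc \<Psi>_RP in auto)
  finally show ?thesis using m xc \<Psi>_RP by simp
qed

lemma hk_hom:
  assumes "\<And>m. m \<in> carrier G \<Longrightarrow> f m \<in> hom M (VP k)"
  shows "(\<lambda>x. hk k (\<lambda>m. f m x)) \<in> hom M (WP k)"
proof (rule homI)
  have fc: "f m x \<in> carrier (VP k)" if "m \<in> carrier G" "x \<in> carrier M" for m x
    using hom_in_carrier[OF assms[OF that(1)] that(2)] .
  show "hk k (\<lambda>m. f m x) \<in> carrier (WP k)" if "x \<in> carrier M" for x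
    by (rule hk_closed) (use fc that in auto)
  fix x y assume x: "x \<in> carrier M" "y \<in> carrier M"
  have "hk k (\<lambda>m. f m (x \<otimes>\<^bsub>M\<^esub> y)) = sumW k (\<lambda>m. RP k m (f m x) \<otimes>\<^bsub>WP k\<^esub> RP k m (f m y))"
    unfolding hk_def
    by (rule W.T.finprod_cong') (use x fc RP_closed hom_mult[OF assms] hom_mult[OF RP_hom] in auto)
  also have "\<dots> = hk k (\<lambda>m. f m x) \<otimes>\<^bsub>WP k\<^esub> hk k (\<lambda>m. f m y)"
    unfolding hk_def by (rule W.T.finprod_multf) (use x fc RP_closed in auto)
  finally show "hk k (\<lambda>m. f m (x \<otimes>\<^bsub>M\<^esub> y)) = hk k (\<lambda>m. f m x) \<otimes>\<^bsub>WP k\<^esub> hk k (\<lambda>m. f m y)" .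
qed

text \<open>
  By induction on the word: \<open>hk_concat\<close> undoes the recursive step in the definition of \<open>wc\<close>.
\<close>

lemma hk_wc:
  "\<lbrakk>set ws \<subseteq> carrier W; length ws = Suc k\<rbrakk> \<Longrightarrow> hk k (wc ws) = W.word (Suc k) ws"
proof (induction ws arbitrary: k)
  case (Cons w ws)
  have w: "w \<in> carrier W" "set ws \<subseteq> carrier W" "length ws = k" using Cons.prems by auto
  have c1: "cw w g \<in> carrier V" if "g \<in> carrier G" for g using w that by (simp add: cw_apply)
  have single: "hk 0 (\<lambda>g. V.word (Suc 0) [cw w g]) = W.word (Suc 0) [w]"
  proof -
    have h: "(\<lambda>w. W.word (Suc 0) [w]) \<in> hom (add_monoid W) (W.pow (Suc 0))"
      using W.word_add0[of "[]"] by (auto simp: hom_def W.words_iff)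
    have "hk 0 (\<lambda>g. V.word (Suc 0) [cw w g]) = finprod (W.pow (Suc 0)) (\<lambda>g. W.word (Suc 0) [J (cw w g) g]) (carrier G)"
      unfolding hk_def
    proof (rule W.T.finprod_cong'[OF refl])
      fix g assume g: "g \<in> carrier G"
      show "RP 0 g (V.word (Suc 0) [cw w g]) = W.word (Suc 0) [J (cw w g) g]"
        using c1[OF g] W.power_right_word[of "\<upsilon> g" "j (cw w g)" "[]" 0] by (simp add: \<Phi>_word V.words_iff)
    qed (use c1 in "auto simp: W.words_iff")
    also have "\<dots> = W.word (Suc 0) [finprod (add_monoid W) (\<lambda>g. J (cw w g) g) (carrier G)]"
      by (rule hom_finprod[OF W.V.a_comm_group W.comm_group_pow h, symmetric]) (use c1 in auto)
    also have "\<dots> = W.word (Suc 0) [w]" using cw_sum[OF w(1)] by (simp add: finsum_def)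
    finally show ?thesis .
  qed
  show ?case
  proof (cases "ws = []")
    case True
    have "hk 0 (wc [w]) = hk 0 (\<lambda>g. V.word (Suc 0) [cw w g])" by (simp add: hk_def)
    then show ?thesis using True single w by simp
  next
    case False
    then obtain n where n: "length ws = Suc n" by (cases ws) auto
    have k: "k = Suc n" using n w by simp
    have "hk (Suc n) (wc (w # ws)) = hk (Suc n) (\<lambda>m. finprod (V.pow (Suc (Suc n))) (\<lambda>g.
        V.cat (Suc (Suc n)) (V.word (Suc 0) [cw w g]) (\<psi>T (Suc n) g (wc ws (inv g \<otimes> m)))) (carrier G))"
      using False n by (simp add: hk_def)
    also have "\<dots> = W.cat (Suc (Suc n)) (hk 0 (\<lambda>g. V.word (Suc 0) [cw w g])) (hk n (wc ws))"
      by (rule hk_concat[symmetric]) (use c1 w False n wc_closed[OF w(2) False] word1_closed in auto)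
    also have "\<dots> = W.cat (Suc (Suc n)) (W.word (Suc 0) [w]) (W.word (Suc n) ws)"
      unfolding single using Cons.IH[OF w(2) n] by simp
    also have "\<dots> = W.word (Suc (Suc n)) (w # ws)"
      using W.concat_word[of "[w]" "Suc 0" ws "Suc n"] w n by (simp add: W.words_iff)
    finally show ?thesis unfolding k .
  qed
qed simp

lemma hk_\<Psi>:
  assumes "y \<in> carrier (WP k)" shows "hk k (\<lambda>m. \<Psi> k m y) = y"
proof (rule W.word_hom_eq[OF W.T.is_group hk_hom[OF \<Psi>_hom], where b = "\<lambda>y. y"])
  fix ws assume ws: "set ws \<subseteq> carrier W" "length ws = Suc k"
  have "hk k (\<lambda>m. \<Psi> k m (W.word (Suc k) ws)) = hk k (wc ws)"
    unfolding hk_def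
  proof (rule W.T.finprod_cong'[OF refl])
    have "ws \<noteq> []" using ws by auto
    then show "(\<lambda>g. RP k g (wc ws g)) \<in> carrier G \<rightarrow> carrier (WP k)"
      using ws wc_closed[OF ws(1)] by (auto intro: RP_closed)
  qed (use ws in "simp add: \<Psi>_word W.words_iff")
  then show "hk k (\<lambda>m. \<Psi> k m (W.word (Suc k) ws)) = W.word (Suc k) ws" using hk_wc[OF ws] by simp
qed (use assms in "auto simp: hom_def")

end

section \<open>The tensor algebra of the skew bimodule\<close>

context bimodule_over
begin

abbreviation TA where "TA \<equiv> tensor_algebra A V"

lemma TA_carrier:
  "x \<in> carrier TA \<longleftrightarrow> fst x \<in> carrier A \<and> snd x \<in> (\<Pi>\<^sub>E k\<in>{1..}. carrier (pow k)) \<and>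
    (\<exists>N. \<forall>k>N. snd x k = \<one>\<^bsub>pow k\<^esub>)"
proof -
  have "finite {k \<in> {1..}. f k \<noteq> \<one>\<^bsub>pow k\<^esub>} \<longleftrightarrow> (\<exists>N. \<forall>k>N. f k = \<one>\<^bsub>pow k\<^esub>)" for f
  proof -
    have "(\<forall>n\<in>{k \<in> {1..}. f k \<noteq> \<one>\<^bsub>pow k\<^esub>}. n \<le> N) \<longleftrightarrow> (\<forall>k>N. f k = \<one>\<^bsub>pow k\<^esub>)" for N
    proof
      assume l: "\<forall>n\<in>{k \<in> {1..}. f k \<noteq> \<one>\<^bsub>pow k\<^esub>}. n \<le> N"
      show "\<forall>k>N. f k = \<one>\<^bsub>pow k\<^esub>"
      proof (intro allI impI, rule ccontr)
        fix k assume "N < k" "f k \<noteq> \<one>\<^bsub>pow k\<^esub>"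
        then show False using l[rule_format, of k] by simp
      qed
    next
      assume r: "\<forall>k>N. f k = \<one>\<^bsub>pow k\<^esub>"
      show "\<forall>n\<in>{k \<in> {1..}. f k \<noteq> \<one>\<^bsub>pow k\<^esub>}. n \<le> N"
      proof (intro ballI, rule ccontr)
        fix n assume "n \<in> {k \<in> {1..}. f k \<noteq> \<one>\<^bsub>pow k\<^esub>}" "\<not> n \<le> N"
        then show False using r[rule_format, of n] by simp
      qed
    qed
    then show ?thesis unfolding finite_nat_set_iff_bounded_le by (simp only:)
  qed
  then show ?thesis
    by (simp add: tensor_algebra_def positive_part_def carrier_sum_group T.is_group mem_Times_iff)
qed

lemma TA_simps:
  "\<zero>\<^bsub>TA\<^esub> = (\<zero>\<^bsub>A\<^esub>, \<lambda>k\<in>{1..}. \<one>\<^bsub>pow k\<^esub>)" "\<one>\<^bsub>TA\<^esub> = (\<one>\<^bsub>A\<^esub>, \<lambda>k\<in>{1..}. \<one>\<^bsub>pow k\<^esub>)"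
  "x \<oplus>\<^bsub>TA\<^esub> y = (fst x \<oplus>\<^bsub>A\<^esub> fst y, \<lambda>k\<in>{1..}. snd x k \<otimes>\<^bsub>pow k\<^esub> snd y k)"
  "c \<odot>\<^bsub>TA\<^esub> x = (c \<odot>\<^bsub>A\<^esub> fst x, \<lambda>k\<in>{1..}. power_left A V k (c \<odot>\<^bsub>A\<^esub> \<one>\<^bsub>A\<^esub>) (snd x k))"
  by (simp_all add: tensor_algebra_def positive_part_def case_prod_beta)

lemma TA_fst [simp]: "x \<in> carrier TA \<Longrightarrow> fst x \<in> carrier A"
  and TA_snd [simp]: "x \<in> carrier TA \<Longrightarrow> snd x (Suc k) \<in> carrier (pow (Suc k))"
  by (auto simp: TA_carrier PiE_iff)

lemma TA_snd': "x \<in> carrier TA \<Longrightarrow> 0 < k \<Longrightarrow> snd x k \<in> carrier (pow k)"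
  by (auto simp: TA_carrier PiE_iff)

lemma TA_eqI:
  assumes "x \<in> carrier TA" "y \<in> carrier TA" "fst x = fst y" "\<And>k. snd x (Suc k) = snd y (Suc k)"
  shows "x = y"
proof (rule prod_eqI[OF assms(3)], rule PiE_ext)
  show "snd x \<in> (\<Pi>\<^sub>E k\<in>{1..}. carrier (pow k))" using assms(1) unfolding TA_carrier by (elim conjE)
  show "snd y \<in> (\<Pi>\<^sub>E k\<in>{1..}. carrier (pow k))" using assms(2) unfolding TA_carrier by (elim conjE)
  show "snd x k = snd y k" if "k \<in> {1..}" for k using assms(4)[of "k - 1"] that by simp
qed

lemma TA_mult_snd:
  "snd (x \<otimes>\<^bsub>TA\<^esub> y) (Suc k) = lft k (fst x) (snd y (Suc k)) \<otimes>\<^bsub>pow (Suc k)\<^esub>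
    rgt k (fst y) (snd x (Suc k)) \<otimes>\<^bsub>pow (Suc k)\<^esub>
    finprod (pow (Suc k)) (\<lambda>i. cat (Suc k) (snd x i) (snd y (Suc k - i))) {1..<Suc k}"
  by (simp add: tensor_algebra_def case_prod_beta)

lemma TA_mult_fst: "fst (x \<otimes>\<^bsub>TA\<^esub> y) = fst x \<otimes>\<^bsub>A\<^esub> fst y"
  by (simp add: tensor_algebra_def case_prod_beta)

lemma TA_concat_closed:
  assumes "x \<in> carrier TA" "y \<in> carrier TA" "i \<in> {1..<Suc k}"
  shows "cat (Suc k) (snd x i) (snd y (Suc k - i)) \<in> carrier (pow (Suc k))"
  using concat_closed[OF TA_snd'[OF assms(1), of i] TA_snd'[OF assms(2), of "Suc k - i"]] assms(3) by simp

lemma TA_mult_closed: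
  assumes x: "x \<in> carrier TA" and y: "y \<in> carrier TA"
  shows "x \<otimes>\<^bsub>TA\<^esub> y \<in> carrier TA"
proof -
  obtain N M where N: "\<And>k. k > N \<Longrightarrow> snd x k = \<one>\<^bsub>pow k\<^esub>" "\<And>k. k > M \<Longrightarrow> snd y k = \<one>\<^bsub>pow k\<^esub>"
    using x y by (auto simp: TA_carrier)
  have c: "snd (x \<otimes>\<^bsub>TA\<^esub> y) (Suc k) \<in> carrier (pow (Suc k))" for k
    unfolding TA_mult_snd using x y left_closed right_closed TA_concat_closed
    by (intro T.m_closed T.finprod_closed) auto
  have z: "snd (x \<otimes>\<^bsub>TA\<^esub> y) (Suc k) = \<one>\<^bsub>pow (Suc k)\<^esub>" if k: "Suc k > N + M" for k
  proof -
    have "cat (Suc k) (snd x i) (snd y (Suc k - i)) = \<one>\<^bsub>pow (Suc k)\<^esub>" if i: "i \<in> {1..<Suc k}" for i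
    (* In a concatenation of total degree above N + M one factor has degree above its bound. *)
    proof (cases "i > N")
      case True
      then show ?thesis
        using hom_one[OF concat_hom1[OF TA_snd'[OF y, of "Suc k - i"], of i] T.is_group T.is_group] i N(1) by simp
    next
      case False
      then have "Suc k - i > M" using k by linarith
      then show ?thesis
        using hom_one[OF concat_hom2[OF TA_snd'[OF x, of i], of "Suc k - i"] T.is_group T.is_group] i N(2) by simp
    qed
    then have "finprod (pow (Suc k)) (\<lambda>i. cat (Suc k) (snd x i) (snd y (Suc k - i))) {1..<Suc k} =
        \<one>\<^bsub>pow (Suc k)\<^esub>" by (rule T.finprod_one_eqI)
    moreover have "N < Suc k" "M < Suc k" using k by auto
    ultimately show ?thesis unfolding TA_mult_snd
      using hom_one[OF power_left_hom T.is_group T.is_group] hom_one[OF power_right_hom T.is_group T.is_group] x y N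
      by simp
  qed
  have "snd (x \<otimes>\<^bsub>TA\<^esub> y) \<in> (\<Pi>\<^sub>E k\<in>{1..}. carrier (pow k))"
  proof (rule PiE_I)
    show "snd (x \<otimes>\<^bsub>TA\<^esub> y) k \<in> carrier (pow k)" if "k \<in> {1..}" for k using c[of "k - 1"] that by simp
    show "snd (x \<otimes>\<^bsub>TA\<^esub> y) k = undefined" if "k \<notin> {1..}" for k
      using that by (simp add: tensor_algebra_def case_prod_beta)
  qed
  moreover have "\<forall>k>N + M. snd (x \<otimes>\<^bsub>TA\<^esub> y) k = \<one>\<^bsub>pow k\<^esub>" using z by (metis less_imp_Suc_add)
  ultimately show ?thesis unfolding TA_carrier using x y by (auto simp: TA_mult_fst)
qed

lemma TA_abelian: "abelian_group TA"
proof -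
  have g: "group (positive_part A V)" unfolding positive_part_def by (rule sum_group) (rule T.is_group)
  interpret PG: comm_group "positive_part A V"
    by (rule group.group_comm_groupI[OF g])
      (auto simp: positive_part_def carrier_sum_group T.is_group PiE_iff T.m_comm intro!: restrict_ext)
  show ?thesis
  proof (rule abelian_groupI)
    fix x assume x: "x \<in> carrier TA"
    show "\<exists>y\<in>carrier TA. y \<oplus>\<^bsub>TA\<^esub> x = \<zero>\<^bsub>TA\<^esub>"
      using x PG.l_inv[of "snd x"] by (intro bexI[of _ "(\<ominus>\<^bsub>A\<^esub> fst x, inv\<^bsub>positive_part A V\<^esub> snd x)"])
        (auto simp: tensor_algebra_def A.l_neg)
  qed (auto simp: tensor_algebra_def A.a_ac PG.m_ac)
qed

sublocale TA: abelian_group TA by (rule TA_abelian)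

lemma TA_fst_hom: "fst \<in> add_hom TA A"
  and TA_snd_hom: "(\<lambda>x. snd x (Suc k)) \<in> hom (add_monoid TA) (pow (Suc k))"
  by (auto simp: hom_def TA_simps)

lemma TA_finsum_fst: "f \<in> I \<rightarrow> carrier TA \<Longrightarrow> fst (finsum TA f I) = finsum A (\<lambda>i. fst (f i)) I"
  by (rule hom_finsum[OF TA_abelian A.is_abelian_group TA_fst_hom])

lemma TA_finsum_snd:
  "f \<in> I \<rightarrow> carrier TA \<Longrightarrow> snd (finsum TA f I) (Suc k) = finprod (pow (Suc k)) (\<lambda>i. snd (f i) (Suc k)) I"
  unfolding finsum_def by (rule hom_finprod[OF TA.a_comm_group comm_group_pow TA_snd_hom]) auto

lemma TA_intro:
  assumes "a \<in> carrier A" "\<And>k. f (Suc k) \<in> carrier (pow (Suc k))" "\<And>k. k > N \<Longrightarrow> f k = \<one>\<^bsub>pow k\<^esub>"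
  shows "(a, \<lambda>k\<in>{1..}. f k) \<in> carrier TA"
proof -
  have "f k \<in> carrier (pow k)" if "k \<in> {1..}" for k using assms(2)[of "k - 1"] that by simp
  then show ?thesis using assms(1,3) by (auto simp: TA_carrier)
qed

end

context skew_bimodule
begin

abbreviation "TV \<equiv> tensor_algebra A V"
abbreviation "TW \<equiv> tensor_algebra B W"
abbreviation "actT \<equiv> tensor_algebra_action A V \<phi> \<psi>"
abbreviation "TG \<equiv> skew_group_algebra TV G actT"

lemma hk_cong:
  assumes "y \<in> carrier G \<rightarrow> carrier (VP k)" "\<And>g. g \<in> carrier G \<Longrightarrow> x g = y g"
  shows "hk k x = hk k y"
  unfolding hk_def by (rule W.T.finprod_cong') (use assms RP_closed in "auto simp: Pi_iff")

lemma hk_one: "(\<And>g. g \<in> carrier G \<Longrightarrow> x g = \<one>\<^bsub>VP k\<^esub>) \<Longrightarrow> hk k x = \<one>\<^bsub>WP k\<^esub>"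
  unfolding hk_def using hom_one[OF RP_hom V.T.is_group W.T.is_group] by (simp add: W.T.finprod_one_eqI)

lemma hk_mult:
  assumes x: "x \<in> carrier G \<rightarrow> carrier (VP k)" and y: "y \<in> carrier G \<rightarrow> carrier (VP k)"
  shows "hk k (\<lambda>g. x g \<otimes>\<^bsub>VP k\<^esub> y g) = hk k x \<otimes>\<^bsub>WP k\<^esub> hk k y"
proof -
  have c: "x g \<in> carrier (VP k)" "y g \<in> carrier (VP k)" if "g \<in> carrier G" for g
    using x y that by auto
  have "hk k (\<lambda>g. x g \<otimes>\<^bsub>VP k\<^esub> y g) =
      sumW k (\<lambda>g. RP k g (x g) \<otimes>\<^bsub>WP k\<^esub> RP k g (y g))"
    unfolding hk_def
    by (intro W.T.finprod_cong'[OF refl] hom_mult[OF RP_hom]) (use c in "auto intro!: RP_closed")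
  also have "\<dots> = hk k x \<otimes>\<^bsub>WP k\<^esub> hk k y"
    unfolding hk_def by (rule W.T.finprod_multf) (use c RP_closed in auto)
  finally show ?thesis .
qed

lemma hk_finprod:
  assumes I: "finite I" and x: "\<And>i g. i \<in> I \<Longrightarrow> g \<in> carrier G \<Longrightarrow> x i g \<in> carrier (VP k)"
  shows "hk k (\<lambda>g. finprod (VP k) (\<lambda>i. x i g) I) = finprod (WP k) (\<lambda>i. hk k (x i)) I"
proof -
  have "hk k (\<lambda>g. finprod (VP k) (\<lambda>i. x i g) I) =
      sumW k (\<lambda>g. finprod (WP k) (\<lambda>i. RP k g (x i g)) I)"
    unfolding hk_def
    by (intro W.T.finprod_cong'[OF refl] hom_finprod[OF V.comm_group_pow W.comm_group_pow RP_hom])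
      (use x in "auto intro!: RP_closed V.T.finprod_closed W.T.finprod_closed")
  also have "\<dots> = finprod (WP k) (\<lambda>i. hk k (x i)) I"
    unfolding hk_def by (rule W.T.finprod_swap[OF finite_G I]) (use x RP_closed in auto)
  finally show ?thesis .
qed

lemma hk_scalar:
  assumes a: "a \<in> carrier A" and x: "x \<in> carrier G \<rightarrow> carrier (VP k)"
  shows "Lw k (e a \<one>) (hk k x) = hk k (\<lambda>g. Lv k a (x g))"
proof -
  have c: "x g \<in> carrier (VP k)" if "g \<in> carrier G" for g using x that by auto
  have "Lw k (e a \<one>) (hk k x) = sumW k (\<lambda>g. Lw k (e a \<one>) (RP k g (x g)))"
    unfolding hk_def
    by (rule hom_finprod[OF W.comm_group_pow W.comm_group_pow W.power_left_hom]) (use a c RP_closed in auto)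
  also have "\<dots> = hk k (\<lambda>g. Lv k a (x g))"
    unfolding hk_def
    by (rule W.T.finprod_cong'[OF refl])
      (use a c in "auto intro!: RP_closed simp: left_RP \<psi>T_one V.left_closed simp del: G.r_one")
  finally show ?thesis .
qed

text \<open>
  An element of the skew group algebra is a family over \<open>G\<close> of graded elements; transposing it and
  applying \<open>hk\<close> in each positive degree gives a graded element over \<open>B\<close>. The shift by one is that
  of \<open>hk\<close>.
\<close>

definition compare where
  "compare x = (\<lambda>g\<in>carrier G. fst (x g), \<lambda>k\<in>{1..}. hk (k - 1) (\<lambda>g. snd (x g) k))"

definition compare_inv where
  "compare_inv y = (\<lambda>g\<in>carrier G. (fst y g, \<lambda>k\<in>{1..}. \<Psi> (k - 1) g (snd y k)))"

lemma TG_carrier: "carrier TG = (\<Pi>\<^sub>E g\<in>carrier G. carrier TV)" by (simp add: skew_group_algebra_def)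

lemma TG_comp [simp]: "x \<in> carrier TG \<Longrightarrow> g \<in> carrier G \<Longrightarrow> x g \<in> carrier TV" by (auto simp: TG_carrier)

lemma TG_snd: "x \<in> carrier TG \<Longrightarrow> (\<lambda>g. snd (x g) (Suc k)) \<in> carrier G \<rightarrow> carrier (VP k)"
  by simp

lemma compare_snd: "snd (compare x) (Suc k) = hk k (\<lambda>g. snd (x g) (Suc k))" by (simp add: compare_def)

lemma compare_closed: assumes x: "x \<in> carrier TG" shows "compare x \<in> carrier TW"
proof -
  have "\<forall>g\<in>carrier G. \<exists>N. \<forall>k>N. snd (x g) k = \<one>\<^bsub>V.pow k\<^esub>"
    using TG_comp[OF x] by (auto simp: V.TA_carrier)
  then obtain N where N: "\<And>g k. g \<in> carrier G \<Longrightarrow> k > N g \<Longrightarrow> snd (x g) k = \<one>\<^bsub>V.pow k\<^esub>" by metis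
  (* A common bound for the degrees of the finitely many components. *)
  define M where "M = sum N (carrier G)"
  have M: "N g \<le> M" if "g \<in> carrier G" for g unfolding M_def by (rule member_le_sum[OF that _ finite_G]) simp
  show ?thesis unfolding compare_def
  proof (rule W.TA_intro[where N = M])
    show "(\<lambda>g\<in>carrier G. fst (x g)) \<in> carrier B" using x by (auto simp: B_carrier)
    show "hk (Suc k - 1) (\<lambda>g. snd (x g) (Suc k)) \<in> carrier (WP k)" for k
      using hk_closed[OF TG_snd[OF x]] by simp
    show "hk (k - 1) (\<lambda>g. snd (x g) k) = \<one>\<^bsub>W.pow k\<^esub>" if k: "k > M" for k
    proof -
      obtain i where i: "k = Suc i" using k by (cases k) auto
      have "snd (x g) k = \<one>\<^bsub>V.pow k\<^esub>" if "g \<in> carrier G" for g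
        using N[OF that] M[OF that] k by simp
      then show ?thesis unfolding i using hk_one[of "\<lambda>g. snd (x g) (Suc i)" i] by simp
    qed
  qed
qed

lemma compare_inv_closed: assumes y: "y \<in> carrier TW" shows "compare_inv y \<in> carrier TG"
proof -
  obtain N where N: "\<And>k. k > N \<Longrightarrow> snd y k = \<one>\<^bsub>W.pow k\<^esub>" using y by (auto simp: W.TA_carrier)
  have "(fst y g, \<lambda>k\<in>{1..}. \<Psi> (k - 1) g (snd y k)) \<in> carrier TV" if g: "g \<in> carrier G" for g
  proof (rule V.TA_intro[where N = N])
    show "fst y g \<in> carrier A" using y g by simp
    show "\<Psi> (Suc k - 1) g (snd y (Suc k)) \<in> carrier (VP k)" for k using \<Psi>_closed[OF g] y by simp
    show "\<Psi> (k - 1) g (snd y k) = \<one>\<^bsub>V.pow k\<^esub>" if "k > N" for k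
      using N[OF that] that hom_one[OF \<Psi>_hom[OF g, of "k - 1"] W.T.is_group V.T.is_group] by simp
  qed
  then show ?thesis by (simp add: compare_inv_def TG_carrier)
qed

lemma compare_bij: "bij_betw compare (carrier TG) (carrier TW)"
proof (rule bij_betw_byWitness[where f' = compare_inv])
  show "\<forall>x\<in>carrier TG. compare_inv (compare x) = x"
  proof
    fix x assume x: "x \<in> carrier TG"
    note c = compare_inv_closed[OF compare_closed[OF x]]
    show "compare_inv (compare x) = x"
    proof (rule PiE_ext[of _ "carrier G" "\<lambda>_. carrier TV"])
      fix g assume g: "g \<in> carrier G"
      show "compare_inv (compare x) g = x g"
      proof (rule V.TA_eqI[OF TG_comp[OF c g] TG_comp[OF x g]])
        show "snd (compare_inv (compare x) g) (Suc k) = snd (x g) (Suc k)" for k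
          using g \<Psi>_hk[OF g TG_snd[OF x]] by (simp add: compare_inv_def compare_snd)
      qed (use g in "simp add: compare_inv_def compare_def")
    qed (use x c in "auto simp: TG_carrier")
  qed
  show "\<forall>y\<in>carrier TW. compare (compare_inv y) = y"
  proof
    fix y assume y: "y \<in> carrier TW"
    note c = compare_closed[OF compare_inv_closed[OF y]]
    show "compare (compare_inv y) = y"
    proof (rule W.TA_eqI[OF c y])
      show "fst (compare (compare_inv y)) = fst y"
        by (rule B_eqI) (use y W.TA_fst[OF c] in "auto simp: compare_def compare_inv_def")
      show "snd (compare (compare_inv y)) (Suc k) = snd y (Suc k)" for k
      proof -
        have "hk k (\<lambda>g. snd (compare_inv y g) (Suc k)) = hk k (\<lambda>g. \<Psi> k g (snd y (Suc k)))"
          by (rule hk_cong) (use y in "auto simp: compare_inv_def \<Psi>_closed")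
        then show ?thesis using hk_\<Psi>[OF W.TA_snd[OF y]] by (simp add: compare_snd)
      qed
    qed
  qed
qed (auto intro: compare_closed compare_inv_closed)

lemma actT_fst: "fst (actT g x) = \<phi> g (fst x)"
  and actT_snd: "0 < k \<Longrightarrow> snd (actT g x) k = \<psi>T k g (snd x k)"
  by (simp_all add: tensor_algebra_action_def case_prod_beta)

lemma actT_closed: assumes g: "g \<in> carrier G" and x: "x \<in> carrier TV" shows "actT g x \<in> carrier TV"
proof -
  obtain N where N: "\<And>k. k > N \<Longrightarrow> snd x k = \<one>\<^bsub>V.pow k\<^esub>" using x by (auto simp: V.TA_carrier)
  show ?thesis unfolding tensor_algebra_action_def case_prod_beta
    by (rule V.TA_intro[where N = N])
      (use g x N \<psi>T_closed hom_one[OF \<psi>T_hom V.T.is_group V.T.is_group] in auto)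
qed

lemma TG_mult_closed:
  assumes x: "x \<in> carrier TG" and y: "y \<in> carrier TG" and g: "g \<in> carrier G" and m: "m \<in> carrier G"
  shows "x g \<otimes>\<^bsub>TV\<^esub> actT g (y (inv g \<otimes> m)) \<in> carrier TV"
  by (rule V.TA_mult_closed[OF TG_comp[OF x g] actT_closed[OF g TG_comp[OF y]]]) (use g m in simp)

lemma TG_mult_comp:
  "m \<in> carrier G \<Longrightarrow> (x \<otimes>\<^bsub>TG\<^esub> y) m = finsum TV (\<lambda>g. x g \<otimes>\<^bsub>TV\<^esub> actT g (y (inv g \<otimes> m))) (carrier G)"
  by (simp add: skew_group_algebra_def)

lemma TG_closed_mult: "x \<in> carrier TG \<Longrightarrow> y \<in> carrier TG \<Longrightarrow> x \<otimes>\<^bsub>TG\<^esub> y \<in> carrier TG"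
  unfolding TG_carrier by (simp add: skew_group_algebra_def PiE_iff)
    (intro ballI V.TA.finsum_closed Pi_I TG_mult_closed; simp add: TG_carrier PiE_iff)

text \<open>
  In positive degree a product is a sum of three kinds of terms: a scalar on the left, a scalar on
  the right, and concatenations. Each is a convolution over \<open>G\<close>, and \<open>hk\<close> carries it to the
  corresponding term over \<open>B\<close> by \<open>hk_left\<close>, \<open>hk_right\<close> and \<open>hk_concat\<close>.
\<close>

lemma compare_mult_snd:
  assumes x: "x \<in> carrier TG" and y: "y \<in> carrier TG"
  shows "hk k (\<lambda>m. snd ((x \<otimes>\<^bsub>TG\<^esub> y) m) (Suc k)) = snd (compare x \<otimes>\<^bsub>TW\<^esub> compare y) (Suc k)"
proof -
  let ?V = "VP k" and ?W = "WP k"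
  let ?y = "\<lambda>g m. y (inv g \<otimes> m)"
  let ?L = "\<lambda>g m. Lv k (fst (x g)) (\<psi>T (Suc k) g (snd (?y g m) (Suc k)))"
  let ?R = "\<lambda>g m. Rv k (\<phi> g (fst (?y g m))) (snd (x g) (Suc k))"
  let ?C = "\<lambda>i g m. V.cat (Suc k) (snd (x g) i) (\<psi>T (Suc k - i) g (snd (?y g m) (Suc k - i)))"
  let ?I = "{1..<Suc k}"
  have xc: "x g \<in> carrier TV" if "g \<in> carrier G" for g using x that by simp
  have yc: "?y g m \<in> carrier TV" if "g \<in> carrier G" "m \<in> carrier G" for g m using y that by simp
  have Lc: "?L g m \<in> carrier ?V" if "g \<in> carrier G" "m \<in> carrier G" for g m
    by (rule V.left_closed[OF V.TA_fst[OF xc] \<psi>T_closed[OF _ V.TA_snd[OF yc]]]) (use that in auto)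
  have Rc: "?R g m \<in> carrier ?V" if "g \<in> carrier G" "m \<in> carrier G" for g m
    by (rule V.right_closed[OF _ V.TA_snd[OF xc]]) (use that yc[OF that] in auto)
  have Cc: "?C i g m \<in> carrier ?V" if "i \<in> ?I" "g \<in> carrier G" "m \<in> carrier G" for i g m
    using V.TA_concat_closed[OF xc[OF that(2)] actT_closed[OF that(2) yc[OF that(2,3)]] that(1)] that(1)
    by (simp add: actT_snd)
  have 1: "snd ((x \<otimes>\<^bsub>TG\<^esub> y) m) (Suc k) = finprod ?V (\<lambda>g. ?L g m) (carrier G) \<otimes>\<^bsub>?V\<^esub> finprod ?V (\<lambda>g. ?R g m) (carrier G)
      \<otimes>\<^bsub>?V\<^esub> finprod ?V (\<lambda>i. finprod ?V (\<lambda>g. ?C i g m) (carrier G)) ?I" if m: "m \<in> carrier G" for m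
  proof -
    have "snd ((x \<otimes>\<^bsub>TG\<^esub> y) m) (Suc k) =
        finprod ?V (\<lambda>g. snd (x g \<otimes>\<^bsub>TV\<^esub> actT g (?y g m)) (Suc k)) (carrier G)"
      unfolding TG_mult_comp[OF m] by (rule V.TA_finsum_snd) (use TG_mult_closed[OF x y _ m] in simp)
    also have "\<dots> = finprod ?V (\<lambda>g. ?L g m \<otimes>\<^bsub>?V\<^esub> ?R g m \<otimes>\<^bsub>?V\<^esub> finprod ?V (\<lambda>i. ?C i g m) ?I) (carrier G)"
    proof (rule V.T.finprod_cong'[OF refl])
      fix g assume g: "g \<in> carrier G"
      have "finprod ?V (\<lambda>i. V.cat (Suc k) (snd (x g) i) (snd (actT g (?y g m)) (Suc k - i))) ?I =
          finprod ?V (\<lambda>i. ?C i g m) ?I"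
        by (rule V.T.finprod_cong') (use Cc g m in "auto simp: actT_snd")
      then show "snd (x g \<otimes>\<^bsub>TV\<^esub> actT g (?y g m)) (Suc k) = ?L g m \<otimes>\<^bsub>?V\<^esub> ?R g m \<otimes>\<^bsub>?V\<^esub> finprod ?V (\<lambda>i. ?C i g m) ?I"
        unfolding V.TA_mult_snd by (simp add: actT_fst actT_snd)
    qed (use Lc Rc Cc m in "auto intro!: V.T.finprod_closed")
    also have "\<dots> = finprod ?V (\<lambda>g. ?L g m) (carrier G) \<otimes>\<^bsub>?V\<^esub> finprod ?V (\<lambda>g. ?R g m) (carrier G)
      \<otimes>\<^bsub>?V\<^esub> finprod ?V (\<lambda>g. finprod ?V (\<lambda>i. ?C i g m) ?I) (carrier G)"
      using Lc Rc Cc m by (subst V.T.finprod_multf, auto intro!: V.T.finprod_closed)+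
    also have "finprod ?V (\<lambda>g. finprod ?V (\<lambda>i. ?C i g m) ?I) (carrier G) =
        finprod ?V (\<lambda>i. finprod ?V (\<lambda>g. ?C i g m) (carrier G)) ?I"
      by (rule V.T.finprod_swap[OF finite_G]) (use Cc m in auto)
    finally show ?thesis .
  qed
  have Lp: "(\<lambda>m. finprod ?V (\<lambda>g. ?L g m) (carrier G)) \<in> carrier G \<rightarrow> carrier ?V"
    and Rp: "(\<lambda>m. finprod ?V (\<lambda>g. ?R g m) (carrier G)) \<in> carrier G \<rightarrow> carrier ?V"
    and Cp: "(\<lambda>m. finprod ?V (\<lambda>i. finprod ?V (\<lambda>g. ?C i g m) (carrier G)) ?I) \<in> carrier G \<rightarrow> carrier ?V"
    using Lc Rc Cc by (auto intro!: V.T.finprod_closed)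
  have LR: "(\<lambda>m. finprod ?V (\<lambda>g. ?L g m) (carrier G) \<otimes>\<^bsub>?V\<^esub> finprod ?V (\<lambda>g. ?R g m) (carrier G)) \<in> carrier G \<rightarrow> carrier ?V"
    using Lp Rp by (auto simp: Pi_iff)
  have all: "(\<lambda>m. finprod ?V (\<lambda>g. ?L g m) (carrier G) \<otimes>\<^bsub>?V\<^esub> finprod ?V (\<lambda>g. ?R g m) (carrier G)
      \<otimes>\<^bsub>?V\<^esub> finprod ?V (\<lambda>i. finprod ?V (\<lambda>g. ?C i g m) (carrier G)) ?I) \<in> carrier G \<rightarrow> carrier ?V"
    using LR Cp by (auto simp: Pi_iff)
  have conc: "hk k (\<lambda>m. finprod ?V (\<lambda>g. ?C i g m) (carrier G)) =
      W.cat (Suc k) (snd (compare x) i) (snd (compare y) (Suc k - i))" if i: "i \<in> ?I" for i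
  proof -
    obtain i' n where n: "i = Suc i'" "Suc k - i = Suc n" "Suc k = Suc i' + Suc n"
    proof
      show "i = Suc (i - 1)" "Suc k - i = Suc (k - i)" "Suc k = Suc (i - 1) + Suc (k - i)" using i by auto
    qed
    show ?thesis unfolding n(2) unfolding n(1) compare_snd
      by (rule hk_concat[OF TG_snd[OF x] TG_snd[OF y] n(3), symmetric])
  qed
  have "hk k (\<lambda>m. snd ((x \<otimes>\<^bsub>TG\<^esub> y) m) (Suc k)) = hk k (\<lambda>m. finprod ?V (\<lambda>g. ?L g m) (carrier G)) \<otimes>\<^bsub>?W\<^esub>
      hk k (\<lambda>m. finprod ?V (\<lambda>g. ?R g m) (carrier G)) \<otimes>\<^bsub>?W\<^esub>
      finprod ?W (\<lambda>i. hk k (\<lambda>m. finprod ?V (\<lambda>g. ?C i g m) (carrier G))) ?I"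
    by (rule trans[OF hk_cong[OF all 1]], assumption, unfold hk_mult[OF LR Cp] hk_mult[OF Lp Rp],
        rule arg_cong[OF hk_finprod]) (use Cc in "auto intro!: V.T.finprod_closed")
  also have "hk k (\<lambda>m. finprod ?V (\<lambda>g. ?L g m) (carrier G)) = Lw k (fst (compare x)) (snd (compare y) (Suc k))"
  proof -
    have "hk k (\<lambda>m. finprod ?V (\<lambda>g. ?L g m) (carrier G)) = hk k (\<lambda>m. finprod ?V (\<lambda>g.
        Lv k (fst (compare x) g) (\<psi>T (Suc k) g (snd (?y g m) (Suc k)))) (carrier G))"
      by (intro hk_cong V.T.finprod_cong') (use Lc in "auto simp: compare_def intro!: V.T.finprod_closed")
    also have "\<dots> = Lw k (fst (compare x)) (hk k (\<lambda>g. snd (y g) (Suc k)))"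
      by (rule hk_left[OF W.TA_fst[OF compare_closed[OF x]] TG_snd[OF y], symmetric])
    finally show ?thesis by (simp add: compare_snd)
  qed
  also have "hk k (\<lambda>m. finprod ?V (\<lambda>g. ?R g m) (carrier G)) = Rw k (fst (compare y)) (snd (compare x) (Suc k))"
  proof -
    have "hk k (\<lambda>m. finprod ?V (\<lambda>g. ?R g m) (carrier G)) = hk k (\<lambda>m. finprod ?V (\<lambda>g.
        Rv k (\<phi> g (fst (compare y) (inv g \<otimes> m))) (snd (x g) (Suc k))) (carrier G))"
      by (intro hk_cong V.T.finprod_cong') (use Rc in "auto simp: compare_def intro!: V.T.finprod_closed")
    also have "\<dots> = Rw k (fst (compare y)) (hk k (\<lambda>g. snd (x g) (Suc k)))"
      by (rule hk_right[OF W.TA_fst[OF compare_closed[OF y]] TG_snd[OF x], symmetric])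
    finally show ?thesis by (simp add: compare_snd)
  qed
  also have "finprod ?W (\<lambda>i. hk k (\<lambda>m. finprod ?V (\<lambda>g. ?C i g m) (carrier G))) ?I =
      finprod ?W (\<lambda>i. W.cat (Suc k) (snd (compare x) i) (snd (compare y) (Suc k - i))) ?I"
    by (intro W.T.finprod_cong'[OF refl] conc Pi_I W.TA_concat_closed compare_closed x y)
  finally show ?thesis unfolding W.TA_mult_snd .
qed

lemma compare_ring_hom: "compare \<in> ring_hom TG TW"
proof (rule ring_hom_memI)
  fix x y assume x: "x \<in> carrier TG" and y: "y \<in> carrier TG"
  note cx = compare_closed[OF x] and cy = compare_closed[OF y]
  show "compare x \<in> carrier TW" by (rule cx)
  show "compare (x \<otimes>\<^bsub>TG\<^esub> y) = compare x \<otimes>\<^bsub>TW\<^esub> compare y"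
  proof (rule W.TA_eqI[OF compare_closed[OF TG_closed_mult[OF x y]] W.TA_mult_closed[OF cx cy]])
    show "fst (compare (x \<otimes>\<^bsub>TG\<^esub> y)) = fst (compare x \<otimes>\<^bsub>TW\<^esub> compare y)"
    proof (rule B_eqI)
      fix m assume m: "m \<in> carrier G"
      have "fst ((x \<otimes>\<^bsub>TG\<^esub> y) m) = finsum A (\<lambda>g. fst (x g) \<otimes>\<^bsub>A\<^esub> \<phi> g (fst (y (inv g \<otimes> m)))) (carrier G)"
        unfolding TG_mult_comp[OF m] using TG_mult_closed[OF x y _ m]
        by (subst V.TA_finsum_fst) (auto simp: V.TA_mult_fst actT_fst)
      also have "\<dots> = finsum A (\<lambda>g. fst (compare x) g \<otimes>\<^bsub>A\<^esub> \<phi> g (fst (compare y) (inv g \<otimes> m))) (carrier G)"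
        by (rule A.finsum_cong') (use x y m W.TA_fst[OF cx] W.TA_fst[OF cy] in "auto simp: compare_def")
      finally show "fst (compare (x \<otimes>\<^bsub>TG\<^esub> y)) m = fst (compare x \<otimes>\<^bsub>TW\<^esub> compare y) m"
        using m by (simp add: W.TA_mult_fst B_simps compare_def)
    qed (use cx cy compare_closed[OF TG_closed_mult[OF x y]] in "simp_all add: W.TA_mult_fst")
    show "snd (compare (x \<otimes>\<^bsub>TG\<^esub> y)) (Suc k) = snd (compare x \<otimes>\<^bsub>TW\<^esub> compare y) (Suc k)" for k
      unfolding compare_snd[of "x \<otimes>\<^bsub>TG\<^esub> y"] by (rule compare_mult_snd[OF x y])
  qed
  have add: "x \<oplus>\<^bsub>TG\<^esub> y \<in> carrier TG" "g \<in> carrier G \<Longrightarrow> (x \<oplus>\<^bsub>TG\<^esub> y) g = x g \<oplus>\<^bsub>TV\<^esub> y g" for g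
    using x y by (auto simp: skew_group_algebra_def PiE_iff)
  show "compare (x \<oplus>\<^bsub>TG\<^esub> y) = compare x \<oplus>\<^bsub>TW\<^esub> compare y"
  proof (rule W.TA_eqI[OF compare_closed[OF add(1)] W.TA.a_closed[OF cx cy]])
    show "fst (compare (x \<oplus>\<^bsub>TG\<^esub> y)) = fst (compare x \<oplus>\<^bsub>TW\<^esub> compare y)"
      by (auto simp: compare_def W.TA_simps B_simps add V.TA_simps intro!: restrict_ext)
    show "snd (compare (x \<oplus>\<^bsub>TG\<^esub> y)) (Suc k) = snd (compare x \<oplus>\<^bsub>TW\<^esub> compare y) (Suc k)" for k
    proof -
      have "hk k (\<lambda>g. snd ((x \<oplus>\<^bsub>TG\<^esub> y) g) (Suc k)) = hk k (\<lambda>g. snd (x g) (Suc k) \<otimes>\<^bsub>VP k\<^esub> snd (y g) (Suc k))"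
        by (rule hk_cong) (use x y in "auto simp: add V.TA_simps")
      then show ?thesis using hk_mult[OF TG_snd[OF x] TG_snd[OF y]] by (simp add: W.TA_simps compare_snd)
    qed
  qed
next
  have one: "\<one>\<^bsub>TG\<^esub> g = (if g = \<one> then \<one>\<^bsub>TV\<^esub> else \<zero>\<^bsub>TV\<^esub>)" if "g \<in> carrier G" for g
    using that by (simp add: skew_group_algebra_def)
  show "compare \<one>\<^bsub>TG\<^esub> = \<one>\<^bsub>TW\<^esub>"
  proof (rule prod_eqI)
    show "fst (compare \<one>\<^bsub>TG\<^esub>) = fst \<one>\<^bsub>TW\<^esub>"
      using one by (auto simp: compare_def W.TA_simps one_B skew_elem_def V.TA_simps intro!: restrict_ext)
    have "hk (k - 1) (\<lambda>g. snd (\<one>\<^bsub>TG\<^esub> g) k) = \<one>\<^bsub>W.pow k\<^esub>" if k: "k \<in> {1..}" for k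
    proof -
      obtain i where i: "k = Suc i" using k by (cases k) auto
      have "hk i (\<lambda>g. snd (\<one>\<^bsub>TG\<^esub> g) (Suc i)) = \<one>\<^bsub>W.pow (Suc i)\<^esub>"
        by (rule hk_one) (simp add: one V.TA_simps)
      then show ?thesis unfolding i by simp
    qed
    then show "snd (compare \<one>\<^bsub>TG\<^esub>) = snd \<one>\<^bsub>TW\<^esub>"
      by (auto simp: compare_def W.TA_simps intro!: restrict_ext)
  qed
qed

theorem tensor_algebra_skew_iso:
  assumes K: "K_algebra K A"
  shows "compare \<in> algebra_isos K TG TW"
proof -
  interpret K: K_algebra K A by fact
  have "compare (c \<odot>\<^bsub>TG\<^esub> x) = c \<odot>\<^bsub>TW\<^esub> compare x" if c: "c \<in> carrier K" and x: "x \<in> carrier TG" for c x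
  proof -
    have sm: "(c \<odot>\<^bsub>TG\<^esub> x) g = c \<odot>\<^bsub>TV\<^esub> x g" if "g \<in> carrier G" for g
      using that by (simp add: skew_group_algebra_def)
    have c1: "c \<odot>\<^bsub>B\<^esub> \<one>\<^bsub>B\<^esub> = e (c \<odot>\<^bsub>A\<^esub> \<one>\<^bsub>A\<^esub>) \<one>"
      using c by (auto simp: B_simps one_B skew_elem_def intro!: restrict_ext)
    have "hk (k - 1) (\<lambda>g. snd ((c \<odot>\<^bsub>TG\<^esub> x) g) k) = power_left B W k (c \<odot>\<^bsub>B\<^esub> \<one>\<^bsub>B\<^esub>) (hk (k - 1) (\<lambda>g. snd (x g) k))"
      if k: "k \<in> {1..}" for k
    proof -
      obtain i where i: "k = Suc i" using k by (cases k) auto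
      have "hk i (\<lambda>g. snd ((c \<odot>\<^bsub>TG\<^esub> x) g) (Suc i)) =
          hk i (\<lambda>g. power_left A V (Suc i) (c \<odot>\<^bsub>A\<^esub> \<one>\<^bsub>A\<^esub>) (snd (x g) (Suc i)))"
        by (rule hk_cong) (use c x in "auto simp: sm V.TA_simps V.left_closed")
      then show ?thesis unfolding i c1 using hk_scalar[OF _ TG_snd[OF x]] c by simp
    qed
    then show ?thesis
      by (auto simp: compare_def W.TA_simps B_simps sm V.TA_simps intro!: restrict_ext)
  qed
  then show ?thesis using compare_ring_hom compare_bij by (simp add: algebra_isos_def ring_iso_def)
qed

end

section \<open>The preprojective algebra\<close>

lemma bimodule_of_right_simps [simp]:
  "carrier (bimodule_of_right K A M) = carrier M" "\<zero>\<^bsub>bimodule_of_right K A M\<^esub> = \<zero>\<^bsub>M\<^esub>"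
  "(\<oplus>\<^bsub>bimodule_of_right K A M\<^esub>) = (\<oplus>\<^bsub>M\<^esub>)"
  "left_act (bimodule_of_right K A M) a v = env_elem K A \<one>\<^bsub>A\<^esub> a \<odot>\<^bsub>M\<^esub> v"
  "right_act (bimodule_of_right K A M) v b = env_elem K A b \<one>\<^bsub>A\<^esub> \<odot>\<^bsub>M\<^esub> v"
  by (simp_all add: bimodule_of_right_def)

lemma finsum_bimodule_of_right: "finsum (bimodule_of_right K A M) f I = finsum M f I"
  by (simp add: finsum_def finprod_def)

text \<open>
  The left action is by \<open>1 \<otimes> a\<close> and the right action by \<open>b \<otimes> 1\<close>. Two reversals of products cancel
  in the left action: that of the opposite algebra and that of right modules.
\<close>

lemma bimodule_over_of_right:
  assumes "K_algebra K A" "left_module (opposite (enveloping K A)) M"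
  shows "bimodule_over A (bimodule_of_right K A M)"
proof -
  interpret K: K_algebra K A by fact
  interpret t: tensor K A "opposite A"
    rewrites "tensor_product K A (opposite A) = enveloping K A" and "tens K A (opposite A) = env_elem K A"
    by (simp_all add: tensor_def assms K_algebra_opposite enveloping_def fun_eq_iff env_elem_eq_tens)
  interpret M: left_module "opposite (enveloping K A)" M by fact
  have assoc: "r \<odot>\<^bsub>M\<^esub> (s \<odot>\<^bsub>M\<^esub> x) = (s \<otimes>\<^bsub>enveloping K A\<^esub> r) \<odot>\<^bsub>M\<^esub> x"
    if "r \<in> carrier (enveloping K A)" "s \<in> carrier (enveloping K A)" "x \<in> carrier M" for r s x
    using M.smult_assoc[of r s x] that by simp
  have cl: "r \<odot>\<^bsub>M\<^esub> x \<in> carrier M" if "r \<in> carrier (enveloping K A)" "x \<in> carrier M" for r x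
    using M.smult_closed[of r x] that by simp
  have ld: "(r \<oplus>\<^bsub>enveloping K A\<^esub> s) \<odot>\<^bsub>M\<^esub> x = r \<odot>\<^bsub>M\<^esub> x \<oplus>\<^bsub>M\<^esub> s \<odot>\<^bsub>M\<^esub> x"
    if "r \<in> carrier (enveloping K A)" "s \<in> carrier (enveloping K A)" "x \<in> carrier M" for r s x
    using M.smult_l_distr[of r s x] that by simp
  have rd: "r \<odot>\<^bsub>M\<^esub> (x \<oplus>\<^bsub>M\<^esub> y) = r \<odot>\<^bsub>M\<^esub> x \<oplus>\<^bsub>M\<^esub> r \<odot>\<^bsub>M\<^esub> y"
    if "r \<in> carrier (enveloping K A)" "x \<in> carrier M" "y \<in> carrier M" for r x y
    using M.smult_r_distr[of r x y] that by simp
  have one: "env_elem K A \<one>\<^bsub>A\<^esub> \<one>\<^bsub>A\<^esub> \<odot>\<^bsub>M\<^esub> x = x" if "x \<in> carrier M" for x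
    using M.smult_one[OF that] by (simp add: t.T_simps(4))
  have "abelian_group (bimodule_of_right K A M)"
    by (rule abelian_groupI) (auto simp: M.M.a_ac intro: M.M.l_neg M.M.a_inv_closed)
  moreover have "bimodule_over_axioms A (bimodule_of_right K A M)"
    by unfold_locales (simp_all add: cl ld rd one assoc t.t_mult t.t_add1 t.t_add2[simplified])
  ultimately show ?thesis by (simp add: bimodule_over_def K.A.ring_axioms)
qed

context skew_comparison
begin

text \<open>
  The results on cohomology in the language of bimodules: right multiplication by \<open>h\<close> on \<open>W\<close> is \<open>\<gamma>
  h 1\<close>, and left multiplication by \<open>g\<close> is \<open>\<gamma> 1 g\<close>, the product of \<open>\<gamma> g\<^sup>-\<^sup>1 g\<close> with \<open>\<gamma> g 1\<close>.
\<close>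

lemma ext_skew_bimodule:
  "skew_bimodule A G \<phi> (ext_bimodule K A (\<lambda>i. res (P i)) d (Suc n)) (ext_bimodule K B Q \<delta> (Suc n))
    (ext_action K A G \<phi> P (Suc n)) (jm n)"
proof -
  let ?V = "V n" and ?W = "W n"
  interpret V: left_module "opposite S" ?V by (rule V_mod)
  interpret W: left_module "opposite E" ?W by (rule W_mod)
  have assoc: "r \<odot>\<^bsub>?W\<^esub> (s \<odot>\<^bsub>?W\<^esub> x) = (s \<otimes>\<^bsub>E\<^esub> r) \<odot>\<^bsub>?W\<^esub> x"
    if "r \<in> carrier E" "s \<in> carrier E" "x \<in> carrier ?W" for r s x
    using W.smult_assoc[of r s x] that by simp
  have env: "env_elem K B \<one>\<^bsub>B\<^esub> (e a g) = w \<one>\<^bsub>A\<^esub> \<one> a g" "env_elem K B (e a g) \<one>\<^bsub>B\<^esub> = w a g \<one>\<^bsub>A\<^esub> \<one>" for a g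
    by (simp_all add: w_def one_B)
  show ?thesis
    unfolding skew_bimodule_def ext_bimodule_def
  proof (intro conjI skew_bimodule_axioms.intro)
    show "skew_ring A G \<phi>" by unfold_locales
    show "bimodule_over A (bimodule_of_right K A ?V)"
      by (rule bimodule_over_of_right[OF KA.K_algebra_axioms V_mod])
    show "bimodule_over B (bimodule_of_right K B ?W)"
      by (rule bimodule_over_of_right[OF K_algebra_B W_mod])
    show "jm n \<in> add_hom (bimodule_of_right K A ?V) (bimodule_of_right K B ?W)"
      by (simp add: hom_def jm_add jm_closed)
    fix h u assume u: "u \<in> carrier G \<rightarrow> carrier (bimodule_of_right K A ?V)" and h: "h \<in> carrier G"
      and z: "finsum (bimodule_of_right K B ?W) (\<lambda>h. right_act (bimodule_of_right K B ?W) (jm n (u h)) (e \<one>\<^bsub>A\<^esub> h)) (carrier G) =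
        \<zero>\<^bsub>bimodule_of_right K B ?W\<^esub>"
    show "u h = \<zero>\<^bsub>bimodule_of_right K A ?V\<^esub>"
      using jm_injective[of u n h] u h z by (simp add: finsum_bimodule_of_right env)
  next
    fix g v assume g: "g \<in> carrier G" and v: "v \<in> carrier (bimodule_of_right K A ?V)"
    show "left_act (bimodule_of_right K B ?W) (e \<one>\<^bsub>A\<^esub> g) (jm n v) =
        right_act (bimodule_of_right K B ?W) (jm n (ext_action K A G \<phi> P (Suc n) g v)) (e \<one>\<^bsub>A\<^esub> g)"
      using g v by (simp add: env jm_eact assoc jm_closed w_mult)
  qed (use jm_surjective[of _ n] in "simp_all add: finsum_bimodule_of_right env eact_closed jm_smult \<kappa>_env")
qed

end

theorem theorem3p13:
  fixes K :: "'k ring" and A :: "('k, 'a) module"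
    and G :: "'g monoid" and \<phi> :: "'g \<Rightarrow> 'a \<Rightarrow> 'a" and n :: nat
    and P :: "nat \<Rightarrow> ('g \<Rightarrow> ('a \<times> 'a \<Rightarrow>\<^sub>0 int) set, 'p) module"
    and d :: "nat \<Rightarrow> 'p \<Rightarrow> 'p" and \<epsilon> :: "'p \<Rightarrow> 'a"
    and Q :: "nat \<Rightarrow> ((('g \<Rightarrow> 'a) \<times> ('g \<Rightarrow> 'a) \<Rightarrow>\<^sub>0 int) set, 'q) module"
    and \<delta> :: "nat \<Rightarrow> 'q \<Rightarrow> 'q" and \<eta> :: "'q \<Rightarrow> 'g \<Rightarrow> 'a"
  assumes action: "algebra_action K A G \<phi>"
    and finite: "finite (carrier G)"
    and n: "n \<ge> 2"
    and P: "projective_resolution (skew_enveloping K A G \<phi>) (skew_regular_bimodule A G \<phi>) P d \<epsilon>"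
    and Q: "projective_resolution (enveloping K (skew_group_algebra A G \<phi>))
              (regular_bimodule (skew_group_algebra A G \<phi>)) Q \<delta> \<eta>"
  shows "\<exists>h. h \<in> algebra_isos K
     (skew_group_algebra
        (preprojective_algebra K A (\<lambda>i. restrict_scalars (enveloping K A) G (P i)) d n)
        G (preprojective_action K A G \<phi> P d n))
     (preprojective_algebra K (skew_group_algebra A G \<phi>) Q \<delta> n)"
proof -
  interpret skew_resolutions K A G \<phi> P d \<epsilon> Q \<delta> \<eta>
    by (intro skew_resolutions.intro skew_algebra.intro skew_resolutions_axioms.intro action finite P Q)
  obtain f c where "skew_comparison K A G \<phi> P d \<epsilon> Q \<delta> \<eta> f c"
  proof (rule comparison_maps, goal_cases)
    case (1 f c)
    show ?case
      by (rule 1(1)[of f c], intro skew_comparison.intro skew_comparison_axioms.intro skew_resolutions_axioms)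
        (fact 1)+
  qed
  then interpret skew_comparison K A G \<phi> P d \<epsilon> Q \<delta> \<eta> f c .
  obtain j where j: "n - 1 = Suc j" using n by (cases "n - 1") auto
  interpret T: skew_bimodule A G \<phi> "ext_bimodule K A (\<lambda>i. res (P i)) d (Suc j)" "ext_bimodule K B Q \<delta> (Suc j)"
    "ext_action K A G \<phi> P (Suc j)" "jm j"
    by (rule ext_skew_bimodule)
  show ?thesis
    unfolding preprojective_algebra_def preprojective_action_def j
    using T.tensor_algebra_skew_iso[OF KA.K_algebra_axioms] by blast
qed

end
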